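(* Let $N\ge3$, $k>0$, $\alpha>\frac{N+1}{2}$, and let $f:\mathbb{R}^N\times\mathbb{C}\to\mathbb{C}$ be a continuous function satisfying $$\sup_{|u|\le M,\,x\in\mathbb{R}^N}\langle x\rangle^\alpha|f(x,u)|<\infty\qquad\text{for all } M>0$$ and one of the following assumptions: $(f_1)$ $f(x,u)=a(x)u+b(x,u)$ with $a\in L^\infty_\alpha(\mathbb{R}^N,\mathbb{R})$ and $$\sup_{|u|\le M,\,x\in\mathbb{R}^N}\langle x\rangle^\alpha|b(x,u)|=o(M)\qquad\text{as } M\to+\infty.$$ $(f_2)$ There exist $Q,b\in L^\infty_\alpha(\mathbb{R}^N,\mathbb{R})$ with $\|Q\|_{L^\infty_\alpha}<\frac1{\kappa_\alpha}$ and $$|f(x,u)|\le Q(x)|u|+b(x)\qquad\text{for all }(x,u)\in\mathbb{R}^N\times\mathbb{C}.$$ Let $\varphi\in L^\infty(\mathbb{R}^N)$, and let $\mathcal{F}\subset L^\infty(\mathbb{R}^N)$ be the set of functions $u$ which solve the equation $$u=\mu\big(\mathcal{R}_kN_f(u)+\varphi\big)\qquad\text{for some }\mu\in[0,1].$$ Then $\mathcal{F}$ is bounded in $L^\infty(\mathbb{R}^N)$.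
   Context: $L^\infty(\mathbb{R}^N)$ consists of complex-valued functions, and $\langle x\rangle=(1+|x|^2)^{1/2}$. For $\alpha\in\mathbb{R}$, $L^\infty_\alpha(\mathbb{R}^N)$ is the space of measurable $w:\mathbb{R}^N\to\mathbb{C}$ with $\|w\|_{L^\infty_\alpha}:=\|\langle\cdot\rangle^\alpha w\|_{L^\infty(\mathbb{R}^N)}<\infty$; $L^\infty_\alpha(\mathbb{R}^N,\mathbb{R})$ is its subspace of real-valued functions. The outgoing fundamental solution is $$\Phi_k(x)=\frac{i}{4}\Big(\frac{k}{2\pi|x|}\Big)^{\frac{N-2}{2}}H^{(1)}_{\frac{N-2}{2}}(k|x|),\qquad x\in\mathbb{R}^N\setminus\{0\},$$ where $H^{(1)}_\nu$ is the Hankel function of the first kind of order $\nu$, and $\mathcal{R}_kf=\Phi_k*f$. $N_f$ is the substitution operator $N_f(u)(x)=f(x,u(x))$. For $\alpha>\frac{N+1}{2}$ set $\tau(\alpha)=\alpha-\frac{N+1}{2}$ if $\frac{N+1}{2}<\alpha<N$ and $\tau(\alpha)=\frac{N-1}{2}$ if $\alpha\ge N$, and $$\kappa_\alpha:=\sup\Big\{\big\||\Phi_k|*w\big\|_{L^\infty_{\tau(\alpha)}}:\ w\in L^\infty_\alpha(\mathbb{R}^N),\ \|w\|_{L^\infty_\alpha}=1\Big\}.$$ *)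

theory Defs
  imports "HOL-Analysis.Analysis" "HOL-Probability.Essential_Supremum"
begin

subsection \<open>Weighted \<open>L\<^sup>\<infinity>\<close> spaces\<close>

definition jbracket :: "real ^ 'n \<Rightarrow> real"
  where "jbracket x = sqrt (1 + (norm x)\<^sup>2)"

text \<open>Elements of \<open>L\<^sup>\<infinity>\<close> are represented by Lebesgue measurable functions, not by
  equivalence classes. The norms take values in \<^typ>\<open>ereal\<close>, so that an essentially unbounded
  function has norm \<open>\<infinity>\<close>.\<close>

definition Linf_norm :: "(real ^ 'n \<Rightarrow> 'b::real_normed_vector) \<Rightarrow> ereal"
  where "Linf_norm w = esssup lebesgue (\<lambda>x. ereal (norm (w x)))"

definition wLinf_norm :: "real \<Rightarrow> (real ^ 'n \<Rightarrow> 'b::real_normed_vector) \<Rightarrow> ereal"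
  where "wLinf_norm \<alpha> w = Linf_norm (\<lambda>x. (jbracket x powr \<alpha>) *\<^sub>R w x)"

definition Linf :: "(real ^ 'n \<Rightarrow> 'b::real_normed_vector) set"
  where "Linf = {w \<in> borel_measurable lebesgue. Linf_norm w < \<infinity>}"

definition wLinf :: "real \<Rightarrow> (real ^ 'n \<Rightarrow> 'b::real_normed_vector) set"
  where "wLinf \<alpha> = {w \<in> borel_measurable lebesgue. wLinf_norm \<alpha> w < \<infinity>}"


subsection \<open>Bessel and Hankel functions of real order and positive argument\<close>

text \<open>The reciprocal Gamma function vanishes at the nonpositive integers, so the power series
  covers every real order.\<close>

definition bessel_J :: "real \<Rightarrow> real \<Rightarrow> real"
  where "bessel_J \<nu> t =
    (\<Sum>m. (-1) ^ m / fact m * rGamma (real m + \<nu> + 1) * (t / 2) powr (2 * real m + \<nu>))"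

definition bessel_Y :: "real \<Rightarrow> real \<Rightarrow> real"
  where "bessel_Y \<nu> t =
    (let q = (\<lambda>\<mu>. (bessel_J \<mu> t * cos (\<mu> * pi) - bessel_J (- \<mu>) t) / sin (\<mu> * pi))
     in if \<nu> \<in> \<int> then Lim (at \<nu>) q else q \<nu>)"

definition hankel1 :: "real \<Rightarrow> real \<Rightarrow> complex"
  where "hankel1 \<nu> t = Complex (bessel_J \<nu> t) (bessel_Y \<nu> t)"


subsection \<open>The outgoing fundamental solution and the resolvent\<close>

text \<open>The value of \<open>\<Phi>\<^sub>k\<close> at the origin is irrelevant, as it only enters through integrals.\<close>

definition outgoing_fund :: "real \<Rightarrow> real ^ 'n \<Rightarrow> complex"
  where "outgoing_fund k x =
    (let \<nu> = (real CARD('n) - 2) / 2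
     in \<i> / 4 * complex_of_real ((k / (2 * pi * norm x)) powr \<nu>) * hankel1 \<nu> (k * norm x))"

definition convolution :: "(real ^ 'n \<Rightarrow> complex) \<Rightarrow> (real ^ 'n \<Rightarrow> complex) \<Rightarrow> real ^ 'n \<Rightarrow> complex"
  where "convolution g w x = (\<integral>y. g (x - y) * w y \<partial>lebesgue)"

definition resolvent_op :: "real \<Rightarrow> (real ^ 'n \<Rightarrow> complex) \<Rightarrow> real ^ 'n \<Rightarrow> complex"
  where "resolvent_op k w = convolution (outgoing_fund k) w"

definition subst_op :: "((real ^ 'n) \<times> complex \<Rightarrow> complex) \<Rightarrow> (real ^ 'n \<Rightarrow> complex) \<Rightarrow> real ^ 'n \<Rightarrow> complex"
  where "subst_op f u x = f (x, u x)"

definition tau :: "nat \<Rightarrow> real \<Rightarrow> real"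
  where "tau N \<alpha> = (if \<alpha> < real N then \<alpha> - (real N + 1) / 2 else (real N - 1) / 2)"

definition kappa_const :: "'n::finite itself \<Rightarrow> real \<Rightarrow> real \<Rightarrow> ereal"
  where "kappa_const _ k \<alpha> =
    Sup {wLinf_norm (tau CARD('n) \<alpha>)
            (convolution (\<lambda>x. complex_of_real (cmod (outgoing_fund k x))) w) |
          w :: real ^ 'n \<Rightarrow> complex. w \<in> wLinf \<alpha> \<and> wLinf_norm \<alpha> w = 1}"


subsection \<open>Conditions on the nonlinearity\<close>

text \<open>The pointwise (not essential) supremum of \<open>\<langle>x\<rangle>\<^sup>\<alpha> |g(x,u)|\<close> over \<open>|u| \<le> M\<close> and
  all \<open>x\<close>.\<close>

definition growth_sup :: "real \<Rightarrow> ((real ^ 'n) \<times> complex \<Rightarrow> complex) \<Rightarrow> real \<Rightarrow> ereal"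
  where "growth_sup \<alpha> g M =
    Sup {ereal (jbracket x powr \<alpha> * cmod (g (x, u))) | x u. cmod u \<le> M}"

text \<open>The condition that the supremum is \<open>o(M)\<close> is written as a limit of extended real quotients;
  it thereby includes that the supremum is finite for large \<open>M\<close>.\<close>

definition cond_f1 :: "real \<Rightarrow> ((real ^ 'n) \<times> complex \<Rightarrow> complex) \<Rightarrow> bool"
  where "cond_f1 \<alpha> f \<longleftrightarrow>
    (\<exists>(a :: real ^ 'n \<Rightarrow> real) (b :: (real ^ 'n) \<times> complex \<Rightarrow> complex).
       a \<in> wLinf \<alpha> \<and>
       (\<forall>x u. f (x, u) = complex_of_real (a x) * u + b (x, u)) \<and>
       ((\<lambda>M. growth_sup \<alpha> b M / ereal M) \<longlongrightarrow> 0) at_top)"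

definition cond_f2 :: "real \<Rightarrow> real \<Rightarrow> ((real ^ 'n) \<times> complex \<Rightarrow> complex) \<Rightarrow> bool"
  where "cond_f2 k \<alpha> f \<longleftrightarrow>
    (\<exists>(Q :: real ^ 'n \<Rightarrow> real) (b :: real ^ 'n \<Rightarrow> real).
       Q \<in> wLinf \<alpha> \<and> b \<in> wLinf \<alpha> \<and>
       wLinf_norm \<alpha> Q < 1 / kappa_const TYPE('n) k \<alpha> \<and>
       (\<forall>x u. cmod (f (x, u)) \<le> Q x * cmod u + b x))"

text \<open>Equality in \<open>L\<^sup>\<infinity>\<close> is equality almost everywhere.\<close>

definition solution_family ::
    "real \<Rightarrow> ((real ^ 'n) \<times> complex \<Rightarrow> complex) \<Rightarrow> (real ^ 'n \<Rightarrow> complex) \<Rightarrow> (real ^ 'n \<Rightarrow> complex) set"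
  where "solution_family k f \<phi> =
    {u \<in> Linf. \<exists>\<mu>\<in>{0..1::real}. AE x in lebesgue.
        u x = complex_of_real \<mu> * (resolvent_op k (subst_op f u) x + \<phi> x)}"

end

(* Under (f2) one takes absolute values in the equation: |u| <= |Phi| * (Q|u| + b) + |phi|, and the
   definition of kappa_alpha gives |u|_inf <= kappa_alpha |Q| |u|_inf + const with kappa_alpha |Q| < 1.

   Under (f1), if F were unbounded, the normalizations w_n = u_n / |u_n|_inf would satisfy
   w_n = mu_n Phi * (a w_n) + o(1). The convolutions are equi-Lipschitz and decay uniformly, so a
   subsequence of them converges to some v <> 0 with v = mu Phi * (a v). Such a v cannot exist.
   Bootstrapping the convolution gives v = O(<x>^(-(N-1)/2)). As a is real, the flux of Im(conj v grad v)
   vanishes, and together with the radiation condition this places v in L^2 with a weight <x>^kp,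
   kp > -1. Multipliers of Pohozaev type raise the exponent of the weight by one, hence indefinitely, and
   the weights |x|^(2m) with m large leave only v = 0.

   The kernel estimates come from writing H_nu as an integral of e^(izt) (1 - t^2)^(nu - 1/2) over the
   half line t = 1 + i s, s > 0. *)

theory Submission
  imports Defs "HOL-Complex_Analysis.Complex_Analysis" "HOL-Real_Asymp.Real_Asymp"
begin

text \<open>The limit \<open>v\<close> solves an equation whose source is merely continuous, so it
  is C1 but possibly not C2. The multiplier identities are therefore derived from a weak
  formulation, with difference quotients in place of second derivatives and cutoffs in place of
  boundary terms. Two kinds of weights are needed: just above the exponent -1 the quadratic form
  becomes positive only after a correction by the energy identity, and only when all weights are
  integrable can the powers |x|^(2m) bring in a square whose large coefficient absorbs a potential
  of any size. The potential enters through |a| = O(<x>^(-2)), a consequence of \<alpha> > (N+1)/2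
  >= 2. In (f1) \<open>a\<close> is only assumed measurable and essentially bounded with weight, but
  the pointwise growth conditions make f(x,M)/M converge uniformly to \<open>a\<close>, which gives
  continuity and a bound at every point. On the side of special functions, Y of integer order is
  defined as a limit in the order; hence the half-line formula is proved for all real orders above
  -1/2 and shown to be continuous in the order.\<close>

abbreviation jb :: "real ^ 'n \<Rightarrow> real" where "jb \<equiv> jbracket"

lemmas integrable_dominated = Bochner_Integration.integrable_bound
  and lebesgue_diff = Bochner_Integration.integral_diff

section \<open>Integrals over Euclidean space: translations, parameters, dyadic shells\<close>

lemma nn_integral_lborel_translate:
  fixes f :: "'a::euclidean_space \<Rightarrow> ennreal"
  assumes [measurable]: "f \<in> borel_measurable borel"
  shows "(\<integral>\<^sup>+x. f (x + c) \<partial>lborel) = (\<integral>\<^sup>+x. f x \<partial>lborel)"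
proof -
  have "(\<integral>\<^sup>+x. f x \<partial>lborel) = (\<integral>\<^sup>+x. f x \<partial>distr lborel borel ((+) c))"
    by (simp add: lborel_distr_plus)
  also have "\<dots> = (\<integral>\<^sup>+x. f (c + x) \<partial>lborel)"
    by (subst nn_integral_distr) auto
  finally show ?thesis by (simp add: add.commute)
qed

lemma lborel_distr_reflect:
  fixes c :: "'a::euclidean_space"
  shows "distr lborel borel (\<lambda>x. c - x) = lborel"
  using lborel_affine[of "-1" c] by (simp add: density_1 one_ennreal_def[symmetric])

lemma
  fixes f :: "'a::euclidean_space \<Rightarrow> 'b::{banach, second_countable_topology}"
  shows integrable_lborel_translate: "integrable lborel f \<Longrightarrow> integrable lborel (\<lambda>x. f (x + c))"
    and integral_lborel_translate: "f \<in> borel_measurable borel \<Longrightarrow> (LBINT x. f (x + c)) = (LBINT x. f x)"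
    and integrable_lborel_reflect: "integrable lborel f \<Longrightarrow> integrable lborel (\<lambda>x. f (c - x))"
    and integral_lborel_reflect: "f \<in> borel_measurable borel \<Longrightarrow> (LBINT x. f (c - x)) = (LBINT x. f x)"
proof -
  show "integrable lborel (\<lambda>x. f (x + c))" if "integrable lborel f"
    using integrable_distr[of "(+) c" lborel borel f] that
    by (simp add: lborel_distr_plus add.commute)
  show "(LBINT x. f (x + c)) = (LBINT x. f x)" if "f \<in> borel_measurable borel"
    using integral_distr[of "(+) c" lborel borel f] that
    by (simp add: lborel_distr_plus add.commute)
  show "integrable lborel (\<lambda>x. f (c - x))" if "integrable lborel f"
    using integrable_distr[of "\<lambda>x. c - x" lborel borel f] that
    by (simp add: lborel_distr_reflect)
  show "(LBINT x. f (c - x)) = (LBINT x. f x)" if "f \<in> borel_measurable borel"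
    using integral_distr[of "\<lambda>x. c - x" lborel borel f] that
    by (simp add: lborel_distr_reflect)
qed

text \<open>Integrate the hypothesis over \<open>x\<close>: translation invariance turns every slice
  \<open>t\<close> on the left into the integral of \<open>D\<close>, while the difference on the
  right integrates to 0. This is the divergence theorem without boundary, applied later to one
  coordinate direction at a time.\<close>

lemma integral_directional_derivative_eq_0:
  fixes F D :: "'a::euclidean_space \<Rightarrow> 'b::euclidean_space"
  assumes F: "integrable lborel F" and D: "integrable lborel D"
    and FTC: "\<And>x. ((\<lambda>t. D (x + t *\<^sub>R e)) has_integral (F (x + e) - F x)) {0..1}"
  shows "(LBINT x. D x) = 0"
proof -
  let ?D = "\<integral>\<^sup>+x. norm (D x) \<partial>lborel"
  have [measurable]: "D \<in> borel_measurable borel" "F \<in> borel_measurable borel"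
    using F D by auto
  define g where "g = (\<lambda>(x::'a) (t::real). indicator {0..1} t *\<^sub>R D (x + t *\<^sub>R e))"
  have gm[measurable]: "case_prod g \<in> borel_measurable (lborel \<Otimes>\<^sub>M lborel)"
    unfolding g_def by measurable
  have nt: "(\<integral>\<^sup>+x. norm (g x t) \<partial>lborel) = indicator {0..1} t * ?D" for t
  proof (cases "t \<in> {0..1}")
    case True
    then show ?thesis
      unfolding g_def using nn_integral_lborel_translate[of "\<lambda>x. ennreal (norm (D x))" "t *\<^sub>R e"]
      by simp
  qed (simp add: g_def)
  have "integrable (lborel \<Otimes>\<^sub>M lborel) (case_prod g)"
  proof (rule integrableI_bounded)
    have "(\<integral>\<^sup>+z. norm (case_prod g z) \<partial>(lborel \<Otimes>\<^sub>M lborel)) = (\<integral>\<^sup>+t. (\<integral>\<^sup>+x. norm (g x t) \<partial>lborel) \<partial>lborel)"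
      by (subst lborel_pair.nn_integral_snd[symmetric]) (auto simp: case_prod_unfold)
    also have "\<dots> = (\<integral>\<^sup>+(t::real). indicator {0..1} t * ?D \<partial>lborel)"
      by (simp only: nt)
    also have "\<dots> = ?D"
      by (subst nn_integral_multc) (auto simp: one_ennreal_def[symmetric])
    also have "\<dots> < \<infinity>"
      using D by (simp add: integrable_iff_bounded)
    finally show "(\<integral>\<^sup>+z. norm (case_prod g z) \<partial>(lborel \<Otimes>\<^sub>M lborel)) < \<infinity>" .
  qed simp
  note gi = this
  have "(LBINT t. (LBINT x. g x t)) = (LBINT x. (LBINT t. g x t))"
    by (rule lborel_pair.Fubini_integral[OF gi])
  moreover have "(LBINT x. g x t) = indicator {0..1} t *\<^sub>R (LBINT x. D x)" for t
    unfolding g_def using integral_lborel_translate[of D "t *\<^sub>R e"] by simp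
  moreover have "(LBINT x. (LBINT t. g x t)) = (LBINT x. F (x + e) - F x)"
  proof (rule integral_cong_AE)
    show "AE x in lborel. (LBINT t. g x t) = F (x + e) - F x"
      using lborel_pair.AE_integrable_fst[OF gi]
    proof eventually_elim
      case (elim x)
      then have "set_integrable lborel {0..1} (\<lambda>t. D (x + t *\<^sub>R e))"
        unfolding set_integrable_def g_def .
      from set_borel_integral_eq_integral(2)[OF this] FTC[of x]
      show ?case
        unfolding g_def set_lebesgue_integral_def by (simp add: integral_unique)
    qed
  qed auto
  moreover have "(LBINT x. F (x + e) - F x) = 0"
    using F by (subst lebesgue_diff)
      (auto simp: integrable_lborel_translate integral_lborel_translate)
  ultimately show ?thesis by simp
qed

lemma has_vector_derivative_iff_quotient:
  fixes f :: "real \<Rightarrow> 'c::real_normed_vector"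
  shows "(f has_vector_derivative D) (at z) \<longleftrightarrow> ((\<lambda>y. (1 / (y - z)) *\<^sub>R (f y - f z)) \<longlongrightarrow> D) (at z)"
proof -
  have "(f has_vector_derivative D) (at z) \<longleftrightarrow>
      ((\<lambda>y. (1 / norm (y - z)) *\<^sub>R (f y - (f z + (y - z) *\<^sub>R D))) \<longlongrightarrow> 0) (at z)"
    unfolding has_vector_derivative_def has_derivative_within
    by (auto intro: bounded_linear_scaleR_left)
  also have "\<dots> \<longleftrightarrow> ((\<lambda>y. (1 / (y - z)) *\<^sub>R (f y - f z) - D) \<longlongrightarrow> 0) (at z)"
  proof (subst (1 2) tendsto_norm_zero_iff[symmetric], rule tendsto_cong)
    have "norm ((1 / norm (y - z)) *\<^sub>R (f y - (f z + (y - z) *\<^sub>R D))) = norm ((1 / (y - z)) *\<^sub>R (f y - f z) - D)"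
      if "y \<noteq> z" for y
    proof -
      have "(1 / (y - z)) *\<^sub>R (f y - f z) - D = (1 / (y - z)) *\<^sub>R (f y - (f z + (y - z) *\<^sub>R D))"
        using that by (simp add: scaleR_diff_right scaleR_add_right)
      then show ?thesis by simp
    qed
    then show "\<forall>\<^sub>F y in at z. norm ((1 / norm (y - z)) *\<^sub>R (f y - (f z + (y - z) *\<^sub>R D)))
        = norm ((1 / (y - z)) *\<^sub>R (f y - f z) - D)"
      by (auto simp: eventually_at_filter)
  qed
  finally show ?thesis by (simp add: LIM_zero_iff)
qed

text \<open>The mean value theorem bounds the difference quotients by \<open>g\<close>, so dominated
  convergence applies along every sequence. The exceptional null set of \<open>s\<close> is common
  to all \<open>y\<close>, because the mean value theorem needs the derivative bound on the whole
  interval.\<close>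

lemma has_vector_derivative_lebesgue_integral:
  fixes f :: "real \<Rightarrow> 'b \<Rightarrow> 'c::{banach, second_countable_topology}"
  assumes z: "a < z" "z < b"
    and fi: "\<And>y. a < y \<Longrightarrow> y < b \<Longrightarrow> integrable M (f y)"
    and fm: "f' z \<in> borel_measurable M"
    and der: "AE s in M. \<forall>y\<in>{a<..<b}. ((\<lambda>y. f y s) has_vector_derivative f' y s) (at y) \<and> norm (f' y s) \<le> g s"
    and g: "integrable M g"
  shows "((\<lambda>y. \<integral>s. f y s \<partial>M) has_vector_derivative (\<integral>s. f' z s \<partial>M)) (at z)"
proof -
  have "((\<lambda>y. (1 / (y - z)) *\<^sub>R ((\<integral>s. f y s \<partial>M) - (\<integral>s. f z s \<partial>M))) \<longlongrightarrow> (\<integral>s. f' z s \<partial>M)) (at z)"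
    unfolding tendsto_at_iff_sequentially comp_def
  proof (intro allI impI)
    fix X :: "nat \<Rightarrow> real" assume X: "\<forall>i. X i \<in> UNIV - {z}" and lim: "X \<longlonglongrightarrow> z"
    obtain n0 where n0: "\<And>n. n \<ge> n0 \<Longrightarrow> X n \<in> {a<..<b}"
      using topological_tendstoD[OF lim, of "{a<..<b}"] z unfolding eventually_sequentially by auto
    define Y where "Y n = X (n + n0)" for n
    have Y: "Y n \<in> {a<..<b}" "Y n \<noteq> z" for n using n0 X by (auto simp: Y_def)
    have Yl: "Y \<longlonglongrightarrow> z" unfolding Y_def using lim by (rule LIMSEQ_ignore_initial_segment)
    have fY: "integrable M (f (Y n))" "integrable M (f z)" for n using fi Y z by auto
    have "(\<lambda>n. \<integral>s. (1 / (Y n - z)) *\<^sub>R (f (Y n) s - f z s) \<partial>M) \<longlonglongrightarrow> (\<integral>s. f' z s \<partial>M)"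
    proof (rule integral_dominated_convergence[where w=g])
      show "AE s in M. (\<lambda>n. (1 / (Y n - z)) *\<^sub>R (f (Y n) s - f z s)) \<longlonglongrightarrow> f' z s"
        using der
      proof eventually_elim
        case (elim s)
        then have "((\<lambda>y. f y s) has_vector_derivative f' z s) (at z)" using z by auto
        then have "((\<lambda>y. (1 / (y - z)) *\<^sub>R (f y s - f z s)) \<longlongrightarrow> f' z s) (at z)"
          unfolding has_vector_derivative_iff_quotient
          by simp
        then show ?case using Yl Y by (auto simp: tendsto_at_iff_sequentially comp_def)
      qed
      show "AE s in M. norm ((1 / (Y n - z)) *\<^sub>R (f (Y n) s - f z s)) \<le> g s" for n
        using der
      proof eventually_elim
        case (elim s)
        have "norm (f (Y n) s - f z s) \<le> g s * norm (Y n - z)"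
        proof (rule differentiable_bound[where S="{a<..<b}" and f'="\<lambda>y d. d *\<^sub>R f' y s"])
          fix y assume "y \<in> {a<..<b}"
          then show "((\<lambda>y. f y s) has_derivative (\<lambda>d. d *\<^sub>R f' y s)) (at y within {a<..<b})"
            using elim by (auto simp: has_vector_derivative_def intro: has_derivative_at_withinI)
          show "onorm (\<lambda>d. d *\<^sub>R f' y s) \<le> g s"
            using elim \<open>y \<in> {a<..<b}\<close> by (intro onorm_le) (auto simp: mult.commute[of "abs _"] intro!: mult_right_mono)
        qed (use Y z in auto)
        then show ?case using Y[of n]
          by (simp only: norm_scaleR) (simp add: field_simps)
      qed
    qed (use fY fm g in auto)
    then have "(\<lambda>n. (1 / (Y n - z)) *\<^sub>R ((\<integral>s. f (Y n) s \<partial>M) - (\<integral>s. f z s \<partial>M))) \<longlonglongrightarrow> (\<integral>s. f' z s \<partial>M)"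
      using fY by simp
    then show "(\<lambda>n. (1 / (X n - z)) *\<^sub>R ((\<integral>s. f (X n) s \<partial>M) - (\<integral>s. f z s \<partial>M))) \<longlonglongrightarrow> (\<integral>s. f' z s \<partial>M)"
      unfolding Y_def by (rule LIMSEQ_offset)
  qed
  then show ?thesis
    unfolding has_vector_derivative_iff_quotient by simp
qed

text \<open>Wherever \<open>f\<close> is nonzero it is at most one term of the series of
  \<open>c n\<close> times the indicator of the ball of radius \<open>r n\<close>, and the volume of
  that ball is a multiple of the power of \<open>r n\<close> in the summability condition. Such
  shells take the place of polar coordinates below.\<close>

lemma integrable_shells:
  fixes f :: "'a::euclidean_space \<Rightarrow> real"
  assumes [measurable]: "f \<in> borel_measurable borel"
    and nn: "\<And>x. f x \<ge> 0" "\<And>n. c n \<ge> 0" "\<And>n::nat. r n \<ge> 0"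
    and ex: "\<And>x. f x \<noteq> 0 \<Longrightarrow> \<exists>n. f x \<le> c n \<and> norm x \<le> r n"
    and sm: "summable (\<lambda>n. c n * r n ^ DIM('a))"
  shows "integrable lborel f"
proof (rule integrableI_bounded)
  let ?b = "\<lambda>n. unit_ball_vol (real DIM('a)) * (c n * r n ^ DIM('a))"
  have "(\<integral>\<^sup>+x. ennreal (norm (f x)) \<partial>lborel) \<le> (\<integral>\<^sup>+(x::'a). (\<Sum>n. ennreal (c n) * indicator (cball 0 (r n)) x) \<partial>lborel)"
  proof (rule nn_integral_mono)
    fix x :: 'a
    show "ennreal (norm (f x)) \<le> (\<Sum>n. ennreal (c n) * indicator (cball 0 (r n)) x)"
    proof (cases "f x = 0")
      case False
    then obtain n where n: "f x \<le> c n" "norm x \<le> r n" using ex by blast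
    have "ennreal (norm (f x)) \<le> (\<Sum>i\<in>{n}. ennreal (c i) * indicator (cball 0 (r i)) x)"
      using n nn by (auto simp: indicator_def intro!: ennreal_leI)
    also have "\<dots> \<le> (\<Sum>n. ennreal (c n) * indicator (cball 0 (r n)) x)"
      by (rule sum_le_suminf) auto
    finally show ?thesis .
    qed simp
  qed
  also have "\<dots> = (\<Sum>n. \<integral>\<^sup>+x. ennreal (c n) * indicator (cball 0 (r n)) x \<partial>(lborel :: 'a measure))"
    by (rule nn_integral_suminf) (intro borel_measurable_times_ennreal borel_measurable_const borel_measurable_indicator, simp)
  also have "\<dots> = (\<Sum>n. ennreal (?b n))"
  proof (rule suminf_cong)
    fix n
    have "(\<integral>\<^sup>+x. ennreal (c n) * indicator (cball 0 (r n)) x \<partial>(lborel :: 'a measure)) = ennreal (c n) * emeasure lborel (cball (0::'a) (r n))"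
      by (rule nn_integral_cmult_indicator) simp
    also have "\<dots> = ennreal (?b n)"
      using nn(2)[of n] nn(3)[of n] by (subst emeasure_cball) (auto simp: ennreal_mult'[symmetric] mult_ac)
    finally show "(\<integral>\<^sup>+x. ennreal (c n) * indicator (cball 0 (r n)) x \<partial>(lborel :: 'a measure)) = ennreal (?b n)" .
  qed
  also have "\<dots> < \<infinity>"
    using nn sm by (subst suminf_ennreal2) (auto intro!: summable_mult)
  finally show "(\<integral>\<^sup>+x. ennreal (norm (f x)) \<partial>lborel) < \<infinity>" .
qed simp

section \<open>The bracket <x> and integrable powers\<close>

lemma jb_ge_1: "jb x \<ge> 1"
  by (simp add: jbracket_def)

lemma jb_pos [simp]: "jb x > 0"
  using jb_ge_1[of x] by linarith

lemma jb_nz [simp]: "jb x \<noteq> 0"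
  using jb_pos[of x] by linarith

lemma jb_nonneg [simp]: "jb x \<ge> 0"
  using jb_pos[of x] by linarith

lemma jb_sq: "jb x ^ 2 = 1 + norm x ^ 2"
  by (simp add: jbracket_def)

lemma norm_le_jb: "norm x \<le> jb x"
  by (rule power2_le_imp_le) (simp_all add: jb_sq)

lemma jb_le_1_norm: "jb x \<le> 1 + norm x"
  by (rule power2_le_imp_le) (simp_all add: jb_sq power2_sum)

lemma jb_triangle: "jb (x + y) \<le> jb x + norm y"
proof (rule power2_le_imp_le)
  have "(jb (x + y))^2 \<le> 1 + (norm x + norm y)^2"
    by (simp add: jb_sq norm_triangle_ineq power_mono)
  also have "\<dots> \<le> (jb x + norm y)^2"
    using mult_right_mono[OF norm_le_jb[of x], of "norm y"] by (simp add: power2_sum jb_sq)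
  finally show "(jb (x + y))^2 \<le> (jb x + norm y)^2" .
qed simp

lemma jb_minus [simp]: "jb (- x) = jb x"
  by (simp add: jbracket_def)

lemma continuous_on_jb [continuous_intros]:
  "continuous_on S f \<Longrightarrow> continuous_on S (\<lambda>x. jb (f x))"
  unfolding jbracket_def by (intro continuous_intros)

lemma measurable_jb [measurable]: "jb \<in> borel_measurable borel"
  by (intro borel_measurable_continuous_onI continuous_on_jb continuous_on_id)

lemma integrable_jb_powr:
  assumes q: "q > real CARD('n)"
  shows "integrable lborel (\<lambda>x :: real ^ 'n. jb x powr (- q))"
proof (rule integrable_shells[where c = "\<lambda>n. 2 powr (q * (1 - real n))" and r = "\<lambda>n. 2 ^ n"])
  fix x :: "real ^ 'n"
  obtain n0 where n0: "jb x \<le> 2 ^ n0"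
    using real_arch_pow[of 2 "jb x"] by (auto intro: less_imp_le)
  \<comment> \<open>The dyadic shell of \<open>x\<close>: minimality gives \<open>jb x\<close> >=
    2^(n-1), and for n = 0 this holds because \<open>jb x\<close> >= 1.\<close>
  define n where "n = (LEAST n. jb x \<le> 2 ^ n)"
  have n: "jb x \<le> 2 ^ n" unfolding n_def by (rule LeastI[of _ n0]) (rule n0)
  have "2 powr (real n - 1) \<le> jb x"
  proof (cases n)
    case 0
    then show ?thesis using jb_ge_1[of x] by (simp add: powr_minus)
  next
    case (Suc m)
    then have "\<not> jb x \<le> 2 ^ m" unfolding n_def by (metis lessI not_less_Least)
    then show ?thesis using Suc by (simp add: powr_realpow)
  qed
  then have "jb x powr (-q) \<le> (2 powr (real n - 1)) powr (-q)"
    using q by (intro powr_mono2') auto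
  also have "\<dots> = 2 powr (q * (1 - real n))" by (simp add: powr_powr algebra_simps)
  finally show "\<exists>n. jb x powr - q \<le> 2 powr (q * (1 - real n)) \<and> norm x \<le> 2 ^ n"
    using n norm_le_jb[of x] by (intro exI[of _ n]) auto
next
  have "(2::real) powr (q * (1 - real n)) * (2 ^ n) ^ DIM(real^'n) = 2 powr q * (2 powr (real CARD('n) - q)) ^ n" for n
    by (simp add: powr_realpow[symmetric] powr_powr powr_add[symmetric] algebra_simps)
  moreover have "(2::real) powr (real CARD('n) - q) < 1" using q by (simp add: powr_less_one)
  ultimately show "summable (\<lambda>n. (2::real) powr (q * (1 - real n)) * (2 ^ n) ^ DIM(real^'n))"
    by (simp add: summable_mult summable_geometric)
qed auto

lemma integrable_norm_powr_ball:
  assumes q: "0 \<le> q" "q < real DIM('a)"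
  shows "integrable lborel (\<lambda>x :: 'a::euclidean_space. indicator (ball 0 1) x * norm x powr (- q))"
proof -
  define f where "f = (\<lambda>x :: 'a. indicator (ball 0 1) x * norm x powr (- q))"
  have fm: "f \<in> borel_measurable borel" unfolding f_def
    by (intro borel_measurable_times borel_measurable_indicator) auto
  have ex: "\<exists>n. norm x \<le> (1/2) ^ n \<and> norm x powr (- q) \<le> 2 powr (q * (1 + real n))"
    if x: "x \<noteq> 0" "norm x < 1" for x :: 'a
  proof -
    define m where "m = (LEAST n. (1/2) ^ n < norm x)"
    have "\<exists>n. (1/2) ^ n < norm x" using that real_arch_pow_inv[of "norm x" "1/2"] by auto
    then have m: "(1/2) ^ m < norm x" unfolding m_def by (rule LeastI_ex)
    then obtain n where n: "m = Suc n" using x by (cases m) auto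
    have n2: "norm x \<le> (1/2) ^ n" using not_less_Least[of n "\<lambda>n. (1/2) ^ n < norm x"] n
      unfolding m_def by auto
    have "norm x powr (-q) \<le> ((1/2) ^ m) powr (-q)"
      using q m by (intro powr_mono2') auto
    also have "(1/2::real) ^ m = 2 powr (- real m)"
      by (simp add: powr_minus powr_realpow power_one_over inverse_eq_divide)
    also have "(2 powr (- real m)) powr (- q) = 2 powr (q * (1 + real n))"
      by (simp add: powr_powr n algebra_simps)
    finally show ?thesis using n2 by auto
  qed
  \<comment> \<open>Index 0 is an artificial shell of weight 0. The shell (1/2)^(n+1) < |x| <=
    (1/2)^n gets the index n+1, so that its weight 2^(q(n+1)) has the index as exponent.\<close>
  define c where "c n = (if n = 0 then 0 else 2 powr (q * real n))" for n
  define r where "r n = (if n = 0 then 1 else (1/2::real) ^ (n - 1))" for n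
  have "integrable lborel f"
  proof (rule integrable_shells[OF fm, where c=c and r=r])
    fix x :: 'a assume "f x \<noteq> 0"
    then have "x \<noteq> 0" "norm x < 1" by (auto simp: f_def indicator_def)
    from ex[OF this] obtain n where "norm x \<le> (1/2) ^ n" "norm x powr (- q) \<le> 2 powr (q * (1 + real n))" by blast
    then show "\<exists>n. f x \<le> c n \<and> norm x \<le> r n"
      using \<open>norm x < 1\<close> by (intro exI[of _ "Suc n"]) (auto simp: c_def r_def f_def)
  next
    have "c (Suc n) * r (Suc n) ^ DIM('a) = 2 powr q * (2 powr (q - real DIM('a))) ^ n" for n
    proof -
      have "(1/2::real) ^ n = 2 powr (- real n)"
        by (simp add: powr_minus powr_realpow power_one_over inverse_eq_divide)
      then show ?thesis unfolding c_def r_def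
        by (simp add: powr_realpow[symmetric] powr_powr powr_add[symmetric] algebra_simps)
    qed
    moreover have "(2::real) powr (q - real DIM('a)) < 1" using q by (simp add: powr_less_one)
    ultimately have "summable (\<lambda>n. c (Suc n) * r (Suc n) ^ DIM('a))"
      by (simp add: summable_mult summable_geometric)
    then show "summable (\<lambda>n. c n * r n ^ DIM('a))" by (subst (asm) summable_Suc_iff)
  qed (auto simp: f_def c_def r_def)
  then show ?thesis unfolding f_def .
qed

section \<open>Hankel functions as integrals over a half line\<close>

text \<open>On \<open>t = 1 + i s\<close> one has \<open>1 - t^2 = hw s\<close> and \<open>e\<^sup>i\<^sup>z\<^sup>t (1 - t^2)\<^sup>p = hI p z s\<close>.\<close>

definition hw :: "real \<Rightarrow> complex"
  where "hw s = Complex (s^2) (- 2 * s)"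

definition hI :: "real \<Rightarrow> real \<Rightarrow> real \<Rightarrow> complex"
  where "hI p z s = exp (\<i> * of_real z - of_real (z * s)) * (hw s powr of_real p)"

definition hX :: "real \<Rightarrow> real \<Rightarrow> complex"
  where "hX p z = (LBINT s:{0<..}. hI p z s)"

lemma cmod_hw: "s > 0 \<Longrightarrow> cmod (hw s) = s * sqrt (s^2 + 4)"
proof -
  assume "s > 0"
  have "cmod (hw s) = sqrt (s^2 * (s^2 + 4))"
    by (simp add: hw_def cmod_def power2_eq_square algebra_simps)
  also have "\<dots> = s * sqrt (s^2 + 4)" using \<open>s > 0\<close> by (simp add: real_sqrt_mult)
  finally show ?thesis .
qed

lemma hw_nonpos: "s > 0 \<Longrightarrow> hw s \<notin> \<real>\<^sub>\<le>\<^sub>0"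
  by (simp add: hw_def complex_nonpos_Reals_iff)

lemma hw_nz: "s > 0 \<Longrightarrow> hw s \<noteq> 0"
  using hw_nonpos by fastforce

lemma sqrt_sq_4_le: "s > 0 \<Longrightarrow> sqrt (s^2 + 4) \<le> s + 2"
  by (rule real_le_lsqrt) (auto simp: power2_sum)

text \<open>By \<open>cmod_hw\<close> the modulus behaves like 2 s near 0 and like s^2 at infinity.
  For p >= 0 the two regimes give the exponents p and 2 p; for p < 0 the lower bound 2 s alone gives
  s^p, and both exponents on the right coincide.\<close>

lemma norm_hw_powr:
  assumes "s > 0"
  shows "norm (hw s powr of_real p) \<le> 4 powr \<bar>p\<bar> * (s powr p + s powr (max p (2 * p)))"
proof -
  have e: "norm (hw s powr of_real p) = cmod (hw s) powr p"
    by (simp add: norm_powr_real_powr')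
  show ?thesis
  proof (cases "p \<ge> 0")
    case True
    have "cmod (hw s) \<le> s * (s + 2)"
      using assms sqrt_sq_4_le[OF assms] by (simp add: cmod_hw mult_left_mono)
    also have "\<dots> \<le> 4 * max s (s^2)"
      using assms by (cases "s \<le> 1") (auto simp: max_def power2_eq_square algebra_simps)
    finally have "cmod (hw s) powr p \<le> (4 * max s (s^2)) powr p"
      using True by (intro powr_mono2) auto
    also have "\<dots> = 4 powr p * (max s (s^2)) powr p" using assms by (simp add: powr_mult)
    also have "(max s (s^2)) powr p \<le> s powr p + s powr (2 * p)"
      using assms by (auto simp: max_def powr_powr[symmetric] powr_numeral)
    finally show ?thesis using True e by (simp add: max_def)
  next
    case False
    have "2 * s \<le> cmod (hw s)"
    proof -
      have "2 \<le> sqrt (s^2 + 4)" by (rule real_le_rsqrt) auto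
      then show ?thesis using assms by (simp add: cmod_hw)
    qed
    then have "cmod (hw s) powr p \<le> (2 * s) powr p"
      using False assms by (intro powr_mono2') auto
    also have "\<dots> \<le> 1 * s powr p"
      using False assms by (subst powr_mult) (auto intro!: mult_right_mono order.trans[OF powr_mono[of p 0 2]])
    also have "\<dots> \<le> 4 powr \<bar>p\<bar> * s powr p"
      using False by (intro mult_right_mono ge_one_powr_ge_zero) auto
    also have "\<dots> \<le> 4 powr \<bar>p\<bar> * (s powr p + s powr (max p (2 * p)))"
      by (intro mult_left_mono) auto
    finally show ?thesis using e by simp
  qed
qed

lemma
  assumes q: "q > -1" and z: "z > (0::real)"
  shows powr_exp_integrable: "set_integrable lborel {0<..} (\<lambda>s. s powr q * exp (- (z * s)))"
    and powr_exp_integral: "(LBINT s:{0<..}. s powr q * exp (- (z * s))) = Gamma (q + 1) / z powr (q + 1)"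
proof -
  have hb: "has_bochner_integral lborel (\<lambda>t. indicator {0<..} t * (t powr q * exp (- t))) (Gamma (q + 1))"
  proof (rule has_bochner_integral_nn_integral)
    have "(\<integral>\<^sup>+t. ennreal (indicator {0<..} t * (t powr q * exp (- t))) \<partial>lborel)
        = (\<integral>\<^sup>+t. ennreal (indicator {0..} t * t powr (q + 1 - 1) / exp t) \<partial>lborel)"
      by (intro nn_integral_cong) (auto simp: indicator_def exp_minus field_simps)
    also have "\<dots> = ennreal (Gamma (q + 1))"
      using Gamma_conv_nn_integral_real[of "q + 1"] q by simp
    finally show "(\<integral>\<^sup>+t. ennreal (indicator {0<..} t * (t powr q * exp (- t))) \<partial>lborel) = ennreal (Gamma (q + 1))" .
  qed (use q in \<open>auto intro!: Gamma_real_nonneg simp: indicator_def\<close>)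
  have "has_bochner_integral lborel (\<lambda>t. indicator {0<..} (0 + z * t) * ((0 + z * t) powr q * exp (- (0 + z * t)))) (Gamma (q + 1) /\<^sub>R \<bar>z\<bar>)"
    by (rule iffD1[OF lborel_has_bochner_integral_real_affine_iff hb]) (use z in auto)
  then have "has_bochner_integral lborel (\<lambda>t. z powr (- q) * (indicator {0<..} (0 + z * t) * ((0 + z * t) powr q * exp (- (0 + z * t))))) (z powr (- q) * (Gamma (q + 1) /\<^sub>R \<bar>z\<bar>))"
    by (rule has_bochner_integral_mult_right)
  also have "(\<lambda>t. z powr (- q) * (indicator {0<..} (0 + z * t) * ((0 + z * t) powr q * exp (- (0 + z * t)))))
      = (\<lambda>t. indicator {0<..} t *\<^sub>R (t powr q * exp (- (z * t))))"
    using z by (auto simp: fun_eq_iff indicator_def powr_mult powr_minus zero_less_mult_iff field_simps)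
  also have "z powr (- q) * (Gamma (q + 1) /\<^sub>R \<bar>z\<bar>) = Gamma (q + 1) / z powr (q + 1)"
    using z by (simp add: powr_add powr_minus field_simps)
  finally have *: "has_bochner_integral lborel (\<lambda>t. indicator {0<..} t *\<^sub>R (t powr q * exp (- (z * t)))) (Gamma (q + 1) / z powr (q + 1))" .
  show "set_integrable lborel {0<..} (\<lambda>s. s powr q * exp (- (z * s)))"
    using * unfolding set_integrable_def by (simp add: has_bochner_integral_iff)
  show "(LBINT s:{0<..}. s powr q * exp (- (z * s))) = Gamma (q + 1) / z powr (q + 1)"
    using * unfolding set_lebesgue_integral_def by (simp add: has_bochner_integral_iff)
qed

definition hB :: "real \<Rightarrow> real \<Rightarrow> real \<Rightarrow> real"
  where "hB p z s = 4 powr \<bar>p\<bar> * (s powr p * exp (- (z * s)) + s powr (max p (2 * p)) * exp (- (z * s)))"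

lemma norm_hI:
  assumes "s > 0"
  shows "norm (hI p z s) \<le> hB p z s"
proof -
  have "norm (hI p z s) = exp (- (z * s)) * norm (hw s powr of_real p)"
    by (simp add: hI_def norm_mult)
  also have "\<dots> \<le> exp (- (z * s)) * (4 powr \<bar>p\<bar> * (s powr p + s powr (max p (2 * p))))"
    by (intro mult_left_mono norm_hw_powr assms) auto
  finally show ?thesis by (simp add: hB_def algebra_simps)
qed

lemma hB_moment:
  assumes "p + j > -1" "z > 0" "0 \<le> j"
  shows "set_integrable lborel {0<..} (\<lambda>s. s powr j * hB p z s)"
    and "(LBINT s:{0<..}. s powr j * hB p z s) =
      4 powr \<bar>p\<bar> * (Gamma (p + j + 1) / z powr (p + j + 1) + Gamma (max p (2 * p) + j + 1) / z powr (max p (2 * p) + j + 1))"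
proof -
  have i: "set_integrable lborel {0<..} (\<lambda>s. s powr (p + j) * exp (- (z * s)))"
    "set_integrable lborel {0<..} (\<lambda>s. s powr (max p (2 * p) + j) * exp (- (z * s)))"
    using assms by (auto intro!: powr_exp_integrable)
  have e: "s powr j * hB p z s = 4 powr \<bar>p\<bar> * (s powr (p + j) * exp (- (z * s)) + s powr (max p (2 * p) + j) * exp (- (z * s)))" for s
    by (simp add: hB_def powr_add algebra_simps)
  show "set_integrable lborel {0<..} (\<lambda>s. s powr j * hB p z s)"
    unfolding e using i by (intro set_integrable_mult_right set_integral_add) auto
  show "(LBINT s:{0<..}. s powr j * hB p z s) =
      4 powr \<bar>p\<bar> * (Gamma (p + j + 1) / z powr (p + j + 1) + Gamma (max p (2 * p) + j + 1) / z powr (max p (2 * p) + j + 1))"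
    unfolding e set_integral_mult_right using i assms
    by (subst set_integral_add) (auto simp: powr_exp_integral)
qed

lemma hI_measurable [measurable]: "hI p z \<in> borel_measurable borel"
proof -
  have [measurable]: "hw \<in> borel_measurable borel"
    unfolding hw_def by (intro borel_measurable_continuous_onI continuous_intros)
  show ?thesis unfolding hI_def powr_def by measurable
qed

lemma hI_moment:
  assumes "p + j > -1" "z > 0" "0 \<le> j"
  shows "set_integrable lborel {0<..} (\<lambda>s. of_real (s powr j) * hI p z s)" (is ?A)
    and "norm (LBINT s:{0<..}. of_real (s powr j) * hI p z s) \<le>
      4 powr \<bar>p\<bar> * (Gamma (p + j + 1) / z powr (p + j + 1) + Gamma (max p (2 * p) + j + 1) / z powr (max p (2 * p) + j + 1))" (is ?B)
proof -
  have b: "norm (of_real (s powr j) * hI p z s) \<le> s powr j * hB p z s" if "s > 0" for s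
    using norm_hI[OF that, of p z] by (simp add: norm_mult mult_left_mono)
  show A: ?A
    using b by (intro set_integrable_bound[OF hB_moment(1)[OF assms]])
      (auto simp: set_borel_measurable_def intro!: AE_I2 order.trans[OF b])
  have "norm (LBINT s:{0<..}. of_real (s powr j) * hI p z s) \<le> (LBINT s:{0<..}. norm (of_real (s powr j) * hI p z s))"
    by (rule set_integral_norm_bound[OF A])
  also have "\<dots> \<le> (LBINT s:{0<..}. s powr j * hB p z s)"
    using b A hB_moment(1)[OF assms] by (intro set_integral_mono set_integrable_norm) auto
  finally show ?B unfolding hB_moment(2)[OF assms] .
qed

lemma hI_integrable: "p > -1 \<Longrightarrow> z > 0 \<Longrightarrow> set_integrable lborel {0<..} (hI p z)"
proof -
  assume "p > -1" "z > 0"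
  from hI_moment(1)[of p 0 z] this have "set_integrable lborel {0<..} (\<lambda>s. of_real (s powr 0) * hI p z s)" by simp
  then show ?thesis
    by (rule set_integrable_cong[THEN iffD1, rotated 3]) auto
qed

lemma hw_deriv: "(hw has_vector_derivative (- 2 * \<i> * (1 + \<i> * of_real s))) (at s within A)"
proof -
  have e: "hw = (\<lambda>s. of_real s ^ 2 - 2 * \<i> * of_real s)"
    by (auto simp: hw_def fun_eq_iff complex_eq_iff power2_eq_square)
  show ?thesis unfolding e
    by (rule derivative_eq_intros has_vector_derivative_real_field refl | simp add: algebra_simps)+
qed

lemma hw_eq: "hw s = 1 - (1 + \<i> * of_real s)^2"
  by (auto simp: hw_def complex_eq_iff power2_eq_square)

lemma hI_deriv_z:
  "((\<lambda>z. hI p z s) has_vector_derivative (\<i> - of_real s) * hI p z s) (at z within A)"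
proof -
  have "((\<lambda>z. exp (\<i> * z - z * of_real s) * (hw s powr of_real p)) has_field_derivative
     (\<i> - of_real s) * (exp (\<i> * z - z * of_real s) * (hw s powr of_real p))) (at z)" for z :: complex
    by (rule derivative_eq_intros refl | simp add: algebra_simps)+
  from has_vector_derivative_real_field[OF this[of "of_real z"]]
  show ?thesis unfolding hI_def by simp
qed

text \<open>The majorant \<open>hB\<close> decreases in its argument \<open>z\<close>, so its value
  at z/2, times 1 + s for the factor produced by differentiation, dominates the derivative on the
  whole interval from z/2 to 2 z.\<close>

lemma hX_deriv:
  assumes p: "p > -1" and z: "z > 0"
  shows "(hX p has_vector_derivative (LBINT s:{0<..}. (\<i> - of_real s) * hI p z s)) (at z within A)"
proof -
  define g where "g s = indicator {0<..} s *\<^sub>R (hB p (z/2) s + s powr 1 * hB p (z/2) s)" for s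
  have "((\<lambda>y. \<integral>s. indicator {0<..} s *\<^sub>R hI p y s \<partial>lborel) has_vector_derivative
    (LBINT s. indicator {0<..} s *\<^sub>R ((\<i> - of_real s) * hI p z s))) (at z)"
  proof (rule has_vector_derivative_lebesgue_integral[where a="z/2" and b = "2*z" and g = g])
    show "integrable lborel (\<lambda>s. indicator {0<..} s *\<^sub>R hI p y s)" if "z / 2 < y" for y
      using hI_integrable[OF p, of y] that z unfolding set_integrable_def by simp
    show "AE s in lborel. \<forall>y\<in>{z / 2<..<2 * z}.
        ((\<lambda>y. indicator {0<..} s *\<^sub>R hI p y s) has_vector_derivative indicator {0<..} s *\<^sub>R ((\<i> - of_real s) * hI p y s)) (at y) \<and>
        norm (indicator {0<..} s *\<^sub>R ((\<i> - of_real s) * hI p y s)) \<le> g s"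
    proof (intro AE_I2 ballI conjI)
      fix s y assume y: "y \<in> {z / 2<..<2 * z}"
      show "((\<lambda>y. indicator {0<..} s *\<^sub>R hI p y s) has_vector_derivative indicator {0<..} s *\<^sub>R ((\<i> - of_real s) * hI p y s)) (at y)"
        by (rule bounded_linear.has_vector_derivative[OF bounded_linear_scaleR_right hI_deriv_z])
      show "norm (indicator {0<..} s *\<^sub>R ((\<i> - of_real s) * hI p y s)) \<le> g s"
      proof (cases "s > 0")
        case True
        have "norm (\<i> - complex_of_real s) \<le> 1 + s" using norm_triangle_ineq4[of \<i> "of_real s"] True by simp
        then have "norm ((\<i> - of_real s) * hI p y s) \<le> (1 + s) * hB p y s"
          unfolding norm_mult using norm_hI[OF True, of p y] True by (intro mult_mono) auto
        also have "\<dots> \<le> (1 + s) * hB p (z/2) s"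
          unfolding hB_def using y True by (intro mult_left_mono add_mono) (auto intro!: mult_right_mono)
        finally show ?thesis using True by (simp add: g_def algebra_simps)
      qed (simp add: g_def)
    qed
    have "set_integrable lborel {0<..} (\<lambda>s. s powr 0 * hB p (z/2) s)"
      using p z by (intro hB_moment) auto
    then have "set_integrable lborel {0<..} (\<lambda>s. hB p (z/2) s)"
      by (rule set_integrable_cong[THEN iffD1, rotated 3]) auto
    moreover have "set_integrable lborel {0<..} (\<lambda>s. s powr 1 * hB p (z/2) s)"
      using p z by (intro hB_moment) auto
    ultimately show "integrable lborel g"
      unfolding g_def set_integrable_def[symmetric] by (rule set_integral_add)
  qed (use z in \<open>auto\<close>)
  then show ?thesis
    unfolding hX_def set_lebesgue_integral_def by (rule has_vector_derivative_at_within)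
qed

text \<open>The remainder carries an extra factor \<open>s\<close>, which in the moment bounds is
  worth one more power of 1/z than \<open>hX\<close> itself has. This gain is the origin of the
  radiation condition.\<close>

lemma hX_deriv_split:
  assumes p: "p > -1" and z: "z > 0"
  shows "(LBINT s:{0<..}. (\<i> - of_real s) * hI p z s) = \<i> * hX p z - (LBINT s:{0<..}. of_real s * hI p z s)"
    and "set_integrable lborel {0<..} (\<lambda>s. of_real s * hI p z s)"
    and "norm (LBINT s:{0<..}. of_real s * hI p z s) \<le> 
      4 powr \<bar>p\<bar> * (Gamma (p + 2) / z powr (p + 2) + Gamma (max p (2 * p) + 2) / z powr (max p (2 * p) + 2))"
proof -
  have c: "set_integrable lborel {0<..} (\<lambda>s. of_real (s powr 1) * hI p z s) = set_integrable lborel {0<..} (\<lambda>s. of_real s * hI p z s)"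
    "(LBINT s:{0<..}. of_real (s powr 1) * hI p z s) = (LBINT s:{0<..}. of_real s * hI p z s)"
    by (rule set_integrable_cong set_lebesgue_integral_cong; simp)+
  show *: "set_integrable lborel {0<..} (\<lambda>s. of_real s * hI p z s)"
    using hI_moment(1)[of p 1 z] p z c by simp
  show "norm (LBINT s:{0<..}. of_real s * hI p z s) \<le> 
      4 powr \<bar>p\<bar> * (Gamma (p + 2) / z powr (p + 2) + Gamma (max p (2 * p) + 2) / z powr (max p (2 * p) + 2))"
    using hI_moment(2)[of p 1 z] p z c by (simp add: algebra_simps)
  show "(LBINT s:{0<..}. (\<i> - of_real s) * hI p z s) = \<i> * hX p z - (LBINT s:{0<..}. of_real s * hI p z s)"
    unfolding hX_def left_diff_distrib using * hI_integrable[OF p z]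
    by (subst set_integral_diff) auto
qed

lemma hI_deriv_s:
  assumes "s > 0"
  shows "((\<lambda>s. hI p z s) has_vector_derivative
     (- of_real z * hI p z s - 2 * \<i> * of_real p * (1 + \<i> * of_real s) * hI (p - 1) z s)) (at s within A)"
proof -
  have "((\<lambda>w. w powr of_real p) has_field_derivative of_real p * hw s powr (of_real p - 1)) (at (hw s))"
    using hw_nonpos[OF assms] by (rule has_field_derivative_powr)
  from field_vector_diff_chain_at[OF hw_deriv[of s UNIV] this]
  have 1: "((\<lambda>s. hw s powr of_real p) has_vector_derivative (- 2 * \<i> * (1 + \<i> * of_real s)) * (of_real p * hw s powr (of_real p - 1))) (at s)"
    by (simp add: o_def)
  have "((\<lambda>s. exp (\<i> * of_real z - of_real z * s)) has_field_derivative (- of_real z) * exp (\<i> * of_real z - of_real z * s)) (at s)" for s :: complex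
    by (rule derivative_eq_intros refl | simp)+
  from has_vector_derivative_real_field[OF this[of "of_real s"]]
  have 2: "((\<lambda>s. exp (\<i> * of_real z - of_real (z * s))) has_vector_derivative (- of_real z) * exp (\<i> * of_real z - of_real (z * s))) (at s)"
    by simp
  have "((\<lambda>s. hI p z s) has_vector_derivative
     (- of_real z * hI p z s - 2 * \<i> * of_real p * (1 + \<i> * of_real s) * hI (p - 1) z s)) (at s)"
    unfolding hI_def by (rule has_vector_derivative_eq_rhs[OF has_vector_derivative_mult[OF 2 1]])
      (simp add: algebra_simps)
  then show ?thesis by (rule has_vector_derivative_at_within)
qed

lemma continuous_hI: "continuous_on {0<..} (hI p z)"
  using hI_deriv_s by (auto simp: continuous_on_eq_continuous_within intro!: has_vector_derivative_continuous)

lemma hI_tendsto_0: 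
  assumes "p > 0"
  shows "(hI p z \<longlongrightarrow> 0) (at_right 0)"
proof (rule Lim_null_comparison)
  show "\<forall>\<^sub>F s in at_right 0. norm (hI p z s) \<le> hB p z s"
    using norm_hI by (auto simp: eventually_at_right_field intro!: exI[of _ 1])
  show "(hB p z \<longlongrightarrow> 0) (at_right 0)"
    unfolding hB_def using assms
    by (auto intro!: tendsto_eq_intros simp: eventually_at_right_field intro!: exI[of _ 1])
qed

lemma powr_exp_at_top: "z > 0 \<Longrightarrow> ((\<lambda>s::real. s powr q * exp (- (z * s))) \<longlongrightarrow> 0) at_top"
  by real_asymp

lemma hI_tendsto_top: 
  assumes "z > 0"
  shows "(hI p z \<longlongrightarrow> 0) at_top" "((\<lambda>s. of_real s * hI p z s) \<longlongrightarrow> 0) at_top"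
proof -
  have 0: "((\<lambda>s. s powr q * exp (- (z * s))) \<longlongrightarrow> 0) at_top" for q by (rule powr_exp_at_top[OF assms])
  show "(hI p z \<longlongrightarrow> 0) at_top"
  proof (rule Lim_null_comparison)
    show "\<forall>\<^sub>F s in at_top. norm (hI p z s) \<le> hB p z s"
      using eventually_gt_at_top[of 0] by eventually_elim (rule norm_hI)
    show "(hB p z \<longlongrightarrow> 0) at_top"
      unfolding hB_def by (rule tendsto_eq_intros 0 refl)+ simp
  qed
  show "((\<lambda>s. of_real s * hI p z s) \<longlongrightarrow> 0) at_top"
  proof (rule Lim_null_comparison)
    show "\<forall>\<^sub>F s in at_top. norm (of_real s * hI p z s) \<le> 4 powr \<bar>p\<bar> * (s powr (p+1) * exp (- (z * s)) + s powr (max p (2 * p) + 1) * exp (- (z * s)))"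
      using eventually_gt_at_top[of 0]
    proof eventually_elim
      case (elim s)
      have "norm (of_real s * hI p z s) \<le> s * hB p z s" 
        using norm_hI[OF elim, of p z] elim by (simp add: norm_mult)
      then show ?case using elim by (simp add: hB_def powr_add algebra_simps)
    qed
    show "((\<lambda>s. 4 powr \<bar>p\<bar> * (s powr (p+1) * exp (- (z * s)) + s powr (max p (2 * p) + 1) * exp (- (z * s)))) \<longlongrightarrow> 0) at_top"
      by (rule tendsto_eq_intros 0 refl)+ simp
  qed
qed

lemma half_line_FTC_zero:
  fixes F f :: "real \<Rightarrow> complex"
  assumes "\<And>s. s > 0 \<Longrightarrow> (F has_vector_derivative f s) (at s)"
    and "continuous_on {0<..} f" "set_integrable lborel {0<..} f"
    and "(F \<longlongrightarrow> 0) (at_right 0)" "(F \<longlongrightarrow> 0) at_top"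
  shows "(LBINT s:{0<..}. f s) = 0"
proof -
  have "(LBINT x=0..\<infinity>. f x) = 0 - 0"
  proof (rule interval_integral_FTC_integrable)
    show "((F \<circ> real_of_ereal) \<longlongrightarrow> 0) (at_right 0)"
      using assms(4) by (simp add: zero_ereal_def ereal_tendsto_simps)
    show "((F \<circ> real_of_ereal) \<longlongrightarrow> 0) (at_left \<infinity>)"
      using assms(5) by (simp add: ereal_tendsto_simps)
    show "isCont f x" if "0 < ereal x" "ereal x < \<infinity>" for x
      using assms(2) that by (simp add: continuous_on_eq_continuous_at)
    have "einterval 0 \<infinity> = {0<..}" by (auto simp: einterval_def)
    then show "set_integrable lborel (einterval 0 \<infinity>) f" using assms(3) by simp
  qed (use assms in auto)
  then show ?thesis by (simp add: interval_lebesgue_integral_0_infty)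
qed

text \<open>Integrating the \<open>s\<close>-derivatives of \<open>e\<^sup>i\<^sup>z\<^sup>t (1 - t^2)\<^sup>p\<close> and \<open>t e\<^sup>i\<^sup>z\<^sup>t (1 - t^2)\<^sup>p\<close>
  along \<open>t = 1 + i s\<close>.\<close>

lemma hX_ibp1:
  assumes p: "p > 0" and z: "z > 0"
  shows "of_real z * hX p z = - 2 * of_real p * (LBINT s:{0<..}. (\<i> - of_real s) * hI (p - 1) z s)"
proof -
  let ?e = "\<lambda>s. \<i> - of_real s"
  let ?d = "\<lambda>s. ?e s * hI (p - 1) z s"
  have i: "set_integrable lborel {0<..} (hI p z)" "set_integrable lborel {0<..} (\<lambda>s. (?e s) * hI (p - 1) z s)"
    using hI_integrable[of p z] hI_integrable[of "p-1" z] hX_deriv_split(2)[of "p - 1" z] p z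
    unfolding left_diff_distrib by auto
  have "(LBINT s:{0<..}. - of_real z * hI p z s - 2 * of_real p * ?d s) = 0"
  proof (rule half_line_FTC_zero)
    show "(hI p z has_vector_derivative - of_real z * hI p z s - 2 * of_real p * ?d s) (at s)" if "s > 0" for s
      by (rule has_vector_derivative_eq_rhs[OF hI_deriv_s[OF that]]) (simp add: algebra_simps)
    show "continuous_on {0<..} (\<lambda>s. - of_real z * hI p z s - 2 * of_real p * ?d s)"
      by (intro continuous_intros continuous_hI)
    show "set_integrable lborel {0<..} (\<lambda>s. - of_real z * hI p z s - 2 * of_real p * ?d s)"
      using i by (intro set_integral_diff set_integrable_mult_right)
  qed (use hI_tendsto_0[OF p] hI_tendsto_top[OF z] in auto)
  also have "(LBINT s:{0<..}. - of_real z * hI p z s - 2 * of_real p * ?d s)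
     = - of_real z * hX p z - 2 * of_real p * (LBINT s:{0<..}. ?e s * hI (p - 1) z s)"
    unfolding hX_def set_integral_mult_right[symmetric]
    by (rule set_integral_diff(2); intro set_integrable_mult_right i)
  finally have "- of_real z * hX p z - 2 * of_real p * (LBINT s:{0<..}. ?e s * hI (p - 1) z s) = 0" .
  then show ?thesis by algebra
qed

text \<open>\<open>hX_ibp1\<close> at order p + 1 evaluates the integral in \<open>hX_deriv\<close>;
  its boundary terms involve only the positive exponent p + 1, so the relation reaches down to p >
  -1. Before normalization, it is the rule (z^(-nu) H_nu)' = -z z^(-nu-1) H_(nu+1).\<close>

lemma hX_deriv':
  assumes p: "p > -1" and z: "z > 0"
  shows "(hX p has_vector_derivative - of_real (z / (2 * (p + 1))) * hX (p + 1) z) (at z within A)"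
proof (rule has_vector_derivative_eq_rhs[OF hX_deriv[OF p z]])
  have e1: "of_real z * hX (p + 1) z = - 2 * of_real (p + 1) * (LBINT s:{0<..}. (\<i> - of_real s) * hI p z s)"
    using hX_ibp1[of "p + 1" z] p z by simp
  have "2 * (p + 1) > 0" using p by simp
  then have e2: "complex_of_real (2 * (p + 1)) \<noteq> 0" by (simp only: of_real_eq_0_iff)
  have alg: "I = - (X / b)" if "X = - 2 * c * I" "b \<noteq> 0" "b = 2 * c" for I X b c :: complex
    using that by (simp add: field_simps)
  have "(LBINT s:{0<..}. (\<i> - of_real s) * hI p z s) = - ((of_real z * hX (p + 1) z) / of_real (2 * (p + 1)))"
    by (rule alg[OF e1 e2]) simp
  then show "(LBINT s:{0<..}. (\<i> - of_real s) * hI p z s) = - of_real (z / (2 * (p + 1))) * hX (p + 1) z"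
    by (simp only: of_real_divide) simp
qed

lemma hX_ibp2:
  assumes p: "p > 0" and z: "z > 0"
  shows "of_real (1 + 2 * p) * hX p z + of_real z * (LBINT s:{0<..}. (\<i> - of_real s) * hI p z s)
    = of_real (2 * p) * hX (p - 1) z"
proof -
  have i: "set_integrable lborel {0<..} (hI p z)" "set_integrable lborel {0<..} (hI (p - 1) z)"
    "set_integrable lborel {0<..} (\<lambda>s. (\<i> - of_real s) * hI p z s)"
    using hI_integrable[of p z] hI_integrable[of "p-1" z] hX_deriv_split(2)[of "p" z] p z
    unfolding left_diff_distrib by auto
  have hh: "hI p z s = hw s * hI (p - 1) z s" if "s > 0" for s
    using hw_nz[OF that] by (simp add: hI_def powr_diff)
  let ?f = "\<lambda>s. of_real (1 + 2 * p) * hI p z s + of_real z * ((\<i> - of_real s) * hI p z s) - of_real (2 * p) * hI (p - 1) z s"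
  have "(LBINT s:{0<..}. ?f s) = 0"
  proof (rule half_line_FTC_zero)
    show "((\<lambda>s. (of_real s - \<i>) * hI p z s) has_vector_derivative ?f s) (at s)" if "s > 0" for s
    proof -
      have 1: "((\<lambda>s. of_real s - \<i>) has_vector_derivative 1) (at s)"
        by (rule derivative_eq_intros refl | simp)+
      show ?thesis
        by (rule has_vector_derivative_eq_rhs[OF has_vector_derivative_mult[OF 1 hI_deriv_s[OF that]]])
          (simp add: hh[OF that] hw_eq power2_eq_square algebra_simps)
    qed
    show "continuous_on {0<..} ?f"
      by (intro continuous_intros continuous_hI)
    show "set_integrable lborel {0<..} ?f"
      using i by (intro set_integral_diff set_integral_add set_integrable_mult_right)
    show "((\<lambda>s. (of_real s - \<i>) * hI p z s) \<longlongrightarrow> 0) (at_right 0)"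
      using hI_tendsto_0[OF p, of z] by (auto intro!: tendsto_eq_intros)
    show "((\<lambda>s. (of_real s - \<i>) * hI p z s) \<longlongrightarrow> 0) at_top"
      using tendsto_diff[OF hI_tendsto_top(2)[OF z, of p] tendsto_mult_left[OF hI_tendsto_top(1)[OF z, of p], of \<i>]]
      by (simp add: left_diff_distrib)
  qed
  also have "(LBINT s:{0<..}. ?f s) = of_real (1 + 2 * p) * hX p z + of_real z * (LBINT s:{0<..}. (\<i> - of_real s) * hI p z s)
    - of_real (2 * p) * hX (p - 1) z"
    unfolding hX_def using i by (subst set_integral_diff set_integral_add | simp)+
  finally show ?thesis by (simp add: algebra_simps)
qed

section \<open>Poisson's integral by Cauchy's theorem on a half strip\<close>

lemma tendsto_lebesgue_integral_within:
  fixes f :: "real \<Rightarrow> 'b \<Rightarrow> 'c::{banach, second_countable_topology}"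
  assumes ev: "eventually (\<lambda>y. f y \<in> borel_measurable M \<and> (AE x in M. norm (f y x) \<le> w x)) (at z within S)"
    and g: "g \<in> borel_measurable M" "integrable M w"
    and lim: "AE x in M. ((\<lambda>y. f y x) \<longlongrightarrow> g x) (at z within S)"
  shows "((\<lambda>y. \<integral>x. f y x \<partial>M) \<longlongrightarrow> (\<integral>x. g x \<partial>M)) (at z within S)"
  unfolding tendsto_at_iff_sequentially comp_def
proof (intro allI impI)
  fix X :: "nat \<Rightarrow> real" assume X: "\<forall>i. X i \<in> S - {z}" and l: "X \<longlonglongrightarrow> z"
  have "filterlim X (at z within S) sequentially"
    using X l by (auto simp: filterlim_at intro!: always_eventually)
  then have "eventually (\<lambda>n. f (X n) \<in> borel_measurable M \<and> (AE x in M. norm (f (X n) x) \<le> w x)) sequentially"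
    using ev by (rule eventually_compose_filterlim[rotated])
  then obtain n0 where n0: "\<And>n. n \<ge> n0 \<Longrightarrow> f (X n) \<in> borel_measurable M \<and> (AE x in M. norm (f (X n) x) \<le> w x)"
    by (auto simp: eventually_sequentially)
  have "(\<lambda>n. \<integral>x. f (X (n + n0)) x \<partial>M) \<longlonglongrightarrow> (\<integral>x. g x \<partial>M)"
  proof (rule integral_dominated_convergence[OF g(1) _ g(2)])
    show "AE x in M. (\<lambda>i. f (X (i + n0)) x) \<longlonglongrightarrow> g x"
      using lim
    proof eventually_elim
      case (elim x)
      then have "(\<lambda>i. f (X i) x) \<longlonglongrightarrow> g x"
        using X l unfolding tendsto_at_iff_sequentially comp_def by blast
      then show ?case by (rule LIMSEQ_ignore_initial_segment)
    qed
  qed (use n0 in auto)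
  then show "(\<lambda>n. \<integral>x. f (X n) x \<partial>M) \<longlonglongrightarrow> (\<integral>x. g x \<partial>M)"
    by (rule LIMSEQ_offset)
qed

lemma half_line_FTC:
  fixes F f :: "real \<Rightarrow> complex"
  assumes "\<And>s. s > 0 \<Longrightarrow> (F has_vector_derivative f s) (at s)"
    and "continuous_on {0<..} f" "set_integrable lborel {0<..} f"
    and "(F \<longlongrightarrow> A) (at_right 0)" "(F \<longlongrightarrow> B) at_top"
  shows "(LBINT s:{0<..}. f s) = B - A"
proof -
  have "(LBINT x=0..\<infinity>. f x) = B - A"
  proof (rule interval_integral_FTC_integrable)
    show "((F \<circ> real_of_ereal) \<longlongrightarrow> A) (at_right 0)"
      using assms(4) by (simp add: zero_ereal_def ereal_tendsto_simps)
    show "((F \<circ> real_of_ereal) \<longlongrightarrow> B) (at_left \<infinity>)"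
      using assms(5) by (simp add: ereal_tendsto_simps)
    show "isCont f x" if "0 < ereal x" "ereal x < \<infinity>" for x
      using assms(2) that by (simp add: continuous_on_eq_continuous_at)
    have "einterval 0 \<infinity> = {0<..}" by (auto simp: einterval_def)
    then show "set_integrable lborel (einterval 0 \<infinity>) f" using assms(3) by simp
  qed (use assms in auto)
  then show ?thesis by (simp add: interval_lebesgue_integral_0_infty)
qed

text \<open>The integrand of Poisson's integral for \<open>J\<close>, on the half strip above \<open>(-1, 1)\<close>.\<close>

definition pG :: "real \<Rightarrow> real \<Rightarrow> complex \<Rightarrow> complex"
  where "pG p z t = (1 - t^2) powr of_real p * exp (\<i> * of_real z * t)"

lemma pG_base_Re:
  assumes "-1 \<le> x" "x \<le> 1" "0 \<le> y"
  shows "Re (1 - (Complex x y)^2) = (1 - x^2) + y^2" "1 - x^2 \<ge> 0"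
  using assms abs_square_le_1[of x] by (auto simp: Re_power2 abs_le_iff)

lemma pG_base_bounds:
  assumes "-1 \<le> x" "x \<le> 1" "0 \<le> y"
  shows "y^2 \<le> norm (1 - (Complex x y)^2)" "norm (1 - (Complex x y)^2) \<le> 2 + y^2"
proof -
  have "y^2 \<le> Re (1 - (Complex x y)^2)" using pG_base_Re[OF assms] by simp
  then show "y^2 \<le> norm (1 - (Complex x y)^2)" using complex_Re_le_cmod order.trans by blast
  have "norm (1 - (Complex x y)^2) \<le> 1 + (norm (Complex x y))^2"
    using norm_triangle_ineq4[of 1 "(Complex x y)^2"] by (simp add: norm_power)
  also have "\<dots> \<le> 2 + y^2"
    using pG_base_Re(2)[OF assms] by (simp add: cmod_def)
  finally show "norm (1 - (Complex x y)^2) \<le> 2 + y^2" .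
qed

lemma norm_pG:
  assumes "-1 \<le> x" "x \<le> 1" "0 \<le> y" "p \<ge> 0"
  shows "norm (pG p z (Complex x y)) \<le> (2 + y^2) powr p * exp (- (z * y))"
proof -
  have "norm (pG p z (Complex x y)) = norm (1 - (Complex x y)^2) powr p * exp (- (z * y))"
    by (simp add: pG_def norm_mult norm_powr_real_powr' norm_exp_eq_Re)
  also have "\<dots> \<le> (2 + y^2) powr p * exp (- (z * y))"
    using pG_base_bounds[OF assms(1-3)] assms(4) by (intro mult_right_mono powr_mono2) auto
  finally show ?thesis .
qed

definition pG' :: "real \<Rightarrow> real \<Rightarrow> complex \<Rightarrow> complex"
  where "pG' p z t = \<i> * of_real z * pG p z t - 2 * of_real p * t * ((1 - t^2) powr (of_real p - 1) * exp (\<i> * of_real z * t))"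

lemma pG_deriv:
  assumes "1 - t^2 \<notin> \<real>\<^sub>\<le>\<^sub>0"
  shows "(pG p z has_field_derivative pG' p z t) (at t)"
  unfolding pG_def pG'_def
  by (rule derivative_eq_intros refl assms | simp)+

lemma pG_dom:
  assumes "-1 \<le> x" "x \<le> 1" "0 < y"
  shows "1 - (Complex x y)^2 \<notin> \<real>\<^sub>\<le>\<^sub>0"
proof -
  have "0 < Re (1 - (Complex x y)^2)"
    using pG_base_Re[of x y] assms zero_less_power[of y 2] by linarith
  then show ?thesis by (auto simp: complex_nonpos_Reals_iff)
qed

text \<open>For p < 1 the power p - 1 is singular at t = 1 and t = -1, and the lower bound y^2 for
  the modulus of 1 - t^2 controls it; for p >= 1 the upper bound 2 + y^2 does.\<close>

lemma norm_pG':
  assumes "-1 \<le> x" "x \<le> 1" "0 < y" "p \<ge> 0" "z > 0"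
  shows "norm (pG' p z (Complex x y)) \<le> z * (2 + y^2) powr p + 2 * p * (1 + y) * (y powr (2 * (p - 1)) + (2 + y^2) powr (p - 1))"
proof -
  have A: "norm (pG p z (Complex x y)) \<le> (2 + y^2) powr p"
    using norm_pG[of x y p z] assms by (simp add: mult_left_le order_trans)
  have B: "norm ((1 - (Complex x y)^2) powr (of_real p - 1)) \<le> y powr (2 * (p - 1)) + (2 + y^2) powr (p - 1)"
  proof -
    have e: "norm ((1 - (Complex x y)^2) powr (of_real p - 1)) = norm (1 - (Complex x y)^2) powr (p - 1)"
      using norm_powr_real_powr'[of "of_real (p - 1)"] by simp
    show ?thesis
    proof (cases "p \<ge> 1")
      case True
      have "norm (1 - (Complex x y)^2) powr (p - 1) \<le> (2 + y^2) powr (p - 1)"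
        using pG_base_bounds[of x y] assms True by (intro powr_mono2) auto
      then show ?thesis using e powr_ge_zero[of y "2 * (p - 1)"] by linarith
    next
      case False
      have "norm (1 - (Complex x y)^2) powr (p - 1) \<le> (y^2) powr (p - 1)"
        using pG_base_bounds[of x y] assms False by (intro powr_mono2') auto
      also have "\<dots> = (y powr 2) powr (p - 1)" using assms by simp
      also have "\<dots> = y powr (2 * (p - 1))" by (simp only: powr_powr)
      finally show ?thesis using e powr_ge_zero[of "2 + y^2" "p - 1"] by linarith
    qed
  qed
  have C: "norm (Complex x y) \<le> 1 + y" using cmod_le[of "Complex x y"] assms by auto
  have "norm (pG' p z (Complex x y)) \<le> z * norm (pG p z (Complex x y)) +
     2 * p * norm (Complex x y) * (norm ((1 - (Complex x y)^2) powr (of_real p - 1)) * exp (- (z * y)))"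
    unfolding pG'_def by (rule order.trans[OF norm_triangle_ineq4])
      (use assms in \<open>simp add: norm_mult norm_exp_eq_Re\<close>)
  also have "\<dots> \<le> z * (2 + y^2) powr p + 2 * p * (1 + y) * ((y powr (2 * (p - 1)) + (2 + y^2) powr (p - 1)) * 1)"
    using A B C assms by (intro add_mono mult_mono mult_left_mono) auto
  finally show ?thesis by simp
qed

lemma Complex_field_derivative_y:
  assumes "(f has_field_derivative f') (at (Complex x y))"
  shows "((\<lambda>y. f (Complex x y)) has_vector_derivative \<i> * f') (at y within A)"
proof -
  have e: "Complex x = (\<lambda>y. of_real x + \<i> * of_real y)" by (auto simp: complex_eq_iff)
  have "(Complex x has_vector_derivative \<i>) (at y)"
    unfolding e by (rule derivative_eq_intros refl | simp)+
  from field_vector_diff_chain_at[OF this assms]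
  show ?thesis by (auto simp: o_def intro: has_vector_derivative_at_within)
qed

lemma Complex_field_derivative_x:
  assumes "(f has_field_derivative f') (at (Complex x y))"
  shows "((\<lambda>x. f (Complex x y)) has_vector_derivative f') (at x within A)"
proof -
  have e: "(\<lambda>x. Complex x y) = (\<lambda>x. of_real x + \<i> * of_real y)" by (auto simp: complex_eq_iff)
  have "((\<lambda>x. Complex x y) has_vector_derivative 1) (at x)"
    unfolding e by (rule derivative_eq_intros refl | simp)+
  from field_vector_diff_chain_at[OF this assms]
  show ?thesis by (auto simp: o_def intro: has_vector_derivative_at_within)
qed

lemma pG_measurable [measurable]:
  "(\<lambda>x. pG p z (Complex x y)) \<in> borel_measurable borel" "(\<lambda>x. pG' p z (Complex x y)) \<in> borel_measurable borel"
proof -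
  have e: "(\<lambda>x. Complex x y) = (\<lambda>x. of_real x + \<i> * of_real y)" by (auto simp: complex_eq_iff)
  have [measurable]: "(\<lambda>x. Complex x y) \<in> borel_measurable borel"
    unfolding e by measurable
  show "(\<lambda>x. pG p z (Complex x y)) \<in> borel_measurable borel" "(\<lambda>x. pG' p z (Complex x y)) \<in> borel_measurable borel"
    unfolding pG_def pG'_def powr_def by measurable
qed

text \<open>The two sides of the strip are exchanged by t -> - cnj t, which conjugates both 1 - t^2
  and \<i> z t. The difference of the two sides therefore reduces to an imaginary part.\<close>

lemma pG_vertical:
  assumes "y > 0"
  shows "pG p z (Complex 1 y) = hI p z y" "pG p z (Complex (-1) y) = cnj (hI p z y)"
proof -
  have 1: "1 - (Complex 1 y)^2 = hw y" "1 - (Complex (-1) y)^2 = cnj (hw y)"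
    by (auto simp: hw_def complex_eq_iff power2_eq_square)
  have 2: "\<i> * of_real z * Complex 1 y = \<i> * of_real z - of_real (z * y)"
    "\<i> * of_real z * Complex (-1) y = cnj (\<i> * of_real z - of_real (z * y))"
    by (auto simp: complex_eq_iff)
  have 3: "cnj (hw y) powr of_real p = cnj (hw y powr of_real p)"
    using cnj_powr[of "hw y" "of_real p"] by (simp add: hw_def)
  show "pG p z (Complex 1 y) = hI p z y" "pG p z (Complex (-1) y) = cnj (hI p z y)"
    unfolding pG_def hI_def 1 2 3 by (simp_all add: exp_cnj)
qed

text \<open>Cauchy's theorem for the half strip, carried out without contours: \<open>F y\<close> is
  the integral over the segment at height \<open>y\<close>, holomorphy turns its derivative into the
  difference of the two vertical sides, and integrating over all heights leaves \<open>F 0\<close>,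
  whose real part is Poisson's integral.\<close>

lemma hX_poisson:
  assumes p: "p > 0" and z: "z > 0"
  shows "(LBINT x:{-1<..<1}. (1 - x^2) powr p * cos (z * x)) = 2 * Im (hX p z)"
    and "set_integrable lborel {-1<..<1} (\<lambda>x. (1 - x^2) powr p * cos (z * x))"
proof -
  let ?g = "\<lambda>x y. indicator {-1<..<1} x *\<^sub>R pG p z (Complex x y)"
  let ?e = "\<lambda>y. (2 + y^2) powr p * exp (- (z * y))"
  define F where "F y = (LBINT x. indicator {-1<..<1} x *\<^sub>R pG p z (Complex x y))" for y :: real
  have cst: "integrable lborel (\<lambda>x::real. indicator {-1<..<1} x *\<^sub>R (c::real))" for c
    by simp
  have int: "integrable lborel (\<lambda>x. indicator {-1<..<1} x *\<^sub>R pG p z (Complex x y))" if "y \<ge> 0" for y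
    by (rule integrable_dominated[OF cst[of "(2 + y^2) powr p * exp (- (z * y))"]])
      (use norm_pG[of _ y p z] that p in \<open>auto simp: indicator_def\<close>)
  have der: "(F has_vector_derivative - 2 * of_real (Im (hI p z y))) (at y)" if y: "y > 0" for y
  proof -
    \<comment> \<open>Bounds \<open>pG'\<close> at all heights between y/2 and 2 y. Both end points
      enter, since v^(2(p-1)) increases or decreases according to the sign of p - 1.\<close>
    define B where "B = z * (2 + (2*y)^2) powr p + 2 * p * (1 + 2*y) * ((y/2) powr (2 * (p - 1)) + (2*y) powr (2 * (p - 1)) + (2 + (2*y)^2) powr p + 1)"
    have "(F has_vector_derivative (LBINT x. indicator {-1<..<1} x *\<^sub>R (\<i> * pG' p z (Complex x y)))) (at y)"
      unfolding F_def
    proof (rule has_vector_derivative_lebesgue_integral[where a="y/2" and b = "2*y" and g = "\<lambda>x. indicator {-1<..<1} x *\<^sub>R B"])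
      show "AE x in lborel. \<forall>v\<in>{y / 2<..<2 * y}.
        ((\<lambda>v. indicator {-1<..<1} x *\<^sub>R pG p z (Complex x v)) has_vector_derivative
          indicator {-1<..<1} x *\<^sub>R (\<i> * pG' p z (Complex x v))) (at v) \<and>
        norm (indicator {-1<..<1} x *\<^sub>R (\<i> * pG' p z (Complex x v))) \<le> indicator {-1<..<1} x *\<^sub>R B"
      proof (intro AE_I2 ballI)
        fix x v :: real assume v: "v \<in> {y / 2<..<2 * y}"
        show "((\<lambda>v. indicator {-1<..<1} x *\<^sub>R pG p z (Complex x v)) has_vector_derivative
          indicator {-1<..<1} x *\<^sub>R (\<i> * pG' p z (Complex x v))) (at v) \<and>
          norm (indicator {-1<..<1} x *\<^sub>R (\<i> * pG' p z (Complex x v))) \<le> indicator {-1<..<1} x *\<^sub>R B"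
        proof (cases "x \<in> {-1<..<1}")
          case True
          have v0: "v > 0" using v y by auto
          have d: "((\<lambda>v. pG p z (Complex x v)) has_vector_derivative \<i> * pG' p z (Complex x v)) (at v)"
            using True v0 by (intro Complex_field_derivative_y pG_deriv pG_dom) auto
          have 1: "v powr (2 * (p - 1)) \<le> (y/2) powr (2 * (p - 1)) + (2*y) powr (2 * (p - 1))"
          proof (cases "p \<ge> 1")
            case True
            have "v powr (2 * (p - 1)) \<le> (2*y) powr (2 * (p - 1))"
              using True v v0 by (intro powr_mono2) auto
            then show ?thesis by (simp add: add_increasing)
          next
            case False
            have "v powr (2 * (p - 1)) \<le> (y/2) powr (2 * (p - 1))"
              using False v v0 y by (intro powr_mono2') auto
            then show ?thesis by (simp add: add_increasing2)
          qed
          have v2: "v^2 \<le> (2*y)^2" using v v0 by (intro power_mono) auto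
          have 2: "(2 + v^2) powr (p - 1) \<le> (2 + (2*y)^2) powr p + 1"
          proof -
            have "(2 + v^2) powr (p - 1) \<le> (2 + v^2) powr p" by (intro powr_mono) auto
            also have "\<dots> \<le> (2 + (2*y)^2) powr p" using v2 p by (intro powr_mono2) auto
            finally show ?thesis by simp
          qed
          have 3: "(2 + v^2) powr p \<le> (2 + (2*y)^2) powr p" using v2 p by (intro powr_mono2) auto
          have "norm (pG' p z (Complex x v)) \<le> z * (2 + v^2) powr p + 2 * p * (1 + v) * (v powr (2 * (p - 1)) + (2 + v^2) powr (p - 1))"
            using True v0 p z by (intro norm_pG') auto
          also have "\<dots> \<le> z * (2 + (2*y)^2) powr p + 2 * p * (1 + 2*y) * (((y/2) powr (2 * (p - 1)) + (2*y) powr (2 * (p - 1))) + ((2 + (2*y)^2) powr p + 1))"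
            using 1 2 3 v v0 p z by (intro add_mono mult_mono mult_left_mono) auto
          also have "\<dots> = B" by (simp add: B_def algebra_simps)
          finally show ?thesis using d True by (simp add: norm_mult)
        qed simp
      qed
    qed (use int y in \<open>auto\<close>)
    also have "(LBINT x. indicator {-1<..<1} x *\<^sub>R (\<i> * pG' p z (Complex x y)))
       = (LBINT x:{-1..1}. \<i> * pG' p z (Complex x y))"
      unfolding set_lebesgue_integral_def
      by (rule integral_cong_AE)
        (auto intro!: AE_I[of _ _ "{-1,1}"] simp: indicator_def emeasure_lborel_countable)
    also have "\<dots> = \<i> * pG p z (Complex 1 y) - \<i> * pG p z (Complex (-1) y)"
    proof -
      have d: "((\<lambda>x. pG p z (Complex x y)) has_vector_derivative pG' p z (Complex x y)) (at x within A)"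
        if "-1 \<le> x" "x \<le> 1" for x A p
        using that y by (intro Complex_field_derivative_x pG_deriv pG_dom) auto
      show ?thesis
        unfolding set_lebesgue_integral_def
      proof (rule integral_FTC_atLeastAtMost)
        show "((\<lambda>x. \<i> * pG p z (Complex x y)) has_vector_derivative \<i> * pG' p z (Complex x y)) (at x within {-1..1})"
          if "-1 \<le> x" "x \<le> 1" for x
          by (rule has_vector_derivative_mult_right[OF d[OF that]])
        have [continuous_intros]: "continuous_on {-1..1} (\<lambda>x. pG p z (Complex x y))" for p
          using d by (auto simp: continuous_on_eq_continuous_within intro!: has_vector_derivative_continuous)
        have e: "(\<lambda>x. \<i> * pG' p z (Complex x y)) = (\<lambda>x. \<i> * (\<i> * of_real z * pG p z (Complex x y) - 2 * of_real p * (of_real x + \<i> * of_real y) * pG (p - 1) z (Complex x y)))"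
          by (auto simp: pG'_def pG_def fun_eq_iff Complex_eq)
        show "continuous_on {-1..1} (\<lambda>x. \<i> * pG' p z (Complex x y))"
          unfolding e by (intro continuous_intros)
      qed simp
    qed
    also have "\<dots> = - 2 * of_real (Im (hI p z y))"
      using y by (simp add: pG_vertical complex_eq_iff)
    finally show ?thesis .
  qed
  \<comment> \<open>For 0 < y < 1 the base 1 - t^2 has modulus at most 2 + y^2 < 3, which gives a
    majorant independent of \<open>y\<close>.\<close>
  have lim0: "(F \<longlongrightarrow> F 0) (at_right 0)"
    unfolding F_def
  proof (rule tendsto_lebesgue_integral_within[where w = "\<lambda>x. indicator {-1<..<1} x *\<^sub>R 3 powr p"])
    show "\<forall>\<^sub>F y in at_right 0. (\<lambda>x. indicator {-1<..<1} x *\<^sub>R pG p z (Complex x y)) \<in> borel_measurable lborel \<and>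
       (AE x in lborel. norm (?g x y) \<le> indicator {-1<..<1} x *\<^sub>R 3 powr p)"
      unfolding eventually_at_right_field
    proof (intro exI[of _ 1] conjI allI impI AE_I2)
      fix y x :: real assume y: "0 < y" "y < 1"
      show "norm (?g x y) \<le> indicator {-1<..<1} x *\<^sub>R 3 powr p"
      proof (cases "x \<in> {-1<..<1}")
        case True
        have "norm (pG p z (Complex x y)) \<le> (2 + y^2) powr p * exp (- (z * y))"
          using True y p by (intro norm_pG) auto
        also have "\<dots> \<le> 3 powr p * 1"
          using y p z by (intro mult_mono powr_mono2) (auto simp: power_le_one)
        finally show ?thesis using True by simp
      qed simp
    qed auto
    show "AE x in lborel. ((\<lambda>y. indicator {-1<..<1} x *\<^sub>R pG p z (Complex x y)) \<longlongrightarrow>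
      indicator {-1<..<1} x *\<^sub>R pG p z (Complex x 0)) (at_right 0)"
    proof (rule AE_I2)
      fix x :: real
      show "((\<lambda>y. indicator {-1<..<1} x *\<^sub>R pG p z (Complex x y)) \<longlongrightarrow>
        indicator {-1<..<1} x *\<^sub>R pG p z (Complex x 0)) (at_right 0)"
      proof (cases "x \<in> {-1<..<1}")
        case True
        have "x^2 < 1" using True by (simp add: abs_square_less_1 abs_less_iff)
        then have "1 - (Complex x 0)^2 \<notin> \<real>\<^sub>\<le>\<^sub>0"
          using True pG_base_Re(1)[of x 0] by (auto simp: complex_nonpos_Reals_iff)
        from pG_deriv[OF this, of p z]
        have "((\<lambda>y. pG p z (Complex x y)) has_vector_derivative \<i> * pG' p z (Complex x 0)) (at 0 within {0<..})"
          by (rule Complex_field_derivative_y)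
        then have "continuous (at 0 within {0<..}) (\<lambda>y. pG p z (Complex x y))"
          by (rule has_vector_derivative_continuous)
        then show ?thesis by (auto simp: continuous_within intro!: tendsto_intros)
      qed simp
    qed
  qed (auto)
  have limtop: "(F \<longlongrightarrow> 0) at_top"
  proof (rule Lim_null_comparison)
    show "\<forall>\<^sub>F y in at_top. norm (F y) \<le> 2 * ?e y"
      using eventually_gt_at_top[of 0]
    proof eventually_elim
      case (elim y)
      have "norm (F y) \<le> (LBINT x. norm (?g x y))"
        unfolding F_def by (rule integral_norm_bound)
      also have "\<dots> \<le> (LBINT x. indicator {-1<..<1::real} x *\<^sub>R (?e y))"
      proof (rule integral_mono)
        show "integrable lborel (\<lambda>x. norm (?g x y))"
          by (rule integrable_norm) (use int elim in auto)
      qed (use norm_pG[of _ y p z] elim p cst in \<open>auto simp: indicator_def\<close>)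
      finally have "norm (F y) \<le> (LBINT x. indicator {-1<..<1::real} x *\<^sub>R (?e y))" .
      then show ?case by simp
    qed
    show "((\<lambda>y. 2 * ?e y) \<longlongrightarrow> 0) at_top"
      using z by real_asymp
  qed
  have i: "set_integrable lborel {0<..} (hI p z)" using hI_integrable[of p z] p z by simp
  have "(LBINT s:{0<..}. - 2 * complex_of_real (Im (hI p z s))) = 0 - F 0"
  proof (rule half_line_FTC[OF der _ _ lim0 limtop])
    show "continuous_on {0<..} (\<lambda>y. - 2 * complex_of_real (Im (hI p z y)))"
      by (intro continuous_intros continuous_hI)
    show "complex_set_integrable lborel {0<..} (\<lambda>y. - 2 * complex_of_real (Im (hI p z y)))"
    proof (rule set_integrable_mult_right)
      have "integrable lborel (\<lambda>s. Im (indicator {0<..} s *\<^sub>R hI p z s))"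
        using i unfolding set_integrable_def by (rule integrable_Im)
      then have "integrable lborel (\<lambda>s. complex_of_real (Im (indicator {0<..} s *\<^sub>R hI p z s)))"
        by (rule integrable_bounded_linear[OF bounded_linear_of_real])
      then show "complex_set_integrable lborel {0<..} (\<lambda>y. complex_of_real (Im (hI p z y)))"
        by (simp add: set_integrable_def scaleR_conv_of_real)
    qed
  qed
  moreover have "(LBINT s:{0<..}. - 2 * complex_of_real (Im (hI p z s))) = - 2 * of_real (Im (hX p z))"
  proof -
    have "(LBINT s:{0<..}. complex_of_real (Im (hI p z s))) = of_real (LBINT s:{0<..}. Im (hI p z s))"
      by (simp add: set_lebesgue_integral_def scaleR_conv_of_real flip: of_real_mult)
    also have "(LBINT s:{0<..}. Im (hI p z s)) = Im (hX p z)"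
      using i unfolding hX_def set_lebesgue_integral_def set_integrable_def by (subst integral_Im[symmetric]) auto
    finally show ?thesis by (simp only: set_integral_mult_right)
  qed
  ultimately have "F 0 = 2 * of_real (Im (hX p z))" by simp
  then have "Re (F 0) = 2 * Im (hX p z)" by simp
  moreover have pr: "Re (indicator {-1<..<1} x *\<^sub>R pG p z (Complex x 0)) = indicator {-1<..<1} x *\<^sub>R ((1 - x^2) powr p * cos (z * x))" for x :: real
  proof (cases "x \<in> {-1<..<1}")
    case True
    then have "1 - x^2 \<ge> 0" using pG_base_Re(2)[of x 0] by auto
    moreover have "1 - (Complex x 0)^2 = of_real (1 - x^2)" "\<i> * of_real z * Complex x 0 = \<i> * of_real (z * x)"
      by (auto simp: complex_eq_iff power2_eq_square)
    ultimately show ?thesis using True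
      by (simp add: pG_def powr_of_real Re_exp del: of_real_diff of_real_mult of_real_power)
  qed simp
  ultimately show "(LBINT x:{-1<..<1}. (1 - x^2) powr p * cos (z * x)) = 2 * Im (hX p z)"
    using integral_Re[OF int[of 0]] unfolding F_def set_lebesgue_integral_def by (simp only: pr)
  show "set_integrable lborel {-1<..<1} (\<lambda>x. (1 - x^2) powr p * cos (z * x))"
    using integrable_Re[OF int[of 0]] unfolding set_integrable_def by (simp only: pr)
qed

section \<open>The power series behind the Bessel functions\<close>

definition bE_coeff :: "real \<Rightarrow> nat \<Rightarrow> real"
  where "bE_coeff nu m = (-1) ^ m / fact m * rGamma (real m + nu + 1)"

text \<open>The Bessel-Clifford function at -w: J_nu(t) = (t/2)^nu \<open>bE nu\<close> (t^2/4).
  Splitting off the power leaves an entire function for every real order.\<close>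

definition bE :: "real \<Rightarrow> real \<Rightarrow> real"
  where "bE nu w = (\<Sum>m. bE_coeff nu m * w ^ m)"

lemma alt_fact_Suc: "(-1::real) ^ Suc m / fact (Suc m) = - (((-1) ^ m / fact m) / (real m + 1))"
  by (simp add: add.commute)

lemma bE_coeff_Suc: "(real m + 1) * (real m + nu + 1) * bE_coeff nu (Suc m) = - bE_coeff nu m"
proof -
  have "(real m + nu + 1) * rGamma (real m + nu + 1 + 1) = rGamma (real m + nu + 1)"
    by (rule rGamma_plus1)
  then have "rGamma (real m + nu + 1) = (real m + nu + 1) * rGamma (real (Suc m) + nu + 1)"
    by (simp add: algebra_simps)
  then show ?thesis
    unfolding bE_coeff_def alt_fact_Suc by simp
qed

lemma bE_summable: "summable (\<lambda>m. bE_coeff nu m * w ^ m)"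
proof -
  \<comment> \<open>Beyond this index m + nu + 1 >= 1, so (m+1)(m+nu+1) >= m + 1 > 2|w|, and each
    term is at most half of its predecessor.\<close>
  define N where "N = nat \<lceil>2 * abs w + abs nu\<rceil>"
  show ?thesis
  proof (rule summable_ratio_test[of "1/2" N])
    fix m assume m: "m \<ge> N"
    then have m2: "real m \<ge> 2 * abs w + abs nu" unfolding N_def by linarith
    define q where "q = (real m + 1) * (real m + nu + 1)"
    have q: "q \<ge> 2 * abs w" "q \<ge> 1"
    proof -
      have "(real m + 1) * 1 \<le> q" unfolding q_def using m2 by (intro mult_left_mono) auto
      then show "q \<ge> 2 * abs w" "q \<ge> 1" using m2 by auto
    qed
    have "q * \<bar>bE_coeff nu (Suc m)\<bar> = \<bar>bE_coeff nu m\<bar>"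
      using arg_cong[OF bE_coeff_Suc[of m nu], of abs] q unfolding q_def[symmetric] by (simp add: abs_mult)
    then have e: "\<bar>bE_coeff nu m\<bar> \<ge> 2 * abs w * \<bar>bE_coeff nu (Suc m)\<bar>"
      using mult_right_mono[OF q(1), of "\<bar>bE_coeff nu (Suc m)\<bar>"] by simp
    have "norm (bE_coeff nu (Suc m) * w ^ Suc m) = (abs w * \<bar>bE_coeff nu (Suc m)\<bar>) * abs w ^ m"
      by (simp add: abs_mult power_abs)
    also have "\<dots> \<le> (1/2 * \<bar>bE_coeff nu m\<bar>) * abs w ^ m"
      using e by (intro mult_right_mono) auto
    finally show "norm (bE_coeff nu (Suc m) * w ^ Suc m) \<le> 1/2 * norm (bE_coeff nu m * w ^ m)"
      by (simp add: abs_mult power_abs)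
  qed simp
qed

lemma bE_deriv: "(bE nu has_field_derivative - bE (nu + 1) w) (at w)"
proof -
  have "((\<lambda>w. \<Sum>m. bE_coeff nu m * w ^ m) has_field_derivative (\<Sum>m. diffs (bE_coeff nu) m * w ^ m)) (at w)"
    by (rule termdiffs_strong_converges_everywhere) (rule bE_summable)
  also have "diffs (bE_coeff nu) = (\<lambda>m. - bE_coeff (nu + 1) m)"
    unfolding diffs_def bE_coeff_def alt_fact_Suc by (rule ext) (simp add: add_ac)
  finally show ?thesis
    using suminf_minus[OF bE_summable[of "nu + 1" w]] by (simp add: bE_def[abs_def])
qed

text \<open>This is J_nu + J_(nu+2) = (2(nu+1)/t) J_(nu+1), checked coefficient by coefficient; the
  functional equation of the reciprocal Gamma function accounts for the factor nu + 1.\<close>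

lemma bE_contig: "bE nu w = (nu + 1) * bE (nu + 1) w - w * bE (nu + 2) w"
proof -
  have 1: "(nu + 1) * bE (nu + 1) w = (\<Sum>m. (nu + 1) * (bE_coeff (nu + 1) m * w ^ m))"
    unfolding bE_def by (rule suminf_mult[symmetric, OF bE_summable])
  \<comment> \<open>The series of \<open>w * bE (nu + 2) w\<close> with its index raised by one and
    a zero term in front, so that it can be compared with the other two series.\<close>
  define g where "g m = (if m = 0 then 0 else bE_coeff (nu + 2) (m - 1) * w ^ m)" for m
  have s: "summable (\<lambda>m. w * (bE_coeff (nu + 2) m * w ^ m))"
    by (intro summable_mult bE_summable)
  then have "summable (\<lambda>m. g (Suc m))" by (simp add: g_def algebra_simps)
  then have gs: "summable g" by (subst (asm) summable_Suc_iff)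
  have 2: "w * bE (nu + 2) w = (\<Sum>m. g m)"
  proof -
    have "w * bE (nu + 2) w = (\<Sum>m. w * (bE_coeff (nu + 2) m * w ^ m))"
      unfolding bE_def by (rule suminf_mult[symmetric, OF bE_summable])
    also have "\<dots> = (\<Sum>m. g (Suc m))" by (simp add: g_def algebra_simps)
    also have "\<dots> = (\<Sum>m. g m)" using suminf_split_head[OF gs] g_def[of 0] by simp
    finally show ?thesis .
  qed
  have 3: "bE_coeff nu m * w ^ m = (nu + 1) * (bE_coeff (nu + 1) m * w ^ m) - g m" for m
  proof (cases m)
    case 0
    have "(nu + 1) * rGamma (nu + 1 + 1) = rGamma (nu + 1)" by (rule rGamma_plus1)
    then show ?thesis using 0 by (simp add: g_def bE_coeff_def algebra_simps)
  next
    case (Suc k)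
    have "(real m + nu + 1) * rGamma (real m + nu + 1 + 1) = rGamma (real m + nu + 1)" by (rule rGamma_plus1)
    then have r: "rGamma (real m + nu + 1) = (real m + nu + 1) * rGamma (real m + (nu + 1) + 1)" by (simp add: algebra_simps)
    have r2: "real k + (nu + 2) + 1 = real m + (nu + 1) + 1" using Suc by simp
    have c: "(-1::real) ^ m / fact m = - (((-1) ^ k / fact k) / real m)"
      unfolding Suc alt_fact_Suc by (simp add: add.commute)
    have m0: "real m > 0" using Suc by simp
    have "- (S / M) * ((M + nu + 1) * R) = (nu + 1) * (- (S / M) * R) - S * R" if "M > 0" for S M R :: real
      using that by (simp add: field_simps)
    from this[OF m0] have cE: "bE_coeff nu m = (nu + 1) * bE_coeff (nu + 1) m - bE_coeff (nu + 2) k"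
      unfolding bE_coeff_def r r2 c .
    have gm: "g m = bE_coeff (nu + 2) k * w ^ m" using Suc by (simp add: g_def)
    show ?thesis unfolding cE gm by (simp add: algebra_simps)
  qed
  have "bE nu w = (\<Sum>m. (nu + 1) * (bE_coeff (nu + 1) m * w ^ m) - g m)"
    unfolding bE_def using 3 by simp
  also have "\<dots> = (\<Sum>m. (nu + 1) * (bE_coeff (nu + 1) m * w ^ m)) - (\<Sum>m. g m)"
    by (rule suminf_diff[symmetric, OF summable_mult[OF bE_summable] gs])
  finally show ?thesis using 1 2 by simp
qed

text \<open>\<open>bM nu z = z\<^sup>-\<^sup>nu J\<^sub>nu(z)\<close> extends smoothly to the origin.\<close>

definition bM :: "real \<Rightarrow> real \<Rightarrow> real"
  where "bM nu z = 2 powr (- nu) * bE nu (z^2 / 4)"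

lemma bessel_J_bM:
  assumes "t > 0"
  shows "bessel_J nu t = t powr nu * bM nu t"
proof -
  have e: "(t / 2) powr (2 * real m + nu) = (t / 2) powr nu * (t^2 / 4) ^ m" for m
  proof -
    have "(t / 2) powr (2 * real m) = (t / 2) ^ (2 * m)"
      using assms powr_realpow[of "t/2" "2 * m"] by simp
    also have "\<dots> = (t^2 / 4) ^ m" by (simp add: power_mult power_divide)
    finally show ?thesis by (simp add: powr_add)
  qed
  have "bessel_J nu t = (\<Sum>m. (t / 2) powr nu * (bE_coeff nu m * (t^2 / 4) ^ m))"
    unfolding bessel_J_def e bE_coeff_def by (simp add: mult_ac)
  also have "\<dots> = (t / 2) powr nu * bE nu (t^2 / 4)"
    unfolding bE_def by (rule suminf_mult[OF bE_summable])
  also have "(t / 2) powr nu = t powr nu * 2 powr (- nu)"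
    using assms by (simp add: powr_divide powr_minus field_simps)
  finally show ?thesis by (simp add: bM_def)
qed

lemma bM_contig: "bM nu z = (2 * nu + 2) * bM (nu + 1) z - z^2 * bM (nu + 2) z"
proof -
  have A: "(2::real) powr (- nu) = 2 * 2 powr (- (nu + 1))" and B: "(2::real) powr (- nu) = 4 * 2 powr (- (nu + 2))"
    using powr_add[of 2 1 "- (nu + 1)"] powr_add[of 2 2 "- (nu + 2)"] by simp_all
  have "2 powr (- nu) * ((nu + 1) * bE (nu + 1) (z^2 / 4)) = (2 * nu + 2) * bM (nu + 1) z"
    by (simp only: bM_def A) (simp add: algebra_simps)
  moreover have "2 powr (- nu) * (z^2 / 4 * bE (nu + 2) (z^2 / 4)) = z^2 * bM (nu + 2) z"
    by (simp only: bM_def B) (simp add: algebra_simps)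
  ultimately show ?thesis
    unfolding bM_def[of nu] bE_contig[of nu] right_diff_distrib by simp
qed

lemma bM_deriv: "(bM nu has_field_derivative - z * bM (nu + 1) z) (at z within A)"
proof -
  have "((\<lambda>z. bE nu (z^2 / 4)) has_field_derivative - bE (nu + 1) (z^2 / 4) * (z / 2)) (at z)"
    by (rule DERIV_chain2[OF bE_deriv]) (rule derivative_eq_intros refl | simp)+
  from DERIV_cmult[OF this, of "2 powr (- nu)"]
  have "(bM nu has_field_derivative 2 powr (- nu) * (- bE (nu + 1) (z^2 / 4) * (z / 2))) (at z)"
    by (simp add: bM_def[abs_def])
  also have "2 powr (- nu) * (- bE (nu + 1) (z^2 / 4) * (z / 2)) = - z * bM (nu + 1) z"
    using powr_add[of 2 1 "- (nu + 1)"] by (simp add: bM_def)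
  finally show ?thesis by (rule has_field_derivative_at_within)
qed

text \<open>The substitution t = x^2 in the Beta integral. The point x = 0 is discarded, since for m
  = 0 the two integrands differ there.\<close>

lemma even_Beta_moment:
  assumes p: "p > -1"
  shows "has_bochner_integral lborel (\<lambda>x. indicator {0..1} x * (x ^ (2 * m) * (1 - x^2) powr p)) (Beta (real m + 1/2) (p + 1) / 2)"
proof -
  let ?b = "\<lambda>x. x ^ (2 * m) * (1 - x^2) powr p"
  let ?i = "\<lambda>x. indicator {0..1} x * ?b x"
  define f where "f t = t powr (real m - 1/2) * (1 - t) powr p" for t :: real
  have hi: "(f has_integral Beta (real m + 1/2) (p + 1)) {0..1}"
    using has_integral_Beta_real[of "real m + 1/2" "p + 1"] p by (simp add: f_def[abs_def])
  have f0: "f t \<ge> 0" for t by (simp add: f_def)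
  have [measurable]: "f \<in> borel_measurable borel" unfolding f_def by measurable
  have "(\<integral>\<^sup>+t. ennreal (f t) * indicator {0..1} t \<partial>lborel) = ennreal (Beta (real m + 1/2) (p + 1))"
    using nn_integral_has_integral_lebesgue[of "{0..1}" f, OF f0 hi]
    by (simp add: mult.commute nn_integral_set_ennreal[symmetric] ennreal_mult' ennreal_indicator[symmetric] del: ennreal_indicator)
  also have "(\<integral>\<^sup>+t. ennreal (f t) * indicator {0..1} t \<partial>lborel) = (\<integral>\<^sup>+t. ennreal (f t * indicator {0^2..1^2} t) \<partial>lborel)"
    by (intro nn_integral_cong) (auto simp: indicator_def)
  also have "\<dots> = (\<integral>\<^sup>+x. ennreal (f (x^2) * (2 * x) * indicator {0..1} x) \<partial>lborel)"
    by (rule nn_integral_substitution[where g = "\<lambda>x. x^2" and g' = "\<lambda>x. 2 * x"])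
      (auto simp: set_borel_measurable_def intro!: derivative_eq_intros continuous_intros)
  also have "\<dots> = (\<integral>\<^sup>+x. ennreal (2 * ?i x) \<partial>lborel)"
  proof (rule nn_integral_cong_AE, rule AE_I[of _ _ "{0}"])
    show "{x \<in> space lborel. ennreal (f (x^2) * (2 * x) * indicator {0..1} x) \<noteq>
          ennreal (2 * ?i x)} \<subseteq> {0::real}"
    proof safe
      fix x :: real assume n: "ennreal (f (x^2) * (2 * x) * indicator {0..1} x) \<noteq>
          ennreal (2 * ?i x)"
      show "x = 0"
      proof (rule ccontr)
        assume "x \<noteq> 0"
        with n have x: "0 < x" by (cases "x \<in> {0..1}") (auto simp: indicator_def)
        have "(x^2) powr (real m - 1/2) * x = x powr (2 * (real m - 1/2)) * x powr 1"
          using x powr_powr[of x 2 "real m - 1/2"] by simp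
        also have "\<dots> = x powr (2 * (real m - 1/2) + 1)" by (rule powr_add[symmetric])
        also have "\<dots> = x powr (2 * real m)" by simp
        also have "\<dots> = x ^ (2 * m)" using x powr_realpow[of x "2 * m"] by simp
        finally have eq: "f (x^2) * (2 * x) = 2 * ?b x"
          by (simp add: f_def mult_ac)
        have "f (x^2) * (2 * x) * indicator {0..1} x = 2 * ?i x"
          unfolding eq by (simp add: mult_ac)
        then show False using n by (simp only: not_True_eq_False)
      qed
    qed
  qed auto
  finally have e: "(\<integral>\<^sup>+x. ennreal (2 * ?i x) \<partial>lborel)
     = ennreal (Beta (real m + 1/2) (p + 1))" by simp
  have B0: "Beta (real m + 1/2) (p + 1) \<ge> 0"
    using p by (auto simp: Beta_def intro!: divide_nonneg_nonneg mult_nonneg_nonneg Gamma_real_nonneg)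
  have "has_bochner_integral lborel (\<lambda>x. 2 * ?i x) (Beta (real m + 1/2) (p + 1))"
    using e B0 by (intro has_bochner_integral_nn_integral) (auto simp: indicator_def)
  from has_bochner_integral_mult_right[of "1/2", OF this] show ?thesis by (simp add: mult.assoc[symmetric])
qed

lemma Gamma_half_fact: "Gamma (real m + 1/2) * (4 ^ m * fact m) = sqrt pi * fact (2 * m)"
proof (induction m)
  case 0
  then show ?case by (simp add: Gamma_one_half_real)
next
  case (Suc m)
  have "Gamma (real (Suc m) + 1/2) = (real m + 1/2) * Gamma (real m + 1/2)"
    using Gamma_plus1[of "real m + 1/2"] nonpos_Ints_nonpos[of "real m + 1/2"] by (force simp: add_ac)
  then have "Gamma (real (Suc m) + 1/2) * (4 ^ Suc m * fact (Suc m)) =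
     (real m + 1/2) * 4 * (real m + 1) * (Gamma (real m + 1/2) * (4 ^ m * fact m))"
    by (simp add: algebra_simps)
  also have "\<dots> = (2 * real m + 1) * (2 * real m + 2) * (sqrt pi * fact (2 * m))"
    unfolding Suc.IH by (simp add: algebra_simps)
  also have "\<dots> = sqrt pi * fact (2 * Suc m)" by (simp add: algebra_simps)
  finally show ?case .
qed

text \<open>The cosine series is integrated term by term: \<open>even_Beta_moment\<close> supplies
  the moments and \<open>Gamma_half_fact\<close>, a form of the duplication formula, turns them into
  the coefficients of \<open>bE\<close>. The series is integrated on [0,1] and doubled by
  evenness.\<close>

lemma bessel_poisson:
  assumes p: "p > 0"
  shows "(LBINT x:{-1<..<1}. (1 - x^2) powr p * cos (z * x)) = sqrt pi * Gamma (p + 1) * bE (p + 1/2) (z^2 / 4)"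
proof -
  let ?b = "\<lambda>m. bE_coeff (p + 1/2) m * (z^2 / 4) ^ m"
  define g where "g x = (1 - x^2) powr p * cos (z * x)" for x
  define h where "h m x = (indicator {0..1} x * (x ^ (2 * m) * (1 - x^2) powr p)) * ((-1) ^ m * z ^ (2 * m) / fact (2 * m))" for m x
  have hb: "has_bochner_integral lborel (h m) (Beta (real m + 1/2) (p + 1) / 2 * ((-1) ^ m * z ^ (2 * m) / fact (2 * m)))" for m
    unfolding h_def using p by (intro has_bochner_integral_mult_left even_Beta_moment) auto
  have val: "Beta (real m + 1/2) (p + 1) / 2 * ((-1) ^ m * z ^ (2 * m) / fact (2 * m))
     = sqrt pi * Gamma (p + 1) / 2 * ?b m" for m
  proof -
    have z2: "z ^ (2 * m) = (z^2) ^ m" by (rule power_mult)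
    have "Gamma (real m + 1/2) / fact (2 * m) = sqrt pi / (4 ^ m * fact m)"
      using Gamma_half_fact[of m] by (simp add: field_simps)
    moreover have "Beta (real m + 1/2) (p + 1) = Gamma (real m + 1/2) * Gamma (p + 1) * rGamma (real m + (p + 1/2) + 1)"
      by (simp add: Beta_altdef add_ac)
    ultimately have "Beta (real m + 1/2) (p + 1) / 2 * ((-1) ^ m * z ^ (2 * m) / fact (2 * m))
       = (sqrt pi / (4 ^ m * fact m)) * Gamma (p + 1) * rGamma (real m + (p + 1/2) + 1) / 2 * ((-1) ^ m * z ^ (2 * m))"
      by (simp add: field_simps)
    also have "\<dots> = sqrt pi * Gamma (p + 1) / 2 * ?b m"
      unfolding z2 by (simp add: bE_coeff_def power_divide mult_ac)
    finally show ?thesis .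
  qed
  have hv: "integral\<^sup>L lborel (h m) = sqrt pi * Gamma (p + 1) / 2 * ?b m" for m
    using hb[of m] unfolding val by (simp only: has_bochner_integral_iff)
  have cs: "(\<lambda>m. (-1) ^ m * t ^ (2 * m) / fact (2 * m)) sums cos t" for t :: real
    using cos_paired[of t] by simp
  have hg: "(\<lambda>m. h m x) sums (indicator {0..1} x * g x)" for x
  proof -
    have "(\<lambda>m. (indicator {0..1} x * (1 - x^2) powr p) * ((-1) ^ m * (z * x) ^ (2 * m) / fact (2 * m))) sums ((indicator {0..1} x * (1 - x^2) powr p) * cos (z * x))"
      by (rule sums_mult[OF cs])
    then show ?thesis by (simp add: h_def g_def power_mult_distrib mult_ac)
  qed
  have hn: "norm (h m x) \<le> indicator {0..1} x * (abs z ^ (2 * m) / fact (2 * m))" for m x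
  proof (cases "x \<in> {0..1}")
    case True
    have "x ^ (2 * m) * (1 - x^2) powr p \<le> 1 * 1"
      using True p by (intro mult_mono powr_le1) (auto simp: power_le_one power2_eq_square mult_le_one)
    then have "x ^ (2 * m) * (1 - x^2) powr p * (abs z ^ (2 * m) / fact (2 * m)) \<le> 1 * (abs z ^ (2 * m) / fact (2 * m))"
      by (intro mult_right_mono) auto
    then show ?thesis using True by (simp add: h_def abs_mult power_abs)
  qed (simp add: h_def)
  have sz: "summable (\<lambda>m. \<bar>z\<bar> ^ (2 * m) / fact (2 * m))"
  proof -
    have "summable (\<lambda>n. (z^2) ^ n / fact n)" using summable_exp[of "z^2"] by (simp add: field_simps)
    moreover have "norm (abs z ^ (2 * n) / fact (2 * n)) \<le> (z^2) ^ n / fact n" for n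
      unfolding power_mult by (simp add: frac_le fact_mono)
    ultimately show ?thesis by (rule summable_comparison_test'[of _ 0])
  qed
  have "(\<lambda>m. integral\<^sup>L lborel (h m)) sums (LBINT x. (\<Sum>m. h m x))"
  proof (rule sums_integral)
    show "integrable lborel (h m)" for m using hb by (simp add: has_bochner_integral_iff)
    show "AE x in lborel. summable (\<lambda>m. norm (h m x))"
      by (intro AE_I2 summable_comparison_test'[OF summable_mult[OF sz]]) (use hn in auto)
    have n: "(LBINT x. norm (h m x)) \<le> abs z ^ (2 * m) / fact (2 * m)" for m
    proof -
      have "(LBINT x. norm (h m x)) \<le> (\<integral>(x::real). indicator {0..1} x * (abs z ^ (2 * m) / fact (2 * m)) \<partial>lborel)"
        using hb hn by (intro integral_mono) (auto simp: has_bochner_integral_iff)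
      then show ?thesis by simp
    qed
    show "summable (\<lambda>m. \<integral>x. norm (h m x) \<partial>lborel)"
      by (rule summable_comparison_test'[OF sz, of 0]) (use n in auto)
  qed
  also have "(\<lambda>x. \<Sum>m. h m x) = (\<lambda>x. indicator {0..1} x * g x)"
    by (rule ext) (rule sums_unique[OF hg, symmetric])
  finally have s1: "(\<lambda>m. sqrt pi * Gamma (p + 1) / 2 * ?b m) sums (LBINT x. indicator {0..1} x * g x)"
    unfolding hv .
  have "(\<lambda>m. sqrt pi * Gamma (p + 1) / 2 * ?b m) sums (sqrt pi * Gamma (p + 1) / 2 * bE (p + 1/2) (z^2 / 4))"
    unfolding bE_def by (intro sums_mult summable_sums bE_summable)
  with s1 have half: "(LBINT x. indicator {0..1} x * g x) = sqrt pi * Gamma (p + 1) / 2 * bE (p + 1/2) (z^2 / 4)"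
    by (rule sums_unique2)
  have gm [measurable]: "g \<in> borel_measurable borel" unfolding g_def by measurable
  have gb: "\<bar>indicator {0..1} x * g x\<bar> \<le> indicator {0..1} x" for x
    using p by (auto simp: g_def indicator_def abs_mult intro!: mult_le_one powr_le1 simp: power2_eq_square mult_le_one)
  have gi: "integrable lborel (\<lambda>x. indicator {0..1} x * g x)"
    by (rule integrable_dominated[where f="indicator {0..1::real} :: real \<Rightarrow> real"]) (use gb in auto)
  have gr: "integrable lborel (\<lambda>x. indicator {0..1} (0 - x) * g (0 - x))"
    using integrable_lborel_reflect[OF gi, of 0] .
  have "(LBINT x:{-1<..<1}. g x) = (LBINT x. indicator {0..1} x * g x + indicator {0..1} (0 - x) * g (0 - x))"
    unfolding set_lebesgue_integral_def
    by (rule integral_cong_AE)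
      (auto intro!: AE_I[of _ _ "{-1,0,1}"] simp: indicator_def g_def emeasure_lborel_countable)
  also have "\<dots> = 2 * (LBINT x. indicator {0..1} x * g x)"
    using gi gr integral_lborel_reflect[of "\<lambda>x. indicator {0..1} x * g x" 0] by simp
  finally show ?thesis unfolding half by (simp add: g_def)
qed

lemma rGamma_mult_Gamma: "x > 0 \<Longrightarrow> rGamma x * Gamma x = (1::real)"
  unfolding rGamma_inverse_Gamma by (rule left_inverse) (metis Gamma_real_pos less_irrefl)

text \<open>Fixed by the requirement that the real part of \<open>hN\<close> be \<open>bM\<close>,
  that is, by equating the two evaluations of Poisson's integral.\<close>

definition cK :: "real \<Rightarrow> complex"
  where "cK \<mu> = - 2 * \<i> * of_real (2 powr (- \<mu>) * rGamma (\<mu> + 1/2) / sqrt pi)"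

text \<open>This will be identified with z^(-\<mu>) H_\<mu>(z) in \<open>hankel1_eq\<close>. In this
  normalization the derivative rule and the contiguous relation contain no negative powers of
  \<open>z\<close>.\<close>

definition hN :: "real \<Rightarrow> real \<Rightarrow> complex"
  where "hN \<mu> z = cK \<mu> * hX (\<mu> - 1/2) z"

lemma cK_rec: "cK \<mu> = of_real (2 * \<mu> + 1) * cK (\<mu> + 1)"
proof -
  have "(\<mu> + 1/2) * rGamma (\<mu> + 1/2 + 1) = rGamma (\<mu> + 1/2)" by (rule rGamma_plus1)
  then have g: "rGamma (\<mu> + 1/2) = (\<mu> + 1/2) * rGamma (\<mu> + 1 + 1/2)" by (simp add: add_ac)
  have p: "(2::real) powr (- \<mu>) = 2 * 2 powr (- (\<mu> + 1))"
    using powr_add[of 2 1 "- (\<mu> + 1)"] by simp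
  have "2 powr (- \<mu>) * rGamma (\<mu> + 1/2) / sqrt pi = (2 * \<mu> + 1) * (2 powr (- (\<mu> + 1)) * rGamma (\<mu> + 1 + 1/2) / sqrt pi)"
    unfolding g p by (simp add: field_simps)
  then show ?thesis unfolding cK_def by (simp only: of_real_mult) (simp add: mult_ac)
qed

lemma hN_deriv:
  assumes "\<mu> > -1/2" "z > 0"
  shows "(hN \<mu> has_vector_derivative - of_real z * hN (\<mu> + 1) z) (at z within A)"
proof -
  have "((\<lambda>z. cK \<mu> * hX (\<mu> - 1/2) z) has_vector_derivative
     cK \<mu> * (- of_real (z / (2 * ((\<mu> - 1/2) + 1))) * hX ((\<mu> - 1/2) + 1) z)) (at z within A)"
    using assms by (intro has_vector_derivative_mult_right hX_deriv') auto
  moreover have "cK \<mu> * (- of_real (z / (2 * ((\<mu> - 1/2) + 1))) * hX ((\<mu> - 1/2) + 1) z) = - of_real z * hN (\<mu> + 1) z"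
  proof -
    have nz: "complex_of_real (2 * \<mu> + 1) \<noteq> 0" using assms by (simp only: of_real_eq_0_iff)
    have e: "complex_of_real (z / (2 * ((\<mu> - 1/2) + 1))) = of_real z / of_real (2 * \<mu> + 1)"
      by (simp add: algebra_simps)
    have e2: "(\<mu> - 1/2) + 1 = (\<mu> + 1) - 1/2" by simp
    show ?thesis unfolding hN_def e unfolding e2 cK_rec[of \<mu>] using nz by simp
  qed
  ultimately show ?thesis by (simp add: hN_def[abs_def])
qed

text \<open>The relation of \<open>bM_contig\<close>, here a consequence of the second integration
  by parts. That \<open>hN\<close> and \<open>bM\<close> share it lets identities descend from
  larger to smaller orders.\<close>

lemma hN_contig:
  assumes "\<mu> > -1/2" "z > 0"
  shows "hN \<mu> z = of_real (2 * \<mu> + 2) * hN (\<mu> + 1) z - of_real (z^2) * hN (\<mu> + 2) z"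
proof -
  define p where "p = \<mu> + 1/2"
  have p: "p > 0" using assms by (simp add: p_def)
  have d: "(LBINT s:{0<..}. (\<i> - of_real s) * hI p z s) = - of_real (z / (2 * (p + 1))) * hX (p + 1) z"
    using vector_derivative_unique_at[OF hX_deriv[of p z UNIV] hX_deriv'[of p z UNIV]] p assms by simp
  have 1: "of_real (1 + 2 * p) * hX p z + of_real z * (- of_real (z / (2 * (p + 1))) * hX (p + 1) z) = of_real (2 * p) * hX (p - 1) z"
    using hX_ibp2[OF p assms(2)] unfolding d .
  have c2: "cK (\<mu> + 1) = of_real (2 * (p + 1)) * cK (\<mu> + 2)"
    using cK_rec[of "\<mu> + 1"] by (simp add: p_def algebra_simps)
  have c1: "cK \<mu> = of_real (2 * p) * cK (\<mu> + 1)" using cK_rec[of \<mu>] by (simp add: p_def)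
  have nz: "complex_of_real (2 * (p + 1)) \<noteq> 0" using p by (simp only: of_real_eq_0_iff) simp
  have "hN \<mu> z = cK (\<mu> + 1) * (of_real (2 * p) * hX (p - 1) z)"
    unfolding hN_def c1 by (simp add: p_def)
  also have "\<dots> = of_real (1 + 2 * p) * (cK (\<mu> + 1) * hX p z) - of_real z * ((cK (\<mu> + 1) * of_real (z / (2 * (p + 1)))) * hX (p + 1) z)"
    unfolding 1[symmetric] by (simp add: algebra_simps)
  also have "cK (\<mu> + 1) * of_real (z / (2 * (p + 1))) = of_real z * cK (\<mu> + 2)"
    unfolding c2 of_real_divide using nz by simp
  finally show ?thesis
    by (simp add: hN_def p_def power2_eq_square algebra_simps)
qed

lemma Re_hN_gt_half:
  assumes "\<mu> > 1/2" "z > 0"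
  shows "Re (hN \<mu> z) = bM \<mu> z"
proof -
  define p where "p = \<mu> - 1/2"
  have p: "p > 0" using assms by (simp add: p_def)
  have "2 * Im (hX p z) = sqrt pi * Gamma (p + 1) * bE (p + 1/2) (z^2 / 4)"
    using hX_poisson(1)[OF p assms(2)] bessel_poisson[OF p, of z] by simp
  moreover have "Re (hN \<mu> z) = 2 powr (- \<mu>) * rGamma (p + 1) / sqrt pi * (2 * Im (hX p z))"
    unfolding hN_def cK_def p_def by (simp add: add.commute)
  moreover have "rGamma (p + 1) * Gamma (p + 1) = 1"
    using p by (simp add: rGamma_mult_Gamma)
  ultimately have "Re (hN \<mu> z) = 2 powr (- \<mu>) * (rGamma (p + 1) * Gamma (p + 1)) * bE (p + 1/2) (z^2 / 4)"
    by (simp add: field_simps)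
  then show ?thesis using \<open>rGamma (p + 1) * Gamma (p + 1) = 1\<close> by (simp add: bM_def p_def)
qed

text \<open>The comparison through Poisson's integral requires an order above 1/2. The common
  contiguous relation expresses the order \<mu> by \<mu> + 1 and \<mu> + 2, which satisfy this as
  soon as \<mu> > -1/2.\<close>

lemma Re_hN:
  assumes "\<mu> > -1/2" "z > 0"
  shows "Re (hN \<mu> z) = bM \<mu> z"
  unfolding hN_contig[OF assms] bM_contig[of \<mu>]
  using assms by (simp add: Re_hN_gt_half)

subsection \<open>Symmetry in the order\<close>

text \<open>A differential equation in \<open>l\<close> replaces the rotation of the ray of
  integration: integration by parts relates the exponents q and q + 1, so the product of the
  integral with (1 + \<i> l)^(q+1) has derivative 0 and keeps its value at l = 0, the Gamma
  integral.\<close>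

lemma Gamma_integral_half_plane:
  assumes q: "q > -1"
  shows "(LBINT t:{0<..}. of_real (t powr q) * exp (- ((1 + \<i> * of_real l) * of_real t))) = of_real (Gamma (q + 1)) * (1 + \<i> * of_real l) powr (- of_real (q + 1))"
proof -
  define w where "w l = 1 + \<i> * complex_of_real l" for l
  define b where "b q t = t powr q * exp (- (1 * t))" for q t :: real
  define g where "g q l t = of_real (t powr q) * exp (- (w l * of_real t))" for q l t :: real
  have w: "w l \<notin> \<real>\<^sub>\<le>\<^sub>0" "w l \<noteq> 0" for l by (auto simp: w_def complex_nonpos_Reals_iff complex_eq_iff)
  have ng: "norm (g q l t) = b q t" for q l t by (simp add: g_def b_def w_def norm_mult norm_exp_eq_Re)
  have [measurable]: "g q l \<in> borel_measurable borel" for q l unfolding g_def by measurable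
  have bi: "set_integrable lborel {0<..} (b q)" if "q > -1" for q
    using powr_exp_integrable[OF that, of 1] by (simp add: b_def[abs_def])
  have gi: "set_integrable lborel {0<..} (g q l)" if "q > -1" for q l
    by (rule set_integrable_bound[OF bi[OF that]]) (auto simp: set_borel_measurable_def ng)
  have gtop: "(g q l \<longlongrightarrow> 0) at_top" for q l
    by (rule Lim_null_comparison[where g = "b q"]) (use powr_exp_at_top[of 1 q] in \<open>auto simp: ng b_def[abs_def]\<close>)
  have g0: "(g q l \<longlongrightarrow> 0) (at_right 0)" if "q > 0" for q l
  proof (rule Lim_null_comparison[where g = "b q"])
    have "(b q \<longlongrightarrow> 0 powr q * exp (- (1 * 0))) (at_right 0)"
      unfolding b_def by (intro tendsto_mult tendsto_powr2 tendsto_intros)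
        (use that in \<open>auto simp: eventually_at_right_field intro!: exI[of _ 1]\<close>)
    then show "(b q \<longlongrightarrow> 0) (at_right 0)" by simp
  qed (simp add: ng)
  have gc: "continuous_on {0<..} (g q l)" for q l
    unfolding g_def by (intro continuous_intros) auto
  define P where "P q l = (LBINT t:{0<..}. g q l t)" for q l
  have ibp: "w l * P (q + 1) l = of_real (q + 1) * P q l" for l
  proof -
    let ?D = "\<lambda>t. of_real (q + 1) * g q l t - w l * g (q + 1) l t"
    have i: "set_integrable lborel {0<..} (\<lambda>t. of_real (q + 1) * g q l t)" "set_integrable lborel {0<..} (\<lambda>t. w l * g (q + 1) l t)"
      using q by (auto intro!: set_integrable_mult_right gi)
    have "(LBINT t:{0<..}. ?D t) = 0 - 0"
    proof (rule half_line_FTC)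
      fix t :: real assume t: "t > 0"
      have "((\<lambda>t. t powr (q + 1)) has_real_derivative (q + 1) * t powr q) (at t)"
        using t by (auto intro!: derivative_eq_intros)
      note 1 = has_vector_derivative_of_real[OF this]
      have "((\<lambda>t. exp (- (w l * t))) has_field_derivative - w l * exp (- (w l * t))) (at t)" for t
        by (rule derivative_eq_intros refl | simp)+
      note 2 = has_vector_derivative_real_field[OF this]
      show "(g (q + 1) l has_vector_derivative ?D t) (at t)"
        unfolding g_def by (rule has_vector_derivative_eq_rhs[OF has_vector_derivative_mult[OF 1 2]]) (simp add: algebra_simps)
    next
      show "continuous_on {0<..} ?D" by (intro continuous_intros gc)
    qed (use q gtop g0 i in \<open>auto intro: set_integral_diff\<close>)
    then show ?thesis using set_integral_diff(2)[OF i] by (simp add: P_def)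
  qed
  have der: "(P q has_vector_derivative - \<i> * P (q + 1) l) (at l)" for l
  proof -
    let ?i = "\<lambda>t. indicator {0<..} t :: real"
    have "((\<lambda>l. LBINT t. ?i t *\<^sub>R g q l t) has_vector_derivative (LBINT t. ?i t *\<^sub>R (- \<i> * g (q + 1) l t))) (at l)"
    proof (rule has_vector_derivative_lebesgue_integral[where a = "l - 1" and b = "l + 1" and g = "\<lambda>t. ?i t *\<^sub>R b (q + 1) t"])
      show "AE s in lborel. \<forall>y\<in>{l - 1<..<l + 1}. ((\<lambda>y. ?i s *\<^sub>R g q y s) has_vector_derivative ?i s *\<^sub>R (- \<i> * g (q + 1) y s)) (at y) \<and>
         norm (?i s *\<^sub>R (- \<i> * g (q + 1) y s)) \<le> ?i s *\<^sub>R b (q + 1) s"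
      proof (intro AE_I2 ballI conjI)
        fix s y :: real
        show "((\<lambda>y. ?i s *\<^sub>R g q y s) has_vector_derivative ?i s *\<^sub>R (- \<i> * g (q + 1) y s)) (at y)"
        proof (cases "s > 0")
          case True
          have "((\<lambda>y. of_real (s powr q) * exp (- ((1 + \<i> * y) * of_real s))) has_field_derivative
            of_real (s powr q) * (exp (- ((1 + \<i> * y) * of_real s)) * (- (\<i> * of_real s)))) (at y)" for y
            by (rule derivative_eq_intros refl | simp)+
          from has_vector_derivative_real_field[OF this, of y UNIV] show ?thesis
            using True by (simp add: g_def w_def powr_add mult_ac)
        qed simp
      qed (simp add: norm_mult ng)
    qed (use gi q bi[of "q + 1"] in \<open>auto simp: set_integrable_def\<close>)
    moreover have "(LBINT t. ?i t *\<^sub>R (- \<i> * g (q + 1) l t)) = - \<i> * P (q + 1) l"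
      unfolding P_def set_integral_mult_right[symmetric] by (simp only: set_lebesgue_integral_def)
    ultimately show ?thesis by (simp only: P_def[abs_def] set_lebesgue_integral_def)
  qed
  define R where "R l = P q l * w l powr of_real (q + 1)" for l
  have "(R has_vector_derivative 0) (at l)" for l
  proof -
    have "((\<lambda>l. (1 + \<i> * l) powr of_real (q + 1)) has_field_derivative of_real (q + 1) * w l powr (of_real (q + 1) - 1) * \<i>) (at (of_real l))"
      using w[of l] by (auto simp: w_def intro!: derivative_eq_intros)
    from has_vector_derivative_real_field[OF this]
    have "(R has_vector_derivative P q l * (of_real (q + 1) * w l powr (of_real (q + 1) - 1) * \<i>) + (- \<i> * P (q + 1) l) * w l powr of_real (q + 1)) (at l)"
      unfolding R_def w_def[symmetric] by (rule has_vector_derivative_mult[OF der])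
    also have "w l powr of_real (q + 1) = w l * w l powr (of_real (q + 1) - 1)"
      using w(2)[of l] by (simp add: powr_add mult.commute)
    also have "P q l * (of_real (q + 1) * w l powr (of_real (q + 1) - 1) * \<i>) + (- \<i> * P (q + 1) l) * (w l * w l powr (of_real (q + 1) - 1))
      = \<i> * w l powr (of_real (q + 1) - 1) * (of_real (q + 1) * P q l - w l * P (q + 1) l)"
      by (simp add: algebra_simps)
    finally show ?thesis unfolding ibp by simp
  qed
  then have R1: "R l = R 0"
    by (intro has_derivative_zero_unique[of UNIV R]) (auto simp: has_vector_derivative_def)
  have "P q 0 = (LBINT t:{0<..}. of_real (t powr q * exp (- (1 * t))))"
    unfolding P_def g_def w_def by (simp add: exp_of_real[symmetric])
  also have "\<dots> = of_real (LBINT t:{0<..}. t powr q * exp (- (1 * t)))"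
    by (simp add: set_lebesgue_integral_def scaleR_conv_of_real flip: of_real_mult)
  also have "\<dots> = of_real (Gamma (q + 1))" using powr_exp_integral[OF q, of 1] by simp
  finally have e: "P q l * w l powr of_real (q + 1) = of_real (Gamma (q + 1))"
    using R1 by (simp add: R_def w_def)
  have "x = g * inverse a" if "x * a = g" "a \<noteq> 0" for x a g :: complex
    using that by (auto simp: field_simps)
  from this[OF e] have "P q l = of_real (Gamma (q + 1)) * w l powr (- of_real (q + 1))"
    unfolding powr_minus using w(2)[of l] by simp
  then show ?thesis unfolding P_def g_def w_def .
qed

lemma Ln_minus_2i: "Ln (- 2 * \<i>) = Complex (ln 2) (- pi / 2)"
proof -
  have "exp (Complex (ln 2) (- pi / 2)) = - 2 * \<i>"
    by (simp add: complex_eq_iff Re_exp Im_exp)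
  moreover have "Ln (exp (Complex (ln 2) (- pi / 2))) = Complex (ln 2) (- pi / 2)"
    by (rule Ln_exp) (auto simp: field_simps)
  ultimately show ?thesis by simp
qed

text \<open>The factors -2 \<i> and 1 + \<i> s/2 have the argument -pi/2 and one in (0, pi/2). The
  sum stays inside the principal range, so the complex power is multiplicative here.\<close>

lemma hw_powr_split:
  assumes "s > 0"
  shows "hw s powr of_real p = (- 2 * \<i>) powr of_real p * of_real (s powr p) * (1 + \<i> * of_real (s / 2)) powr of_real p"
proof -
  have e: "hw s = of_real s * ((- 2 * \<i>) * (1 + \<i> * of_real (s / 2)))"
    by (simp add: hw_def complex_eq_iff power2_eq_square)
  define a where "a = - 2 * \<i>"
  define b where "b = 1 + \<i> * complex_of_real (s / 2)"
  have nz: "a \<noteq> 0" "b \<noteq> 0" using assms by (auto simp: a_def b_def complex_eq_iff)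
  have "0 < Re b" "Im b > 0" using assms by (auto simp: b_def)
  then have "\<bar>Im (Ln b)\<bar> < pi / 2" "0 < Im (Ln b)"
    using Im_Ln_pos_lt_imp[OF \<open>Im b > 0\<close>] Re_Ln_pos_lt[of b] nz by auto
  moreover have La: "Ln a = Complex (ln 2) (- pi / 2)" unfolding a_def by (rule Ln_minus_2i)
  ultimately have "Ln (a * b) = Ln a + Ln b"
    unfolding Ln_times[OF nz] by (simp add: La)
  then have ab: "(a * b) powr of_real p = a powr of_real p * b powr of_real p"
    using nz by (simp add: powr_def distrib_left exp_add)
  have "hw s powr of_real p = of_real s powr of_real p * (a * b) powr of_real p"
    unfolding e a_def[symmetric] b_def[symmetric] using assms by (intro powr_times_real_left) auto
  also have "of_real s powr of_real p = complex_of_real (s powr p)" using assms by (simp add: powr_of_real)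
  finally show ?thesis using ab by (simp add: a_def b_def mult_ac)
qed

text \<open>Integrating out \<open>t\<close> in \<open>hS\<close> gives a multiple of the integrand of \<open>hX p\<close> after rescaling; the
  exchange \<open>s \<leftrightarrow> t\<close>, \<open>p \<leftrightarrow> - 1 - p\<close> is the reflection \<open>nu \<mapsto> - nu\<close> of the order.\<close>

definition hS :: "real \<Rightarrow> real \<Rightarrow> real \<Rightarrow> real \<Rightarrow> complex"
  where "hS p z s t = indicator {0<..} s *\<^sub>R indicator {0<..} t *\<^sub>R
     (of_real (s powr p * exp (- s)) * (of_real (t powr (- 1 - p)) * exp (- ((1 + \<i> * of_real (s / (2 * z))) * of_real t))))"

lemma hS_swap: "hS p z s t = hS (- 1 - p) z t s"
  by (auto simp: hS_def indicator_def mult_ac mult_exp_exp exp_of_real[symmetric] algebra_simps)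

text \<open>In modulus \<open>hS\<close> is a product of two Gamma integrands with the exponents p
  and -1 - p, and both exceed -1 precisely for -1 < p < 0.\<close>

lemma hS_integrable:
  assumes "-1 < p" "p < 0" "z > 0"
  shows "integrable (lborel \<Otimes>\<^sub>M lborel) (\<lambda>(s, t). hS p z s t)"
proof (rule lborel_pair.Fubini_integrable)
  show "(\<lambda>(s, t). hS p z s t) \<in> borel_measurable (lborel \<Otimes>\<^sub>M lborel)"
    unfolding hS_def by measurable
  have n: "norm (hS p z s t) = indicator {0<..} s * (s powr p * exp (- (1 * s))) * (indicator {0<..} t *\<^sub>R (t powr (- 1 - p) * exp (- (1 * t))))" for s t
    by (simp add: hS_def norm_mult norm_exp_eq_Re)
  have i: "integrable lborel (\<lambda>t. indicator {0<..} t *\<^sub>R (t powr q * exp (- (1 * t))))" if "q > -1" for q :: real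
    using powr_exp_integrable[OF that, of 1] unfolding set_integrable_def by simp
  have "(LBINT t. norm (case (s, t) of (s, t) \<Rightarrow> hS p z s t)) = (indicator {0<..} s *\<^sub>R (s powr p * exp (- (1 * s)))) * (LBINT t. indicator {0<..} t *\<^sub>R (t powr (- 1 - p) * exp (- (1 * t))))" for s
    unfolding prod.case n by (simp only: integral_mult_right_zero real_scaleR_def)
  then show "integrable lborel (\<lambda>s. \<integral>t. norm (case (s, t) of (s, t) \<Rightarrow> hS p z s t) \<partial>lborel)"
    using i[of p] assms by (simp only:) (intro integrable_mult_left, simp)
  show "AE s in lborel. integrable lborel (\<lambda>t. case (s, t) of (s, t) \<Rightarrow> hS p z s t)"
  proof (rule AE_I2)
    fix s
    have "integrable lborel (\<lambda>t. norm (hS p z s t))"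
      unfolding n using i[of "- 1 - p"] assms by (intro integrable_mult_right) simp
    moreover have "hS p z s \<in> borel_measurable lborel" unfolding hS_def by measurable
    ultimately show "integrable lborel (\<lambda>t. case (s, t) of (s, t) \<Rightarrow> hS p z s t)"
      by (simp add: integrable_norm_iff)
  qed
qed

definition hSS :: "real \<Rightarrow> real \<Rightarrow> complex"
  where "hSS p z = (LBINT s. (LBINT t. hS p z s t))"

lemma hSS_sym:
  assumes "-1 < p" "p < 0" "z > 0"
  shows "hSS (- 1 - p) z = hSS p z"
proof -
  have "hSS p z = (LBINT t. (LBINT s. hS p z s t))"
    unfolding hSS_def by (rule lborel_pair.Fubini_integral[symmetric, OF hS_integrable[OF assms]])
  also have "\<dots> = hSS (- 1 - p) z"
    unfolding hSS_def by (subst hS_swap) simp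
  finally show ?thesis by simp
qed

lemma hX_hSS:
  assumes p: "-1 < p" "p < 0" and z: "z > 0"
  shows "of_real (Gamma (- p)) * hX p z = exp (\<i> * of_real z) * (- 2 * \<i>) powr of_real p * of_real (z powr (- p - 1)) * hSS p z"
proof -
  define G where "G = complex_of_real (Gamma (- p))"
  define c where "c = exp (\<i> * of_real z) * (- 2 * \<i>) powr of_real p"
  define k where "k s = indicator {0<..} s *\<^sub>R (of_real (s powr p * exp (- s)) * (1 + \<i> * of_real (s / (2 * z))) powr of_real p)" for s
  have 1: "indicator {0<..} s *\<^sub>R hI p z s = c * of_real (z powr (- p)) * k (0 + z * s)" for s
  proof (cases "s > 0")
    case True
    have zz: "of_real (z powr (- p)) * complex_of_real ((z * s) powr p) = of_real (s powr p)"
    proof -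
      have "z powr (- p) * (z * s) powr p = s powr p" using True z by (simp add: powr_mult powr_minus)
      then show ?thesis by (simp only: of_real_mult[symmetric])
    qed
    have "c * of_real (z powr (- p)) * k (0 + z * s) = c * (of_real (z powr (- p)) * of_real ((z * s) powr p)) * of_real (exp (- (z * s))) * (1 + \<i> * of_real (s / 2)) powr of_real p"
      using True z by (simp add: k_def)
    also have "\<dots> = hI p z s" unfolding zz hI_def hw_powr_split[OF True] c_def
      by (simp add: exp_diff exp_minus of_real_exp field_simps)
    finally show ?thesis using True by simp
  next
    case False
    then show ?thesis using z by (simp add: k_def zero_less_mult_iff)
  qed
  have "hX p z = (LBINT s. c * of_real (z powr (- p)) * k (0 + z * s))"
    unfolding hX_def set_lebesgue_integral_def 1 ..
  also have "\<dots> = c * of_real (z powr (- p)) * (LBINT s. k (0 + z * s))" by simp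
  also have "(LBINT s. k (0 + z * s)) = of_real (1 / z) * (LBINT s. k s)"
    using lborel_integral_real_affine[of z k 0] z by (simp add: scaleR_conv_of_real)
  finally have hx: "hX p z = c * of_real (z powr (- p - 1)) * (LBINT s. k s)"
    using z by (simp add: powr_diff field_simps)
  have "(LBINT t. hS p z s t) = G * k s" for s
  proof -
    have "(LBINT t. hS p z s t) = indicator {0<..} s *\<^sub>R (of_real (s powr p * exp (- s)) *
       (LBINT t:{0<..}. of_real (t powr (- 1 - p)) * exp (- ((1 + \<i> * of_real (s / (2 * z))) * of_real t))))"
    proof -
      have "(LBINT t. hS p z s t) = (LBINT t. (of_real (indicator {0<..} s) * of_real (s powr p * exp (- s))) *
         (indicator {0<..} t *\<^sub>R (of_real (t powr (- 1 - p)) * exp (- ((1 + \<i> * of_real (s / (2 * z))) * of_real t)))))"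
        by (simp add: hS_def scaleR_conv_of_real mult_ac)
      then show ?thesis
        unfolding integral_mult_right_zero by (simp add: set_lebesgue_integral_def scaleR_conv_of_real)
    qed
    also have "\<dots> = G * k s"
      using p by (subst Gamma_integral_half_plane) (auto simp: G_def k_def)
    finally show ?thesis .
  qed
  then have "hSS p z = G * (LBINT s. k s)" unfolding hSS_def by simp
  then show ?thesis unfolding hx by (simp add: G_def c_def)
qed

text \<open>The reflection H_(-\<mu>) = e^(\<i> \<mu> pi) H_\<mu>. Up to explicit factors
  \<open>hN m\<close> is \<open>hSS (m - 1/2)\<close> divided by Gamma(1/2 + m) Gamma(1/2 - m), and
  both of these are invariant under m -> -m, so only the explicit factors have to be
  compared.\<close>

lemma hN_minus:
  assumes "\<bar>\<mu>\<bar> < 1/2" "z > 0"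
  shows "hN (- \<mu>) z = exp (\<i> * of_real (\<mu> * pi)) * of_real (z powr (2 * \<mu>)) * hN \<mu> z"
proof -
  define S where "S = hSS (\<mu> - 1/2) z"
  define E where "E = exp (\<i> * of_real z) * - 2 * \<i> * of_real (1 / sqrt pi) * S"
  have gen: "of_real (Gamma (1/2 + m) * Gamma (1/2 - m)) * hN m z =
      E * exp (- of_real (ln 2 / 2) - \<i> * of_real (pi / 2 * (m - 1/2))) * of_real (z powr (- m - 1/2))"
    if m: "abs m < 1/2" and S: "hSS (m - 1/2) z = S" for m
  proof -
    have r: "Gamma (1/2 + m) * rGamma (m + 1/2) = 1"
      using m rGamma_mult_Gamma[of "1/2 + m"] by (auto simp: add.commute mult.commute)
    have h: "of_real (Gamma (1/2 - m)) * hX (m - 1/2) z = exp (\<i> * of_real z) * (- 2 * \<i>) powr of_real (m - 1/2) * of_real (z powr (- m - 1/2)) * S"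
    proof -
      have e: "- (m - 1/2) = 1/2 - m" "1/2 - m - 1 = - m - 1/2" by simp_all
      have "-1 < m - 1/2" "m - 1/2 < 0" using m by auto
      from hX_hSS[OF this assms(2)] show ?thesis unfolding e S .
    qed
    have "of_real (Gamma (1/2 + m) * Gamma (1/2 - m)) * hN m z = - 2 * \<i> * of_real (2 powr (- m) * (Gamma (1/2 + m) * rGamma (m + 1/2)) / sqrt pi) * (of_real (Gamma (1/2 - m)) * hX (m - 1/2) z)"
      by (simp add: hN_def cK_def)
    also have "\<dots> = E * (of_real (2 powr (- m)) * (- 2 * \<i>) powr of_real (m - 1/2)) * of_real (z powr (- m - 1/2))"
      unfolding r h by (simp add: E_def)
    also have "of_real (2 powr (- m)) * (- 2 * \<i>) powr of_real (m - 1/2) = exp (- of_real (ln 2 / 2) - \<i> * of_real (pi / 2 * (m - 1/2)))"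
    proof -
      have "complex_of_real (2 powr (- m)) = exp (of_real (- m * ln 2))"
        unfolding exp_of_real by (simp add: powr_def)
      moreover have "(- 2 * \<i>) powr of_real (m - 1/2) = exp (of_real (m - 1/2) * Complex (ln 2) (- pi / 2))"
        unfolding powr_def Ln_minus_2i by simp
      moreover have "of_real (- m * ln 2) + of_real (m - 1/2) * Complex (ln 2) (- pi / 2) = - of_real (ln 2 / 2) - \<i> * of_real (pi / 2 * (m - 1/2))"
        by (simp add: complex_eq_iff field_simps)
      ultimately show ?thesis by (simp add: exp_add[symmetric])
    qed
    finally show ?thesis .
  qed
  have S': "hSS (- \<mu> - 1/2) z = S"
  proof -
    have e: "- 1 - (\<mu> - 1/2) = - \<mu> - 1/2" by simp
    have "-1 < \<mu> - 1/2" "\<mu> - 1/2 < 0" using assms(1) by auto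
    from hSS_sym[OF this assms(2)] show ?thesis unfolding e S_def .
  qed
  define GG where "GG = complex_of_real (Gamma (1/2 + \<mu>) * Gamma (1/2 - \<mu>))"
  have g1: "GG * hN \<mu> z = E * exp (- of_real (ln 2 / 2) - \<i> * of_real (pi / 2 * (\<mu> - 1/2))) * of_real (z powr (- \<mu> - 1/2))"
    using gen[of \<mu>] assms S_def by (simp add: GG_def)
  have "GG * hN (- \<mu>) z = E * exp (- of_real (ln 2 / 2) - \<i> * of_real (pi / 2 * (- \<mu> - 1/2))) * of_real (z powr (\<mu> - 1/2))"
    using gen[of "- \<mu>"] assms S' by (simp add: GG_def mult.commute)
  also have "exp (- of_real (ln 2 / 2) - \<i> * of_real (pi / 2 * (- \<mu> - 1/2))) =
      exp (\<i> * of_real (\<mu> * pi)) * exp (- of_real (ln 2 / 2) - \<i> * of_real (pi / 2 * (\<mu> - 1/2)))"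
  proof -
    have "- of_real (ln 2 / 2) - \<i> * of_real (pi / 2 * (- \<mu> - 1/2)) = \<i> * of_real (\<mu> * pi) + (- of_real (ln 2 / 2) - \<i> * of_real (pi / 2 * (\<mu> - 1/2)))"
      by (simp add: complex_eq_iff field_simps)
    then show ?thesis by (simp only: exp_add)
  qed
  also have "complex_of_real (z powr (\<mu> - 1/2)) = of_real (z powr (2 * \<mu>)) * of_real (z powr (- \<mu> - 1/2))"
    by (simp add: powr_add[symmetric] flip: of_real_mult)
  finally have "GG * hN (- \<mu>) z = GG * (exp (\<i> * of_real (\<mu> * pi)) * of_real (z powr (2 * \<mu>)) * hN \<mu> z)"
    using g1 by (simp add: mult_ac)
  moreover have "GG \<noteq> 0" using assms Gamma_real_pos[of "1/2 + \<mu>"] Gamma_real_pos[of "1/2 - \<mu>"]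
    unfolding GG_def of_real_eq_0_iff mult_eq_0_iff by fastforce
  ultimately show ?thesis by simp
qed

text \<open>The connection formula \<open>i sin(\<mu>\<pi>) H\<^sub>\<mu> = J\<^sub>-\<^sub>\<mu> - e\<^sup>-\<^sup>i\<^sup>\<mu>\<^sup>\<pi> J\<^sub>\<mu>\<close>, divided by \<open>z\<^sup>\<mu>\<close>.\<close>

definition connection :: "real \<Rightarrow> real \<Rightarrow> bool"
  where "connection \<mu> z \<longleftrightarrow> \<i> * of_real (sin (\<mu> * pi)) * hN \<mu> z =
     of_real (z powr (- 2 * \<mu>) * bM (- \<mu>) z) - exp (- \<i> * of_real (\<mu> * pi)) * of_real (bM \<mu> z)"

text \<open>By \<open>Re_hN\<close> the real parts at \<mu> and at -\<mu> are values of
  \<open>bM\<close>, so the real part of \<open>hN_minus\<close> is the real part of the formula;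
  the imaginary part is \<open>Re_hN\<close> again.\<close>

lemma connection_base:
  assumes "\<bar>\<mu>\<bar> < 1/2" "z > 0"
  shows "connection \<mu> z"
proof -
  define x where "x = Re (hN \<mu> z)"
  define y where "y = Im (hN \<mu> z)"
  have x: "bM \<mu> z = x" using Re_hN[of \<mu> z] assms by (auto simp: x_def)
  have h: "hN \<mu> z = Complex x y" by (simp add: x_def y_def)
  have "bM (- \<mu>) z = Re (hN (- \<mu>) z)" using Re_hN[of "- \<mu>" z] assms by auto
  also have "\<dots> = z powr (2 * \<mu>) * (x * cos (\<mu> * pi) - y * sin (\<mu> * pi))"
    unfolding hN_minus[OF assms] h by (simp add: Re_exp Im_exp algebra_simps)
  finally have "z powr (- 2 * \<mu>) * bM (- \<mu>) z = x * cos (\<mu> * pi) - y * sin (\<mu> * pi)"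
    using assms by (simp add: powr_minus)
  then show ?thesis unfolding connection_def x h
    by (simp add: complex_eq_iff Re_exp Im_exp algebra_simps)
qed

lemma hX_0:
  assumes "z > 0"
  shows "hX 0 z = exp (\<i> * of_real z) / of_real z"
proof -
  have "hX 0 z = (LBINT s:{0<..}. exp (\<i> * of_real z) * of_real (s powr 0 * exp (- (z * s))))"
    unfolding hX_def by (rule set_lebesgue_integral_cong)
      (auto simp: hI_def hw_nz exp_diff exp_minus exp_of_real[symmetric] field_simps)
  also have "\<dots> = exp (\<i> * of_real z) * of_real (LBINT s:{0<..}. s powr 0 * exp (- (z * s)))"
    by (simp add: set_lebesgue_integral_def scaleR_conv_of_real flip: of_real_mult)
  also have "\<dots> = exp (\<i> * of_real z) / of_real z"
    using powr_exp_integral[of 0 z] assms by simp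
  finally show ?thesis .
qed

text \<open>The order 1/2 completes the interval from which the induction starts. The reflection
  argument stops short of it, as Gamma(1/2 - \<mu>) has a pole there, but all functions are
  elementary, since \<open>hX 0 z\<close> = e^(\<i> z)/z.\<close>

lemma connection_half:
  assumes z: "z > 0"
  shows "connection (1/2) z"
proof -
  define a where "a = 2 * 2 powr (- (1/2)) / sqrt pi"
  have N: "hN (1/2) z = - \<i> * of_real a * exp (\<i> * of_real z) / of_real z" if "z > 0" for z
    using that by (simp add: hN_def cK_def a_def hX_0)
  have J: "bM (1/2) z = a * sin z / z" if "z > 0" for z
    using Re_hN[of "1/2" z] that unfolding N[OF that] by (simp add: Re_divide_of_real Re_exp Im_exp)
  \<comment> \<open>Differentiating sin z / z in two ways gives \<open>bM (3/2)\<close>, and the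
    contiguous relation then yields \<open>bM (- (1/2))\<close>.\<close>
  have "((\<lambda>z. a * sin z / z) has_field_derivative - z * bM (1/2 + 1) z) (at z)"
    by (rule has_field_derivative_transform_within_open[OF bM_deriv[of "1/2" z UNIV], of "{0<..}"]) (use z J in auto)
  moreover have "((\<lambda>z. a * sin z / z) has_field_derivative (a * cos z * z - a * sin z) / z^2) (at z)"
    using z by (auto intro!: derivative_eq_intros simp: power2_eq_square)
  ultimately have d: "- z * bM (1/2 + 1) z = (a * cos z * z - a * sin z) / z^2"
    by (rule DERIV_unique)
  have "z^2 * bM (3/2) z = - z * (- z * bM (1/2 + 1) z)" by (simp add: power2_eq_square)
  also have "\<dots> = (a * sin z - a * cos z * z) / z"
  proof -
    have "- z * (X / z^2) = - X / z" for X using z by (simp add: power2_eq_square)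
    then show ?thesis unfolding d by (simp only: minus_diff_eq)
  qed
  finally have "bM (- (1/2)) z = a * sin z / z - (a * sin z - a * cos z * z) / z"
    using bM_contig[of "- (1/2)" z] J[OF z] by simp
  also have "\<dots> = a * cos z" using z by (simp add: diff_divide_distrib)
  finally have Jm: "bM (- (1/2)) z = a * cos z" .
  have "- 2 * (1/2) = - (1::real)" by simp
  then have "z powr (- 2 * (1/2)) = 1 / z" unfolding powr_minus_divide using z by simp
  then show ?thesis
    unfolding connection_def N[OF z] J[OF z] Jm using z
    by (simp add: complex_eq_iff Re_exp Im_exp Re_divide_of_real Im_divide_of_real)
qed

text \<open>The formula may be differentiated in \<open>z\<close>: the orders \<mu> pass to \<mu> +
  1 with a factor -z, the order -\<mu> passes to -\<mu> - 1, and the change of sign is absorbed by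
  the sine and the exponential at (\<mu> + 1) pi.\<close>

lemma connection_step:
  assumes \<mu>: "\<mu> > -1/2" and st: "\<And>z. z > 0 \<Longrightarrow> connection \<mu> z" and z: "z > 0"
  shows "connection (\<mu> + 1) z"
proof -
  let ?m = "- 2 * \<mu> - 1"
  define e where "e = exp (- \<i> * of_real (\<mu> * pi))"
  have 1: "((\<lambda>z. \<i> * of_real (sin (\<mu> * pi)) * hN \<mu> z) has_vector_derivative \<i> * of_real (sin (\<mu> * pi)) * (- of_real z * hN (\<mu> + 1) z)) (at z)"
    by (intro has_vector_derivative_mult_right hN_deriv \<mu> z)
  have "((\<lambda>z. z powr (- 2 * \<mu>) * bM (- \<mu>) z) has_field_derivative
     (- 2 * \<mu> * z powr (- 2 * \<mu> - 1)) * bM (- \<mu>) z + (- z * bM (- \<mu> + 1) z) * z powr (- 2 * \<mu>)) (at z)"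
    using z by (intro DERIV_mult bM_deriv) (auto intro!: derivative_eq_intros)
  also have "(- 2 * \<mu> * z powr (- 2 * \<mu> - 1)) * bM (- \<mu>) z + (- z * bM (- \<mu> + 1) z) * z powr (- 2 * \<mu>)
     = z powr (- 2 * \<mu> - 1) * bM (- (\<mu> + 1)) z"
  proof -
    have e1: "bM (- (\<mu> + 1)) z = - 2 * \<mu> * bM (- \<mu>) z - z^2 * bM (- \<mu> + 1) z"
      using bM_contig[of "- (\<mu> + 1)" z] by simp
    have e2: "z powr (- 2 * \<mu>) = z powr (- 2 * \<mu> - 1) * z"
      using z powr_add[of z "- 2 * \<mu> - 1" 1] by simp
    show ?thesis unfolding e1 e2 by (simp only: power2_eq_square algebra_simps)
  qed
  finally have "((\<lambda>z. complex_of_real (z powr (- 2 * \<mu>) * bM (- \<mu>) z)) has_vector_derivative of_real (z powr (- 2 * \<mu> - 1) * bM (- (\<mu> + 1)) z)) (at z)"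
    by (rule has_vector_derivative_of_real)
  moreover have "((\<lambda>z. e * of_real (bM \<mu> z)) has_vector_derivative e * of_real (- z * bM (\<mu> + 1) z)) (at z)"
    by (intro has_vector_derivative_mult_right has_vector_derivative_of_real bM_deriv)
  ultimately have "((\<lambda>z. of_real (z powr (- 2 * \<mu>) * bM (- \<mu>) z) - e * of_real (bM \<mu> z)) has_vector_derivative
      of_real (z powr (- 2 * \<mu> - 1) * bM (- (\<mu> + 1)) z) - e * of_real (- z * bM (\<mu> + 1) z)) (at z)"
    by (rule has_vector_derivative_diff)
  then have "((\<lambda>z. \<i> * of_real (sin (\<mu> * pi)) * hN \<mu> z) has_vector_derivative
      of_real (z powr (- 2 * \<mu> - 1) * bM (- (\<mu> + 1)) z) - e * of_real (- z * bM (\<mu> + 1) z)) (at z)"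
    by (rule has_vector_derivative_transform_within_open[where S = "{0<..}"])
      (use z st in \<open>auto simp: connection_def e_def\<close>)
  from vector_derivative_unique_at[OF 1 this]
  have eq: "\<i> * of_real (sin (\<mu> * pi)) * (- of_real z * hN (\<mu> + 1) z) = of_real (z powr (- 2 * \<mu> - 1) * bM (- (\<mu> + 1)) z) - e * of_real (- z * bM (\<mu> + 1) z)" .
  have zp: "z powr (- 2 * \<mu> - 1) = z * z powr (- 2 * (\<mu> + 1))"
  proof -
    have e: "- 2 * \<mu> - 1 = - 2 * (\<mu> + 1) + 1" by simp
    show ?thesis unfolding e powr_add using z by simp
  qed
  have s: "sin ((\<mu> + 1) * pi) = - sin (\<mu> * pi)" by (simp add: distrib_right)
  have e': "exp (- \<i> * of_real ((\<mu> + 1) * pi)) = - e"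
    unfolding e_def by (simp add: complex_eq_iff Re_exp Im_exp distrib_right)
  have "of_real z * (\<i> * of_real (sin ((\<mu> + 1) * pi)) * hN (\<mu> + 1) z) =
     of_real z * (of_real (z powr (- 2 * (\<mu> + 1)) * bM (- (\<mu> + 1)) z) - exp (- \<i> * of_real ((\<mu> + 1) * pi)) * of_real (bM (\<mu> + 1) z))"
    using eq unfolding s e' zp by (simp add: algebra_simps)
  then show ?thesis unfolding connection_def using z by simp
qed

lemma connection_all:
  assumes "\<mu> > -1/2" "z > 0"
  shows "connection \<mu> z"
proof -
  have ind: "connection (m + real n) z" if "-1/2 < m" "m \<le> 1/2" "z > 0" for m n z
    using that
  proof (induction n arbitrary: z)
    case 0
    show ?case
    proof (cases "m = 1/2")
      case True
      show ?thesis unfolding True of_nat_0 add_0_right by (rule connection_half) fact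
    next
      case False
      then show ?thesis using 0 by (intro connection_base) auto
    qed
  next
    case (Suc n)
    then show ?case using connection_step[of "m + real n" z] by (simp add: algebra_simps)
  qed
  define n where "n = nat \<lceil>\<mu> - 1/2\<rceil>"
  have "-1/2 < \<mu> - real n" "\<mu> - real n \<le> 1/2" using assms unfolding n_def by linarith+
  from ind[OF this assms(2), of n] show ?thesis by simp
qed

text \<open>Serves the integer orders, where Y is a limit over the order. For orders between
  \<open>p1\<close> and \<open>p2\<close> every power of the modulus of \<open>hw s\<close> is at
  most the sum of the two extreme powers, which gives a common integrable majorant.\<close>

lemma hX_isCont_order:
  assumes p0: "p0 > -1" and z: "z > 0"
  shows "isCont (\<lambda>p. hX p z) p0"
  unfolding isCont_def hX_def set_lebesgue_integral_def
proof (rule tendsto_lebesgue_integral_within)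
  define p1 where "p1 = (p0 - 1) / 2"
  have p1: "p1 > -1" "p1 < p0" using p0 by (auto simp: p1_def)
  define p2 where "p2 = p0 + 1"
  define w where "w s = indicator {0<..} s *\<^sub>R (s powr 0 * hB p1 z s + s powr 0 * hB p2 z s)" for s
  show "integrable lborel w"
    unfolding w_def set_integrable_def[symmetric]
    by (intro set_integral_add hB_moment) (use p1 p0 z in \<open>auto simp: p2_def\<close>)
  have b: "norm (indicator {0<..} s *\<^sub>R hI p z s) \<le> w s" if p: "p1 \<le> p" "p \<le> p2" for p s
  proof (cases "s > 0")
    case True
    have ex: "x powr p \<le> x powr p1 + x powr p2" if "x > 0" for x :: real
    proof (cases "x \<ge> 1")
      case True
      then have "x powr p \<le> x powr p2" using p by (intro powr_mono) auto
      then show ?thesis by (simp add: add_increasing)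
    next
      case False
      then have "x powr p \<le> x powr p1" using p \<open>x > 0\<close> by (intro powr_mono') auto
      then show ?thesis by (simp add: add_increasing2)
    qed
    have n: "norm (hI q z s) = exp (- (z * s)) * cmod (hw s) powr q" for q
      by (simp add: hI_def norm_mult norm_powr_real_powr')
    have "norm (hI p z s) \<le> norm (hI p1 z s) + norm (hI p2 z s)"
      unfolding n using mult_left_mono[OF ex[of "cmod (hw s)"], of "exp (- (z * s))"] hw_nz[OF True]
      by (simp add: algebra_simps)
    also have "\<dots> \<le> hB p1 z s + hB p2 z s" by (intro add_mono norm_hI True)
    finally show ?thesis using True by (simp add: w_def)
  qed (simp add: w_def)
  show "\<forall>\<^sub>F p in at p0. (\<lambda>s. indicator {0<..} s *\<^sub>R hI p z s) \<in> borel_measurable lborel \<and>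
     (AE s in lborel. norm (indicator {0<..} s *\<^sub>R hI p z s) \<le> w s)"
    unfolding eventually_at
    by (intro exI[of _ "min 1 (p0 - p1)"] conjI ballI impI AE_I2 b)
      (use p1 in \<open>auto simp: p2_def dist_real_def\<close>)
  show "AE s in lborel. ((\<lambda>p. indicator {0<..} s *\<^sub>R hI p z s) \<longlongrightarrow> indicator {0<..} s *\<^sub>R hI p0 z s) (at p0)"
  proof (rule AE_I2)
    fix s
    show "((\<lambda>p. indicator {0<..} s *\<^sub>R hI p z s) \<longlongrightarrow> indicator {0<..} s *\<^sub>R hI p0 z s) (at p0)"
    proof (cases "s > 0")
      case True
      have "((\<lambda>p. hI p z s) \<longlongrightarrow> hI p0 z s) (at p0)"
        unfolding hI_def powr_def using hw_nz[OF True] by (auto intro!: tendsto_eq_intros)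
      then show ?thesis by (intro tendsto_intros)
    qed simp
  qed
qed auto

text \<open>Off the integers the connection formula, solved for the imaginary part of
  \<open>hN\<close>, is the quotient that defines Y. At an integer order Y is the limit of these
  quotients, which continuity in the order evaluates.\<close>

theorem hankel1_eq:
  assumes nu: "nu > -1/2" and z: "z > 0"
  shows "hankel1 nu z = of_real (z powr nu) * hN nu z"
proof -
  define q where "q \<mu> = (bessel_J \<mu> z * cos (\<mu> * pi) - bessel_J (- \<mu>) z) / sin (\<mu> * pi)" for \<mu>
  have J: "bessel_J nu z = Re (of_real (z powr nu) * hN nu z)"
    using Re_hN[OF nu z] by (simp add: bessel_J_bM z)
  have qq: "q \<mu> = z powr \<mu> * Im (hN \<mu> z)" if \<mu>: "\<mu> > -1/2" "\<mu> \<notin> \<int>" for \<mu>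
  proof -
    have s: "sin (\<mu> * pi) \<noteq> 0" using \<mu> by (simp add: sin_times_pi_eq_0)
    have "Re (\<i> * of_real (sin (\<mu> * pi)) * hN \<mu> z) = z powr (- 2 * \<mu>) * bM (- \<mu>) z - cos (\<mu> * pi) * bM \<mu> z"
      using connection_all[OF \<mu>(1) z] unfolding connection_def by (simp add: Re_exp)
    then have "- sin (\<mu> * pi) * Im (hN \<mu> z) = z powr (- 2 * \<mu>) * bM (- \<mu>) z - cos (\<mu> * pi) * bM \<mu> z" by simp
    then have "sin (\<mu> * pi) * (z powr \<mu> * Im (hN \<mu> z)) = z powr \<mu> * (cos (\<mu> * pi) * bM \<mu> z - z powr (- 2 * \<mu>) * bM (- \<mu>) z)"
      by (simp add: algebra_simps)
    also have "\<dots> = bessel_J \<mu> z * cos (\<mu> * pi) - bessel_J (- \<mu>) z"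
    proof -
      have e: "z powr (- \<mu>) = z powr \<mu> * z powr (- 2 * \<mu>)" by (simp add: powr_add[symmetric])
      show ?thesis unfolding bessel_J_bM[OF z] e right_diff_distrib by (simp only: mult_ac)
    qed
    finally show ?thesis using s by (simp add: q_def field_simps)
  qed
  have "bessel_Y nu z = Im (of_real (z powr nu) * hN nu z)"
  proof (cases "nu \<in> \<int>")
    case False
    then show ?thesis using qq[OF nu False] by (simp add: bessel_Y_def Let_def q_def)
  next
    case True
    have c: "isCont (\<lambda>\<mu>. z powr \<mu> * Im (hN \<mu> z)) nu"
    proof -
      have "isCont (\<lambda>\<mu>. hX (\<mu> - 1/2) z) nu"
        by (rule isCont_o2[where g = "\<lambda>p. hX p z"]) (use nu z in \<open>auto intro!: hX_isCont_order\<close>)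
      moreover have "isCont cK nu"
        unfolding cK_def by (intro continuous_intros) auto
      ultimately have "isCont (\<lambda>\<mu>. hN \<mu> z) nu" unfolding hN_def by (intro continuous_intros)
      then show ?thesis using z by (intro continuous_intros) auto
    qed
    have "(q \<longlongrightarrow> z powr nu * Im (hN nu z)) (at nu)"
    proof (rule Lim_transform_eventually[OF c[unfolded isCont_def]])
      obtain n :: int where n: "nu = of_int n" using True by (auto elim: Ints_cases)
      \<comment> \<open>An integer order above -1/2 is nonnegative, so all orders within 1/2 of it
        remain above -1/2, and apart from the centre none of them is an integer.\<close>
      then have n0: "nu \<ge> 0" using nu by auto
      show "\<forall>\<^sub>F \<mu> in at nu. z powr \<mu> * Im (hN \<mu> z) = q \<mu>"
        unfolding eventually_at
      proof (intro exI[of _ "1/2"] conjI ballI impI)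
        fix \<mu> assume \<mu>: "\<mu> \<noteq> nu \<and> dist \<mu> nu < 1/2"
        then have "\<mu> > -1/2" using n0 unfolding dist_real_def by linarith
        moreover have "\<mu> \<notin> \<int>"
        proof
          assume "\<mu> \<in> \<int>"
          then obtain m :: int where "\<mu> = of_int m" by (auto elim: Ints_cases)
          then have "\<bar>real_of_int (m - n)\<bar> < 1/2" "m \<noteq> n" using \<mu> n by (auto simp: dist_real_def)
          then show False by linarith
        qed
        ultimately show "z powr \<mu> * Im (hN \<mu> z) = q \<mu>" using qq by simp
      qed simp
    qed
    then have "Lim (at nu) q = z powr nu * Im (hN nu z)" by (intro tendsto_Lim) auto
    then show ?thesis using True by (simp add: bessel_Y_def Let_def q_def[abs_def])
  qed
  with J show ?thesis by (simp add: hankel1_def complex_eq_iff)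
qed

text \<open>With sg = z s the rescaled integrand is (sg^2 - 2 \<i> sg z)^p e^(\<i> z - sg), and z ->
  0 leaves a real Gamma integrand. The limit determines the flux of the fundamental solution through
  small spheres.\<close>

lemma hX_limit_0:
  assumes p: "p > 0"
  shows "((\<lambda>z. of_real (z powr (2 * p + 1)) * hX p z) \<longlongrightarrow> of_real (Gamma (2 * p + 1))) (at_right 0)"
proof -
  define kk where "kk z sg = indicator {0<..} sg *\<^sub>R (exp (\<i> * of_real z - of_real sg) * (Complex (sg^2) (- 2 * sg * z)) powr of_real p)" for z sg :: real
  define w where "w sg = indicator {0<..} sg *\<^sub>R (sg powr 0 * hB p 1 sg)" for sg
  have eq: "of_real (z powr (2 * p + 1)) * hX p z = (\<integral>sg. kk z sg \<partial>lborel)" if z: "z > 0" for z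
  proof -
    have 1: "of_real (z powr (2 * p)) * (indicator {0<..} s *\<^sub>R hI p z s) = kk z (0 + z * s)" for s
    proof (cases "s > 0")
      case True
      have "Complex ((z * s)^2) (- 2 * (z * s) * z) = of_real (z^2) * hw s"
        by (simp add: hw_def complex_eq_iff power2_eq_square)
      moreover have "(of_real (z^2) * hw s) powr of_real p = of_real (z^2) powr of_real p * hw s powr of_real p"
        by (rule powr_times_real_left) auto
      moreover have "of_real (z^2) powr of_real p = complex_of_real (z powr (2 * p))"
      proof -
        have "z powr (2 * p) = (z powr 2) powr p" by (simp only: powr_powr)
        then show ?thesis using z by (simp add: powr_of_real del: of_real_power)
      qed
      ultimately show ?thesis using True z by (simp add: kk_def hI_def)
    qed (use z in \<open>simp add: kk_def zero_less_mult_iff\<close>)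
    have "of_real (z powr (2 * p + 1)) * hX p z = of_real z * (LBINT s. of_real (z powr (2 * p)) * (indicator {0<..} s *\<^sub>R hI p z s))"
      unfolding hX_def set_lebesgue_integral_def integral_mult_right_zero using z by (simp add: powr_add)
    also have "\<dots> = of_real z * (LBINT s. kk z (0 + z * s))" unfolding 1 ..
    also have "\<dots> = (\<integral>sg. kk z sg \<partial>lborel)"
      using lborel_integral_real_affine[of z "kk z" 0] z by (simp add: scaleR_conv_of_real)
    finally show ?thesis .
  qed
  have "((\<lambda>z. \<integral>sg. kk z sg \<partial>lborel) \<longlongrightarrow> (\<integral>sg. kk 0 sg \<partial>lborel)) (at_right 0)"
  proof (rule tendsto_lebesgue_integral_within[where w = w])
    have m: "kk z \<in> borel_measurable lborel" for z
    proof -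
      have "(\<lambda>sg. Complex (sg^2) (- 2 * sg * z)) \<in> borel_measurable borel"
        by (intro borel_measurable_continuous_onI continuous_intros)
      then show ?thesis unfolding kk_def powr_def by measurable
    qed
    show "kk 0 \<in> borel_measurable lborel" by (rule m)
    show "integrable lborel w"
      unfolding w_def set_integrable_def[symmetric] by (intro hB_moment) (use p in auto)
    show "\<forall>\<^sub>F z in at_right 0. kk z \<in> borel_measurable lborel \<and> (AE sg in lborel. norm (kk z sg) \<le> w sg)"
      unfolding eventually_at_right_field
    proof (intro exI[of _ 1] conjI allI impI AE_I2 m)
      fix z sg :: real assume z: "0 < z" "z < 1"
      show "norm (kk z sg) \<le> w sg"
      proof (cases "sg > 0")
        case True
        have "norm (Complex (sg^2) (- 2 * sg * z)) \<le> sg^2 + 2 * sg * z"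
          using cmod_le[of "Complex (sg^2) (- 2 * sg * z)"] True z by (simp add: abs_mult)
        also have "\<dots> \<le> sg * (sg + 2)" using True z by (simp add: power2_eq_square algebra_simps)
        also have "\<dots> \<le> 4 * max sg (sg^2)"
          using True by (cases "sg \<le> 1") (auto simp: max_def power2_eq_square algebra_simps)
        finally have "norm (Complex (sg^2) (- 2 * sg * z)) powr p \<le> (4 * max sg (sg^2)) powr p"
          using p by (intro powr_mono2) auto
        also have "\<dots> = 4 powr p * (max sg (sg^2)) powr p" using True by (simp add: powr_mult)
        also have "(max sg (sg^2)) powr p \<le> sg powr p + sg powr (2 * p)"
          using True by (auto simp: max_def powr_powr[symmetric] powr_numeral)
        finally have b: "norm (Complex (sg^2) (- 2 * sg * z)) powr p \<le> 4 powr p * (sg powr p + sg powr (2 * p))" by simp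
        have "norm (kk z sg) = exp (- sg) * norm (Complex (sg^2) (- 2 * sg * z)) powr p"
          using True by (simp add: kk_def norm_mult norm_powr_real_powr')
        also have "\<dots> \<le> exp (- sg) * (4 powr p * (sg powr p + sg powr (2 * p)))"
          by (intro mult_left_mono b) auto
        also have "\<dots> = w sg" using True p by (simp add: w_def hB_def max_def algebra_simps)
        finally show ?thesis .
      qed (simp add: kk_def w_def)
    qed simp
    show "AE sg in lborel. ((\<lambda>z. kk z sg) \<longlongrightarrow> kk 0 sg) (at_right 0)"
    proof (rule AE_I2)
      fix sg :: real
      show "((\<lambda>z. kk z sg) \<longlongrightarrow> kk 0 sg) (at_right 0)"
      proof (cases "sg > 0")
        case True
        have t: "((\<lambda>z. Complex (sg^2) (- 2 * sg * z)) \<longlongrightarrow> Complex (sg^2) (- 2 * sg * 0)) (at_right 0)"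
          by (intro tendsto_intros)
        have nn: "Complex (sg^2) (- 2 * sg * 0) \<notin> \<real>\<^sub>\<le>\<^sub>0" using True by (simp add: complex_nonpos_Reals_iff)
        have "((\<lambda>z. (Complex (sg^2) (- 2 * sg * z)) powr of_real p) \<longlongrightarrow> (Complex (sg^2) (- 2 * sg * 0)) powr of_real p) (at_right 0)"
          by (rule tendsto_powr_complex[OF nn t]) (rule tendsto_const)
        then show ?thesis unfolding kk_def
          by (intro tendsto_scaleR tendsto_const tendsto_mult tendsto_exp tendsto_diff tendsto_of_real tendsto_ident_at)
      qed (simp add: kk_def)
    qed
  qed
  also have "(\<integral>sg. kk 0 sg \<partial>lborel) = of_real (Gamma (2 * p + 1))"
  proof -
    have e: "kk 0 sg = of_real (indicator {0<..} sg *\<^sub>R (sg powr (2 * p) * exp (- (1 * sg))))" for sg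
    proof (cases "sg > 0")
      case True
      have "Complex (sg^2) (- 2 * sg * 0) = of_real (sg^2)" by (simp add: complex_eq_iff)
      moreover have "(sg^2) powr p = sg powr (2 * p)" using True powr_powr[of sg 2 p] by simp
      ultimately show ?thesis using True
        by (simp add: kk_def powr_of_real of_real_exp del: of_real_power)
    qed (simp add: kk_def)
    show ?thesis unfolding e integral_complex_of_real using powr_exp_integral[of "2 * p" 1] p
      by (simp add: set_lebesgue_integral_def)
  qed
  finally show ?thesis
    by (rule Lim_transform_eventually) (auto simp: eventually_at_right_field eq intro!: exI[of _ 1])
qed

section \<open>The radial profile of the fundamental solution\<close>

definition hr :: "nat \<Rightarrow> real \<Rightarrow> real \<Rightarrow> complex"
  where "hr N k r = \<i> / 4 * of_real ((k^2 / (2 * pi)) powr ((real N - 2) / 2)) * hN ((real N - 2) / 2) (k * r)"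

definition hr' :: "nat \<Rightarrow> real \<Rightarrow> real \<Rightarrow> complex"
  where "hr' N k r = - of_real (k^2 * r) * (\<i> / 4 * of_real ((k^2 / (2 * pi)) powr ((real N - 2) / 2)) * hN (real N / 2) (k * r))"

text \<open>The powers of |x| cancel: (k/(2 pi r))^nu times (k r)^nu is the constant (k^2/(2
  pi))^nu, so the profile is a constant multiple of \<open>hN\<close>.\<close>

lemma outgoing_fund_hr:
  fixes x :: "real ^ 'n"
  assumes "k > 0" "x \<noteq> 0" "CARD('n) \<ge> 2"
  shows "outgoing_fund k x = hr CARD('n) k (norm x)"
proof -
  define nu where "nu = (real CARD('n) - 2) / 2"
  have "(k / (2 * pi * norm x)) powr nu * (k * norm x) powr nu = (k^2 / (2 * pi)) powr nu"
    using assms by (subst powr_mult[symmetric]) (auto simp: power2_eq_square)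
  then have e: "complex_of_real ((k / (2 * pi * norm x)) powr nu) * of_real ((k * norm x) powr nu) = of_real ((k^2 / (2 * pi)) powr nu)"
    by (simp only: of_real_mult[symmetric])
  have "hankel1 nu (k * norm x) = of_real ((k * norm x) powr nu) * hN nu (k * norm x)"
    using assms by (intro hankel1_eq) (auto simp: nu_def)
  then show ?thesis
    unfolding outgoing_fund_def hr_def Let_def nu_def[symmetric] e[symmetric] by simp
qed

lemma hr_deriv:
  assumes "k > 0" "r > 0" "N \<ge> 2"
  shows "(hr N k has_vector_derivative hr' N k r) (at r)"
proof -
  define nu where "nu = (real N - 2) / 2"
  have nu: "nu > -1/2" using assms by (simp add: nu_def)
  have e: "nu + 1 = real N / 2" by (simp add: nu_def field_simps)
  have 1: "((\<lambda>r. k * r) has_vector_derivative k) (at r)"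
    by (auto intro!: derivative_eq_intros)
  have 2: "(hN nu has_vector_derivative - of_real (k * r) * hN (nu + 1) (k * r)) (at (k * r))"
    using hN_deriv[OF nu, of "k * r"] assms by simp
  have "((\<lambda>r. hN nu (k * r)) has_vector_derivative k *\<^sub>R (- of_real (k * r) * hN (nu + 1) (k * r))) (at r)"
    using vector_diff_chain_at[OF 1 2] by (simp add: o_def)
  from has_vector_derivative_mult_right[OF this]
  show ?thesis unfolding hr_def[abs_def] hr'_def nu_def[symmetric]
    by (rule has_vector_derivative_eq_rhs) (simp add: e scaleR_conv_of_real power2_eq_square)
qed

text \<open>The radial Helmholtz equation in divergence form. In the normalization \<open>hN\<close>
  it is the contiguous relation, because 2 nu + 2 = N.\<close>

lemma hr_ode:
  assumes "k > 0" "r > 0" "N \<ge> 2"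
  shows "((\<lambda>r. of_real (r ^ (N - 1)) * hr' N k r) has_vector_derivative - of_real (k^2 * r ^ (N - 1)) * hr N k r) (at r)"
proof -
  define nu where "nu = (real N - 2) / 2"
  define A where "A = \<i> / 4 * complex_of_real ((k^2 / (2 * pi)) powr nu)"
  have nu: "nu > -1/2" using assms by (simp add: nu_def)
  have e: "real N / 2 = nu + 1" "2 * nu + 2 = real N" by (simp_all add: nu_def field_simps)
  have 1: "((\<lambda>r. k * r) has_vector_derivative k) (at r)"
    by (auto intro!: derivative_eq_intros)
  have 2: "(hN (nu + 1) has_vector_derivative - of_real (k * r) * hN (nu + 2) (k * r)) (at (k * r))"
    using hN_deriv[of "nu + 1" "k * r"] nu assms by (simp add: add.assoc)
  have 3: "((\<lambda>r. hN (nu + 1) (k * r)) has_vector_derivative k *\<^sub>R (- of_real (k * r) * hN (nu + 2) (k * r))) (at r)"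
    using vector_diff_chain_at[OF 1 2] by (simp add: o_def)
  have "((\<lambda>r. r ^ N) has_field_derivative real N * r ^ (N - 1)) (at r)"
    by (auto intro!: derivative_eq_intros)
  from has_vector_derivative_of_real[OF this]
  have 4: "((\<lambda>r. complex_of_real (r ^ N)) has_vector_derivative of_real (real N * r ^ (N - 1))) (at r)" .
  have 5: "((\<lambda>r. of_real (r ^ N) * hN (nu + 1) (k * r)) has_vector_derivative
     of_real (r ^ N) * (k *\<^sub>R (- of_real (k * r) * hN (nu + 2) (k * r))) + of_real (real N * r ^ (N - 1)) * hN (nu + 1) (k * r)) (at r)"
    by (rule has_vector_derivative_mult[OF 4 3])
  obtain m where N: "N = Suc m" using assms by (cases N) auto
  have f: "(\<lambda>r. of_real (r ^ (N - 1)) * hr' N k r) = (\<lambda>r. (- of_real (k^2) * A) * (of_real (r ^ N) * hN (nu + 1) (k * r)))"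
    unfolding hr'_def e A_def nu_def by (simp add: N fun_eq_iff)
  have hne: "hN nu (k * r) = of_real (real N) * hN (nu + 1) (k * r) - of_real ((k * r)^2) * hN (nu + 2) (k * r)"
    using hN_contig[OF nu, of "k * r"] assms unfolding e by simp
  have "- of_real (k^2 * r ^ (N - 1)) * hr N k r = (- of_real (k^2) * A) * (of_real (r ^ N) * (k *\<^sub>R (- of_real (k * r) * hN (nu + 2) (k * r))) + of_real (real N * r ^ (N - 1)) * hN (nu + 1) (k * r))"
    unfolding hr_def nu_def[symmetric] A_def[symmetric] hne
    by (simp add: N scaleR_conv_of_real power2_eq_square algebra_simps)
  then show ?thesis unfolding f
    by (intro has_vector_derivative_eq_rhs[OF has_vector_derivative_mult_right[OF 5]]) (rule sym)
qed

text \<open>The two powers come from the two regimes of \<open>hw\<close>: small \<open>s\<close>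
  gives the exponent p + 1, which governs large \<open>z\<close>, and large \<open>s\<close> gives 2
  p + 1, which governs small \<open>z\<close>.\<close>

lemma norm_hX:
  assumes "p \<ge> 0"
  obtains C where "C \<ge> 0" "\<And>z. z > 0 \<Longrightarrow> norm (hX p z) \<le> C * (z powr - (p + 1) + z powr - (2 * p + 1))"
    "\<And>z. z > 0 \<Longrightarrow> norm (LBINT s:{0<..}. of_real s * hI p z s) \<le> C * (z powr - (p + 2) + z powr - (2 * p + 2))"
proof -
  define G where "G = Gamma (p + 1) + Gamma (2 * p + 1) + Gamma (p + 2) + Gamma (2 * p + 2)"
  have pos: "Gamma (p + 1) \<ge> 0" "Gamma (2 * p + 1) \<ge> 0" "Gamma (p + 2) \<ge> 0" "Gamma (2 * p + 2) \<ge> 0"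
    using assms by (auto intro!: Gamma_real_nonneg)
  have m: "max p (2 * p) = 2 * p" using assms by auto
  show ?thesis
  proof (rule that[of "4 powr p * G"])
    show "0 \<le> 4 powr p * G" using pos by (simp add: G_def)
    fix z :: real assume z: "z > 0"
    have "(LBINT s:{0<..}. of_real (s powr 0) * hI p z s) = hX p z"
      unfolding hX_def by (rule set_lebesgue_integral_cong) auto
    then have "norm (hX p z) \<le> 4 powr \<bar>p\<bar> * (Gamma (p + 0 + 1) / z powr (p + 0 + 1) + Gamma (max p (2 * p) + 0 + 1) / z powr (max p (2 * p) + 0 + 1))"
      using hI_moment(2)[of p 0 z] assms z by simp
    also have "\<dots> = 4 powr p * (Gamma (p + 1) * z powr - (p + 1) + Gamma (2 * p + 1) * z powr - (2 * p + 1))"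
      unfolding m powr_minus_divide using assms by simp
    also have "\<dots> \<le> 4 powr p * (G * z powr - (p + 1) + G * z powr - (2 * p + 1))"
      using pos by (intro mult_left_mono add_mono mult_right_mono) (auto simp: G_def)
    finally show "norm (hX p z) \<le> 4 powr p * G * (z powr - (p + 1) + z powr - (2 * p + 1))"
      by (simp only: distrib_left mult.assoc)
    have "norm (LBINT s:{0<..}. of_real s * hI p z s) \<le> 4 powr \<bar>p\<bar> * (Gamma (p + 2) / z powr (p + 2) + Gamma (max p (2 * p) + 2) / z powr (max p (2 * p) + 2))"
      using hX_deriv_split(3)[of p z] assms z by simp
    also have "\<dots> = 4 powr p * (Gamma (p + 2) * z powr - (p + 2) + Gamma (2 * p + 2) * z powr - (2 * p + 2))"
      unfolding m powr_minus_divide using assms by simp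
    also have "\<dots> \<le> 4 powr p * (G * z powr - (p + 2) + G * z powr - (2 * p + 2))"
      using pos by (intro mult_left_mono add_mono mult_right_mono) (auto simp: G_def)
    finally show "norm (LBINT s:{0<..}. of_real s * hI p z s) \<le> 4 powr p * G * (z powr - (p + 2) + z powr - (2 * p + 2))"
      by (simp only: distrib_left mult.assoc)
  qed
qed

lemma hN_radiation:
  assumes "\<mu> > -1/2" "z > 0"
  shows "- of_real z * hN (\<mu> + 1) z - \<i> * hN \<mu> z = - cK \<mu> * (LBINT s:{0<..}. of_real s * hI (\<mu> - 1/2) z s)"
proof -
  have "(hN \<mu> has_vector_derivative cK \<mu> * (LBINT s:{0<..}. (\<i> - of_real s) * hI (\<mu> - 1/2) z s)) (at z)"
    unfolding hN_def[abs_def] using assms by (intro has_vector_derivative_mult_right hX_deriv) auto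
  from vector_derivative_unique_at[OF hN_deriv[OF assms, of UNIV] this]
  have "- of_real z * hN (\<mu> + 1) z = cK \<mu> * (\<i> * hX (\<mu> - 1/2) z - (LBINT s:{0<..}. of_real s * hI (\<mu> - 1/2) z s))"
    using hX_deriv_split(1)[of "\<mu> - 1/2" z] assms by simp
  then show ?thesis by (simp add: hN_def algebra_simps)
qed

text \<open>N >= 3 makes nu - 1/2 nonnegative, as \<open>norm_hX\<close> requires. The exponents N -
  2 and N - 1 are the singularities of the kernel and of its gradient, and (N-1)/2 is their common
  decay; in the last bound the leading oscillating parts cancel by \<open>hN_radiation\<close>,
  which raises the decay to (N+1)/2.\<close>

lemma hr_bounds:
  assumes k: "k > 0" and N: "N \<ge> 3"
  obtains C where "C \<ge> 0"
    "\<And>r. r > 0 \<Longrightarrow> norm (hr N k r) \<le> C * (r powr - (real N - 2) + r powr - ((real N - 1) / 2))"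
    "\<And>r. r > 0 \<Longrightarrow> norm (hr' N k r) \<le> C * (r powr - (real N - 1) + r powr - ((real N - 1) / 2))"
    "\<And>r. r > 0 \<Longrightarrow> norm (hr' N k r - \<i> * of_real k * hr N k r) \<le> C * (r powr - (real N - 1) + r powr - ((real N + 1) / 2))"
proof -
  let ?p = "(real N - 1) / 2"
  define nu where "nu = (real N - 2) / 2"
  define A where "A = \<i> / 4 * complex_of_real ((k^2 / (2 * pi)) powr nu)"
  have nu: "nu \<ge> 1/2" using N by (simp add: nu_def)
  have p1: "0 \<le> nu - 1/2" and p2: "0 \<le> nu + 1/2" using nu by auto
  obtain C1 where C1: "C1 \<ge> 0" "\<And>z. z > 0 \<Longrightarrow> norm (hX (nu - 1/2) z) \<le> C1 * (z powr - (nu - 1/2 + 1) + z powr - (2 * (nu - 1/2) + 1))"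
    "\<And>z. z > 0 \<Longrightarrow> norm (LBINT s:{0<..}. of_real s * hI (nu - 1/2) z s) \<le> C1 * (z powr - (nu - 1/2 + 2) + z powr - (2 * (nu - 1/2) + 2))"
    by (rule norm_hX[OF p1]) (rule that; assumption)
  obtain C2 where C2: "C2 \<ge> 0" "\<And>z. z > 0 \<Longrightarrow> norm (hX (nu + 1/2) z) \<le> C2 * (z powr - (nu + 1/2 + 1) + z powr - (2 * (nu + 1/2) + 1))"
    by (rule norm_hX[OF p2]) (rule that; assumption)
  have ex: "- (nu - 1/2 + 1) = - ?p" "- (2 * (nu - 1/2) + 1) = - (real N - 2)"
    "- (nu - 1/2 + 2) = - ((real N + 1) / 2)" "- (2 * (nu - 1/2) + 2) = - (real N - 1)"
    "- (nu + 1/2 + 1) = - ?p - 1" "- (2 * (nu + 1/2) + 1) = - (real N - 1) - 1"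
    by (simp_all add: nu_def field_simps)
  define K where "K e = k powr e" for e
  have sc: "(k * r) powr e = K e * r powr e" if "r > 0" for r e
    using that k by (simp add: powr_mult K_def)
  have K0: "K e \<ge> 0" for e by (simp add: K_def)
  define B where "B = norm A * norm (cK nu) * C1"
  define B' where "B' = norm A * norm (cK (nu + 1)) * C2 * k^2"
  have B0: "B \<ge> 0" "B' \<ge> 0" using C1 C2 by (auto simp: B_def B'_def)
  \<comment> \<open>The sum of all six coefficients below, so that each of them is at most
    \<open>C\<close>.\<close>
  define C where "C = B * K (- (real N - 2)) + B * K (- ?p) + B' * K (- (real N - 1) - 1) + B' * K (- ?p - 1)
     + k * B * K (- (real N - 1)) + k * B * K (- ((real N + 1) / 2))"
  show ?thesis
  proof (rule that[of C])
    show "C \<ge> 0" using B0 K0 k by (simp add: C_def)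
    fix r :: real assume r: "r > 0"
    have kr: "k * r > 0" using k r by simp
    have le: "X * u + Y * v \<le> C * (u + v)" if "0 \<le> u" "0 \<le> v" "X \<le> C" "Y \<le> C" for X Y u v
      using mult_right_mono[OF that(3,1)] mult_right_mono[OF that(4,2)] by (simp add: distrib_left)
    have "norm (hr N k r) = norm A * norm (cK nu) * norm (hX (nu - 1/2) (k * r))"
      unfolding hr_def nu_def[symmetric] A_def[symmetric] hN_def by (simp add: norm_mult)
    also have "\<dots> \<le> norm A * norm (cK nu) * (C1 * ((k * r) powr - (nu - 1/2 + 1) + (k * r) powr - (2 * (nu - 1/2) + 1)))"
      by (intro mult_left_mono C1 kr) auto
    also have "\<dots> = (B * K (- (real N - 2))) * r powr - (real N - 2) + (B * K (- ?p)) * r powr - ?p"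
      unfolding ex sc[OF r] by (simp add: B_def algebra_simps)
    also have "\<dots> \<le> C * (r powr - (real N - 2) + r powr - ?p)"
      using B0 K0 k by (intro le) (auto simp: C_def intro!: add_nonneg_nonneg mult_nonneg_nonneg)
    finally show "norm (hr N k r) \<le> C * (r powr - (real N - 2) + r powr - ?p)" .
    have e1: "real N / 2 = nu + 1" "nu + 1 - 1/2 = nu + 1/2" by (simp_all add: nu_def field_simps)
    have "norm (hr' N k r) = norm A * norm (cK (nu + 1)) * k^2 * r * norm (hX (nu + 1/2) (k * r))"
      unfolding hr'_def nu_def[symmetric] A_def[symmetric] hN_def e1 using r k by (simp add: norm_mult norm_power)
    also have "\<dots> \<le> norm A * norm (cK (nu + 1)) * k^2 * r * (C2 * ((k * r) powr - (nu + 1/2 + 1) + (k * r) powr - (2 * (nu + 1/2) + 1)))"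
      using r by (intro mult_left_mono C2 kr) auto
    also have "\<dots> = (B' * K (- (real N - 1) - 1)) * (r * r powr (- (real N - 1) - 1)) + (B' * K (- ?p - 1)) * (r * r powr (- ?p - 1))"
      unfolding ex sc[OF r] by (simp add: B'_def algebra_simps)
    finally have n: "norm (hr' N k r) \<le> (B' * K (- (real N - 1) - 1)) * (r * r powr (- (real N - 1) - 1)) + (B' * K (- ?p - 1)) * (r * r powr (- ?p - 1))" .
    have "r * r powr (e - 1) = r powr e" for e
      using r by (simp add: powr_diff)
    with n have "norm (hr' N k r) \<le> (B' * K (- (real N - 1) - 1)) * r powr - (real N - 1) + (B' * K (- ?p - 1)) * r powr - ?p"
      by (simp only:)
    also have "\<dots> \<le> C * (r powr - (real N - 1) + r powr - ?p)"
      using B0 K0 k by (intro le) (auto simp: C_def intro!: add_nonneg_nonneg mult_nonneg_nonneg)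
    finally show "norm (hr' N k r) \<le> C * (r powr - (real N - 1) + r powr - ?p)" .
    have "hr' N k r - \<i> * of_real k * hr N k r = of_real k * A * (- of_real (k * r) * hN (nu + 1) (k * r) - \<i> * hN nu (k * r))"
      unfolding hr_def hr'_def nu_def[symmetric] A_def[symmetric] e1 by (simp add: power2_eq_square algebra_simps)
    also have "norm \<dots> = k * norm A * norm (cK nu) * norm (LBINT s:{0<..}. of_real s * hI (nu - 1/2) (k * r) s)"
      using nu kr k by (subst hN_radiation) (auto simp: norm_mult)
    also have "\<dots> \<le> k * norm A * norm (cK nu) * (C1 * ((k * r) powr - (nu - 1/2 + 2) + (k * r) powr - (2 * (nu - 1/2) + 2)))"
      using k by (intro mult_left_mono C1 kr) auto
    also have "\<dots> = (k * B * K (- (real N - 1))) * r powr - (real N - 1) + (k * B * K (- ((real N + 1) / 2))) * r powr - ((real N + 1) / 2)"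
      unfolding ex sc[OF r] by (simp add: B_def algebra_simps)
    also have "\<dots> \<le> C * (r powr - (real N - 1) + r powr - ((real N + 1) / 2))"
      using B0 K0 k by (intro le) (auto simp: C_def intro!: add_nonneg_nonneg mult_nonneg_nonneg)
    finally show "norm (hr' N k r - \<i> * of_real k * hr N k r) \<le> C * (r powr - (real N - 1) + r powr - ((real N + 1) / 2))" .
  qed
qed

text \<open>The limit is real because the factor \<i>/4 of the fundamental solution meets the factor
  -2 \<i> of \<open>cK\<close>. Realness of this constant keeps the potential of the later Helmholtz
  equation real.\<close>

lemma hr'_limit_0:
  assumes k: "k > 0" and N: "N \<ge> 3"
  obtains c where "((\<lambda>r. of_real (r ^ (N - 1)) * hr' N k r) \<longlongrightarrow> complex_of_real c) (at_right 0)"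
proof -
  define nu where "nu = (real N - 2) / 2"
  define p where "p = (real N - 1) / 2"
  have p0: "p > 0" "2 * p + 1 = real N" "real N / 2 - 1/2 = p" using N by (auto simp: p_def field_simps)
  define B where "B = - of_real (k^2) * (\<i> / 4 * complex_of_real ((k^2 / (2 * pi)) powr nu)) * cK (real N / 2) * of_real (k powr - real N)"
  have eq: "of_real (r ^ (N - 1)) * hr' N k r = B * (of_real ((k * r) powr (2 * p + 1)) * hX p (k * r))" if r: "r > 0" for r
  proof -
    have "r ^ (N - 1) * r = k powr - real N * (k * r) powr (2 * p + 1)"
    proof -
      obtain m where m: "N = Suc m" using N by (cases N) auto
      have "(k * r) powr real N = k ^ N * r ^ N" using r k powr_realpow[of "k * r" N] by (simp add: power_mult_distrib)
      moreover have "k powr - real N * k ^ N = 1" using k powr_realpow[of k N] by (simp add: powr_minus)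
      ultimately have "k powr - real N * (k * r) powr real N = r ^ N" by (metis mult.assoc mult_1)
      then show ?thesis unfolding p0 by (simp add: m)
    qed
    then have e: "of_real (r ^ (N - 1)) * of_real r = complex_of_real (k powr - real N) * of_real ((k * r) powr (2 * p + 1))"
      by (simp only: of_real_mult[symmetric])
    have "of_real (r ^ (N - 1)) * hr' N k r = - of_real (k^2) * (\<i> / 4 * complex_of_real ((k^2 / (2 * pi)) powr nu)) * cK (real N / 2) * (of_real (r ^ (N - 1)) * of_real r) * hX p (k * r)"
      unfolding hr'_def hN_def p0 nu_def by simp
    then show ?thesis unfolding e B_def by (simp only: mult_ac)
  qed
  have fl: "filterlim (\<lambda>r. k * r) (at_right 0) (at_right 0)"
    unfolding filterlim_at using k
    by (auto intro!: tendsto_eq_intros simp: eventually_at_right_field intro!: exI[of _ 1])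
  have "((\<lambda>r. B * (of_real ((k * r) powr (2 * p + 1)) * hX p (k * r))) \<longlongrightarrow> B * of_real (Gamma (2 * p + 1))) (at_right 0)"
    by (intro tendsto_mult_left filterlim_compose[OF hX_limit_0[OF p0(1)] fl])
  then have lim: "((\<lambda>r. of_real (r ^ (N - 1)) * hr' N k r) \<longlongrightarrow> B * of_real (Gamma (2 * p + 1))) (at_right 0)"
    by (rule Lim_transform_eventually) (auto simp only: eventually_at_right_field eq intro!: exI[of _ 1])
  moreover have "B * of_real (Gamma (2 * p + 1)) = of_real (- (1/2) * (k^2 * (k^2 / (2 * pi)) powr nu * k powr - real N) * (2 powr - (real N / 2)) * (rGamma (real N / 2 + 1/2) * Gamma (real N)) / sqrt pi)"
    unfolding B_def cK_def p0 by (simp add: algebra_simps)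
  ultimately show ?thesis by (intro that) (simp only:)
qed

lemma jb_diff: "jb x \<le> jb (x - y) + jb y"
  using jb_triangle[of "x - y" y] norm_le_jb[of y] by simp

lemma jb_powr_diff:
  assumes "sg \<ge> 0"
  shows "jb x powr sg \<le> 2 powr sg * (jb (x - y) powr sg + jb y powr sg)"
proof -
  have "jb x \<le> 2 * max (jb (x - y)) (jb y)"
    using jb_diff[of x y] by auto
  then have "jb x powr sg \<le> (2 * max (jb (x - y)) (jb y)) powr sg"
    using assms by (intro powr_mono2) auto
  also have "\<dots> = 2 powr sg * (max (jb (x - y)) (jb y)) powr sg"
    by (subst powr_mult) (auto simp: le_max_iff_disj)
  also have "\<dots> \<le> 2 powr sg * (jb (x - y) powr sg + jb y powr sg)"
    by (intro mult_left_mono) (auto simp: max_def)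
  finally show ?thesis .
qed

text \<open>Replacing the larger base by the smaller one increases a nonpositive power, so the
  product is at most one of the two powers on the right.\<close>

lemma powr_prod_le_sum:
  fixes a b :: real
  assumes "a \<ge> 1" "b \<ge> 1" "s \<ge> 0" "u \<ge> 0"
  shows "a powr (- s) * b powr (- u) \<le> a powr (- (s + u)) + b powr (- (s + u))"
proof (cases "a \<le> b")
  case True
  have "b powr (- u) \<le> a powr (- u)" using assms True by (intro powr_mono2') auto
  then have "a powr (- s) * b powr (- u) \<le> a powr (- s) * a powr (- u)" by (intro mult_left_mono) auto
  also have "\<dots> = a powr (- (s + u))" by (simp add: powr_add[symmetric])
  finally show ?thesis by (simp add: add_increasing2)
next
  case False
  have "a powr (- s) \<le> b powr (- s)" using assms False by (intro powr_mono2') auto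
  then have "a powr (- s) * b powr (- u) \<le> b powr (- s) * b powr (- u)" by (intro mult_right_mono) auto
  also have "\<dots> = b powr (- (s + u))" by (simp add: powr_add[symmetric])
  finally show ?thesis by (simp add: add_increasing)
qed

section \<open>Convolution with an outgoing radial kernel\<close>

text \<open>The exponent N - 1 is the singularity of the gradient of the kernel. Being the stronger
  one it serves for the kernel as well, so that a single \<open>wkern\<close> dominates
  both.\<close>

definition sing :: "real ^ 'n \<Rightarrow> real"
  where "sing x = indicator (ball 0 1) x * norm x powr (- (real CARD('n) - 1))"

definition wkern :: "real \<Rightarrow> real ^ 'n \<Rightarrow> real"
  where "wkern q x = sing x + jb x powr (- q)"

lemma sing_nonneg [simp]: "sing x \<ge> 0" by (simp add: sing_def)

lemma wkern_nonneg [simp]: "wkern q x \<ge> 0" by (simp add: wkern_def)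

lemma sing_integrable: "integrable lborel (sing :: real ^ 'n \<Rightarrow> real)"
  unfolding sing_def[abs_def] by (rule integrable_norm_powr_ball) auto

lemma sing_measurable [measurable]: "sing \<in> borel_measurable borel"
  using borel_measurable_integrable[OF sing_integrable] by simp

lemma wkern_measurable [measurable]: "wkern q \<in> borel_measurable borel"
  unfolding wkern_def by measurable

text \<open>Near the diagonal <x> <= 2 <y>, so decay in \<open>y\<close> passes to \<open>x\<close>.
  For the remaining part <x>^sg is at most 2^sg times the sum of <x-y>^sg and <y>^sg, and
  \<open>powr_prod_le_sum\<close> separates the products. What multiplies <x>^(-sg) is integrable in
  \<open>y\<close> once q + bt - sg > N.\<close>

lemma wkern_pointwise:
  fixes x y :: "real ^ 'n"
  assumes "0 \<le> sg" "sg \<le> q" "sg \<le> bt"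
  shows "wkern q (x - y) * jb y powr (- bt) \<le> jb x powr (- sg) *
     (2 powr bt * sing (x - y) + 2 powr (sg + 1) * (jb (x - y) powr (- (q + bt - sg)) + jb y powr (- (q + bt - sg))))"
proof -
  have A: "sing (x - y) * jb y powr (- bt) \<le> jb x powr (- sg) * (2 powr bt * sing (x - y))"
  proof (cases "norm (x - y) < 1")
    case True
    have "jb x \<le> jb y + norm (x - y)" using jb_triangle[of y "x - y"] by simp
    also have "\<dots> \<le> 2 * jb y" using True jb_ge_1[of y] by linarith
    finally have "(2 * jb y) powr (- bt) \<le> jb x powr (- bt)"
      using assms by (intro powr_mono2') auto
    also have "\<dots> \<le> jb x powr (- sg)"
      using assms jb_ge_1[of x] by (intro powr_mono) auto
    finally have "2 powr bt * (2 * jb y) powr (- bt) \<le> 2 powr bt * jb x powr (- sg)"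
      by (intro mult_left_mono) auto
    moreover have "2 powr bt * (2 * jb y) powr (- bt) = jb y powr (- bt)"
      by (simp add: powr_mult powr_minus)
    ultimately have "jb y powr (- bt) \<le> 2 powr bt * jb x powr (- sg)" by simp
    from mult_left_mono[OF this, of "sing (x - y)"] show ?thesis by (simp add: mult_ac)
  next
    case False
    then have "sing (x - y) = 0" by (simp add: sing_def)
    then show ?thesis by simp
  qed
  define a where "a = jb (x - y)"
  define b where "b = jb y"
  define c where "c = jb x"
  have ab: "a \<ge> 1" "b \<ge> 1" "c > 0" by (simp_all add: a_def b_def c_def jb_ge_1)
  have "c powr sg * (a powr (- q) * b powr (- bt)) \<le> (2 powr sg * (a powr sg + b powr sg)) * (a powr (- q) * b powr (- bt))"
    using jb_powr_diff[OF assms(1), of x y] unfolding a_def b_def c_def by (intro mult_right_mono) auto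
  also have "\<dots> = 2 powr sg * (a powr (- (q - sg)) * b powr (- bt) + a powr (- q) * b powr (- (bt - sg)))"
    by (simp add: distrib_left distrib_right powr_add[symmetric] algebra_simps) (simp add: mult.assoc[symmetric] powr_add[symmetric])
  also have "\<dots> \<le> 2 powr sg * ((a powr (- (q - sg + bt)) + b powr (- (q - sg + bt))) + (a powr (- (q + (bt - sg))) + b powr (- (q + (bt - sg)))))"
    using ab assms by (intro mult_left_mono add_mono powr_prod_le_sum) auto
  also have "\<dots> = 2 powr (sg + 1) * (a powr (- (q + bt - sg)) + b powr (- (q + bt - sg)))"
    by (simp add: powr_add algebra_simps)
  finally have F: "c powr (- sg) * (c powr sg * (a powr (- q) * b powr (- bt))) \<le> c powr (- sg) * (2 powr (sg + 1) * (a powr (- (q + bt - sg)) + b powr (- (q + bt - sg))))"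
    by (intro mult_left_mono) auto
  have eqc: "c powr (- sg) * (c powr sg * (a powr (- q) * b powr (- bt))) = a powr (- q) * b powr (- bt)"
    using ab by (simp add: powr_minus)
  from F[unfolded eqc] have B: "jb (x - y) powr (- q) * jb y powr (- bt) \<le> jb x powr (- sg) * (2 powr (sg + 1) * (jb (x - y) powr (- (q + bt - sg)) + jb y powr (- (q + bt - sg))))"
    unfolding a_def b_def c_def .
  show ?thesis using add_mono[OF A B] by (simp add: wkern_def distrib_left distrib_right)
qed

lemma wkern_convolution:
  assumes "0 \<le> sg" "sg \<le> q" "sg \<le> bt" "q + bt - sg > real CARD('n)"
  obtains C where "C > 0"
    "\<And>x :: real ^ 'n. integrable lborel (\<lambda>y. wkern q (x - y) * jb y powr (- bt))"
    "\<And>x :: real ^ 'n. (LBINT y. wkern q (x - y) * jb y powr (- bt)) \<le> C * jb x powr (- sg)"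
proof -
  define t where "t = q + bt - sg"
  define S where "S = (\<integral>x. sing x \<partial>(lborel :: (real ^ 'n) measure))"
  define I where "I = (\<integral>x. jb x powr (- t) \<partial>(lborel :: (real ^ 'n) measure))"
  have it: "integrable lborel (\<lambda>x :: real ^ 'n. jb x powr (- t))"
    using assms by (intro integrable_jb_powr) (simp add: t_def)
  have S0: "S \<ge> 0" "I \<ge> 0" unfolding S_def I_def by (intro integral_nonneg_AE; simp)+
  define B where "B x y = jb x powr (- sg) * (2 powr bt * sing (x - y) + 2 powr (sg + 1) * (jb (x - y) powr (- t) + jb y powr (- t)))" for x y :: "real ^ 'n"
  have Bi: "integrable lborel (B x)" for x
    unfolding B_def using sing_integrable it integrable_lborel_reflect[OF sing_integrable, of x] integrable_lborel_reflect[OF it, of x]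
    by (intro integrable_mult_right Bochner_Integration.integrable_add) auto
  have Bv: "(LBINT y. B x y) = jb x powr (- sg) * (2 powr bt * S + 2 powr (sg + 1) * (I + I))" for x
    unfolding B_def S_def I_def
    using sing_integrable it integrable_lborel_reflect[OF sing_integrable, of x] integrable_lborel_reflect[OF it, of x]
      integral_lborel_reflect[of sing x] integral_lborel_reflect[of "\<lambda>x. jb x powr (- t)" x]
    by (simp add: Bochner_Integration.integral_add)
  have le: "wkern q (x - y) * jb y powr (- bt) \<le> B x y" for x y :: "real ^ 'n"
    using wkern_pointwise[OF assms(1-3), of x y] by (simp add: B_def t_def)
  have ii: "integrable lborel (\<lambda>y. wkern q (x - y) * jb y powr (- bt))" for x :: "real ^ 'n"
    by (rule integrable_dominated[OF Bi[of x]])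
      (use le in \<open>auto intro!: AE_I2 order.trans[OF le] simp: abs_mult\<close>)
  show ?thesis
  proof (rule that[of "2 powr bt * S + 2 powr (sg + 1) * (I + I) + 1"])
    show "2 powr bt * S + 2 powr (sg + 1) * (I + I) + 1 > 0" using S0 by (simp add: add_nonneg_pos)
    show "integrable lborel (\<lambda>y. wkern q (x - y) * jb y powr (- bt))" for x :: "real ^ 'n" by (rule ii)
    fix x :: "real ^ 'n"
    have "(LBINT y. wkern q (x - y) * jb y powr (- bt)) \<le> (LBINT y. B x y)"
      by (intro integral_mono ii Bi le)
    also have "\<dots> = jb x powr (- sg) * (2 powr bt * S + 2 powr (sg + 1) * (I + I))" by (rule Bv)
    also have "\<dots> \<le> (2 powr bt * S + 2 powr (sg + 1) * (I + I) + 1) * jb x powr (- sg)"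
      by (simp add: algebra_simps)
    finally show "(LBINT y. wkern q (x - y) * jb y powr (- bt)) \<le> (2 powr bt * S + 2 powr (sg + 1) * (I + I) + 1) * jb x powr (- sg)" .
  qed
qed

lemma norm_powr_le_wkern:
  fixes x :: "real ^ 'n"
  assumes "x \<noteq> 0" "0 \<le> a" "a \<le> real CARD('n) - 1" "0 \<le> b" "b \<le> real CARD('n) - 1" "b \<le> a"
  shows "norm x powr (- a) + norm x powr (- b) \<le> 2 powr (b + 1) * wkern b x"
proof (cases "norm x < 1")
  case True
  have "norm x powr (- a) \<le> sing x" "norm x powr (- b) \<le> sing x"
    using True assms by (auto simp: sing_def intro!: powr_mono')
  then have "norm x powr (- a) + norm x powr (- b) \<le> 2 * wkern b x" by (simp add: wkern_def add_increasing2)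
  also have "\<dots> \<le> 2 powr (b + 1) * wkern b x"
    using assms ge_one_powr_ge_zero[of 2 b] by (intro mult_right_mono) (auto simp: powr_add)
  finally show ?thesis .
next
  case False
  have "norm x powr (- a) \<le> norm x powr (- b)" using False assms by (intro powr_mono) auto
  then have "norm x powr (- a) + norm x powr (- b) \<le> 2 * norm x powr (- b)" by simp
  also have "norm x powr (- b) \<le> (jb x / 2) powr (- b)"
  proof (rule powr_mono2')
    show "jb x / 2 \<le> norm x" using False jb_le_1_norm[of x] by linarith
  qed (use assms in auto)
  also have "(jb x / 2) powr (- b) = 2 powr b * jb x powr (- b)"
    by (simp add: powr_divide powr_minus field_simps)
  finally have "norm x powr (- a) + norm x powr (- b) \<le> 2 powr (b + 1) * jb x powr (- b)"
    by (simp add: powr_add)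
  also have "\<dots> \<le> 2 powr (b + 1) * wkern b x" by (intro mult_left_mono) (auto simp: wkern_def)
  finally show ?thesis .
qed

text \<open>From here on the Hankel function is visible only through its radial equation, three size
  estimates and the real limit \<open>c0\<close>. The parameter \<open>T\<close> carries the
  dimension as a type.\<close>

locale radial_kernel =
  fixes T :: "'n::finite itself" and k :: real and h h' :: "real \<Rightarrow> complex" and C0 c0 :: real
  assumes N3: "CARD('n) \<ge> 3" and k: "k > 0" and C0: "C0 \<ge> 0"
    and h_deriv: "\<And>r. r > 0 \<Longrightarrow> (h has_vector_derivative h' r) (at r)"
    and ode: "\<And>r. r > 0 \<Longrightarrow> ((\<lambda>r. of_real (r ^ (CARD('n) - 1)) * h' r) has_vector_derivative
        - of_real (k^2 * r ^ (CARD('n) - 1)) * h r) (at r)"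
    and h_bound: "\<And>r. r > 0 \<Longrightarrow> norm (h r) \<le> C0 * (r powr - (real CARD('n) - 2) + r powr - ((real CARD('n) - 1) / 2))"
    and h'_bound: "\<And>r. r > 0 \<Longrightarrow> norm (h' r) \<le> C0 * (r powr - (real CARD('n) - 1) + r powr - ((real CARD('n) - 1) / 2))"
    and radiation: "\<And>r. r > 0 \<Longrightarrow> norm (h' r - \<i> * of_real k * h r) \<le> C0 * (r powr - (real CARD('n) - 1) + r powr - ((real CARD('n) + 1) / 2))"
    and h'_lim: "((\<lambda>r. of_real (r ^ (CARD('n) - 1)) * h' r) \<longlongrightarrow> of_real c0) (at_right 0)"
begin

definition p where "p = (real CARD('n) - 1) / 2"

lemma p_eq: "real CARD('n) = 2 * p + 1"
  unfolding p_def by argo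

lemma p_ge_1: "p \<ge> 1" using N3 by (simp add: p_def)

definition \<Phi> :: "real ^ 'n \<Rightarrow> complex"
  where "\<Phi> x = (if x = 0 then 0 else h (norm x))"

definition d\<Phi> :: "real ^ 'n \<Rightarrow> real ^ 'n \<Rightarrow> complex"
  where "d\<Phi> e x = of_real ((x \<bullet> e) / norm x) * h' (norm x)"

lemma h_continuous: "continuous_on {0<..} h"
  using h_deriv by (auto simp: continuous_on_eq_continuous_at intro!: has_vector_derivative_continuous)

lemma h'_continuous: "continuous_on {0<..} h'"
proof -
  have c: "continuous_on {0<..} (\<lambda>r. of_real (r ^ (CARD('n) - 1)) * h' r)"
    using ode by (auto simp: continuous_on_eq_continuous_at intro!: has_vector_derivative_continuous)
  have "continuous_on {0<..} (\<lambda>r. of_real (1 / r ^ (CARD('n) - 1)) * (of_real (r ^ (CARD('n) - 1)) * h' r))"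
    by (rule continuous_on_mult[OF _ c]) (intro continuous_intros; simp)
  then show ?thesis
  proof (rule continuous_on_eq)
    fix r :: real assume "r \<in> {0<..}"
    moreover have "of_real (1 / R) * (of_real R * w) = w" if "R > 0" for R and w :: complex using that by simp
    ultimately show "of_real (1 / r ^ (CARD('n) - 1)) * (of_real (r ^ (CARD('n) - 1)) * h' r) = h' r" by simp
  qed
qed

lemma continuous_\<Phi>: "continuous_on (- {0}) \<Phi>"
proof -
  have "continuous_on (- {0}) (\<lambda>x :: real ^ 'n. h (norm x))"
    by (rule continuous_on_compose2[OF h_continuous]) (auto intro: continuous_intros)
  then show ?thesis by (rule continuous_on_eq) (auto simp: \<Phi>_def)
qed

lemma continuous_d\<Phi>: "continuous_on (- {0}) (d\<Phi> e)"
proof -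
  have [continuous_intros]: "continuous_on (- {0}) (\<lambda>x :: real ^ 'n. h' (norm x))"
    by (rule continuous_on_compose2[OF h'_continuous]) (auto intro: continuous_intros)
  show ?thesis unfolding d\<Phi>_def by (intro continuous_intros) auto
qed

lemma measurable_punctured:
  fixes f :: "real ^ 'n \<Rightarrow> complex"
  assumes "continuous_on (- {0}) f" "f 0 = 0"
  shows "f \<in> borel_measurable borel"
proof -
  have "(\<lambda>x. indicator (- {0}) x *\<^sub>R f x) \<in> borel_measurable borel"
    using assms by (intro borel_measurable_continuous_on_indicator) auto
  also have "(\<lambda>x. indicator (- {0}) x *\<^sub>R f x) = f" using assms by (auto simp: indicator_def)
  finally show ?thesis .
qed

lemma \<Phi>_measurable [measurable]: "\<Phi> \<in> borel_measurable borel"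
  by (rule measurable_punctured[OF continuous_\<Phi>]) (simp add: \<Phi>_def)

lemma d\<Phi>_measurable [measurable]: "d\<Phi> e \<in> borel_measurable borel"
  by (rule measurable_punctured[OF continuous_d\<Phi>]) (simp add: d\<Phi>_def)

definition CK where "CK = C0 * 2 powr (p + 2)"

lemma CK_nonneg: "CK \<ge> 0" using C0 by (simp add: CK_def)

text \<open>Stated for every radius r >= |x| because the regularized radius sqrt(eps^2 + |x|^2) is
  inserted later; the majorizing powers decrease in \<open>r\<close>.\<close>

lemma h_wkern:
  fixes x :: "real ^ 'n"
  assumes x: "x \<noteq> 0" and r: "norm x \<le> r"
  shows "norm (h r) \<le> CK * wkern p x" "norm (h' r) \<le> CK * wkern p x"
proof -
  have r0: "r > 0" using x r by (meson less_le_trans zero_less_norm_iff)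
  have *: "w \<le> CK * wkern p x" if w: "w \<le> C0 * (r powr - a + r powr - p)" and a: "p \<le> a" "a \<le> real CARD('n) - 1" for w a
  proof -
    have "r powr - a + r powr - p \<le> norm x powr - a + norm x powr - p"
      using x r a p_ge_1 by (intro add_mono powr_mono2') auto
    also have "\<dots> \<le> 2 powr (p + 1) * wkern p x"
      using x a N3 p_ge_1 by (intro norm_powr_le_wkern) (auto simp: p_def field_simps)
    also have "\<dots> \<le> 2 powr (p + 2) * wkern p x" by (intro mult_right_mono) auto
    finally have "C0 * (r powr - a + r powr - p) \<le> C0 * (2 powr (p + 2) * wkern p x)" using C0 by (rule mult_left_mono)
    with w show ?thesis by (simp add: CK_def)
  qed
  have N: "p \<le> real CARD('n) - 2 \<or> CARD('n) = 2" "p \<le> real CARD('n) - 1" using N3 by (auto simp: p_def field_simps)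
  show "norm (h r) \<le> CK * wkern p x" using h_bound[OF r0] N N3 by (intro *[of _ "real CARD('n) - 2"]) (auto simp: p_def)
  show "norm (h' r) \<le> CK * wkern p x" using h'_bound[OF r0] N by (intro *[of _ "real CARD('n) - 1"]) (auto simp: p_def)
qed

lemma norm_\<Phi>: "norm (\<Phi> x) \<le> CK * wkern p x"
  using h_wkern(1)[of x] CK_nonneg by (simp add: \<Phi>_def)

lemma norm_d\<Phi>: "norm (d\<Phi> e x) \<le> CK * wkern p x * norm e"
proof (cases "x = 0")
  case False
  have "\<bar>x \<bullet> e\<bar> / norm x \<le> norm e" using Cauchy_Schwarz_ineq2[of x e] False by (simp add: field_simps)
  then have "norm (d\<Phi> e x) \<le> norm e * (CK * wkern p x)"
    unfolding d\<Phi>_def norm_mult norm_of_real abs_divide using h_wkern(2)[OF False order_refl] CK_nonneg by (intro mult_mono) auto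
  then show ?thesis by (simp add: mult_ac)
qed (use CK_nonneg in \<open>simp add: d\<Phi>_def\<close>)

lemma norm_radiation:
  fixes x :: "real ^ 'n"
  assumes "x \<noteq> 0"
  shows "norm (h' (norm x) - \<i> * of_real k * h (norm x)) \<le> CK * wkern (p + 1) x"
proof -
  have e: "(real CARD('n) + 1) / 2 = p + 1" by (simp add: p_def field_simps)
  have "norm (h' (norm x) - \<i> * of_real k * h (norm x)) \<le> C0 * (norm x powr - (real CARD('n) - 1) + norm x powr - (p + 1))"
    using radiation[of "norm x"] assms by (simp add: e)
  also have "\<dots> \<le> C0 * (2 powr (p + 1 + 1) * wkern (p + 1) x)"
    using assms N3 C0 by (intro mult_left_mono norm_powr_le_wkern) (auto simp: p_def field_simps)
  finally show ?thesis by (simp add: CK_def add.assoc)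
qed

lemma d\<Phi>_linear: "d\<Phi> (a *\<^sub>R e + b *\<^sub>R f) x = of_real a * d\<Phi> e x + of_real b * d\<Phi> f x"
  by (simp add: d\<Phi>_def inner_add_right add_divide_distrib algebra_simps)

lemma \<Phi>_line_deriv:
  assumes "x + t *\<^sub>R e \<noteq> 0"
  shows "((\<lambda>t. \<Phi> (x + t *\<^sub>R e)) has_vector_derivative d\<Phi> e (x + t *\<^sub>R e)) (at t within A)"
proof -
  let ?y = "\<lambda>t. x + t *\<^sub>R e"
  have 1: "((\<lambda>t. x + t *\<^sub>R e) has_vector_derivative e) (at t)"
    by (auto intro!: derivative_eq_intros)
  have "((\<lambda>t. norm (?y t)) has_derivative (\<lambda>d. (d *\<^sub>R e) \<bullet> sgn (?y t))) (at t)"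
    using has_derivative_compose[OF 1[unfolded has_vector_derivative_def] has_derivative_norm[OF assms]] .
  then have 2: "((\<lambda>t. norm (?y t)) has_vector_derivative (?y t \<bullet> e) / norm (?y t)) (at t)"
    unfolding has_vector_derivative_def by (simp add: sgn_div_norm divide_inverse mult_ac inner_commute)
  from vector_diff_chain_at[OF 2 h_deriv] assms
  have "((\<lambda>t. h (norm (?y t))) has_vector_derivative d\<Phi> e (?y t)) (at t)"
    by (simp add: o_def d\<Phi>_def scaleR_conv_of_real)
  moreover have "open {s. x + s *\<^sub>R e \<noteq> 0}"
    by (intro open_Collect_neq continuous_intros)
  ultimately have "((\<lambda>t. \<Phi> (?y t)) has_vector_derivative d\<Phi> e (?y t)) (at t)"
    using assms by (elim has_vector_derivative_transform_within_open) (auto simp: \<Phi>_def)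
  then show ?thesis by (rule has_vector_derivative_at_within)
qed

end

definition decays :: "real \<Rightarrow> real \<Rightarrow> (real ^ 'n \<Rightarrow> complex) \<Rightarrow> bool"
  where "decays A bt g \<longleftrightarrow> g \<in> borel_measurable borel \<and> A \<ge> 0 \<and> (\<forall>y. norm (g y) \<le> A * jb y powr (- bt))"

text \<open>The exceptional \<open>y\<close> lie on an affine line, a null set in dimension at least
  2. Hence for almost every \<open>y\<close> the kernel can be differentiated along the whole line
  without meeting its singularity.\<close>

lemma AE_off_line:
  fixes x e :: "'a::euclidean_space"
  assumes "DIM('a) \<ge> 2"
  shows "AE y in lborel. \<forall>t. x - y + t *\<^sub>R e \<noteq> 0"
proof -
  define S where "S = (\<lambda>v. x + v) ` span {e}"
  have "dim (span {e}) \<le> card {e}" unfolding dim_span by (rule dim_le_card') simp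
  then have "negligible (span {e})" using assms by (intro negligible_lowdim) simp
  then have "negligible S" unfolding S_def by (rule negligible_translation)
  moreover have "closed S" unfolding S_def by (intro closed_translation) simp
  ultimately have "S \<in> null_sets lborel"
    by (simp add: negligible_iff_null_sets null_sets_completion_iff)
  then have "AE y in lborel. y \<notin> S" by (rule AE_not_in)
  then show ?thesis
  proof eventually_elim
    case (elim y)
    show ?case
    proof (intro allI notI)
      fix t assume "x - y + t *\<^sub>R e = 0"
      then have "y = x + t *\<^sub>R e" by (simp add: algebra_simps)
      then have "y \<in> S" unfolding S_def by (auto intro: span_mul span_base)
      then show False using elim by simp
    qed
  qed
qed

context radial_kernel
begin

definition cv :: "(real ^ 'n \<Rightarrow> complex) \<Rightarrow> real ^ 'n \<Rightarrow> complex"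
  where "cv g x = (LBINT y. \<Phi> (x - y) * g y)"

definition cG :: "(real ^ 'n \<Rightarrow> complex) \<Rightarrow> real ^ 'n \<Rightarrow> real ^ 'n \<Rightarrow> complex"
  where "cG g e x = (LBINT y. d\<Phi> e (x - y) * g y)"

lemma kernel_product_bounds:
  assumes "decays A bt g"
  shows "norm (\<Phi> (x - y) * g y) \<le> A * CK * (wkern p (x - y) * jb y powr (- bt))"
    and "norm (d\<Phi> e (x - y) * g y) \<le> A * CK * norm e * (wkern p (x - y) * jb y powr (- bt))"
proof -
  have g: "norm (g y) \<le> A * jb y powr (- bt)" "A \<ge> 0" using assms by (auto simp: decays_def)
  have "norm (\<Phi> (x - y) * g y) \<le> (CK * wkern p (x - y)) * (A * jb y powr (- bt))"
    unfolding norm_mult using norm_\<Phi>[of "x - y"] g CK_nonneg by (intro mult_mono) auto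
  then show "norm (\<Phi> (x - y) * g y) \<le> A * CK * (wkern p (x - y) * jb y powr (- bt))"
    by (simp add: mult_ac)
  have "norm (d\<Phi> e (x - y) * g y) \<le> (CK * wkern p (x - y) * norm e) * (A * jb y powr (- bt))"
    unfolding norm_mult using norm_d\<Phi>[of e "x - y"] g CK_nonneg by (intro mult_mono) auto
  then show "norm (d\<Phi> e (x - y) * g y) \<le> A * CK * norm e * (wkern p (x - y) * jb y powr (- bt))"
    by (simp add: mult_ac)
qed

lemma wkern_p_integrable:
  assumes "0 \<le> bt" "p + bt > real CARD('n)"
  shows "integrable lborel (\<lambda>y. wkern p (x - y) * jb (y :: real ^ 'n) powr (- bt))"
proof -
  have s: "0 \<le> (0::real)" "0 \<le> p" "0 \<le> bt" "p + bt - 0 > real CARD('n)" using p_ge_1 assms by auto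
  obtain C where C: "C > 0"
    "\<And>x :: real ^ 'n. integrable lborel (\<lambda>y. wkern p (x - y) * jb y powr (- bt))"
    "\<And>x :: real ^ 'n. (LBINT y. wkern p (x - y) * jb y powr (- bt)) \<le> C * jb x powr (- 0)"
    by (rule wkern_convolution[OF s]) (rule that; assumption)
  show ?thesis by (rule C(2))
qed

lemma kernel_integrable:
  assumes g: "decays A bt g" and bt: "0 \<le> bt" "p + bt > real CARD('n)"
  shows "integrable lborel (\<lambda>y. \<Phi> (x - y) * g y)" "integrable lborel (\<lambda>y. d\<Phi> e (x - y) * g y)"
proof -
  have [measurable]: "g \<in> borel_measurable borel" using g by (simp add: decays_def)
  note w = wkern_p_integrable[OF bt, of x]
  have A: "A \<ge> 0" using g by (simp add: decays_def)
  show "integrable lborel (\<lambda>y. \<Phi> (x - y) * g y)"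
    by (rule integrable_dominated[OF integrable_mult_right[OF w, of "A * CK"]])
      (auto intro!: AE_I2 order.trans[OF kernel_product_bounds(1)[OF g]])
  show "integrable lborel (\<lambda>y. d\<Phi> e (x - y) * g y)"
    by (rule integrable_dominated[OF integrable_mult_right[OF w, of "A * CK * norm e"]])
      (auto intro!: AE_I2 order.trans[OF kernel_product_bounds(2)[OF g]])
qed

text \<open>The constant depends on the exponents only and the density enters through the factor
  \<open>A\<close>, which makes the bounds uniform along sequences of densities.\<close>

lemma cv_bounds:
  assumes "0 \<le> sg" "sg \<le> p" "sg \<le> bt" "p + bt - sg > real CARD('n)"
  obtains C where "C > 0"
    "\<And>A (g :: real ^ 'n \<Rightarrow> complex) x. decays A bt g \<Longrightarrow> norm (cv g x) \<le> A * C * jb x powr (- sg)"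
    "\<And>A (g :: real ^ 'n \<Rightarrow> complex) e x. decays A bt g \<Longrightarrow> norm (cG g e x) \<le> A * C * norm e * jb x powr (- sg)"
proof -
  obtain C where C: "C > 0"
    "\<And>x :: real ^ 'n. integrable lborel (\<lambda>y. wkern p (x - y) * jb y powr (- bt))"
    "\<And>x :: real ^ 'n. (LBINT y. wkern p (x - y) * jb y powr (- bt)) \<le> C * jb x powr (- sg)"
    by (rule wkern_convolution[OF assms]) (rule that; assumption)
  have bt: "0 \<le> bt" "p + bt > real CARD('n)" using assms by auto
  have gen: "norm (integral\<^sup>L lborel f) \<le> c * ((CK * C + 1) * jb x powr (- sg))"
    if "integrable lborel f" "\<And>y. norm (f y) \<le> c * CK * (wkern p (x - y) * jb y powr (- bt))" "c \<ge> 0"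
    for f :: "real ^ 'n \<Rightarrow> complex" and c x
  proof -
    have "norm (integral\<^sup>L lborel f) \<le> (LBINT y. norm (f y))" by (rule integral_norm_bound)
    also have "\<dots> \<le> (LBINT y. c * CK * (wkern p (x - y) * jb y powr (- bt)))"
      using that C(2) by (intro integral_mono integrable_norm integrable_mult_right) auto
    also have "\<dots> = c * CK * (LBINT y. wkern p (x - y) * jb y powr (- bt))" by simp
    also have "\<dots> \<le> c * CK * (C * jb x powr (- sg))"
      using that CK_nonneg by (intro mult_left_mono C) auto
    also have "\<dots> \<le> c * ((CK * C + 1) * jb x powr (- sg))"
      using that by (simp add: algebra_simps)
    finally show ?thesis .
  qed
  show ?thesis
  proof (rule that[of "CK * C + 1"])
    show "CK * C + 1 > 0" using C CK_nonneg by (simp add: add_nonneg_pos)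
    fix A and g :: "real ^ 'n \<Rightarrow> complex" and x :: "real ^ 'n" assume g: "decays A bt g"
    then have A: "A \<ge> 0" by (simp add: decays_def)
    show "norm (cv g x) \<le> A * (CK * C + 1) * jb x powr (- sg)"
      unfolding cv_def using gen[OF kernel_integrable(1)[OF g bt] kernel_product_bounds(1)[OF g] A] by (simp add: mult.assoc)
    fix e :: "real ^ 'n"
    have "norm (cG g e x) \<le> (A * norm e) * ((CK * C + 1) * jb x powr (- sg))"
      unfolding cG_def
    proof (rule gen[OF kernel_integrable(2)[OF g bt]])
      show "norm (d\<Phi> e (x - y) * g y) \<le> A * norm e * CK * (wkern p (x - y) * jb y powr (- bt))" for y
        using kernel_product_bounds(2)[OF g, of e x y] by (simp add: mult_ac)
    qed (use A in auto)
    then show "norm (cG g e x) \<le> A * (CK * C + 1) * norm e * jb x powr (- sg)" by (simp add: mult_ac)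
  qed
qed

lemma cG_linear:
  assumes g: "decays A bt g" and bt: "0 \<le> bt" "p + bt > real CARD('n)"
  shows "cG g (a *\<^sub>R e + b *\<^sub>R f) x = of_real a * cG g e x + of_real b * cG g f x"
  unfolding cG_def d\<Phi>_linear distrib_right mult.assoc
  using kernel_integrable(2)[OF g bt] by (subst Bochner_Integration.integral_add) auto

lemma cG_bounded_linear:
  assumes g: "decays A bt g" and bt: "0 \<le> bt" "p + bt > real CARD('n)"
  shows "bounded_linear (\<lambda>e. cG g e x)"
proof -
  have "linear (\<lambda>e. cG g e x)"
    by (rule linearI) (use cG_linear[OF g bt, of 1 _ 1] cG_linear[OF g bt, of _ _ 0] in \<open>auto simp: scaleR_conv_of_real\<close>)
  then show ?thesis by (simp add: linear_conv_bounded_linear)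
qed

lemma cG_measurable [measurable (raw)]:
  assumes [measurable]: "g \<in> borel_measurable borel"
  shows "cG g e \<in> borel_measurable borel"
  unfolding cG_def[abs_def] by measurable

lemma cv_measurable [measurable (raw)]:
  assumes [measurable]: "g \<in> borel_measurable borel"
  shows "cv g \<in> borel_measurable borel"
  unfolding cv_def[abs_def] by measurable

lemma \<Phi>_FTC_line:
  assumes "\<And>t. x + t *\<^sub>R e \<noteq> 0"
  shows "(LBINT t. indicator {0..1} t *\<^sub>R d\<Phi> e (x + t *\<^sub>R e)) = \<Phi> (x + e) - \<Phi> x"
proof -
  have "(LBINT t. indicator {0..1} t *\<^sub>R d\<Phi> e (x + t *\<^sub>R e)) = \<Phi> (x + 1 *\<^sub>R e) - \<Phi> (x + 0 *\<^sub>R e)"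
  proof (rule integral_FTC_atLeastAtMost)
    show "continuous_on {0..1} (\<lambda>t. d\<Phi> e (x + t *\<^sub>R e))"
      by (rule continuous_on_compose2[OF continuous_d\<Phi>]) (use assms in \<open>auto intro!: continuous_intros\<close>)
  qed (use assms \<Phi>_line_deriv in auto)
  then show ?thesis by simp
qed

text \<open>The fundamental theorem of calculus is applied to the kernel on the segment, for almost
  every \<open>y\<close>, and integrated against \<open>g\<close> by Fubini. In this form it is
  available for densities that are only measurable.\<close>

lemma cv_line:
  assumes g: "decays A bt g" and bt: "0 \<le> bt" "p + bt > real CARD('n)"
  shows "integrable lborel (\<lambda>t. indicator {0..1} t *\<^sub>R cG g e (x + t *\<^sub>R e))"
    and "(LBINT t. indicator {0..1} t *\<^sub>R cG g e (x + t *\<^sub>R e)) = cv g (x + e) - cv g x"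
proof -
  have gm[measurable]: "g \<in> borel_measurable borel" and A: "A \<ge> 0" using g by (auto simp: decays_def)
  define H where "H t y = indicator {0..1::real} t *\<^sub>R (d\<Phi> e (x + t *\<^sub>R e - y) * g y)" for t y
  have Hm: "case_prod H \<in> borel_measurable (lborel \<Otimes>\<^sub>M lborel)"
    unfolding H_def by measurable
  have s: "0 \<le> (0::real)" "0 \<le> p" "0 \<le> bt" "p + bt - 0 > real CARD('n)" using p_ge_1 bt by auto
  obtain C where C: "C > 0"
    "\<And>x :: real ^ 'n. integrable lborel (\<lambda>y. wkern p (x - y) * jb y powr (- bt))"
    "\<And>x :: real ^ 'n. (LBINT y. wkern p (x - y) * jb y powr (- bt)) \<le> C * jb x powr (- 0)"
    by (rule wkern_convolution[OF s]) (rule that; assumption)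
  have Hi: "integrable lborel (H t)" for t
    unfolding H_def by (intro integrable_scaleR_right kernel_integrable[OF g bt])
  have gi: "integrable (lborel \<Otimes>\<^sub>M lborel) (case_prod H)"
  proof (rule lborel_pair.Fubini_integrable[OF Hm])
    show "AE t in lborel. integrable lborel (\<lambda>y. case (t, y) of (t, y) \<Rightarrow> H t y)"
      using Hi by simp
    have b: "norm (LBINT y. norm (H t y)) \<le> indicator {0..1} t * (A * CK * norm e * C)" for t
    proof (cases "t \<in> {0..1}")
      case True
      have "(LBINT y. norm (H t y)) \<le> (LBINT y. A * CK * norm e * (wkern p (x + t *\<^sub>R e - y) * jb y powr (- bt)))"
        using kernel_product_bounds(2)[OF g, of e "x + t *\<^sub>R e"] True
        by (intro integral_mono integrable_norm Hi integrable_mult_right wkern_p_integrable bt) (simp add: H_def)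
      also have "\<dots> = A * CK * norm e * (LBINT y. wkern p (x + t *\<^sub>R e - y) * jb y powr (- bt))" by simp
      also have "\<dots> \<le> A * CK * norm e * C"
        using C(3)[of "x + t *\<^sub>R e"] A CK_nonneg by (intro mult_left_mono) auto
      finally show ?thesis using True by simp
    qed (simp add: H_def)
    have c: "integrable lborel (\<lambda>t::real. indicator {0..1} t * (A * CK * norm e * C))" by simp
    show "integrable lborel (\<lambda>t. \<integral>y. norm (case (t, y) of (t, y) \<Rightarrow> H t y) \<partial>lborel)"
      unfolding prod.case
    proof (rule integrable_dominated[OF c])
      show "(\<lambda>t. \<integral>y. norm (H t y) \<partial>lborel) \<in> borel_measurable lborel"
        using Hm by measurable
      show "AE t in lborel. norm (LBINT y. norm (H t y)) \<le> norm (indicator {0..1} t * (A * CK * norm e * C))"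
        by (intro AE_I2 order.trans[OF b]) simp
    qed
  qed
  have e1: "(LBINT y. H t y) = indicator {0..1} t *\<^sub>R cG g e (x + t *\<^sub>R e)" for t
    unfolding H_def cG_def by simp
  show "integrable lborel (\<lambda>t. indicator {0..1} t *\<^sub>R cG g e (x + t *\<^sub>R e))"
    using lborel_pair.integrable_fst[OF gi] unfolding e1 .
  have "(LBINT t. (LBINT y. H t y)) = (LBINT y. (LBINT t. H t y))"
    by (rule lborel_pair.Fubini_integral[symmetric, OF gi])
  also have "\<dots> = (LBINT y. \<Phi> (x + e - y) * g y - \<Phi> (x - y) * g y)"
  proof (rule integral_cong_AE)
    have "AE y in lborel. \<forall>t. x - y + t *\<^sub>R e \<noteq> 0" using N3 by (intro AE_off_line) simp
    then show "AE y in lborel. (LBINT t. H t y) = \<Phi> (x + e - y) * g y - \<Phi> (x - y) * g y"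
    proof eventually_elim
      case (elim y)
      have "(LBINT t. H t y) = (LBINT t. indicator {0..1} t *\<^sub>R d\<Phi> e ((x - y) + t *\<^sub>R e) * g y)"
        by (intro Bochner_Integration.integral_cong refl) (simp add: H_def algebra_simps)
      also have "\<dots> = (LBINT t. indicator {0..1} t *\<^sub>R d\<Phi> e ((x - y) + t *\<^sub>R e)) * g y" by (rule integral_mult_left_zero)
      also have "\<dots> = (\<Phi> ((x - y) + e) - \<Phi> (x - y)) * g y"
        using elim by (subst \<Phi>_FTC_line) auto
      finally show ?case by (simp add: algebra_simps)
    qed
    show "(\<lambda>y. \<integral>t. H t y \<partial>lborel) \<in> borel_measurable lborel"
      using lborel_pair.integrable_snd[OF gi] by (rule borel_measurable_integrable)
  qed simp
  also have "\<dots> = cv g (x + e) - cv g x"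
    unfolding cv_def by (rule lebesgue_diff; rule kernel_integrable[OF g bt])
  finally show "(LBINT t. indicator {0..1} t *\<^sub>R cG g e (x + t *\<^sub>R e)) = cv g (x + e) - cv g x"
    unfolding e1 .
qed

text \<open>\<open>cv_line\<close> together with the bound on \<open>cG\<close> for sg = 0. Since
  \<open>L\<close> is the same for all densities, this is the equicontinuity behind the compactness
  argument.\<close>

lemma cv_lipschitz:
  assumes "0 \<le> bt" "p + bt > real CARD('n)"
  obtains L where "L > 0" "\<And>A (g :: real ^ 'n \<Rightarrow> complex) (x :: real ^ 'n) y. decays A bt g \<Longrightarrow> norm (cv g x - cv g y) \<le> A * L * norm (x - y)"
proof -
  have s: "0 \<le> (0::real)" "0 \<le> p" "p + bt - 0 > real CARD('n)" using p_ge_1 assms by auto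
  obtain L where L: "L > 0"
    "\<And>A (g :: real ^ 'n \<Rightarrow> complex) x. decays A bt g \<Longrightarrow> norm (cv g x) \<le> A * L * jb x powr (- 0)"
    "\<And>A (g :: real ^ 'n \<Rightarrow> complex) e x. decays A bt g \<Longrightarrow> norm (cG g e x) \<le> A * L * norm e * jb x powr (- 0)"
    by (rule cv_bounds[OF s(1,2) assms(1) s(3)]) (rule that; assumption)
  show ?thesis
  proof (rule that[OF L(1)])
    fix A and g :: "real ^ 'n \<Rightarrow> complex" and x y :: "real ^ 'n" assume g: "decays A bt g"
    define e where "e = x - y"
    have b: "norm (indicator {0..1} t *\<^sub>R cG g e (y + t *\<^sub>R e)) \<le> indicator {0..1} t * (A * L * norm e)" for t :: real
      using L(3)[OF g, of e "y + t *\<^sub>R e"] by (auto simp: indicator_def)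
    have "norm (cv g (y + e) - cv g y) \<le> (LBINT t. norm (indicator {0..1} t *\<^sub>R cG g e (y + t *\<^sub>R e)))"
      unfolding cv_line(2)[OF g assms, symmetric] by (rule integral_norm_bound)
    also have "\<dots> \<le> (LBINT t. indicator {0..1::real} t * (A * L * norm e))"
      using b cv_line(1)[OF g assms] by (intro integral_mono integrable_norm) auto
    finally show "norm (cv g x - cv g y) \<le> A * L * norm (x - y)" by (simp add: e_def)
  qed
qed

lemma cG_continuous:
  assumes g: "decays A bt g" and bt: "0 \<le> bt" "p + bt > real CARD('n)" and gc: "continuous_on UNIV g"
  shows "continuous_on UNIV (cG g e)"
proof -
  have gm[measurable]: "g \<in> borel_measurable borel" and A: "A \<ge> 0" using g by (auto simp: decays_def)
  \<comment> \<open>After this reflection the singular factor no longer moves with \<open>x\<close>,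
    so continuity of \<open>g\<close> passes to the integral by dominated convergence.\<close>
  have eq: "cG g e x = (LBINT z. d\<Phi> e z * g (x - z))" for x
    unfolding cG_def using integral_lborel_reflect[of "\<lambda>z. d\<Phi> e z * g (x - z)" x] by simp
  have "continuous (at x) (cG g e)" for x
    unfolding continuous_at_sequentially comp_def
  proof (intro allI impI)
    fix X assume X: "X \<longlonglongrightarrow> x"
    obtain R where R: "\<And>n. norm (X n) \<le> R" "R > 0"
      using convergent_imp_Bseq[OF convergentI[OF X]] by (auto simp: Bseq_def)
    show "(\<lambda>n. cG g e (X n)) \<longlonglongrightarrow> cG g e x"
      unfolding eq
    proof (rule integral_dominated_convergence[where w = "\<lambda>z. (CK * norm e * A * (1 + R) powr bt) * (wkern p (0 - z) * jb z powr (- bt))"])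
      show "integrable lborel (\<lambda>z. (CK * norm e * A * (1 + R) powr bt) * (wkern p (0 - z) * jb (z :: real ^ 'n) powr (- bt)))"
        by (intro integrable_mult_right wkern_p_integrable bt)
      show "AE z in lborel. (\<lambda>i. d\<Phi> e z * g (X i - z)) \<longlonglongrightarrow> d\<Phi> e z * g (x - z)"
      proof (intro AE_I2 tendsto_intros)
        fix z
        have "isCont g (x - z)" using gc by (simp add: continuous_on_eq_continuous_at)
        then show "(\<lambda>i. g (X i - z)) \<longlonglongrightarrow> g (x - z)"
          by (rule isCont_tendsto_compose) (intro tendsto_intros X)
      qed
      fix n
      show "AE z in lborel. norm (d\<Phi> e z * g (X n - z)) \<le> (CK * norm e * A * (1 + R) powr bt) * (wkern p (0 - z) * jb z powr (- bt))"
      proof (rule AE_I2)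
        fix z :: "real ^ 'n"
        \<comment> \<open>Along the bounded sequence \<open>X n\<close> the brackets of z and of X n
          - z are comparable, so a single power of <z> dominates all densities g (X n - z).\<close>
        have "jb z \<le> jb (X n - z) + norm (X n)"
          using jb_triangle[of "z - X n" "X n"] jb_minus[of "z - X n"] by simp
        also have "\<dots> \<le> (1 + R) * jb (X n - z)"
        proof -
          have "R * 1 \<le> R * jb (X n - z)" using R(2) by (intro mult_left_mono jb_ge_1) simp
          then show ?thesis using R(1)[of n] unfolding distrib_right by linarith
        qed
        finally have "((1 + R) * jb (X n - z)) powr (- bt) \<le> jb z powr (- bt)"
          using bt by (intro powr_mono2') auto
        then have "(1 + R) powr bt * ((1 + R) * jb (X n - z)) powr (- bt) \<le> (1 + R) powr bt * jb z powr (- bt)"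
          by (intro mult_left_mono) auto
        moreover have "(1 + R) powr bt * ((1 + R) * jb (X n - z)) powr (- bt) = jb (X n - z) powr (- bt)"
          using R(2) by (simp add: powr_mult powr_minus)
        ultimately have j: "jb (X n - z) powr (- bt) \<le> (1 + R) powr bt * jb z powr (- bt)" by simp
        have "norm (g (X n - z)) \<le> A * jb (X n - z) powr (- bt)" using g by (simp add: decays_def)
        also have "\<dots> \<le> A * ((1 + R) powr bt * jb z powr (- bt))" using A j by (intro mult_left_mono)
        finally have "norm (d\<Phi> e z * g (X n - z)) \<le> (CK * wkern p z * norm e) * (A * ((1 + R) powr bt * jb z powr (- bt)))"
          unfolding norm_mult using norm_d\<Phi>[of e z] CK_nonneg by (intro mult_mono) auto
        moreover have "wkern p (0 - z) = wkern p z" by (simp add: wkern_def sing_def indicator_def)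
        ultimately show "norm (d\<Phi> e z * g (X n - z)) \<le> (CK * norm e * A * (1 + R) powr bt) * (wkern p (0 - z) * jb z powr (- bt))"
          by (simp add: mult_ac)
      qed
    qed simp_all
  qed
  then show ?thesis by (simp add: continuous_on_eq_continuous_at)
qed

text \<open>\<open>cv_line\<close> writes the increment as the average of \<open>cG\<close> over a
  segment, and continuity of \<open>cG\<close> keeps this average close to the value at
  \<open>x\<close>. The quantity \<open>D\<close> below measures the deviation of all partial
  derivatives at once.\<close>

lemma cv_has_derivative:
  assumes g: "decays A bt g" and bt: "0 \<le> bt" "p + bt > real CARD('n)" and gc: "continuous_on UNIV g"
  shows "(cv g has_derivative (\<lambda>e. cG g e x)) (at x)"
  unfolding has_derivative_at_alt
proof (intro conjI allI impI cG_bounded_linear[OF g bt])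
  fix eps :: real assume eps: "eps > 0"
  define D where "D z = (\<Sum>b\<in>Basis. norm (cG g b z - cG g b x))" for z
  have "continuous_on UNIV D" unfolding D_def by (intro continuous_intros cG_continuous[OF g bt gc])
  then have "isCont D x" by (simp add: continuous_on_eq_continuous_at)
  moreover have "D x = 0" by (simp add: D_def)
  ultimately obtain d where d: "d > 0" "\<And>z. dist z x < d \<Longrightarrow> \<bar>D z\<bar> < eps"
    using eps unfolding continuous_at_eps_delta by (auto simp: dist_real_def)
  show "\<exists>d>0. \<forall>y. norm (y - x) < d \<longrightarrow> norm (cv g y - cv g x - cG g (y - x) x) \<le> eps * norm (y - x)"
  proof (intro exI[of _ d] conjI allI impI d(1))
    fix y assume y: "norm (y - x) < d"
    define e where "e = y - x"
    let ?y = "\<lambda>t. x + t *\<^sub>R e"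
    have lin: "linear (\<lambda>e. cG g e z)" for z
      using cG_bounded_linear[OF g bt] bounded_linear.linear by blast
    have df: "norm (cG g e z - cG g e x) \<le> norm e * D z" for z
    proof -
      have ex: "cG g e w = (\<Sum>b\<in>Basis. (e \<bullet> b) *\<^sub>R cG g b w)" for w
      proof -
        have "cG g e w = cG g (\<Sum>b\<in>Basis. (e \<bullet> b) *\<^sub>R b) w" by (simp add: euclidean_representation)
        also have "\<dots> = (\<Sum>b\<in>Basis. (e \<bullet> b) *\<^sub>R cG g b w)"
          by (subst linear_sum[OF lin]) (simp add: linear_cmul[OF lin])
        finally show ?thesis .
      qed
      have "cG g e z - cG g e x = (\<Sum>b\<in>Basis. (e \<bullet> b) *\<^sub>R (cG g b z - cG g b x))"
        unfolding ex by (simp add: sum_subtractf scaleR_diff_right)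
      also have "norm \<dots> \<le> (\<Sum>b\<in>Basis. norm e * norm (cG g b z - cG g b x))"
        by (intro sum_norm_le) (auto intro!: mult_right_mono Basis_le_norm)
      also have "\<dots> = norm e * D z" by (simp add: D_def sum_distrib_left)
      finally show ?thesis .
    qed
    have i1: "integrable lborel (\<lambda>t::real. indicator {0..1} t *\<^sub>R cG g e x)" by simp
    have "cv g y - cv g x - cG g (y - x) x = (LBINT t. indicator {0..1} t *\<^sub>R cG g e (?y t)) - (LBINT t. indicator {0..1::real} t *\<^sub>R cG g e x)"
      unfolding cv_line(2)[OF g bt] by (simp add: e_def)
    also have "\<dots> = (LBINT t. indicator {0..1} t *\<^sub>R cG g e (?y t) - indicator {0..1} t *\<^sub>R cG g e x)"
      by (rule lebesgue_diff[symmetric, OF cv_line(1)[OF g bt] i1])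
    also have "norm \<dots> \<le> (LBINT t. norm (indicator {0..1} t *\<^sub>R cG g e (?y t) - indicator {0..1} t *\<^sub>R cG g e x))"
      by (rule integral_norm_bound)
    also have "\<dots> \<le> (LBINT t. indicator {0..1::real} t * (norm e * eps))"
    proof (rule integral_mono)
      show "integrable lborel (\<lambda>t. norm (indicator {0..1} t *\<^sub>R cG g e (?y t) - indicator {0..1} t *\<^sub>R cG g e x))"
        by (intro integrable_norm Bochner_Integration.integrable_diff cv_line(1)[OF g bt] i1)
      fix t :: real
      show "norm (indicator {0..1} t *\<^sub>R cG g e (?y t) - indicator {0..1} t *\<^sub>R cG g e x) \<le> indicator {0..1} t * (norm e * eps)"
      proof (cases "t \<in> {0..1}")
        case True
        have "dist (?y t) x = t * norm e" using True by (simp add: dist_norm)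
        also have "\<dots> \<le> 1 * norm e" using True by (intro mult_right_mono) auto
        also have "\<dots> < d" using y by (simp add: e_def)
        finally have "\<bar>D (?y t)\<bar> < eps" by (rule d(2))
        then have "norm e * D (?y t) \<le> norm e * eps" by (intro mult_left_mono) auto
        with df[of "x + t *\<^sub>R e"] show ?thesis using True by simp
      qed simp
    qed simp
    also have "\<dots> = eps * norm (y - x)" by (simp add: e_def)
    finally show "norm (cv g y - cv g x - cG g (y - x) x) \<le> eps * norm (y - x)" .
  qed
qed

end

section \<open>Continuously differentiable functions with explicit gradients\<close>

definition C1 :: "(real ^ 'n \<Rightarrow> real) \<Rightarrow> (real ^ 'n \<Rightarrow> real ^ 'n) \<Rightarrow> bool"
  where "C1 u D \<longleftrightarrow> (\<forall>x. (u has_derivative (\<lambda>e. D x \<bullet> e)) (at x)) \<and> continuous_on UNIV D"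

definition C1c :: "(real ^ 'n \<Rightarrow> real) \<Rightarrow> (real ^ 'n \<Rightarrow> real ^ 'n) \<Rightarrow> bool"
  where "C1c u D \<longleftrightarrow> C1 u D \<and> (\<exists>R. \<forall>x. norm x \<ge> R \<longrightarrow> u x = 0 \<and> D x = 0)"

lemma C1_continuous: "C1 u D \<Longrightarrow> continuous_on UNIV u"
  by (auto simp: C1_def continuous_on_eq_continuous_at intro: has_derivative_continuous)

lemma C1_D_continuous: "C1 u D \<Longrightarrow> continuous_on UNIV D"
  by (simp add: C1_def)

lemma C1c_C1: "C1c u D \<Longrightarrow> C1 u D" by (simp add: C1c_def)

lemma C1_line:
  assumes "C1 u D"
  shows "((\<lambda>t. u (x + t *\<^sub>R e)) has_vector_derivative D (x + t *\<^sub>R e) \<bullet> e) (at t within A)"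
proof -
  have 1: "((\<lambda>t. x + t *\<^sub>R e) has_derivative (\<lambda>d. d *\<^sub>R e)) (at t within A)"
    by (auto intro!: derivative_eq_intros)
  have 2: "(u has_derivative (\<lambda>d. D (x + t *\<^sub>R e) \<bullet> d)) (at (x + t *\<^sub>R e))"
    using assms by (simp add: C1_def)
  from has_derivative_compose[OF 1 2] show ?thesis by (simp add: has_vector_derivative_def)
qed

lemma C1_translate: "C1 u D \<Longrightarrow> C1 (\<lambda>x. u (x + y)) (\<lambda>x. D (x + y))"
  unfolding C1_def
proof (intro conjI allI)
  assume u: "(\<forall>x. (u has_derivative (\<lambda>e. D x \<bullet> e)) (at x)) \<and> continuous_on UNIV D"
  fix x
  have 1: "((\<lambda>x. x + y) has_derivative (\<lambda>d. d)) (at x)" by (auto intro!: derivative_eq_intros)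
  have 2: "(u has_derivative (\<lambda>e. D (x + y) \<bullet> e)) (at (x + y))" using u by simp
  from has_derivative_compose[OF 1 2] show "((\<lambda>x. u (x + y)) has_derivative (\<lambda>e. D (x + y) \<bullet> e)) (at x)" .
  show "continuous_on UNIV (\<lambda>x. D (x + y))"
    by (rule continuous_on_compose2[of UNIV D]) (use u in \<open>auto intro!: continuous_intros\<close>)
qed

lemma C1c_translate:
  assumes "C1c u D"
  shows "C1c (\<lambda>x. u (x + y)) (\<lambda>x. D (x + y))"
proof -
  obtain R where R: "\<And>x. norm x \<ge> R \<Longrightarrow> u x = 0 \<and> D x = 0" using assms by (auto simp: C1c_def)
  have "norm (x + y) \<ge> R" if "norm x \<ge> R + norm y" for x
    using that norm_triangle_ineq4[of "x + y" y] by simp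
  then show ?thesis using R C1_translate[of u D y] assms unfolding C1c_def by blast
qed

lemma C1_mult:
  assumes "C1 u D" "C1 v E"
  shows "C1 (\<lambda>x. u x * v x) (\<lambda>x. u x *\<^sub>R E x + v x *\<^sub>R D x)"
  unfolding C1_def
proof (intro conjI allI)
  fix x
  have "((\<lambda>x. u x * v x) has_derivative (\<lambda>e. u x * (E x \<bullet> e) + (D x \<bullet> e) * v x)) (at x)"
    using assms by (intro has_derivative_mult) (auto simp: C1_def)
  then show "((\<lambda>x. u x * v x) has_derivative (\<lambda>e. (u x *\<^sub>R E x + v x *\<^sub>R D x) \<bullet> e)) (at x)"
    by (simp add: inner_add_left mult.commute)
  show "continuous_on UNIV (\<lambda>x. u x *\<^sub>R E x + v x *\<^sub>R D x)"
    using assms by (intro continuous_intros C1_continuous C1_D_continuous)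
qed

lemma C1_inner: "C1 (\<lambda>x. x \<bullet> b) (\<lambda>x. b)"
  by (auto simp: C1_def inner_commute intro!: derivative_eq_intros)

lemma C1_compose:
  assumes u: "C1 u D" and g: "\<And>x. (g has_real_derivative g' (u x)) (at (u x))" and c: "continuous_on (range u) g'"
  shows "C1 (\<lambda>x. g (u x)) (\<lambda>x. g' (u x) *\<^sub>R D x)"
  unfolding C1_def
proof (intro conjI allI)
  fix x
  have "(u has_derivative (\<lambda>e. D x \<bullet> e)) (at x)" using u by (simp add: C1_def)
  from has_derivative_compose[OF this g[unfolded has_field_derivative_def]]
  show "((\<lambda>x. g (u x)) has_derivative (\<lambda>e. (g' (u x) *\<^sub>R D x) \<bullet> e)) (at x)" by simp
  show "continuous_on UNIV (\<lambda>x. g' (u x) *\<^sub>R D x)"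
    by (intro continuous_intros continuous_on_compose2[OF c C1_continuous[OF u]] C1_D_continuous[OF u]) auto
qed

lemma C1_inner_self: "C1 (\<lambda>x. x \<bullet> x) (\<lambda>x. 2 *\<^sub>R x)"
  unfolding C1_def
proof (intro conjI allI)
  fix x :: "real ^ 'n"
  have "((\<lambda>x. x \<bullet> x) has_derivative (\<lambda>e. x \<bullet> e + e \<bullet> x)) (at x)"
    by (rule has_derivative_inner) auto
  then show "((\<lambda>x. x \<bullet> x) has_derivative (\<lambda>e. (2 *\<^sub>R x) \<bullet> e)) (at x)"
    by (simp add: inner_commute)
qed (intro continuous_intros)

lemma C1_sqrt:
  assumes "c > 0"
  shows "C1 (\<lambda>x. sqrt (c + x \<bullet> x)) (\<lambda>x. (1 / sqrt (c + x \<bullet> x)) *\<^sub>R x)"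
proof -
  have "C1 (\<lambda>x :: real ^ 'a. sqrt (c + x \<bullet> x)) (\<lambda>x. (1 / (2 * sqrt (c + x \<bullet> x))) *\<^sub>R (2 *\<^sub>R x))"
  proof (rule C1_compose[OF C1_inner_self, where g = "\<lambda>t. sqrt (c + t)" and g' = "\<lambda>t. 1 / (2 * sqrt (c + t))"])
    fix x :: "real ^ 'a"
    have "c + x \<bullet> x > 0" using assms by (simp add: add_pos_nonneg)
    from DERIV_chain2[OF DERIV_real_sqrt[OF this] DERIV_add[OF DERIV_const DERIV_ident]]
    have "((\<lambda>t. sqrt (c + t)) has_real_derivative inverse (sqrt (c + x \<bullet> x)) / 2 * (0 + 1)) (at (x \<bullet> x))" .
    moreover have "inverse s / 2 * (0 + 1) = 1 / (2 * s)" for s :: real unfolding inverse_eq_divide by simp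
    ultimately show "((\<lambda>t. sqrt (c + t)) has_real_derivative 1 / (2 * sqrt (c + x \<bullet> x))) (at (x \<bullet> x))" by (simp only:)
    show "continuous_on (range (\<lambda>x :: real ^ 'a. x \<bullet> x)) (\<lambda>t. 1 / (2 * sqrt (c + t)))"
      by (intro continuous_intros) (auto, metis assms add_pos_nonneg inner_ge_zero less_irrefl)
  qed
  then show ?thesis by simp
qed

lemma integrable_continuous_compact_support:
  fixes f :: "'a::euclidean_space \<Rightarrow> 'b::{banach, second_countable_topology}"
  assumes "continuous_on UNIV f" "\<And>x. norm x \<ge> R \<Longrightarrow> f x = 0"
  shows "integrable lborel f"
proof -
  have "integrable lborel (\<lambda>x. indicator (cball 0 R) x *\<^sub>R f x)"
    by (rule borel_integrable_compact) (auto intro: continuous_on_subset[OF assms(1)])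
  also have "(\<lambda>x. indicator (cball 0 R) x *\<^sub>R f x) = f"
    using assms(2) by (auto simp: indicator_def fun_eq_iff)
  finally show ?thesis .
qed

lemma bounded_continuous_compact_support:
  fixes f :: "'a::euclidean_space \<Rightarrow> 'b::real_normed_vector"
  assumes "continuous_on UNIV f" "\<And>x. norm x \<ge> R \<Longrightarrow> f x = 0"
  obtains M where "M \<ge> 0" "\<And>x. norm (f x) \<le> M"
proof -
  have "compact (f ` cball 0 R)"
    by (intro compact_continuous_image continuous_on_subset[OF assms(1)]) auto
  then obtain B where B: "\<And>x. x \<in> cball 0 R \<Longrightarrow> norm (f x) \<le> B"
    by (meson bounded_iff compact_imp_bounded imageI)
  have "norm (f x) \<le> max B 0" for x
    using assms(2)[of x] B[of x] by (cases "norm x \<ge> R") (auto simp: le_max_iff_disj)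
  then show ?thesis using that[of "max B 0"] by auto
qed

section \<open>The kernel as a fundamental solution in weak form\<close>

context radial_kernel
begin

lemma d\<Phi>_sum: "d\<Phi> e z = (\<Sum>b\<in>Basis. of_real (e \<bullet> b) * d\<Phi> b z)"
proof -
  have "z \<bullet> e = (\<Sum>b\<in>Basis. (e \<bullet> b) * (z \<bullet> b))"
    by (subst euclidean_inner) (simp add: mult.commute)
  then have "of_real ((z \<bullet> e) / norm z) = (\<Sum>b\<in>Basis. of_real (e \<bullet> b) * complex_of_real ((z \<bullet> b) / norm z))"
    by (simp add: sum_divide_distrib)
  then show ?thesis unfolding d\<Phi>_def by (simp add: sum_distrib_right mult.assoc)
qed

lemma h'_deriv:
  assumes "r > 0"
  shows "(h' has_vector_derivative - of_real (k^2) * h r - of_real ((real CARD('n) - 1) / r) * h' r) (at r)"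
proof -
  define m where "m = CARD('n) - 1"
  have m1: "real m = real CARD('n) - 1" "m \<ge> 1" using N3 by (auto simp: m_def)
  have 1: "((\<lambda>r. complex_of_real (inverse (r ^ m))) has_vector_derivative of_real (- real m * inverse (r ^ m) / r)) (at r)"
  proof (rule has_vector_derivative_of_real)
    have "((\<lambda>r. inverse (r ^ m)) has_real_derivative - (inverse (r ^ m) * (real m * r ^ (m - 1)) * inverse (r ^ m))) (at r)"
      using assms by (auto intro!: derivative_eq_intros)
    moreover have "- (inverse (r ^ m) * (real m * r ^ (m - 1)) * inverse (r ^ m)) = - real m * inverse (r ^ m) / r"
    proof -
      have "r ^ (m - 1) = r ^ m / r" using m1 assms by (simp add: power_diff)
      then show ?thesis using assms by (simp add: field_simps)
    qed
    ultimately show "((\<lambda>r. inverse (r ^ m)) has_real_derivative - real m * inverse (r ^ m) / r) (at r)"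
      by (simp only:)
  qed
  have 2: "((\<lambda>r. of_real (inverse (r ^ m)) * (of_real (r ^ m) * h' r)) has_vector_derivative
     of_real (inverse (r ^ m)) * (- of_real (k^2 * r ^ m) * h r) + of_real (- real m * inverse (r ^ m) / r) * (of_real (r ^ m) * h' r)) (at r)"
    using has_vector_derivative_mult[OF 1 ode[OF assms, folded m_def]] .
  have c: "of_real (inverse (r ^ m)) * (of_real (r ^ m) * w) = w" if "r > 0" for r and w :: complex
    using that by simp
  have e: "of_real (inverse (r ^ m)) * (- of_real (k^2 * r ^ m) * h r) + of_real (- real m * inverse (r ^ m) / r) * (of_real (r ^ m) * h' r)
      = - of_real (k^2) * h r - of_real ((real CARD('n) - 1) / r) * h' r"
    using assms unfolding m1(1)[symmetric] by (simp add: field_simps)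
  show ?thesis
    by (rule has_vector_derivative_transform_within_open[OF 2[unfolded e], of "{0<..}"]) (use assms c in auto)
qed

lemma kernel_test_bound:
  "norm (d\<Phi> (D x) z - of_real (k^2 * \<psi> x) * \<Phi> z) \<le> CK * (norm (D x) + k^2 * \<bar>\<psi> x\<bar>) * wkern p z"
proof -
  have "norm (d\<Phi> (D x) z - of_real (k^2 * \<psi> x) * \<Phi> z) \<le> norm (d\<Phi> (D x) z) + k^2 * \<bar>\<psi> x\<bar> * norm (\<Phi> z)"
    by (rule order.trans[OF norm_triangle_ineq4]) (simp add: norm_mult norm_power abs_mult)
  also have "\<dots> \<le> CK * wkern p z * norm (D x) + k^2 * \<bar>\<psi> x\<bar> * (CK * wkern p z)"
    by (intro add_mono mult_left_mono norm_d\<Phi> norm_\<Phi>) auto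
  also have "\<dots> = CK * (norm (D x) + k^2 * \<bar>\<psi> x\<bar>) * wkern p z" by (simp add: algebra_simps)
  finally show ?thesis .
qed

text \<open>A smooth substitute for |x| that never falls below \<open>eps\<close>, so that the
  profile can be evaluated away from its singularity.\<close>

definition reg :: "real \<Rightarrow> real ^ 'n \<Rightarrow> real"
  where "reg eps x = sqrt (eps^2 + x \<bullet> x)"

lemma reg: assumes "eps > 0" shows "reg eps x > 0" "norm x \<le> reg eps x" "(reg eps x)^2 = eps^2 + x \<bullet> x"
  using assms by (auto simp: reg_def norm_eq_sqrt_inner add_pos_nonneg)

lemma reg_continuous: "eps > 0 \<Longrightarrow> continuous_on UNIV (reg eps)"
  unfolding reg_def[abs_def] by (intro continuous_intros)

lemma h_reg_continuous:
  assumes "eps > 0"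
  shows "continuous_on UNIV (\<lambda>x. h (reg eps x))" "continuous_on UNIV (\<lambda>x. h' (reg eps x))"
  by (rule continuous_on_compose2[OF h_continuous reg_continuous[OF assms]] continuous_on_compose2[OF h'_continuous reg_continuous[OF assms]];
      use reg(1)[OF assms] in auto)+

text \<open>The divergence of the smooth field \<open>x \<psi>(x) h'(s)/s\<close> with \<open>s = (eps\<^sup>2 + |x|\<^sup>2)\<^sup>1\<^sup>/\<^sup>2\<close>.\<close>

lemma regularized_identity:
  assumes \<psi>: "C1c \<psi> D" and eps: "eps > 0"
  shows "(LBINT x. of_real ((x \<bullet> D x) / reg eps x) * h' (reg eps x) - of_real (k^2 * ((x \<bullet> x) / (reg eps x)^2 * \<psi> x)) * h (reg eps x)
      + of_real (real CARD('n) * eps^2 * \<psi> x / (reg eps x)^3) * h' (reg eps x)) = 0"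
proof -
  define M where "M r = of_real (inverse r) * h' r" for r
  define h2 where "h2 r = - of_real (k^2) * h r - of_real ((real CARD('n) - 1) / r) * h' r" for r
  define m where "m r = of_real (inverse r) * h2 r + of_real (- (inverse r * inverse r)) * h' r" for r
  obtain R where R: "\<And>x. norm x \<ge> R \<Longrightarrow> \<psi> x = 0 \<and> D x = 0" using \<psi> by (auto simp: C1c_def)
  note \<psi>1 = C1c_C1[OF \<psi>]
  note c = C1_continuous[OF \<psi>1] C1_D_continuous[OF \<psi>1] h_reg_continuous[OF eps] reg_continuous[OF eps]
  have s0: "reg eps x \<noteq> 0" for x :: "real ^ 'n" using reg(1)[OF eps, of x] by simp
  have Md: "(M has_vector_derivative m r) (at r)" if "r > 0" for r
  proof -
    have "((\<lambda>r. of_real (inverse r)) has_vector_derivative complex_of_real (- (inverse r * inverse r))) (at r)"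
      using that by (intro has_vector_derivative_of_real) (auto intro!: derivative_eq_intros)
    from has_vector_derivative_mult[OF this h'_deriv[OF that]] show ?thesis unfolding M_def m_def h2_def .
  qed
  \<comment> \<open>\<open>F j\<close> is the component of the field in direction \<open>j\<close>,
    \<open>DF j\<close> its derivative in that direction; the sum over the basis is the
    divergence.\<close>
  define F where "F j x = M (reg eps x) * of_real ((x \<bullet> j) * \<psi> x)" for j x
  define E where "E j x = (x \<bullet> j) *\<^sub>R D x + \<psi> x *\<^sub>R j" for j x
  define DF where "DF j x = M (reg eps x) * of_real (E j x \<bullet> j) + (((1 / reg eps x) *\<^sub>R x) \<bullet> j) *\<^sub>R m (reg eps x) * of_real ((x \<bullet> j) * \<psi> x)" for j x
  have line: "((\<lambda>t. F j (x + t *\<^sub>R j)) has_vector_derivative DF j (x + t *\<^sub>R j)) (at t)" for j x t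
  proof -
    let ?y = "x + t *\<^sub>R j"
    have "((\<lambda>t. reg eps (x + t *\<^sub>R j)) has_vector_derivative ((1 / reg eps ?y) *\<^sub>R ?y) \<bullet> j) (at t)"
      unfolding reg_def using eps by (intro C1_line[OF C1_sqrt]) simp
    from vector_diff_chain_at[OF this Md[OF reg(1)[OF eps]]]
    have 1: "((\<lambda>t. M (reg eps (x + t *\<^sub>R j))) has_vector_derivative (((1 / reg eps ?y) *\<^sub>R ?y) \<bullet> j) *\<^sub>R m (reg eps ?y)) (at t)"
      by (simp add: o_def)
    have "((\<lambda>t. ((x + t *\<^sub>R j) \<bullet> j) * \<psi> (x + t *\<^sub>R j)) has_real_derivative E j ?y \<bullet> j) (at t)"
      unfolding has_real_derivative_iff_has_vector_derivative E_def by (rule C1_line[OF C1_mult[OF C1_inner \<psi>1]])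
    from has_vector_derivative_mult[OF 1 has_vector_derivative_of_real[OF this]] show ?thesis
      unfolding F_def DF_def .
  qed
  have cont: "continuous_on UNIV (F j)" "continuous_on UNIV (DF j)" for j
    unfolding F_def DF_def E_def M_def m_def h2_def by (intro continuous_intros c; use s0 in simp)+
  have int: "integrable lborel (F j)" "integrable lborel (DF j)" for j
    by (rule integrable_continuous_compact_support[OF cont(1), of R], simp add: F_def R,
        rule integrable_continuous_compact_support[OF cont(2), of R], simp add: DF_def E_def R)
  have z: "(LBINT x. DF j x) = 0" for j
  proof (rule integral_directional_derivative_eq_0[OF int])
    fix x
    have "((\<lambda>t. DF j (x + t *\<^sub>R j)) has_integral (F j (x + 1 *\<^sub>R j) - F j (x + 0 *\<^sub>R j))) {0..1}"
      by (rule fundamental_theorem_of_calculus) (auto intro: has_vector_derivative_at_within line)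
    then show "((\<lambda>t. DF j (x + t *\<^sub>R j)) has_integral (F j (x + j) - F j x)) {0..1}" by simp
  qed
  \<comment> \<open>As x \<bullet> x = s^2 - eps^2 rather than s^2, the radial equation does not
    cancel the terms with h' completely; it leaves the one with eps^2, which concentrates at the
    origin as eps -> 0.\<close>
  have "(\<Sum>j\<in>Basis. DF j x) = of_real ((x \<bullet> D x) / reg eps x) * h' (reg eps x) - of_real (k^2 * ((x \<bullet> x) / (reg eps x)^2 * \<psi> x)) * h (reg eps x)
      + of_real (real CARD('n) * eps^2 * \<psi> x / (reg eps x)^3) * h' (reg eps x)" (is "_ = ?rhs") for x
  proof -
    define s where "s = reg eps x"
    have s: "s \<noteq> 0" "x \<bullet> x = s^2 - eps^2" using s0 reg(3)[OF eps, of x] by (simp_all add: s_def)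
    have e: "(\<Sum>j\<in>Basis. (x \<bullet> j) * (y \<bullet> j)) = x \<bullet> y" for y by (rule euclidean_inner[symmetric])
    have "E j x \<bullet> j = (x \<bullet> j) * (D x \<bullet> j) + \<psi> x" if "j \<in> Basis" for j
      using that by (simp add: E_def inner_add_left inner_same_Basis)
    then have E1: "(\<Sum>j\<in>Basis. E j x \<bullet> j) = x \<bullet> D x + real CARD('n) * \<psi> x"
      by (simp add: sum.distrib e)
    have "DF j x = M s * of_real (E j x \<bullet> j) + m s * of_real ((x \<bullet> j) * (x \<bullet> j) * (\<psi> x / s))" for j
      unfolding DF_def inner_scaleR_left unfolding scaleR_conv_of_real by (simp add: s_def)
    then have "(\<Sum>j\<in>Basis. DF j x) = M s * of_real (x \<bullet> D x + real CARD('n) * \<psi> x) + m s * of_real ((x \<bullet> x) * (\<psi> x / s))"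
      by (simp only: sum.distrib sum_distrib_left[symmetric] sum_distrib_right[symmetric] of_real_sum[symmetric] E1 e)
    also have "\<dots> = ?rhs"
      unfolding M_def m_def h2_def s_def[symmetric] s(2) using s(1) by (simp add: field_simps power2_eq_square power3_eq_cube)
    finally show ?thesis .
  qed
  then show ?thesis using Bochner_Integration.integral_sum[of Basis lborel DF] int z by simp
qed

lemma integral_lborel_scale:
  fixes f :: "real ^ 'n \<Rightarrow> complex"
  assumes c: "c > 0" and [measurable]: "f \<in> borel_measurable borel"
  shows "(LBINT x. f x) = (LBINT x. of_real (c ^ CARD('n)) * f (c *\<^sub>R x))"
proof -
  have "(LBINT x. f x) = integral\<^sup>L (density (distr lborel borel (\<lambda>x :: real ^ 'n. 0 + c *\<^sub>R x)) (\<lambda>_. \<bar>c\<bar> ^ DIM(real ^ 'n))) f"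
    using lborel_affine[of c "0 :: real ^ 'n"] c by simp
  also have "\<dots> = (LBINT x. (c ^ CARD('n)) *\<^sub>R f (c *\<^sub>R x))"
    using c by (subst integral_density) (auto simp: integral_distr)
  finally show ?thesis by (simp only: scaleR_conv_of_real[of _ "f _"])
qed

text \<open>The normalization of the kernel is immaterial; it only matters that \<open>cE\<close> is real.\<close>

definition cE where "cE = - c0 * real CARD('n) * (LBINT y. jb (y :: real ^ 'n) powr (- (real CARD('n) + 2)))"

text \<open>As eps -> 0 in \<open>regularized_identity\<close>, the regular terms converge by
  domination to the left side, while the term with eps^2 tends to a multiple of \<psi> 0. The kernel
  is thus a real multiple of a fundamental solution of the Helmholtz equation.\<close>

lemma kernel_identity_0:
  assumes \<psi>: "C1c \<psi> D"
  shows "(LBINT x. d\<Phi> (D x) x - of_real (k^2 * \<psi> x) * \<Phi> x) = of_real (cE * \<psi> 0)"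
proof -
  define N where "N = real CARD('n)"
  obtain R where R: "\<And>x. norm x \<ge> R \<Longrightarrow> \<psi> x = 0 \<and> D x = 0" and R0: "R \<ge> 0"
    using \<psi> unfolding C1c_def by (metis max.bounded_iff max.cobounded2)
  let ?q = "1 + (R + 1) powr p"
  note \<psi>1 = C1c_C1[OF \<psi>]
  note cc = C1_continuous[OF \<psi>1] C1_D_continuous[OF \<psi>1]
  have [measurable]: "\<psi> \<in> borel_measurable borel" "D \<in> borel_measurable borel"
    using cc by (auto intro: borel_measurable_continuous_onI)
  define c where "c x = norm (D x) + k^2 * \<bar>\<psi> x\<bar> + \<bar>\<psi> x\<bar>" for x
  obtain M where M: "M \<ge> 0" "\<And>x. norm (c x) \<le> M"
    by (rule bounded_continuous_compact_support[of c R]) (use R in \<open>auto simp: c_def[abs_def] intro!: continuous_intros cc\<close>)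
  define e where "e n = 1 / real (Suc n)" for n
  have e: "0 < e n" "e n \<le> 1" for n by (auto simp: e_def)
  have e0: "e \<longlonglongrightarrow> 0" unfolding e_def using LIMSEQ_Suc[OF lim_1_over_n[where 'a=real]] .
  note hc = h_reg_continuous[OF e(1)] reg_continuous[OF e(1)]
  have s0: "reg (e n) x \<noteq> 0" for n and x :: "real ^ 'n" using reg(1)[OF e(1), of n x] by simp
  define K where "K x = d\<Phi> (D x) x - of_real (k^2 * \<psi> x) * \<Phi> x" for x
  define P where "P n x = of_real ((x \<bullet> D x) / reg (e n) x) * h' (reg (e n) x) - of_real (k^2 * ((x \<bullet> x) / (reg (e n) x)^2 * \<psi> x)) * h (reg (e n) x)" for n x
  define Z where "Z n x = of_real (N * (e n)^2 * \<psi> x / (reg (e n) x)^3) * h' (reg (e n) x)" for n x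
  have PZc: "continuous_on UNIV (P n)" "continuous_on UNIV (Z n)" for n
    unfolding P_def Z_def by (intro continuous_intros cc hc; use s0 in simp)+
  have PZ: "(LBINT x. P n x) = - (LBINT x. Z n x)" for n
  proof -
    have "integrable lborel (P n)" "integrable lborel (Z n)"
      by (rule integrable_continuous_compact_support[OF PZc(1), of R], simp add: P_def R,
          rule integrable_continuous_compact_support[OF PZc(2), of R], simp add: Z_def R)
    then show ?thesis using regularized_identity[OF \<psi> e(1)[of n]]
      by (simp add: P_def[abs_def] Z_def[abs_def] N_def eq_neg_iff_add_eq_0)
  qed
  have lim1: "(\<lambda>n. LBINT x. P n x) \<longlonglongrightarrow> (LBINT x. K x)"
  proof (rule integral_dominated_convergence[where w = "\<lambda>x. CK * M * (sing x + indicator (cball 0 R) x)"])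
    show "integrable lborel (\<lambda>x :: real ^ 'n. CK * M * (sing x + indicator (cball 0 R) x))"
      by (intro integrable_mult_right Bochner_Integration.integrable_add sing_integrable integrable_real_indicator emeasure_bounded_finite) auto
    show "AE x in lborel. (\<lambda>n. P n x) \<longlonglongrightarrow> K x"
    proof (rule AE_I2)
      fix x
      show "(\<lambda>n. P n x) \<longlonglongrightarrow> K x"
      proof (cases "x = 0")
        case False
        have "(\<lambda>n. reg (e n) x) \<longlonglongrightarrow> sqrt (0^2 + x \<bullet> x)" unfolding reg_def by (intro tendsto_intros e0)
        then have r: "(\<lambda>n. reg (e n) x) \<longlonglongrightarrow> norm x" by (simp add: norm_eq_sqrt_inner)
        have hl: "(\<lambda>n. h (reg (e n) x)) \<longlonglongrightarrow> h (norm x)" "(\<lambda>n. h' (reg (e n) x)) \<longlonglongrightarrow> h' (norm x)"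
          by (rule isCont_tendsto_compose[OF _ r]; use h_continuous h'_continuous False in \<open>simp add: continuous_on_eq_continuous_at\<close>)+
        have "(\<lambda>n. P n x) \<longlonglongrightarrow> of_real ((x \<bullet> D x) / norm x) * h' (norm x) - of_real (k^2 * ((x \<bullet> x) / (norm x)^2 * \<psi> x)) * h (norm x)"
          unfolding P_def by (intro tendsto_intros r hl) (use False in auto)
        then show ?thesis using False by (simp add: K_def d\<Phi>_def \<Phi>_def power2_norm_eq_inner)
      qed (simp add: P_def K_def d\<Phi>_def \<Phi>_def)
    qed
    fix n show "AE x in lborel. norm (P n x) \<le> CK * M * (sing x + indicator (cball 0 R) x)"
    proof (rule AE_I2)
      fix x
      show "norm (P n x) \<le> CK * M * (sing x + indicator (cball 0 R) x)"
      proof (cases "x = 0 \<or> norm x > R")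
        case True
        then show ?thesis using R[of x] M(1) CK_nonneg by (auto simp: P_def)
      next
        case False
        let ?s = "reg (e n) x"
        have s: "?s > 0" "norm x \<le> ?s" by (rule reg[OF e(1)])+
        have "\<bar>x \<bullet> D x\<bar> \<le> norm (D x) * ?s"
          using s mult_left_mono[OF s(2) norm_ge_zero[of "D x"]] by (intro order_trans[OF Cauchy_Schwarz_ineq2]) (simp add: mult.commute)
        then have 1: "\<bar>(x \<bullet> D x) / ?s\<bar> \<le> norm (D x)" using s by (simp add: divide_le_eq)
        have "(x \<bullet> x) / ?s^2 \<le> 1" using s power_mono[OF s(2), of 2] by (simp add: power2_norm_eq_inner)
        then have 2: "\<bar>k^2 * ((x \<bullet> x) / ?s^2 * \<psi> x)\<bar> \<le> k^2 * \<bar>\<psi> x\<bar>"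
          unfolding abs_mult by (intro mult_mono mult_left_le_one_le) auto
        have "norm (P n x) \<le> \<bar>(x \<bullet> D x) / ?s\<bar> * norm (h' ?s) + \<bar>k^2 * ((x \<bullet> x) / ?s^2 * \<psi> x)\<bar> * norm (h ?s)"
          unfolding P_def by (rule order_trans[OF norm_triangle_ineq4]) (simp only: norm_mult norm_of_real order_refl)
        also have "\<dots> \<le> norm (D x) * (CK * wkern p x) + k^2 * \<bar>\<psi> x\<bar> * (CK * wkern p x)"
          using False h_wkern[of x ?s] s 1 2 by (intro add_mono mult_mono) auto
        also have "\<dots> \<le> CK * c x * wkern p x" using CK_nonneg by (simp add: c_def algebra_simps)
        also have "\<dots> \<le> CK * M * (sing x + indicator (cball 0 R) x)"
          using M(2)[of x] M(1) CK_nonneg False p_ge_1 jb_ge_1[of x] powr_mono[of "- p" 0 "jb x"]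
          by (intro mult_mono mult_left_mono) (auto simp: wkern_def)
        finally show ?thesis .
      qed
    qed
  qed (use PZc in \<open>auto intro: borel_measurable_continuous_onI simp: K_def[abs_def] d\<Phi>_sum[of "D _"]\<close>)
  \<comment> \<open>By the hypothesis \<open>h'_lim\<close> this tends to \<open>c0\<close> at the
    origin. The substitution x = e n y spreads the concentrating term \<open>Z n\<close> over the
    whole space, with the integrable weight <y>^(-(N+2)).\<close>
  define th where "th r = of_real (r ^ (CARD('n) - 1)) * h' r" for r
  define W where "W n y = of_real (N * \<psi> (e n *\<^sub>R y) * jb y powr (- (N + 2))) * th (e n * jb y)" for n y
  have ZW: "(LBINT x. Z n x) = (LBINT y. W n y)" for n
  proof -
    have "of_real (e n ^ CARD('n)) * Z n (e n *\<^sub>R y) = W n y" for y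
    proof -
      have r: "reg (e n) (e n *\<^sub>R y) = e n * jb y"
      proof -
        have "(e n)^2 + (e n *\<^sub>R y) \<bullet> (e n *\<^sub>R y) = (e n)^2 * (1 + (norm y)^2)"
          by (simp add: dot_square_norm power2_eq_square algebra_simps)
        then show ?thesis using e(1)[of n] by (simp add: reg_def jbracket_def real_sqrt_mult)
      qed
      obtain m where m: "CARD('n) = Suc m" using N3 by (cases "CARD('n)") auto
      have "jb y powr (- (N + 2)) = 1 / jb y ^ (m + 3)"
        using powr_realpow[of "jb y" "m + 3"] unfolding powr_minus_divide N_def m by (simp add: add_ac)
      then have "e n ^ CARD('n) * (N * (e n)^2 * \<psi> (e n *\<^sub>R y) / (e n * jb y)^3) = N * \<psi> (e n *\<^sub>R y) * jb y powr (- (N + 2)) * (e n * jb y) ^ m"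
        using e(1)[of n] by (simp add: m power_mult_distrib power_add power2_eq_square power3_eq_cube field_simps)
      then show ?thesis unfolding Z_def W_def th_def r mult.assoc[symmetric] of_real_mult[symmetric] by (simp add: m)
    qed
    then show ?thesis using integral_lborel_scale[OF e(1), of "Z n" n] PZc(2) by (simp add: borel_measurable_continuous_onI)
  qed
  have thb: "norm (th r) \<le> C0 * ?q" if r: "0 < r" "r \<le> R + 1" for r
  proof -
    have rp: "r ^ (CARD('n) - 1) = r powr (2 * p)"
    proof -
      have "real (CARD('n) - 1) = 2 * p" using N3 p_eq by (simp add: of_nat_diff)
      then show ?thesis using powr_realpow[OF r(1), of "CARD('n) - 1"] by simp
    qed
    have "norm (th r) \<le> r powr (2 * p) * (C0 * (r powr - (2 * p) + r powr - p))"
      using h'_bound[OF r(1)] r unfolding p_eq th_def norm_mult norm_of_real rp by (intro mult_mono) auto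
    also have "\<dots> = C0 * (r powr (2 * p) * r powr - (2 * p) + r powr (2 * p) * r powr - p)" by (simp only: distrib_left mult.left_commute)
    also have "\<dots> = C0 * (1 + r powr p)" using r by (simp add: powr_add[symmetric])
    also have "\<dots> \<le> C0 * ?q" using r C0 p_ge_1 by (intro mult_left_mono add_mono powr_mono2) auto
    finally show ?thesis .
  qed
  have jm: "(\<lambda>y. jb (y :: real ^ 'n) powr s) \<in> borel_measurable borel" for s by measurable
  have lim2: "(\<lambda>n. LBINT y. W n y) \<longlonglongrightarrow> (LBINT y. of_real (N * \<psi> 0 * jb (y :: real ^ 'n) powr (- (N + 2))) * of_real c0)"
  proof (rule integral_dominated_convergence[where w = "\<lambda>y. N * M * (C0 * ?q) * jb y powr (- (N + 2))"])
    show "integrable lborel (\<lambda>y :: real ^ 'n. N * M * (C0 * ?q) * jb y powr (- (N + 2)))"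
      by (intro integrable_mult_right integrable_jb_powr) (simp add: N_def)
    show "W n \<in> borel_measurable lborel" for n
    proof -
      have "continuous_on {0<..} th" unfolding th_def by (intro continuous_intros h'_continuous)
      then have "continuous_on UNIV (\<lambda>y :: real ^ 'n. th (e n * jb y))"
        by (rule continuous_on_compose2) (use e(1) in \<open>auto intro!: continuous_intros\<close>)
      then have "continuous_on UNIV (W n)" unfolding W_def
        by (intro continuous_intros continuous_on_compose2[OF cc(1)]) auto
      then show ?thesis by (simp add: borel_measurable_continuous_onI)
    qed
    show "AE y in lborel. (\<lambda>n. W n y) \<longlonglongrightarrow> of_real (N * \<psi> 0 * jb y powr (- (N + 2))) * of_real c0"
    proof (rule AE_I2)
      fix y :: "real ^ 'n"
      have "(\<lambda>n. e n * jb y) \<longlonglongrightarrow> 0 * jb y" by (intro tendsto_intros e0)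
      then have "filterlim (\<lambda>n. e n * jb y) (at_right 0) sequentially"
        unfolding filterlim_at using mult_pos_pos[OF e(1) jb_pos] by (auto intro!: always_eventually) (metis less_irrefl e(1))
      from filterlim_compose[OF h'_lim this] have 1: "(\<lambda>n. th (e n * jb y)) \<longlonglongrightarrow> of_real c0" by (simp add: th_def)
      have "(\<lambda>n. e n *\<^sub>R y) \<longlonglongrightarrow> 0 *\<^sub>R y" by (intro tendsto_intros e0)
      then have "(\<lambda>n. \<psi> (e n *\<^sub>R y)) \<longlonglongrightarrow> \<psi> 0"
        using cc(1) by (intro isCont_tendsto_compose[of _ \<psi>]) (auto simp: continuous_on_eq_continuous_at)
      then show "(\<lambda>n. W n y) \<longlonglongrightarrow> of_real (N * \<psi> 0 * jb y powr (- (N + 2))) * of_real c0"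
        unfolding W_def by (intro tendsto_intros 1)
    qed
    fix n show "AE y in lborel. norm (W n y) \<le> N * M * (C0 * ?q) * jb y powr (- (N + 2))"
    proof (rule AE_I2)
      fix y :: "real ^ 'n"
      show "norm (W n y) \<le> N * M * (C0 * ?q) * jb y powr (- (N + 2))"
      proof (cases "norm (e n *\<^sub>R y) \<ge> R")
        case True
        then show ?thesis using R M(1) C0 by (simp add: W_def N_def)
      next
        case False
        have "e n * jb y \<le> e n * (1 + norm y)" using e(1)[of n] jb_le_1_norm by (intro mult_left_mono) auto
        also have "\<dots> \<le> R + 1" using False e[of n] by (simp add: distrib_left)
        finally have "norm (th (e n * jb y)) \<le> C0 * ?q" using e(1)[of n] by (intro thb) auto
        moreover have "\<bar>\<psi> (e n *\<^sub>R y)\<bar> \<le> M" using M(2)[of "e n *\<^sub>R y"] norm_ge_zero[of "D (e n *\<^sub>R y)"]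
          mult_nonneg_nonneg[OF zero_le_power2[of k] abs_ge_zero[of "\<psi> (e n *\<^sub>R y)"]] unfolding c_def real_norm_def by linarith
        ultimately have "N * \<bar>\<psi> (e n *\<^sub>R y)\<bar> * jb y powr (- (N + 2)) * norm (th (e n * jb y)) \<le> N * M * jb y powr (- (N + 2)) * (C0 * ?q)"
          using M(1) by (intro mult_mono mult_left_mono) (auto simp: N_def)
        then show ?thesis by (simp add: W_def norm_mult abs_mult N_def mult_ac)
      qed
    qed
  qed (use jm in measurable)
  have "(LBINT y. of_real (N * \<psi> 0 * jb (y :: real ^ 'n) powr (- (N + 2))) * of_real c0) = - complex_of_real (cE * \<psi> 0)"
    unfolding of_real_mult[symmetric] integral_complex_of_real by (simp add: cE_def N_def)
  with tendsto_minus[OF lim2] have "(\<lambda>n. LBINT x. P n x) \<longlonglongrightarrow> of_real (cE * \<psi> 0)" by (simp add: PZ ZW)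
  from LIMSEQ_unique[OF lim1 this] show ?thesis by (simp add: K_def)
qed

lemma kernel_identity:
  assumes \<psi>: "C1c \<psi> D"
  shows "(LBINT x. d\<Phi> (D x) (x - y) - of_real (k^2 * \<psi> x) * \<Phi> (x - y)) = of_real (cE * \<psi> y)"
proof -
  have [measurable]: "\<psi> \<in> borel_measurable borel" "D \<in> borel_measurable borel"
    using C1_continuous[OF C1c_C1[OF \<psi>]] C1_D_continuous[OF C1c_C1[OF \<psi>]] by (auto intro: borel_measurable_continuous_onI)
  have "(LBINT x. d\<Phi> (D x) (x - y) - of_real (k^2 * \<psi> x) * \<Phi> (x - y))
     = (LBINT x. d\<Phi> (D (x + y)) (x + y - y) - of_real (k^2 * \<psi> (x + y)) * \<Phi> (x + y - y))"
    by (rule integral_lborel_translate[symmetric]) (unfold d\<Phi>_sum[of "D _"], measurable)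
  also have "\<dots> = of_real (cE * \<psi> y)"
    using kernel_identity_0[OF C1c_translate[OF \<psi>, of y]] by simp
  finally show ?thesis .
qed

text \<open>Integrating \<open>kernel_identity\<close> against \<open>g\<close> and exchanging the
  integrals: u = \<open>cv g\<close> is a weak solution of - Laplace u - k^2 u = \<open>cE\<close>
  g.\<close>

theorem weak_form:
  assumes g: "decays A bt g" and bt: "0 \<le> bt" "p + bt > real CARD('n)" and \<psi>: "C1c \<psi> D"
  shows "(LBINT x. cG g (D x) x - of_real (k^2 * \<psi> x) * cv g x) = of_real cE * (LBINT y. of_real (\<psi> y) * g y)"
    and "integrable lborel (\<lambda>x. cG g (D x) x - of_real (k^2 * \<psi> x) * cv g x)"
proof -
  have gm[measurable]: "g \<in> borel_measurable borel" and A: "A \<ge> 0" using g by (auto simp: decays_def)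
  obtain R where R: "\<And>x. norm x \<ge> R \<Longrightarrow> \<psi> x = 0 \<and> D x = 0" using \<psi> by (auto simp: C1c_def)
  have \<psi>c: "continuous_on UNIV \<psi>" and Dc: "continuous_on UNIV D"
    using \<psi> by (auto simp: C1c_def C1_continuous C1_D_continuous)
  have [measurable]: "\<psi> \<in> borel_measurable borel" "D \<in> borel_measurable borel"
    using \<psi>c Dc by (auto intro: borel_measurable_continuous_onI)
  define c where "c x = norm (D x) + k^2 * \<bar>\<psi> x\<bar>" for x
  have cc: "continuous_on UNIV c" unfolding c_def by (intro continuous_intros \<psi>c Dc)
  have c0: "c x \<ge> 0" for x by (simp add: c_def)
  have ci: "integrable lborel c"
    by (rule integrable_continuous_compact_support[OF cc, of R]) (use R in \<open>auto simp: c_def\<close>)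
  define W where "W x y = (d\<Phi> (D x) (x - y) - of_real (k^2 * \<psi> x) * \<Phi> (x - y)) * g y" for x y
  have Wm: "case_prod W \<in> borel_measurable (lborel \<Otimes>\<^sub>M lborel)"
    unfolding W_def d\<Phi>_sum[of "D _"] by measurable
  have s: "0 \<le> (0::real)" "0 \<le> p" "0 \<le> bt" "p + bt - 0 > real CARD('n)" using p_ge_1 bt by auto
  obtain C where C: "C > 0"
    "\<And>x :: real ^ 'n. integrable lborel (\<lambda>y. wkern p (x - y) * jb y powr (- bt))"
    "\<And>x :: real ^ 'n. (LBINT y. wkern p (x - y) * jb y powr (- bt)) \<le> C * jb x powr (- 0)"
    by (rule wkern_convolution[OF s]) (rule that; assumption)
  have Wb: "norm (W x y) \<le> CK * A * c x * (wkern p (x - y) * jb y powr (- bt))" for x y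
  proof -
    have "norm (W x y) \<le> (CK * c x * wkern p (x - y)) * (A * jb y powr (- bt))"
      unfolding W_def norm_mult c_def
      using kernel_test_bound[of D x "x - y" \<psi>] g CK_nonneg by (intro mult_mono) (auto simp: decays_def)
    then show ?thesis by (simp add: mult_ac)
  qed
  have Wi: "integrable lborel (W x)" for x
    unfolding W_def left_diff_distrib
    by (intro Bochner_Integration.integrable_diff) (auto simp: mult.assoc intro!: kernel_integrable[OF g bt])
  have gi: "integrable (lborel \<Otimes>\<^sub>M lborel) (case_prod W)"
  proof (rule lborel_pair.Fubini_integrable[OF Wm])
    show "AE x in lborel. integrable lborel (\<lambda>y. case (x, y) of (x, y) \<Rightarrow> W x y)"
      using Wi by simp
    have b: "norm (LBINT y. norm (W x y)) \<le> CK * A * C * c x" for x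
    proof -
      have "(LBINT y. norm (W x y)) \<le> (LBINT y. CK * A * c x * (wkern p (x - y) * jb y powr (- bt)))"
        using Wb C(2) by (intro integral_mono integrable_norm Wi integrable_mult_right) auto
      also have "\<dots> = CK * A * c x * (LBINT y. wkern p (x - y) * jb y powr (- bt))" by simp
      also have "\<dots> \<le> CK * A * c x * C"
        using C(3)[of x] A CK_nonneg c0 by (intro mult_left_mono) auto
      finally show ?thesis by (simp add: mult_ac)
    qed
    show "integrable lborel (\<lambda>x. \<integral>y. norm (case (x, y) of (x, y) \<Rightarrow> W x y) \<partial>lborel)"
      unfolding prod.case
    proof (rule integrable_dominated[OF integrable_mult_right[OF ci, of "CK * A * C"]])
      show "(\<lambda>x. \<integral>y. norm (W x y) \<partial>lborel) \<in> borel_measurable lborel" using Wm by measurable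
      show "AE x in lborel. norm (LBINT y. norm (W x y)) \<le> norm (CK * A * C * c x)"
        by (intro AE_I2 order.trans[OF b]) simp
    qed
  qed
  have e1: "(LBINT y. W x y) = cG g (D x) x - of_real (k^2 * \<psi> x) * cv g x" for x
    unfolding W_def left_diff_distrib cG_def cv_def
    by (subst lebesgue_diff) (auto simp: mult.assoc intro!: kernel_integrable[OF g bt])
  have e2: "(LBINT x. W x y) = of_real cE * (of_real (\<psi> y) * g y)" for y
    unfolding W_def integral_mult_left_zero kernel_identity[OF \<psi>] by simp
  show "integrable lborel (\<lambda>x. cG g (D x) x - of_real (k^2 * \<psi> x) * cv g x)"
    using lborel_pair.integrable_fst[OF gi] unfolding e1 .
  show "(LBINT x. cG g (D x) x - of_real (k^2 * \<psi> x) * cv g x) = of_real cE * (LBINT y. of_real (\<psi> y) * g y)"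
    using lborel_pair.Fubini_integral[OF gi] unfolding e1 e2 by simp
qed

text \<open>The defect \<open>h' - i k h\<close> decays one order faster, while replacing the direction \<open>x - y\<close>
  by \<open>x\<close> costs a factor \<open>|y| / |x|\<close>, of which only the power \<open>th\<close> is used.\<close>

lemma radiation_pointwise:
  fixes x y :: "real ^ 'n"
  assumes "x \<noteq> y" "norm x \<ge> 1" "0 \<le> th" "th \<le> 1"
  shows "norm (d\<Phi> x (x - y) / of_real (norm x) - \<i> * of_real k * \<Phi> (x - y))
     \<le> CK * wkern (p + 1) (x - y) + 2 * 2 powr th * CK * jb x powr (- th) * (wkern p (x - y) * jb y powr th)"
proof -
  define z where "z = x - y"
  have z: "z \<noteq> 0" using assms by (simp add: z_def)
  have x: "norm x > 0" using assms by linarith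
  \<comment> \<open>The cosine of the angle between x - y and x: the derivative of the kernel in the
    direction x/|x| is c h', so c - 1 measures the error of replacing the direction x - y by
    x.\<close>
  define c where "c = (z \<bullet> x) / (norm z * norm x)"
  have e: "d\<Phi> x z / of_real (norm x) - \<i> * of_real k * \<Phi> z = (h' (norm z) - \<i> * of_real k * h (norm z)) + of_real (c - 1) * h' (norm z)"
    using z x by (simp add: d\<Phi>_def \<Phi>_def c_def field_simps)
  have c1: "\<bar>c - 1\<bar> \<le> 2"
  proof -
    have "abs c \<le> 1" unfolding c_def using Cauchy_Schwarz_ineq2[of z x] z x by (simp add: abs_mult divide_le_eq_1)
    then show ?thesis by linarith
  qed
  have c2: "\<bar>c - 1\<bar> \<le> 2 * (norm y / norm x)"
  proof -
    have "z \<bullet> x = norm z * norm x + (z \<bullet> x - norm z * norm x)" by simp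
    have a: "z \<bullet> x = z \<bullet> z + z \<bullet> y" unfolding z_def by (simp add: inner_diff_right)
    have "\<bar>norm x - norm z\<bar> \<le> norm y" using norm_triangle_ineq3[of x z] by (simp add: z_def)
    then have b: "\<bar>norm z * (norm z - norm x)\<bar> \<le> norm z * norm y" by (simp add: abs_mult abs_minus_commute mult_left_mono)
    have "z \<bullet> x - norm z * norm x = z \<bullet> y + norm z * (norm z - norm x)"
      unfolding a by (simp add: power2_norm_eq_inner[symmetric] power2_eq_square algebra_simps)
    then have "\<bar>z \<bullet> x - norm z * norm x\<bar> \<le> 2 * (norm z * norm y)"
      using b Cauchy_Schwarz_ineq2[of z y] by linarith
    moreover have "c - 1 = (z \<bullet> x - norm z * norm x) / (norm z * norm x)"
      using z x by (simp add: c_def field_simps)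
    then have "\<bar>c - 1\<bar> = \<bar>z \<bullet> x - norm z * norm x\<bar> / (norm z * norm x)" by (simp add: abs_mult)
    ultimately have "\<bar>c - 1\<bar> \<le> 2 * (norm z * norm y) / (norm z * norm x)"
      by (metis divide_right_mono mult_nonneg_nonneg norm_ge_zero)
    also have "\<dots> = 2 * (norm y / norm x)" using z by simp
    finally show ?thesis .
  qed
  \<comment> \<open>Interpolates between \<open>c1\<close> and \<open>c2\<close> by min 1 t <= t^th.
    The full gain th = 1 would cost one whole power of <y>, more than the density may have to
    spare.\<close>
  have c3: "\<bar>c - 1\<bar> \<le> 2 * (2 powr th * jb y powr th * jb x powr (- th))"
  proof -
    have "jb x \<le> 2 * norm x" using jb_le_1_norm[of x] assms by linarith
    then have xx: "1 / norm x \<le> 2 / jb x" using x by (simp add: field_simps)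
    define t where "t = 2 * jb y / jb x"
    have t0: "t > 0" by (simp add: t_def)
    have "norm y / norm x \<le> t"
      using mult_mono[OF norm_le_jb[of y] xx] by (simp add: t_def mult.commute)
    then have "\<bar>c - 1\<bar> \<le> 2 * min 1 t" using c1 c2 by auto
    also have "min 1 t \<le> t powr th"
    proof (cases "t \<ge> 1")
      case True then show ?thesis using assms by (simp add: ge_one_powr_ge_zero)
    next
      case False
      have "t powr 1 \<le> t powr th" using False t0 assms by (intro powr_mono') auto
      then show ?thesis using False t0 by simp
    qed
    also have "t powr th = 2 powr th * jb y powr th * jb x powr (- th)"
      by (simp add: t_def powr_divide powr_mult powr_minus_divide)
    finally show ?thesis by simp
  qed
  have "norm (d\<Phi> x z / of_real (norm x) - \<i> * of_real k * \<Phi> z) \<le> norm (h' (norm z) - \<i> * of_real k * h (norm z)) + \<bar>c - 1\<bar> * norm (h' (norm z))"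
    unfolding e by (rule order.trans[OF norm_triangle_ineq]) (simp add: norm_mult flip: of_real_diff)
  also have "\<dots> \<le> CK * wkern (p + 1) z + 2 * (2 powr th * jb y powr th * jb x powr (- th)) * (CK * wkern p z)"
    using c3 by (intro add_mono norm_radiation z mult_mono h_wkern(2) order_refl) auto
  finally show ?thesis by (simp add: z_def mult_ac)
qed

text \<open>The defect part has kernel decay p + 1 and convolves to order p + th. The direction part
  spends <y>^th of the density; as bt - th > N, what is left still convolves to order p, and the
  factor <x>^(-th) completes the exponent.\<close>

theorem cv_radiation:
  assumes bt: "bt > real CARD('n)" and th: "0 < th" "th \<le> 1" "th < bt - real CARD('n)" and g: "decays A bt g"
  obtains B where "B \<ge> 0" "\<And>x. norm x \<ge> 1 \<Longrightarrow> norm (cG g x x / of_real (norm x) - \<i> * of_real k * cv g x) \<le> B * jb x powr (- (p + th))"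
proof -
  have gm[measurable]: "g \<in> borel_measurable borel" and A: "A \<ge> 0" using g by (auto simp: decays_def)
  have pbt: "0 \<le> bt" "p + bt > real CARD('n)" using bt p_ge_1 by auto
  have pN: "p + 1 \<le> real CARD('n)" using N3 by (simp add: p_def field_simps)
  have s1: "0 \<le> p + th" "p + th \<le> p + 1" "p + th \<le> bt" "p + 1 + bt - (p + th) > real CARD('n)"
    using p_ge_1 bt th pN by auto
  have s2: "0 \<le> p" "p \<le> p" "p \<le> bt - th" "p + (bt - th) - p > real CARD('n)"
    using p_ge_1 bt th pN by auto
  obtain Ca where Ca: "Ca > 0"
    "\<And>x :: real ^ 'n. integrable lborel (\<lambda>y. wkern (p + 1) (x - y) * jb y powr (- bt))"
    "\<And>x :: real ^ 'n. (LBINT y. wkern (p + 1) (x - y) * jb y powr (- bt)) \<le> Ca * jb x powr (- (p + th))"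
    by (rule wkern_convolution[OF s1]) (rule that; assumption)
  obtain Cb where Cb: "Cb > 0"
    "\<And>x :: real ^ 'n. integrable lborel (\<lambda>y. wkern p (x - y) * jb y powr (- (bt - th)))"
    "\<And>x :: real ^ 'n. (LBINT y. wkern p (x - y) * jb y powr (- (bt - th))) \<le> Cb * jb x powr (- p)"
    by (rule wkern_convolution[OF s2]) (rule that; assumption)
  define K2 where "K2 = 2 * 2 powr th * CK * A"
  have K2: "K2 \<ge> 0" using A CK_nonneg by (simp add: K2_def)
  show ?thesis
  proof (rule that[of "CK * A * Ca + K2 * Cb"])
    show "0 \<le> CK * A * Ca + K2 * Cb" using A CK_nonneg K2 Ca Cb by (intro add_nonneg_nonneg mult_nonneg_nonneg) auto
    fix x :: "real ^ 'n" assume x: "norm x \<ge> 1"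
    define f where "f y = d\<Phi> x (x - y) * g y / of_real (norm x) - \<i> * of_real k * (\<Phi> (x - y) * g y)" for y
    define B where "B y = CK * A * (wkern (p + 1) (x - y) * jb y powr (- bt)) + K2 * jb x powr (- th) * (wkern p (x - y) * jb y powr (- (bt - th)))" for y
    have fi: "integrable lborel f"
      unfolding f_def using kernel_integrable[OF g pbt, of x]
      by (intro Bochner_Integration.integrable_diff integrable_divide_zero integrable_mult_right) auto
    have Bi: "integrable lborel B" unfolding B_def by (intro Bochner_Integration.integrable_add integrable_mult_right Ca Cb)
    have "cG g x x / of_real (norm x) - \<i> * of_real k * cv g x = (LBINT y. f y)"
      unfolding f_def cG_def cv_def using kernel_integrable[OF g pbt, of x]
      by (subst lebesgue_diff) (auto intro!: integrable_divide_zero integrable_mult_right)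
    also have "norm \<dots> \<le> (LBINT y. norm (f y))" by (rule integral_norm_bound)
    also have "\<dots> \<le> (LBINT y. B y)"
    proof (rule integral_mono_AE)
      have "AE y in lborel. y \<noteq> x" by (rule AE_lborel_singleton)
      then show "AE y in lborel. norm (f y) \<le> B y"
      proof eventually_elim
        case (elim y)
        have jb: "jb y powr th * jb y powr (- bt) = jb y powr (- (bt - th))" by (simp add: powr_add[symmetric])
        have "f y = (d\<Phi> x (x - y) / of_real (norm x) - \<i> * of_real k * \<Phi> (x - y)) * g y" by (simp add: f_def algebra_simps)
        also have "norm \<dots> \<le> (CK * wkern (p + 1) (x - y) + 2 * 2 powr th * CK * jb x powr (- th) * (wkern p (x - y) * jb y powr th)) * (A * jb y powr (- bt))"
          unfolding norm_mult using g elim x th CK_nonneg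
          by (intro mult_mono radiation_pointwise add_nonneg_nonneg mult_nonneg_nonneg) (auto simp: decays_def)
        also have "\<dots> = CK * A * (wkern (p + 1) (x - y) * jb y powr (- bt)) + K2 * jb x powr (- th) * (wkern p (x - y) * (jb y powr th * jb y powr (- bt)))"
          by (simp add: K2_def algebra_simps)
        finally show ?case unfolding jb B_def .
      qed
    qed (intro integrable_norm fi Bi)+
    also have "\<dots> = CK * A * (LBINT y. wkern (p + 1) (x - y) * jb y powr (- bt)) + K2 * jb x powr (- th) * (LBINT y. wkern p (x - y) * jb y powr (- (bt - th)))"
      unfolding B_def by (subst Bochner_Integration.integral_add) (intro integrable_mult_right Ca(2) Cb(2) | simp)+
    also have "\<dots> \<le> CK * A * (Ca * jb x powr (- (p + th))) + K2 * jb x powr (- th) * (Cb * jb x powr (- p))"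
      using A CK_nonneg K2 by (intro add_mono mult_left_mono Ca Cb) auto
    also have "\<dots> = (CK * A * Ca + K2 * Cb) * jb x powr (- (p + th))"
      by (simp add: powr_add powr_minus algebra_simps powr_diff divide_inverse)
    finally show "norm (cG g x x / of_real (norm x) - \<i> * of_real k * cv g x) \<le> (CK * A * Ca + K2 * Cb) * jb x powr (- (p + th))" .
  qed
qed

end

section \<open>Integral identities for weak solutions\<close>

text \<open>The equation - Laplace u - k^2 u = f with \<open>u\<close> only in C1: the convolution
  of the kernel with a continuous density need not have second derivatives.\<close>

definition weak_sol :: "real \<Rightarrow> (real ^ 'n \<Rightarrow> real) \<Rightarrow> (real ^ 'n \<Rightarrow> real ^ 'n) \<Rightarrow> (real ^ 'n \<Rightarrow> real) \<Rightarrow> bool"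
  where "weak_sol k u G f \<longleftrightarrow> C1 u G \<and> continuous_on UNIV f \<and>
    (\<forall>\<psi> D. C1c \<psi> D \<longrightarrow> (LBINT x. G x \<bullet> D x - k^2 * u x * \<psi> x) = (LBINT x. f x * \<psi> x))"

lemma C1c_mult_left:
  assumes "C1c u D" "C1 v E"
  shows "C1c (\<lambda>x. u x * v x) (\<lambda>x. u x *\<^sub>R E x + v x *\<^sub>R D x)"
  using C1_mult[OF C1c_C1[OF assms(1)] assms(2)] assms unfolding C1c_def by fastforce

lemma C1_scale:
  assumes "C1 u D"
  shows "C1 (\<lambda>x. c * u x) (\<lambda>x. c *\<^sub>R D x)"
  unfolding C1_def
proof (intro conjI allI)
  fix x
  have "(u has_derivative (\<lambda>e. D x \<bullet> e)) (at x)" using assms by (simp add: C1_def)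
  then show "((\<lambda>x. c * u x) has_derivative (\<lambda>e. (c *\<^sub>R D x) \<bullet> e)) (at x)"
    unfolding inner_scaleR_left by (rule has_derivative_mult_right)
  show "continuous_on UNIV (\<lambda>x. c *\<^sub>R D x)"
    using C1_D_continuous[OF assms] by (intro continuous_intros)
qed

lemma C1_diff:
  assumes "C1 u D" "C1 v E"
  shows "C1 (\<lambda>x. u x - v x) (\<lambda>x. D x - E x)"
  unfolding C1_def
proof (intro conjI allI)
  fix x
  have "(u has_derivative (\<lambda>e. D x \<bullet> e)) (at x)" "(v has_derivative (\<lambda>e. E x \<bullet> e)) (at x)"
    using assms by (simp_all add: C1_def)
  then show "((\<lambda>x. u x - v x) has_derivative (\<lambda>e. (D x - E x) \<bullet> e)) (at x)"
    unfolding inner_diff_left by (rule has_derivative_diff)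
  show "continuous_on UNIV (\<lambda>x. D x - E x)"
    using assms by (intro continuous_intros C1_D_continuous)
qed

lemma inner_sum_Basis: "(\<Sum>b\<in>Basis. (x \<bullet> b) * (y \<bullet> b)) = x \<bullet> (y :: 'a::euclidean_space)"
  by (rule euclidean_inner[symmetric])

lemma C1_difference_bound:
  assumes u: "C1 u G" and M: "\<And>y. norm y \<le> R \<Longrightarrow> norm (G y) \<le> M" and x: "norm x \<le> R" "norm y \<le> R"
  shows "\<bar>u x - u y\<bar> \<le> M * norm (x - y)"
proof -
  have "norm (u x - u y) \<le> M * norm (x - y)"
  proof (rule differentiable_bound[of "cball 0 R" u "\<lambda>x e. G x \<bullet> e"])
    fix z assume z: "z \<in> cball (0 :: real ^ 'a) R"
    show "(u has_derivative (\<lambda>e. G z \<bullet> e)) (at z within cball 0 R)"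
      using u by (auto simp: C1_def intro: has_derivative_at_withinI)
    show "onorm (\<lambda>e. G z \<bullet> e) \<le> M"
    proof (rule onorm_le)
      fix e
      have "norm (G z \<bullet> e) \<le> norm (G z) * norm e" using Cauchy_Schwarz_ineq2[of "G z" e] by simp
      also have "\<dots> \<le> M * norm e" using M[of z] z by (intro mult_right_mono) auto
      finally show "norm (G z \<bullet> e) \<le> M * norm e" .
    qed
  qed (use x in auto)
  then show ?thesis by simp
qed

lemma C1_quotient_tendsto:
  assumes "C1 u G"
  shows "((\<lambda>t. (u (x + t *\<^sub>R e) - u x) / t) \<longlongrightarrow> G x \<bullet> e) (at 0)"
proof -
  have "((\<lambda>t. u (x + t *\<^sub>R e)) has_vector_derivative G (x + 0 *\<^sub>R e) \<bullet> e) (at 0)"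
    by (rule C1_line[OF assms])
  then show ?thesis unfolding has_vector_derivative_iff_quotient by (simp add: divide_inverse mult.commute)
qed

lemma continuous_bound_ball:
  fixes f :: "'a::euclidean_space \<Rightarrow> 'b::real_normed_vector"
  assumes "continuous_on UNIV f"
  obtains M where "M \<ge> 0" "\<And>x. norm x \<le> R \<Longrightarrow> norm (f x) \<le> M"
proof -
  have "compact (f ` cball 0 R)"
    by (intro compact_continuous_image continuous_on_subset[OF assms(1)]) auto
  then obtain B where B: "\<And>x. x \<in> cball 0 R \<Longrightarrow> norm (f x) \<le> B"
    by (meson bounded_iff compact_imp_bounded imageI)
  then show ?thesis using that[of "max B 0"] by (force simp: le_max_iff_disj)
qed

lemma seq_inverse_Suc_at_0: "filterlim (\<lambda>n. 1 / real (Suc n)) (at 0) sequentially"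
  unfolding filterlim_at using LIMSEQ_Suc[OF lim_1_over_n[where 'a=real]] by (auto intro!: always_eventually)

text \<open>The test function is \<open>q\<close> times the symmetric
  difference quotient of \<open>u\<close>; discrete summation by parts then moves the difference onto \<open>q\<close>,
  so that no second derivatives of \<open>u\<close> are needed.\<close>

lemma pohozaev_direction:
  fixes u :: "real ^ 'n \<Rightarrow> real"
  assumes w: "weak_sol k u G f" and q: "C1c q Q"
  shows "(LBINT x. (G x \<bullet> Q x) * (G x \<bullet> e) - (1/2) * (Q x \<bullet> e) * ((norm (G x))^2 - k^2 * (u x)^2))
     = (LBINT x. f x * q x * (G x \<bullet> e))"
proof -
  have u: "C1 u G" and fc: "continuous_on UNIV f" and q1: "C1 q Q" using w q by (auto simp: weak_sol_def C1c_C1)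
  note uc = C1_continuous[OF u] and Gc = C1_D_continuous[OF u] and qc = C1_continuous[OF q1] and Qc = C1_D_continuous[OF q1]
  let ?h = "\<lambda>x. - (1/2) * (Q x \<bullet> e)"
  let ?Q = "\<lambda>x. G x \<bullet> Q x"
  let ?e = "\<lambda>x. G x \<bullet> e"
  obtain R0 where R0: "\<And>x. norm x \<ge> R0 \<Longrightarrow> q x = 0 \<and> Q x = 0" using q by (auto simp: C1c_def)
  define R where "R = abs R0 + norm e"
  have RR: "R0 + norm e \<le> R" "R0 \<le> R" using abs_ge_self[of R0] norm_ge_zero[of e] by (simp_all add: R_def del: norm_ge_zero)
  obtain M where M: "M \<ge> 0" and Mb: "\<And>x. norm x \<le> R + norm e \<Longrightarrow> norm (norm (G x) + \<bar>u x\<bar> + \<bar>f x\<bar> + \<bar>q x\<bar> + norm (Q x)) \<le> M"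
    by (rule continuous_bound_ball[of "\<lambda>x. norm (G x) + \<bar>u x\<bar> + \<bar>f x\<bar> + \<bar>q x\<bar> + norm (Q x)"])
      (auto intro!: continuous_intros fc uc Gc qc Qc)
  have B: "norm (G x) \<le> M" "\<bar>u x\<bar> \<le> M" "\<bar>f x\<bar> \<le> M" "\<bar>q x\<bar> \<le> M" "norm (Q x) \<le> M" if "norm x \<le> R + norm e" for x
    using Mb[OF that] norm_ge_zero[of "G x"] norm_ge_zero[of "Q x"] unfolding real_norm_def by linarith+
  have wide: "norm x \<le> R + norm e" if "norm x \<le> R" for x :: "real ^ 'n" using that by (auto intro: add_increasing2)
  define t where "t n = 1 / real (Suc n)" for n
  have t: "0 < t n" "t n \<noteq> 0" for n by (auto simp: t_def)
  have tl: "filterlim t (at 0) sequentially" unfolding t_def by (rule seq_inverse_Suc_at_0)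
  define s where "s n x = x + t n *\<^sub>R e" for n x
  have te: "norm (t n *\<^sub>R e) \<le> norm e" for n by (simp add: t_def divide_le_eq mult_le_cancel_left1)
  have near: "norm (s n x) \<le> R + norm e" "norm (x - t n *\<^sub>R e) \<le> R + norm e" if "norm x \<le> R" for n x
    using norm_triangle_ineq[of x "t n *\<^sub>R e"] norm_triangle_ineq4[of x "t n *\<^sub>R e"] te[of n] that unfolding s_def by linarith+
  have far: "q x = 0" "Q x = 0" "q (s n x) = 0" if "norm x > R" for n x
  proof -
    have "norm x \<ge> R0" "norm (s n x) \<ge> R0"
      using norm_triangle_ineq4[of "s n x" "t n *\<^sub>R e"] te[of n] that RR by (simp_all add: s_def del: norm_scaleR)
    with R0 show "q x = 0" "Q x = 0" "q (s n x) = 0" by auto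
  qed
  have lim: "(\<lambda>n. (v (s n x) - v x) / t n) \<longlonglongrightarrow> V x \<bullet> e" if "C1 v V" for v V x
    unfolding s_def by (rule filterlim_compose[OF C1_quotient_tendsto[OF that] tl])
  \<comment> \<open>\<open>d\<close> is the symmetric quotient of \<open>u\<close>, and
    \<open>r\<close> is minus half the forward quotient of \<open>q\<close>. The symmetry is what
    makes summation by parts close: the products P(x) \<bullet> P(x + t e) and P(x) \<bullet> P(x -
    t e) are translates of each other.\<close>
  define d where "d n x = (u (s n x) - u (x - t n *\<^sub>R e)) / (2 * t n)" for n x
  define dG where "dG n x = (1 / (2 * t n)) *\<^sub>R (G (s n x) - G (x - t n *\<^sub>R e))" for n x
  define r where "r n x = (q x - q (s n x)) / (2 * t n)" for n x
  have d1: "C1 (d n) (dG n)" for n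
  proof -
    have "C1 (\<lambda>x. (1 / (2 * t n)) * (u (x + t n *\<^sub>R e) - u (x + - (t n *\<^sub>R e)))) (\<lambda>x. (1 / (2 * t n)) *\<^sub>R (G (x + t n *\<^sub>R e) - G (x + - (t n *\<^sub>R e))))"
      by (intro C1_scale C1_diff C1_translate u)
    then show ?thesis by (simp add: d_def[abs_def] dG_def[abs_def] s_def)
  qed
  note dc = C1_continuous[OF d1] and dGc = C1_D_continuous[OF d1]
  have sc: "continuous_on UNIV (\<lambda>x. F (s n x))" "continuous_on UNIV (\<lambda>x. F (x - t n *\<^sub>R e))" if "continuous_on UNIV F" for F :: "real ^ 'n \<Rightarrow> 'c::topological_space" and n
    unfolding s_def by (rule continuous_on_compose2[OF that]; auto intro!: continuous_intros)+
  have rc: "continuous_on UNIV (r n)" for n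
    unfolding r_def using t[of n] by (intro continuous_intros sc qc) auto
  have db: "\<bar>d n x\<bar> \<le> M * norm e" if x: "norm x \<le> R" for n x
  proof -
    have "\<bar>u (s n x) - u (x - t n *\<^sub>R e)\<bar> \<le> M * norm (s n x - (x - t n *\<^sub>R e))"
      by (rule C1_difference_bound[OF u B(1) near[OF x]])
    also have "s n x - (x - t n *\<^sub>R e) = (2 * t n) *\<^sub>R e" by (simp add: s_def algebra_simps scaleR_2[symmetric])
    finally show ?thesis using t[of n] by (simp add: d_def field_simps)
  qed
  have rb: "\<bar>r n x\<bar> \<le> M * norm e" if x: "norm x \<le> R" for n x
  proof -
    have "\<bar>q x - q (s n x)\<bar> \<le> M * norm (x - s n x)"
      by (rule C1_difference_bound[OF q1 B(5) wide[OF x] near(1)[OF x]])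
    also have "\<dots> \<le> M * norm e * (2 * t n)" using M t[of n] by (simp add: s_def mult_left_mono)
    finally show ?thesis using t[of n] by (simp add: r_def divide_le_eq)
  qed
  have rz: "r n x = 0" if "norm x > R" for n x using far[OF that] by (simp add: r_def)
  have dl: "(\<lambda>n. d n x) \<longlonglongrightarrow> G x \<bullet> e" for x
  proof -
    have "(\<lambda>n. (u (x + t n *\<^sub>R (- e)) - u x) / t n) \<longlonglongrightarrow> G x \<bullet> (- e)"
      by (rule filterlim_compose[OF C1_quotient_tendsto[OF u] tl])
    then have "(\<lambda>n. (1/2) * ((u (s n x) - u x) / t n - (u (x + t n *\<^sub>R (- e)) - u x) / t n)) \<longlonglongrightarrow> (1/2) * (G x \<bullet> e - G x \<bullet> (- e))"
      by (intro tendsto_intros lim[OF u])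
    moreover have "d n x = (1/2) * ((u (s n x) - u x) / t n - (u (x + t n *\<^sub>R (- e)) - u x) / t n)" for n
      using t[of n] by (simp add: d_def s_def field_simps)
    ultimately have "(\<lambda>n. d n x) \<longlonglongrightarrow> (1/2) * (G x \<bullet> e - G x \<bullet> (- e))" by (simp only:)
    then show ?thesis by simp
  qed
  have rl: "(\<lambda>n. r n x) \<longlonglongrightarrow> ?h x" for x
  proof -
    have "(\<lambda>n. - (1/2) * ((q (s n x) - q x) / t n)) \<longlonglongrightarrow> ?h x"
      by (intro tendsto_intros lim[OF q1])
    moreover have "r n x = - (1/2) * ((q (s n x) - q x) / t n)" for n
      using t[of n] by (simp add: r_def field_simps)
    ultimately show ?thesis by (simp only:)
  qed
  have sl: "(\<lambda>n. P (s n x)) \<longlonglongrightarrow> P x" if "continuous_on UNIV P" for P :: "real ^ 'n \<Rightarrow> 'c::topological_space" and x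
  proof (rule isCont_tendsto_compose)
    show "isCont P x" using that by (simp add: continuous_on_eq_continuous_at)
    have "(\<lambda>n. x + t n *\<^sub>R e) \<longlonglongrightarrow> x + 0 *\<^sub>R e" using tl by (intro tendsto_intros) (simp add: filterlim_at)
    then show "(\<lambda>n. s n x) \<longlonglongrightarrow> x" by (simp add: s_def)
  qed
  have DCT: "(\<lambda>n. LBINT x. F n x) \<longlonglongrightarrow> (LBINT x. L x)"
    if Fc: "\<And>n. continuous_on UNIV (F n)" "continuous_on UNIV L" and l: "\<And>x. (\<lambda>n. F n x) \<longlonglongrightarrow> L x"
      and b: "\<And>n x. norm x \<le> R \<Longrightarrow> \<bar>F n x\<bar> \<le> c" and z: "\<And>n x. norm x > R \<Longrightarrow> F n x = 0" for F :: "nat \<Rightarrow> real ^ 'n \<Rightarrow> real" and L and c :: real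
  proof (rule integral_dominated_convergence[where w = "\<lambda>x. indicator (cball 0 R) x * abs c"])
    show "AE x in lborel. norm (F n x) \<le> indicator (cball 0 R) x * abs c" for n
    proof (rule AE_I2)
      fix x show "norm (F n x) \<le> indicator (cball 0 R) x * abs c"
        using b[of x n] z[of x n] by (cases "norm x \<le> R") auto
    qed
    show "integrable lborel (\<lambda>x :: real ^ 'n. indicator (cball 0 R) x * abs c)"
      by (intro integrable_mult_left integrable_real_indicator emeasure_bounded_finite) auto
  qed (use Fc l in \<open>auto intro: borel_measurable_continuous_onI\<close>)
  have Fi: "integrable lborel F" if "continuous_on UNIV F" "\<And>x. norm x > R \<Longrightarrow> F x = 0" for F :: "real ^ 'n \<Rightarrow> real"
    by (rule integrable_continuous_compact_support[OF that(1), of "R + 1"]) (use that(2) in auto)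
  \<comment> \<open>Applied with P = G and with P = u; these yield the two quadratic terms
    multiplied by the derivative of \<open>q\<close> in the limit.\<close>
  have parts: "(LBINT x. q x * (P x \<bullet> ((1 / (2 * t n)) *\<^sub>R (P (s n x) - P (x - t n *\<^sub>R e))))) = (LBINT x. r n x * (P x \<bullet> P (s n x)))"
    if Pc: "continuous_on UNIV P" for P :: "real ^ 'n \<Rightarrow> 'b::euclidean_space" and n
  proof -
    define a where "a x = q x * (P x \<bullet> P (s n x)) / (2 * t n)" for x
    define b where "b x = q (s n x) * (P (s n x) \<bullet> P x) / (2 * t n)" for x
    have c: "continuous_on UNIV a" "continuous_on UNIV b"
      unfolding a_def b_def using t[of n] by (auto intro!: continuous_intros sc Pc qc)
    have ai: "integrable lborel a" and bi: "integrable lborel b"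
      by (rule Fi[OF c(1)], simp add: a_def far, rule Fi[OF c(2)], simp add: b_def far)
    have bt: "b (x + - (t n *\<^sub>R e)) = q x * (P x \<bullet> P (x - t n *\<^sub>R e)) / (2 * t n)" for x by (simp add: b_def s_def)
    have "(LBINT x. q x * (P x \<bullet> ((1 / (2 * t n)) *\<^sub>R (P (s n x) - P (x - t n *\<^sub>R e))))) = (LBINT x. a x - b (x + - (t n *\<^sub>R e)))"
      unfolding bt a_def by (intro Bochner_Integration.integral_cong refl) (simp add: inner_diff_right diff_divide_distrib right_diff_distrib)
    also have "\<dots> = (LBINT x. a x - b x)"
      unfolding lebesgue_diff[OF ai integrable_lborel_translate[OF bi]] lebesgue_diff[OF ai bi]
        integral_lborel_translate[OF borel_measurable_continuous_onI[OF c(2)]] ..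
    also have "\<dots> = (LBINT x. r n x * (P x \<bullet> P (s n x)))"
      by (intro Bochner_Integration.integral_cong refl) (simp add: a_def b_def r_def inner_commute left_diff_distrib diff_divide_distrib)
    finally show ?thesis .
  qed
  have eq: "(LBINT x. (?Q x) * d n x) + (LBINT x. r n x * (G x \<bullet> G (s n x))) - k^2 * (LBINT x. r n x * (u x \<bullet> u (s n x))) = (LBINT x. f x * q x * d n x)" for n
  proof -
    have i: "integrable lborel (\<lambda>x. (?Q x) * d n x)" "integrable lborel (\<lambda>x. q x * (G x \<bullet> dG n x))" "integrable lborel (\<lambda>x. q x * (u x \<bullet> d n x))"
      by (rule Fi; use far in \<open>auto intro!: continuous_intros Gc Qc qc uc dc dGc\<close>)+
    have "(LBINT x. G x \<bullet> (q x *\<^sub>R dG n x + d n x *\<^sub>R Q x) - k^2 * u x * (q x * d n x)) = (LBINT x. f x * (q x * d n x))"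
      using w C1c_mult_left[OF q d1[of n]] unfolding weak_sol_def by blast
    note this[symmetric]
    also have "(LBINT x. G x \<bullet> (q x *\<^sub>R dG n x + d n x *\<^sub>R Q x) - k^2 * u x * (q x * d n x)) = (LBINT x. (?Q x) * d n x + q x * (G x \<bullet> dG n x) - k^2 * (q x * (u x \<bullet> d n x)))"
      by (intro Bochner_Integration.integral_cong refl) (simp add: inner_add_right algebra_simps)
    also have "\<dots> = (LBINT x. (?Q x) * d n x) + (LBINT x. q x * (G x \<bullet> dG n x)) - k^2 * (LBINT x. q x * (u x \<bullet> d n x))"
      using i by simp
    also have "(LBINT x. q x * (G x \<bullet> dG n x)) = (LBINT x. r n x * (G x \<bullet> G (s n x)))" unfolding dG_def by (rule parts[OF Gc])
    also have "(LBINT x. q x * (u x \<bullet> d n x)) = (LBINT x. r n x * (u x \<bullet> u (s n x)))" using parts[OF uc, of n] by (simp add: d_def)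
    finally show ?thesis by (simp add: mult.assoc)
  qed
  have L1: "(\<lambda>n. LBINT x. (?Q x) * d n x) \<longlonglongrightarrow> (LBINT x. (?Q x) * ?e x)"
  proof (rule DCT[of _ _ "M * M * (M * norm e)"])
    fix n :: nat and x :: "real ^ 'n" assume x: "norm x \<le> R"
    have "\<bar>G x \<bullet> Q x\<bar> \<le> M * M"
      using B[OF wide[OF x]] M by (intro order_trans[OF Cauchy_Schwarz_ineq2] mult_mono) auto
    then show "\<bar>?Q x * d n x\<bar> \<le> M * M * (M * norm e)"
      unfolding abs_mult using db[OF x, of n] M by (intro mult_mono) auto
  qed (use far in \<open>auto intro!: continuous_intros tendsto_intros Gc Qc dc dl\<close>)
  have L2: "(\<lambda>n. LBINT x. r n x * (P x \<bullet> P (s n x))) \<longlonglongrightarrow> (LBINT x. - (1/2) * (Q x \<bullet> e) * (P x \<bullet> P x))"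
    if P: "continuous_on UNIV P" "\<And>x. norm x \<le> R + norm e \<Longrightarrow> norm (P x) \<le> M" for P :: "real ^ 'n \<Rightarrow> 'b::euclidean_space"
  proof (rule DCT[of _ _ "M * norm e * (M * M)"])
    fix n :: nat and x :: "real ^ 'n" assume x: "norm x \<le> R"
    have "\<bar>P x \<bullet> P (s n x)\<bar> \<le> M * M"
      using P(2)[OF wide[OF x]] P(2)[OF near(1)[OF x]] M by (intro order_trans[OF Cauchy_Schwarz_ineq2] mult_mono) auto
    then show "\<bar>r n x * (P x \<bullet> P (s n x))\<bar> \<le> M * norm e * (M * M)"
      unfolding abs_mult using rb[OF x, of n] M by (intro mult_mono) auto
  next
    show "(\<lambda>n. r n x * (P x \<bullet> P (s n x))) \<longlonglongrightarrow> ?h x * (P x \<bullet> P x)" for x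
      by (intro tendsto_intros rl sl P(1))
  qed (use rz in \<open>auto intro!: continuous_intros P(1) Qc rc sc\<close>)
  have L4: "(\<lambda>n. LBINT x. f x * q x * d n x) \<longlonglongrightarrow> (LBINT x. f x * q x * ?e x)"
  proof (rule DCT[of _ _ "M * M * (M * norm e)"])
    fix n :: nat and x :: "real ^ 'n" assume x: "norm x \<le> R"
    show "\<bar>f x * q x * d n x\<bar> \<le> M * M * (M * norm e)"
      unfolding abs_mult using db[OF x, of n] B[OF wide[OF x]] M by (intro mult_mono) auto
  qed (use far in \<open>auto intro!: continuous_intros tendsto_intros Gc fc qc dc dl\<close>)
  have "(\<lambda>n. LBINT x. f x * q x * d n x) \<longlonglongrightarrow> (LBINT x. (?Q x) * ?e x) + (LBINT x. - (1/2) * (Q x \<bullet> e) * (G x \<bullet> G x))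
     - k^2 * (LBINT x. - (1/2) * (Q x \<bullet> e) * (u x \<bullet> u x))"
    unfolding eq[symmetric] using B by (intro tendsto_intros L1 L2 Gc uc) auto
  from LIMSEQ_unique[OF L4 this]
  have "(LBINT x. f x * q x * ?e x) = (LBINT x. (?Q x) * ?e x) + (LBINT x. - (1/2) * (Q x \<bullet> e) * (G x \<bullet> G x))
     - k^2 * (LBINT x. - (1/2) * (Q x \<bullet> e) * (u x \<bullet> u x))" .
  also have "\<dots> = (LBINT x. (?Q x) * ?e x + ?h x * (G x \<bullet> G x) - k^2 * (?h x * (u x \<bullet> u x)))"
  proof -
    have i: "integrable lborel (\<lambda>x. (?Q x) * ?e x)" "integrable lborel (\<lambda>x. - (1/2) * (Q x \<bullet> e) * (G x \<bullet> G x))"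
      "integrable lborel (\<lambda>x. - (1/2) * (Q x \<bullet> e) * (u x \<bullet> u x))"
      by (rule Fi; use far in \<open>auto intro!: continuous_intros Gc Qc uc\<close>)+
    show ?thesis
      by (subst lebesgue_diff[OF Bochner_Integration.integrable_add[OF i(1,2)] integrable_mult_right[OF i(3)]],
          subst Bochner_Integration.integral_add[OF i(1,2)], subst integral_mult_right_zero) (rule refl)
  qed
  also have "\<dots> = (LBINT x. (?Q x) * ?e x - (1/2) * (Q x \<bullet> e) * ((norm (G x))^2 - k^2 * (u x)^2))"
    by (intro Bochner_Integration.integral_cong refl) (simp add: power2_norm_eq_inner[symmetric] power2_eq_square[of "u _"] algebra_simps)
  finally show ?thesis by simp
qed

lemma C1_UNIV_integrals:
  assumes "continuous_on UNIV F" "C1c s S" "\<And>x. s x = 0 \<Longrightarrow> S x = 0 \<Longrightarrow> F x = (0::real)"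
  shows "integrable lborel F"
proof -
  obtain R where "\<And>x. norm x \<ge> R \<Longrightarrow> s x = 0 \<and> S x = 0" using assms(2) by (auto simp: C1c_def)
  then show ?thesis using assms by (intro integrable_continuous_compact_support[OF assms(1), of R]) auto
qed

text \<open>Summing \<open>pohozaev_direction\<close> over the coordinate directions with q = s (x
  \<bullet> b) amounts to the multiplier s (x \<bullet> G), the classical one of Pohozaev and
  Rellich.\<close>

lemma pohozaev_compact:
  fixes u :: "real ^ 'n \<Rightarrow> real"
  assumes w: "weak_sol k u G f" and s: "C1c s S"
  shows "(LBINT x. s x * (norm (G x))^2 + (G x \<bullet> S x) * (x \<bullet> G x) - (1/2) * (real CARD('n) * s x + x \<bullet> S x) * ((norm (G x))^2 - k^2 * (u x)^2))
     = (LBINT x. f x * s x * (x \<bullet> G x))"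
proof -
  have u: "C1 u G" and fc: "continuous_on UNIV f" using w by (auto simp: weak_sol_def)
  have uc: "continuous_on UNIV u" and Gc: "continuous_on UNIV G" using u by (auto simp: C1_continuous C1_D_continuous)
  have sc: "continuous_on UNIV s" and Sc: "continuous_on UNIV S" using C1c_C1[OF s] by (auto simp: C1_continuous C1_D_continuous)
  define Q where "Q b x = s x *\<^sub>R b + (x \<bullet> b) *\<^sub>R S x" for b x :: "real ^ 'n"
  let ?S = "\<lambda>x. \<Sum>b\<in>Basis. (G x \<bullet> Q b x) * (G x \<bullet> b)"
  have q: "C1c (\<lambda>x. s x * (x \<bullet> b)) (Q b)" for b unfolding Q_def by (rule C1c_mult_left[OF s C1_inner])
  define L where "L b x = (G x \<bullet> Q b x) * (G x \<bullet> b) - (1/2) * (Q b x \<bullet> b) * ((norm (G x))^2 - k^2 * (u x)^2)" for b x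
  have Li: "integrable lborel (L b)" for b
    by (rule C1_UNIV_integrals[OF _ s]) (auto simp: L_def Q_def intro!: continuous_intros Gc uc sc Sc)
  have Ri: "integrable lborel (\<lambda>x. f x * (s x * (x \<bullet> b)) * (G x \<bullet> b))" for b
    by (rule C1_UNIV_integrals[OF _ s]) (auto intro!: continuous_intros Gc uc sc fc)
  have cB: "card (Basis :: (real ^ 'n) set) = CARD('n)" by simp
  have "(LBINT x. (\<Sum>b\<in>Basis. L b x)) = (\<Sum>b\<in>Basis. \<integral>x. L b x \<partial>lborel)"
    by (rule Bochner_Integration.integral_sum) (rule Li)
  also have "\<dots> = (\<Sum>b\<in>Basis. \<integral>x. f x * (s x * (x \<bullet> b)) * (G x \<bullet> b) \<partial>lborel)"
    unfolding L_def by (intro sum.cong refl pohozaev_direction[OF w q])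
  also have "\<dots> = (LBINT x. (\<Sum>b\<in>Basis. f x * (s x * (x \<bullet> b)) * (G x \<bullet> b)))"
    by (rule Bochner_Integration.integral_sum[symmetric]) (rule Ri)
  also have "(\<lambda>x. \<Sum>b\<in>Basis. f x * (s x * (x \<bullet> b)) * (G x \<bullet> b)) = (\<lambda>x. f x * s x * (x \<bullet> G x))"
    by (simp only: inner_sum_Basis sum_distrib_left[symmetric] mult.assoc)
  also have "(\<lambda>x. \<Sum>b\<in>Basis. L b x) = (\<lambda>x. s x * (norm (G x))^2 + (G x \<bullet> S x) * (x \<bullet> G x) - (1/2) * (real CARD('n) * s x + x \<bullet> S x) * ((norm (G x))^2 - k^2 * (u x)^2))"
  proof (rule ext)
    fix x
    have a: "?S x = s x * (norm (G x))^2 + (G x \<bullet> S x) * (x \<bullet> G x)"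
    proof -
      have "?S x = (\<Sum>b\<in>Basis. s x * ((G x \<bullet> b) * (G x \<bullet> b)) + (G x \<bullet> S x) * ((x \<bullet> b) * (G x \<bullet> b)))"
        by (intro sum.cong refl) (simp add: Q_def inner_add_right distrib_left distrib_right mult_ac)
      also have "\<dots> = s x * (\<Sum>b\<in>Basis. (G x \<bullet> b) * (G x \<bullet> b)) + (G x \<bullet> S x) * (\<Sum>b\<in>Basis. (x \<bullet> b) * (G x \<bullet> b))"
        by (simp only: sum.distrib sum_distrib_left)
      finally show ?thesis by (simp only: inner_sum_Basis power2_norm_eq_inner)
    qed
    have b: "(\<Sum>b\<in>Basis. Q b x \<bullet> b) = real CARD('n) * s x + x \<bullet> S x"
    proof -
      have "(\<Sum>b\<in>Basis. Q b x \<bullet> b) = (\<Sum>b\<in>(Basis :: (real ^ 'n) set). s x + (x \<bullet> b) * (S x \<bullet> b))"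
        by (intro sum.cong refl) (simp add: Q_def inner_add_left inner_same_Basis)
      then show ?thesis by (simp only: sum.distrib inner_sum_Basis sum_constant cB)
    qed
    have "(\<Sum>b\<in>Basis. L b x) = ?S x - (1/2) * (\<Sum>b\<in>Basis. Q b x \<bullet> b) * ((norm (G x))^2 - k^2 * (u x)^2)"
      unfolding L_def sum_subtractf sum_distrib_left sum_distrib_right ..
    then show "(\<Sum>b\<in>Basis. L b x) = s x * (norm (G x))^2 + (G x \<bullet> S x) * (x \<bullet> G x) - (1/2) * (real CARD('n) * s x + x \<bullet> S x) * ((norm (G x))^2 - k^2 * (u x)^2)"
      by (simp only: a b)
  qed
  finally show ?thesis .
qed

text \<open>The equation tested with s u, which is an admissible test function because
  \<open>u\<close> is C1.\<close>

lemma energy_compact: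
  assumes w: "weak_sol k u G f" and s: "C1c s S"
  shows "(LBINT x. s x * ((norm (G x))^2 - k^2 * (u x)^2) + u x * (G x \<bullet> S x)) = (LBINT x. f x * s x * u x)"
proof -
  have "(LBINT x. G x \<bullet> (s x *\<^sub>R G x + u x *\<^sub>R S x) - k^2 * u x * (s x * u x)) = (LBINT x. f x * (s x * u x))"
    using w C1c_mult_left[OF s, of u G] unfolding weak_sol_def by blast
  moreover have "G x \<bullet> (s x *\<^sub>R G x + u x *\<^sub>R S x) - k^2 * u x * (s x * u x) = s x * ((norm (G x))^2 - k^2 * (u x)^2) + u x * (G x \<bullet> S x)" for x
    unfolding power2_norm_eq_inner by (simp add: inner_add_right power2_eq_square algebra_simps)
  ultimately show ?thesis by (simp add: mult.assoc)
qed

text \<open>The field s u^2 x is C1 with compact support, so its divergence integrates to 0. No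
  equation for \<open>u\<close> enters.\<close>

lemma divergence_compact:
  fixes u :: "real ^ 'n \<Rightarrow> real"
  assumes u: "C1 u G" and s: "C1c s S"
  shows "(LBINT x. 2 * s x * u x * (x \<bullet> G x) + (real CARD('n) * s x + x \<bullet> S x) * (u x)^2) = 0"
proof -
  have uc: "continuous_on UNIV u" and Gc: "continuous_on UNIV G" using u by (auto simp: C1_continuous C1_D_continuous)
  have sc: "continuous_on UNIV s" and Sc: "continuous_on UNIV S" using C1c_C1[OF s] by (auto simp: C1_continuous C1_D_continuous)
  define F where "F b x = (s x * (x \<bullet> b)) * (u x * u x)" for b x :: "real ^ 'n"
  define D where "D b x = (s x * (x \<bullet> b)) *\<^sub>R (u x *\<^sub>R G x + u x *\<^sub>R G x) + (u x * u x) *\<^sub>R (s x *\<^sub>R b + (x \<bullet> b) *\<^sub>R S x)" for b x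
  have FD: "C1c (F b) (D b)" for b
    unfolding F_def D_def by (intro C1c_mult_left[OF C1c_mult_left[OF s C1_inner] C1_mult[OF u u]])
  have Dc: "continuous_on UNIV (\<lambda>x. D b x \<bullet> b)" for b
    using C1_D_continuous[OF C1c_C1[OF FD]] by (intro continuous_intros)
  have Di: "integrable lborel (\<lambda>x. D b x \<bullet> b)" for b
    by (rule C1_UNIV_integrals[OF Dc s]) (simp add: D_def)
  have Fi: "integrable lborel (F b)" for b
    by (rule C1_UNIV_integrals[OF C1_continuous[OF C1c_C1[OF FD]] s]) (simp add: F_def)
  have z: "(LBINT x. D b x \<bullet> b) = 0" for b
  proof (rule integral_directional_derivative_eq_0[OF Fi Di])
    fix x
    have "((\<lambda>t. D b (x + t *\<^sub>R b) \<bullet> b) has_integral (F b (x + 1 *\<^sub>R b) - F b (x + 0 *\<^sub>R b))) {0..1}"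
      by (rule fundamental_theorem_of_calculus) (auto intro: C1_line[OF C1c_C1[OF FD]])
    then show "((\<lambda>t. D b (x + t *\<^sub>R b) \<bullet> b) has_integral (F b (x + b) - F b x)) {0..1}" by simp
  qed
  have cB: "card (Basis :: (real ^ 'n) set) = CARD('n)" by simp
  have "(LBINT x. (\<Sum>b\<in>Basis. D b x \<bullet> b)) = (\<Sum>b\<in>Basis. \<integral>x. D b x \<bullet> b \<partial>lborel)"
    by (rule Bochner_Integration.integral_sum) (rule Di)
  also have "\<dots> = 0" by (simp add: z)
  also have "(\<lambda>x. \<Sum>b\<in>Basis. D b x \<bullet> b) = (\<lambda>x. 2 * s x * u x * (x \<bullet> G x) + (real CARD('n) * s x + x \<bullet> S x) * (u x)^2)"
  proof (rule ext)
    fix x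
    have "(\<Sum>b\<in>Basis. D b x \<bullet> b) = 2 * s x * u x * (\<Sum>b\<in>Basis. (x \<bullet> b) * (G x \<bullet> b)) + (u x * u x) * ((\<Sum>b\<in>(Basis :: (real ^ 'n) set). s x) + (\<Sum>b\<in>Basis. (x \<bullet> b) * (S x \<bullet> b)))"
    proof -
      have "D b x \<bullet> b = 2 * s x * u x * ((x \<bullet> b) * (G x \<bullet> b)) + (u x * u x) * (s x + (x \<bullet> b) * (S x \<bullet> b))"
        if "b \<in> Basis" for b
        unfolding D_def inner_add_left inner_scaleR_left using that by (simp add: inner_same_Basis distrib_left)
      then have "(\<Sum>b\<in>Basis. D b x \<bullet> b) = (\<Sum>b\<in>Basis. 2 * s x * u x * ((x \<bullet> b) * (G x \<bullet> b)) + (u x * u x) * (s x + (x \<bullet> b) * (S x \<bullet> b)))"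
        by (rule sum.cong[OF refl])
      then show ?thesis by (simp only: sum.distrib sum_distrib_left distrib_left)
    qed
    also have "\<dots> = 2 * s x * u x * (x \<bullet> G x) + (real CARD('n) * s x + x \<bullet> S x) * (u x)^2"
      unfolding inner_sum_Basis by (simp add: cB power2_eq_square)
    finally show "(\<Sum>b\<in>Basis. D b x \<bullet> b) = 2 * s x * u x * (x \<bullet> G x) + (real CARD('n) * s x + x \<bullet> S x) * (u x)^2" .
  qed
  finally show ?thesis .
qed

section \<open>Cutoffs and the passage to unbounded multipliers\<close>

lemma integrable_pointwise_limit:
  fixes g :: "'a \<Rightarrow> real"
  assumes "\<And>n. integrable M (h n)" "\<And>n x. h n x \<ge> 0" "\<And>n. (\<integral>x. h n x \<partial>M) \<le> B"
    and lim: "\<And>x. (\<lambda>n. h n x) \<longlonglongrightarrow> g x"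
  shows "integrable M g"
proof (rule integrableI_nonneg)
  have [measurable]: "h n \<in> borel_measurable M" for n using assms(1) by (rule borel_measurable_integrable)
  show "g \<in> borel_measurable M" by (rule borel_measurable_LIMSEQ_real[OF lim]) measurable
  show "AE x in M. 0 \<le> g x" by (intro AE_I2 LIMSEQ_le_const[OF lim]) (use assms(2) in auto)
  have "(\<integral>\<^sup>+x. ennreal (g x) \<partial>M) = (\<integral>\<^sup>+x. liminf (\<lambda>n. ennreal (h n x)) \<partial>M)"
    by (intro nn_integral_cong lim_imp_Liminf[symmetric] tendsto_ennrealI lim) simp
  also have "\<dots> \<le> liminf (\<lambda>n. \<integral>\<^sup>+x. ennreal (h n x) \<partial>M)" by (rule nn_integral_liminf) measurable
  also have "\<dots> \<le> liminf (\<lambda>n :: nat. ennreal B)"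
  proof (intro Liminf_mono always_eventually allI)
    fix n show "(\<integral>\<^sup>+x. ennreal (h n x) \<partial>M) \<le> ennreal B"
      using assms(3)[of n] by (subst nn_integral_eq_integral) (auto intro!: assms ennreal_leI)
  qed
  also have "\<dots> = ennreal B" by (simp add: Liminf_const)
  also have "\<dots> < \<infinity>" by simp
  finally show "(\<integral>\<^sup>+x. ennreal (g x) \<partial>M) < \<infinity>" .
qed

text \<open>Squaring the positive part makes the function C1 across the sphere |x| = n + 1, and it
  keeps the gradient proportional to the square root of the cutoff.\<close>

definition cutoff :: "nat \<Rightarrow> real ^ 'n \<Rightarrow> real"
  where "cutoff n x = (max 0 (1 - (x \<bullet> x) / (real (Suc n))^2))^2"

definition cutoff_grad :: "nat \<Rightarrow> real ^ 'n \<Rightarrow> real ^ 'n"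
  where "cutoff_grad n x = (- 4 * max 0 (1 - (x \<bullet> x) / (real (Suc n))^2) / (real (Suc n))^2) *\<^sub>R x"

lemma max0_square_has_real_derivative:
  "((\<lambda>t::real. (max 0 t)^2) has_real_derivative 2 * max 0 t) (at t)"
proof (cases t "0 :: real" rule: linorder_cases)
  case less
  have "((\<lambda>t::real. 0) has_real_derivative 2 * max 0 t) (at t)" using less by simp
  then show ?thesis by (rule has_field_derivative_transform_within_open[of _ _ _ "{..<0}"]) (use less in auto)
next
  case greater
  have "((\<lambda>t::real. t^2) has_real_derivative 2 * max 0 t) (at t)" using greater by (auto intro!: derivative_eq_intros)
  then show ?thesis by (rule has_field_derivative_transform_within_open[of _ _ _ "{0<..}"]) (use greater in auto)
next
  case equal
  have "((\<lambda>h::real. ((max 0 h)^2 - 0) / h) \<longlongrightarrow> 0) (at 0)"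
  proof (rule tendsto_0_le[where K = 1 and f = "\<lambda>h::real. h"])
    show "\<forall>\<^sub>F h in at 0. norm (((max 0 h)^2 - 0) / h) \<le> norm (h::real) * 1"
      by (auto simp: eventually_at_filter max_def power2_eq_square)
  qed (rule tendsto_ident_at)
  then show ?thesis using equal by (simp add: has_field_derivative_iff)
qed

lemma cutoff_C1: "C1 (cutoff n) (cutoff_grad n)"
proof -
  have 1: "C1 (\<lambda>x :: real ^ 'a. 1 - (1 / (real (Suc n))^2) * (x \<bullet> x)) (\<lambda>x. 0 - (1 / (real (Suc n))^2) *\<^sub>R (2 *\<^sub>R x))"
    by (intro C1_diff C1_scale C1_inner_self) (simp add: C1_def)
  have "C1 (\<lambda>x :: real ^ 'a. (max 0 (1 - (1 / (real (Suc n))^2) * (x \<bullet> x)))^2)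
     (\<lambda>x. (2 * max 0 (1 - (1 / (real (Suc n))^2) * (x \<bullet> x))) *\<^sub>R (0 - (1 / (real (Suc n))^2) *\<^sub>R (2 *\<^sub>R x)))"
    by (rule C1_compose[OF 1]) (auto intro!: max0_square_has_real_derivative continuous_intros)
  moreover have "(1 / c) * (x \<bullet> x) = (x \<bullet> x) / c" for c and x :: "real ^ 'a" by simp
  moreover have "(2 * m) *\<^sub>R (0 - (1 / c) *\<^sub>R (2 *\<^sub>R x)) = (- 4 * m / c) *\<^sub>R x" for m c and x :: "real ^ 'a"
    by simp
  ultimately show ?thesis unfolding cutoff_def[abs_def] cutoff_grad_def[abs_def] by (simp only:)
qed

lemma cutoff_C1c: "C1c (cutoff n) (cutoff_grad n)"
  unfolding C1c_def
proof (intro conjI exI[of _ "real (Suc n)"] allI impI cutoff_C1)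
  fix x :: "real ^ 'a" assume "norm x \<ge> real (Suc n)"
  then have "x \<bullet> x \<ge> (real (Suc n))^2" unfolding power2_norm_eq_inner[symmetric] by (intro power_mono) auto
  then have "1 - (x \<bullet> x) / (real (Suc n))^2 \<le> 0" by simp
  then have "max 0 (1 - (x \<bullet> x) / (real (Suc n))^2) = 0" by (rule max_absorb1)
  then show "cutoff n x = 0" "cutoff_grad n x = 0" by (simp_all only: cutoff_def cutoff_grad_def) auto
qed

lemma cutoff_bounds: "0 \<le> cutoff n x" "cutoff n x \<le> 1"
proof -
  show "0 \<le> cutoff n x" by (simp add: cutoff_def)
  show "cutoff n x \<le> 1" unfolding cutoff_def by (intro power_le_one) auto
qed

text \<open>The gradient of a square m^2 carries the factor m, here the square root of the cutoff;
  this later permits absorption by Young's inequality. On the support |x| <= n + 1, hence <x> <= 2(n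
  + 1), which converts |x|/(n+1)^2 into 2/<x>.\<close>

lemma cutoff_grad_bound: "norm (cutoff_grad n x) \<le> 8 / jb x * sqrt (cutoff n x)"
proof -
  define m where "m = max 0 (1 - (x \<bullet> x) / (real (Suc n))^2)"
  define N where "N = real (Suc n)"
  have m0: "m \<ge> 0" by (simp add: m_def)
  have c: "sqrt (cutoff n x) = m" unfolding cutoff_def m_def[symmetric] using m0 by simp
  have N: "N \<ge> 1" by (simp add: N_def)
  show ?thesis
  proof (cases "m = 0")
    case True
    have "norm (cutoff_grad n x) = 0" unfolding cutoff_grad_def m_def[symmetric] True by simp
    then show ?thesis unfolding c True by linarith
  next
    case False
    then have "x \<bullet> x / N^2 < 1" unfolding m_def N_def[symmetric] by auto
    then have "(norm x)^2 < N^2" using N by (simp add: power2_norm_eq_inner)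
    then have nx: "norm x \<le> N" using N power2_less_imp_less[of "norm x" N] by linarith
    have "jb x \<le> 1 + norm x" by (rule jb_le_1_norm)
    then have "jb x \<le> 2 * N" using nx N by simp
    then have "norm x * jb x \<le> N * (2 * N)" using nx jb_pos[of x] N by (intro mult_mono) auto
    then have "norm x * jb x \<le> 2 * N^2" by (simp add: power2_eq_square)
    then have "norm x / N^2 \<le> 2 / jb x" using N jb_pos[of x] by (simp add: field_simps)
    then have "(4 * m) * (norm x / N^2) \<le> (4 * m) * (2 / jb x)" using m0 by (intro mult_left_mono) auto
    moreover have "norm (cutoff_grad n x) = (4 * m) * (norm x / N^2)"
      unfolding cutoff_grad_def m_def[symmetric] unfolding N_def[symmetric] using m0 by simp
    ultimately show ?thesis unfolding c by simp
  qed
qed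

lemma cutoff_tendsto: "(\<lambda>n. cutoff n x) \<longlonglongrightarrow> 1" "(\<lambda>n. cutoff_grad n x) \<longlonglongrightarrow> 0"
proof -
  have i: "(\<lambda>n. 1 / (real (Suc n))^2) \<longlonglongrightarrow> 0"
    using tendsto_power[OF LIMSEQ_Suc[OF lim_1_over_n[where 'a=real]], of 2] by (simp add: power_divide)
  have m: "(\<lambda>n. max 0 (1 - (x \<bullet> x) * (1 / (real (Suc n))^2))) \<longlonglongrightarrow> max 0 (1 - (x \<bullet> x) * 0)"
    by (intro tendsto_intros i)
  from tendsto_power[OF m, of 2] show "(\<lambda>n. cutoff n x) \<longlonglongrightarrow> 1" by (simp add: cutoff_def)
  have "(\<lambda>n. (- 4 * max 0 (1 - (x \<bullet> x) * (1 / (real (Suc n))^2)) * (1 / (real (Suc n))^2)) *\<^sub>R x) \<longlonglongrightarrow> (- 4 * max 0 (1 - (x \<bullet> x) * 0) * 0) *\<^sub>R x"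
    by (intro tendsto_intros m i)
  then show "(\<lambda>n. cutoff_grad n x) \<longlonglongrightarrow> 0" by (simp add: cutoff_grad_def)
qed

text \<open>Growth of order \<open>kp\<close> with a gradient of one order less: the class that is
  preserved, with uniform constants, under multiplication by the cutoffs.\<close>

definition adm :: "real \<Rightarrow> (real ^ 'n \<Rightarrow> real) \<Rightarrow> (real ^ 'n \<Rightarrow> real ^ 'n) \<Rightarrow> bool"
  where "adm kp s S \<longleftrightarrow> C1 s S \<and>
    (\<exists>C. \<forall>x. \<bar>s x\<bar> \<le> C * jb x powr kp \<and> norm (S x) \<le> C * jb x powr (kp - 1))"

text \<open>One limit argument for all three identities: \<open>F\<close> is the density of an
  identity as a function of the value and the gradient of the multiplier. Since the gradient of the
  cutoff is O(1/<x>), the truncated multipliers obey the same bounds uniformly, and dominated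
  convergence removes the cutoff.\<close>

lemma cutoff_extension:
  fixes F :: "real ^ 'n \<Rightarrow> real \<Rightarrow> real ^ 'n \<Rightarrow> real"
  assumes cont: "continuous_on UNIV (\<lambda>(x, a, b). F x a b)"
    and bd: "\<And>x a b. \<bar>F x a b\<bar> \<le> K * q x * (abs a + jb x * norm b)" and K: "K \<ge> 0" "\<And>x. q x \<ge> 0"
    and cpt: "\<And>s S. C1c s S \<Longrightarrow> (LBINT x. F x (s x) (S x)) = 0"
    and int: "integrable lborel (\<lambda>x. jb x powr kp * q x)" and s: "adm kp s S"
  shows "integrable lborel (\<lambda>x. F x (s x) (S x))" "(LBINT x. F x (s x) (S x)) = 0"
proof -
  obtain C where C: "\<And>x. \<bar>s x\<bar> \<le> C * jb x powr kp" "\<And>x. norm (S x) \<le> C * jb x powr (kp - 1)"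
    and s1: "C1 s S" using s by (auto simp: adm_def)
  have C0: "C \<ge> 0" using C(1)[of 0] by (auto simp: jbracket_def dest: order_trans[OF abs_ge_zero])
  define sn where "sn n x = cutoff n x * s x" for n x
  define Sn where "Sn n x = cutoff n x *\<^sub>R S x + s x *\<^sub>R cutoff_grad n x" for n x
  have n1: "C1c (sn n) (Sn n)" for n unfolding sn_def Sn_def by (rule C1c_mult_left[OF cutoff_C1c s1])
  have meas: "(\<lambda>x. F x (a x) (b x)) \<in> borel_measurable lborel" if "C1 a b" for a b
  proof -
    have "continuous_on UNIV (\<lambda>x. case (x, a x, b x) of (x, a, b) \<Rightarrow> F x a b)"
      by (rule continuous_on_compose2[OF cont]) (auto intro!: continuous_intros C1_continuous[OF that] C1_D_continuous[OF that])
    then show ?thesis by (simp add: borel_measurable_continuous_onI)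
  qed
  have bn: "\<bar>F x (sn n x) (Sn n x)\<bar> \<le> (10 * K * C) * (jb x powr kp * q x)" for n x
  proof -
    have j: "jb x > 0" by (rule jb_pos)
    have pw: "jb x * jb x powr (kp - 1) = jb x powr kp" using j by (simp add: powr_diff)
    have a: "\<bar>sn n x\<bar> \<le> C * jb x powr kp"
    proof -
      have "\<bar>sn n x\<bar> = cutoff n x * \<bar>s x\<bar>" unfolding sn_def abs_mult by (simp add: cutoff_bounds)
      also have "\<dots> \<le> 1 * (C * jb x powr kp)" using C(1)[of x] cutoff_bounds[of n x] by (intro mult_mono) auto
      finally show ?thesis by simp
    qed
    have b: "jb x * norm (Sn n x) \<le> 9 * (C * jb x powr kp)"
    proof -
      have sq: "sqrt (cutoff n x) \<le> 1" using cutoff_bounds[of n x] by simp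
      have g: "norm (cutoff_grad n x) \<le> 8 / jb x"
        using cutoff_grad_bound[of n x] mult_left_mono[OF sq, of "8 / jb x"] j by simp
      have "norm (Sn n x) \<le> cutoff n x * norm (S x) + \<bar>s x\<bar> * norm (cutoff_grad n x)"
        unfolding Sn_def by (rule order_trans[OF norm_triangle_ineq]) (simp add: cutoff_bounds)
      also have "\<dots> \<le> 1 * (C * jb x powr (kp - 1)) + (C * jb x powr kp) * (8 / jb x)"
        using C(1)[of x] C(2)[of x] g cutoff_bounds[of n x] C0 by (intro add_mono mult_mono) auto
      finally have "jb x * norm (Sn n x) \<le> jb x * (1 * (C * jb x powr (kp - 1)) + (C * jb x powr kp) * (8 / jb x))"
        using j by (intro mult_left_mono) auto
      also have "\<dots> = C * (jb x * jb x powr (kp - 1)) + 8 * (C * jb x powr kp)"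
        using j by (simp add: distrib_left)
      finally show ?thesis unfolding pw by simp
    qed
    have "\<bar>F x (sn n x) (Sn n x)\<bar> \<le> K * q x * (\<bar>sn n x\<bar> + jb x * norm (Sn n x))" by (rule bd)
    also have "\<dots> \<le> K * q x * (10 * (C * jb x powr kp))" using a b K by (intro mult_left_mono) auto
    finally show ?thesis by (simp add: mult_ac)
  qed
  have lim: "(\<lambda>n. F x (sn n x) (Sn n x)) \<longlonglongrightarrow> F x (s x) (S x)" for x
  proof -
    have "isCont (\<lambda>(x, a, b). F x a b) (x, s x, S x)" using cont by (simp add: continuous_on_eq_continuous_at)
    moreover have "(\<lambda>n. (x, sn n x, Sn n x)) \<longlonglongrightarrow> (x, 1 * s x, 1 *\<^sub>R S x + s x *\<^sub>R 0)"
      unfolding sn_def Sn_def by (intro tendsto_intros cutoff_tendsto)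
    ultimately have "(\<lambda>n. (\<lambda>(x, a, b). F x a b) (x, sn n x, Sn n x)) \<longlonglongrightarrow> (\<lambda>(x, a, b). F x a b) (x, s x, S x)"
      by (intro isCont_tendsto_compose[of "(x, s x, S x)" "\<lambda>(x, a, b). F x a b" "\<lambda>n. (x, sn n x, Sn n x)"]) simp_all
    then show ?thesis by simp
  qed
  note dct = meas[OF s1] integrable_mult_right[OF int, of "10 * K * C"]
  show "integrable lborel (\<lambda>x. F x (s x) (S x))"
    by (rule integrable_dominated_convergence[OF dct(1) _ dct(2), where s = "\<lambda>n x. F x (sn n x) (Sn n x)"])
      (use lim bn meas[OF C1c_C1[OF n1]] in auto)
  have "(\<lambda>n. \<integral>x. F x (sn n x) (Sn n x) \<partial>lborel) \<longlonglongrightarrow> (LBINT x. F x (s x) (S x))"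
    by (rule integral_dominated_convergence[OF dct(1) _ dct(2)]) (use lim bn meas[OF C1c_C1[OF n1]] in auto)
  then show "(LBINT x. F x (s x) (S x)) = 0" unfolding cpt[OF n1] by (simp add: LIMSEQ_const_iff)
qed

section \<open>Weighted estimates for real solutions\<close>

lemma norm_inner_le_jb: "\<bar>x \<bullet> y\<bar> \<le> jb x * norm y"
  by (rule order_trans[OF Cauchy_Schwarz_ineq2]) (simp add: mult_right_mono norm_le_jb)

lemma mult_le_sum_squares: "abs u * g \<le> u^2 + (g::real)^2"
proof -
  have "0 \<le> (abs u - g)^2 + u^2 + g^2" by simp
  then show ?thesis by (simp add: power2_diff)
qed

lemma energy_density_le:
  fixes u g k :: real
  shows "\<bar>g^2 - k^2 * u^2\<bar> \<le> (1 + k^2) * (u^2 + g^2)"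
proof -
  have "0 \<le> k^2 * u^2" "0 \<le> k^2 * g^2" "0 \<le> u^2" "0 \<le> g^2" by simp_all
  then show ?thesis unfolding abs_le_iff distrib_left distrib_right by auto
qed

text \<open>The source stands for a real potential times \<open>u\<close>. The decay <x>^(-2) makes
  even f (x \<bullet> G), the worst term of the Pohozaev identity, smaller than \<open>q\<close> by
  a factor 1/<x>.\<close>

locale helmholtz_solution =
  fixes k A :: real and u f :: "real ^ 'n \<Rightarrow> real" and G :: "real ^ 'n \<Rightarrow> real ^ 'n"
  assumes sol: "weak_sol k u G f" and k: "k > 0" and A: "A \<ge> 0"
    and f: "\<And>x. \<bar>f x\<bar> \<le> A * jb x powr (-2) * \<bar>u x\<bar>"
begin

abbreviation q :: "real ^ 'n \<Rightarrow> real" where "q x \<equiv> (u x)^2 + (norm (G x))^2"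

lemma u1: "C1 u G" and fc: "continuous_on UNIV f" using sol by (auto simp: weak_sol_def)
lemmas uc = C1_continuous[OF u1] and Gc = C1_D_continuous[OF u1]

lemma f_jb: "\<bar>f x\<bar> * jb x \<le> A * \<bar>u x\<bar> / jb x"
  and f_le: "\<bar>f x\<bar> \<le> A * \<bar>u x\<bar> / jb x"
proof -
  have j: "jb x \<ge> 1" by (rule jb_ge_1)
  have "jb x powr (-2) = 1 / (jb x * jb x)" using j by (simp add: powr_minus_divide power2_eq_square)
  then have "\<bar>f x\<bar> * jb x \<le> (A * (1 / (jb x * jb x)) * \<bar>u x\<bar>) * jb x"
    using f[of x] j by (intro mult_right_mono) auto
  then show 1: "\<bar>f x\<bar> * jb x \<le> A * \<bar>u x\<bar> / jb x" using j by simp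
  have "\<bar>f x\<bar> * 1 \<le> \<bar>f x\<bar> * jb x" using j by (intro mult_left_mono) auto
  then show "\<bar>f x\<bar> \<le> A * \<bar>u x\<bar> / jb x" using 1 by simp
qed

lemma f_jb': "\<bar>f x\<bar> * jb x \<le> A * \<bar>u x\<bar>" "\<bar>f x\<bar> \<le> A * \<bar>u x\<bar>"
proof -
  have j: "jb x \<ge> 1" by (rule jb_ge_1)
  have "A * \<bar>u x\<bar> / jb x \<le> A * \<bar>u x\<bar> / 1" using j A by (intro divide_left_mono) auto
  then show "\<bar>f x\<bar> * jb x \<le> A * \<bar>u x\<bar>" "\<bar>f x\<bar> \<le> A * \<bar>u x\<bar>" using f_jb[of x] f_le[of x] by simp_all
qed

lemma q_nonneg: "q x \<ge> 0" by simp

lemma q_terms: "(u x)^2 \<le> q x" "(norm (G x))^2 \<le> q x" "\<bar>u x\<bar> * norm (G x) \<le> q x"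
    "\<bar>(norm (G x))^2 - k^2 * (u x)^2\<bar> \<le> (1 + k^2) * q x"
  using mult_le_sum_squares[of "u x" "norm (G x)"] energy_density_le[of "norm (G x)" k "u x"] by simp_all

abbreviation E :: "real ^ 'n \<Rightarrow> real" where "E x \<equiv> (norm (G x))^2 - k^2 * (u x)^2"
abbreviation dv :: "real ^ 'n \<Rightarrow> real \<Rightarrow> real ^ 'n \<Rightarrow> real" where "dv x a b \<equiv> real CARD('n) * a + x \<bullet> b"
abbreviation m :: "real ^ 'n \<Rightarrow> real \<Rightarrow> real ^ 'n \<Rightarrow> real" where "m x a b \<equiv> abs a + jb x * norm b"

text \<open>The letters P, E and D stand for the Pohozaev, energy and divergence identities: each
  density has the source moved to the left side, with \<open>a\<close> and \<open>b\<close> in the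
  places of the multiplier and its gradient.\<close>

definition FP :: "real ^ 'n \<Rightarrow> real \<Rightarrow> real ^ 'n \<Rightarrow> real"
  where "FP x a b = a * (norm (G x))^2 + (G x \<bullet> b) * (x \<bullet> G x) - (1/2) * dv x a b * E x - f x * a * (x \<bullet> G x)"

definition FE :: "real ^ 'n \<Rightarrow> real \<Rightarrow> real ^ 'n \<Rightarrow> real"
  where "FE x a b = a * E x + u x * (G x \<bullet> b) - f x * a * u x"

definition FD :: "real ^ 'n \<Rightarrow> real \<Rightarrow> real ^ 'n \<Rightarrow> real"
  where "FD x a b = 2 * a * u x * (x \<bullet> G x) + dv x a b * (u x)^2"

lemma F_cont:
  "continuous_on UNIV (\<lambda>(x, a, b). FP x a b)" "continuous_on UNIV (\<lambda>(x, a, b). FE x a b)" "continuous_on UNIV (\<lambda>(x, a, b). FD x a b)"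
  unfolding FP_def FE_def FD_def case_prod_beta
  by (intro continuous_intros continuous_on_compose2[OF uc] continuous_on_compose2[OF Gc] continuous_on_compose2[OF fc]; simp)+

lemma F_compact:
  assumes s: "C1c s S"
  shows "(LBINT x. FP x (s x) (S x)) = 0" "(LBINT x. FE x (s x) (S x)) = 0" "(LBINT x. FD x (s x) (S x)) = 0"
proof -
  note c = uc Gc fc C1_continuous[OF C1c_C1[OF s]] C1_D_continuous[OF C1c_C1[OF s]]
  have P: "integrable lborel (\<lambda>x. s x * (norm (G x))^2 + (G x \<bullet> S x) * (x \<bullet> G x) - (1/2) * dv x (s x) (S x) * E x)"
      "integrable lborel (\<lambda>x. f x * s x * (x \<bullet> G x))"
    and E: "integrable lborel (\<lambda>x. s x * E x + u x * (G x \<bullet> S x))" "integrable lborel (\<lambda>x. f x * s x * u x)"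
    by (rule C1_UNIV_integrals[OF _ s]; auto intro!: continuous_intros c)+
  show "(LBINT x. FP x (s x) (S x)) = 0"
    unfolding FP_def lebesgue_diff[OF P] pohozaev_compact[OF sol s] by simp
  show "(LBINT x. FE x (s x) (S x)) = 0"
    unfolding FE_def lebesgue_diff[OF E] energy_compact[OF sol s] by simp
  show "(LBINT x. FD x (s x) (S x)) = 0" unfolding FD_def by (rule divergence_compact[OF u1 s])
qed

lemma m_ge: "abs a \<le> m x a b" "jb x * norm b \<le> m x a b" "norm b \<le> m x a b" "\<bar>dv x a b\<bar> \<le> real CARD('n) * m x a b"
proof -
  have N: "real CARD('n) \<ge> 1" by (simp add: Suc_leI)
  have b0: "norm b \<le> jb x * norm b" using mult_right_mono[OF jb_ge_1[of x] norm_ge_zero[of b]] by simp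
  show "abs a \<le> m x a b" "jb x * norm b \<le> m x a b" "norm b \<le> m x a b"
    using b0 order_trans[OF norm_ge_zero b0] by auto
  have "\<bar>dv x a b\<bar> \<le> real CARD('n) * abs a + 1 * (jb x * norm b)"
    using norm_inner_le_jb[of x b] abs_triangle_ineq[of "real CARD('n) * a" "x \<bullet> b"] by (simp add: abs_mult)
  also have "\<dots> \<le> real CARD('n) * abs a + real CARD('n) * (jb x * norm b)"
    by (intro add_left_mono mult_right_mono N) simp
  finally show "\<bar>dv x a b\<bar> \<le> real CARD('n) * m x a b" by (simp add: distrib_left)
qed

lemma xG_le: "\<bar>u x\<bar> * \<bar>x \<bullet> G x\<bar> \<le> jb x * q x"
proof -
  have "\<bar>u x\<bar> * \<bar>x \<bullet> G x\<bar> \<le> \<bar>u x\<bar> * (jb x * norm (G x))" by (intro mult_left_mono norm_inner_le_jb) auto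
  also have "\<dots> = jb x * (\<bar>u x\<bar> * norm (G x))" by simp
  also have "\<dots> \<le> jb x * q x" using q_terms[of x] by (intro mult_left_mono) auto
  finally show ?thesis .
qed

lemma FP_bound: "\<bar>FP x a b\<bar> \<le> (2 + real CARD('n) * (1 + k^2) + A) * q x * m x a b"
proof -
  have 1: "\<bar>a * (norm (G x))^2\<bar> \<le> m x a b * q x" unfolding abs_mult using q_terms[of x] m_ge by (intro mult_mono) auto
  have "\<bar>(G x \<bullet> b) * (x \<bullet> G x)\<bar> \<le> (norm (G x) * norm b) * (jb x * norm (G x))"
    unfolding abs_mult by (intro mult_mono Cauchy_Schwarz_ineq2 norm_inner_le_jb) auto
  also have "\<dots> = (jb x * norm b) * (norm (G x))^2" by (simp add: power2_eq_square)
  also have "\<dots> \<le> m x a b * q x" using q_terms[of x] by (intro mult_mono) auto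
  finally have 2: "\<bar>(G x \<bullet> b) * (x \<bullet> G x)\<bar> \<le> m x a b * q x" .
  have "\<bar>(1/2) * dv x a b * E x\<bar> \<le> \<bar>dv x a b\<bar> * \<bar>E x\<bar>" unfolding abs_mult by simp
  also have "\<dots> \<le> (real CARD('n) * m x a b) * ((1 + k^2) * q x)" by (intro mult_mono m_ge q_terms) auto
  finally have 3: "\<bar>(1/2) * dv x a b * E x\<bar> \<le> real CARD('n) * (1 + k^2) * (m x a b * q x)" by (simp only: mult_ac)
  have "\<bar>f x * a * (x \<bullet> G x)\<bar> \<le> \<bar>f x\<bar> * abs a * (jb x * norm (G x))"
    unfolding abs_mult by (intro mult_left_mono norm_inner_le_jb) auto
  also have "\<dots> = (\<bar>f x\<bar> * jb x) * (norm (G x) * abs a)" by (simp only: mult_ac)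
  also have "\<dots> \<le> (A * \<bar>u x\<bar>) * (norm (G x) * abs a)" by (intro mult_right_mono f_jb') auto
  also have "\<dots> = A * (abs a * (\<bar>u x\<bar> * norm (G x)))" by (simp only: mult_ac)
  also have "\<dots> \<le> A * (m x a b * q x)" using A q_terms[of x] by (intro mult_left_mono mult_mono) auto
  finally have "\<bar>FP x a b\<bar> \<le> 2 * (m x a b * q x) + real CARD('n) * (1 + k^2) * (m x a b * q x) + A * (m x a b * q x)"
    unfolding FP_def using 1 2 3 by (simp only: abs_le_iff) linarith
  then show ?thesis by (simp only: algebra_simps mult_1 mult_1_right)
qed

lemma FE_bound: "\<bar>FE x a b\<bar> \<le> (1 + (1 + k^2) + A) * q x * m x a b"
proof -
  have 1: "\<bar>a * E x\<bar> \<le> m x a b * ((1 + k^2) * q x)"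
    unfolding abs_mult by (intro mult_mono m_ge q_terms) auto
  have "\<bar>u x * (G x \<bullet> b)\<bar> \<le> \<bar>u x\<bar> * (norm (G x) * norm b)"
    unfolding abs_mult by (intro mult_left_mono Cauchy_Schwarz_ineq2) auto
  also have "\<dots> = norm b * (\<bar>u x\<bar> * norm (G x))" by simp
  also have "\<dots> \<le> m x a b * q x" by (intro mult_mono m_ge q_terms) auto
  finally have 2: "\<bar>u x * (G x \<bullet> b)\<bar> \<le> m x a b * q x" .
  have "\<bar>f x * a * u x\<bar> \<le> (A * \<bar>u x\<bar>) * abs a * \<bar>u x\<bar>"
    unfolding abs_mult by (intro mult_right_mono f_jb') auto
  also have "\<dots> = A * (abs a * (u x)^2)" by (simp add: power2_eq_square)
  also have "\<dots> \<le> A * (m x a b * q x)" using A by (intro mult_left_mono mult_mono m_ge q_terms) auto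
  finally have "\<bar>FE x a b\<bar> \<le> m x a b * q x + m x a b * ((1 + k^2) * q x) + A * (m x a b * q x)"
    unfolding FE_def using 1 2 by (simp only: abs_le_iff) linarith
  then show ?thesis by (simp only: algebra_simps mult_1 mult_1_right)
qed

text \<open>Here x \<bullet> G is accompanied neither by the decaying source nor by the gradient of
  the multiplier, so a factor <x> remains. This is why \<open>FD_adm\<close> asks for one more power
  in the weight.\<close>

lemma FD_bound: "\<bar>FD x a b\<bar> \<le> (2 + real CARD('n)) * (jb x * q x) * m x a b"
proof -
  have j: "jb x \<ge> 1" by (rule jb_ge_1)
  have "\<bar>2 * a * u x * (x \<bullet> G x)\<bar> = 2 * (abs a * (\<bar>u x\<bar> * \<bar>x \<bullet> G x\<bar>))" unfolding abs_mult by simp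
  also have "\<dots> \<le> 2 * (m x a b * (jb x * q x))" by (intro mult_left_mono mult_mono m_ge xG_le) auto
  finally have 1: "\<bar>2 * a * u x * (x \<bullet> G x)\<bar> \<le> 2 * (m x a b * (jb x * q x))" .
  have "\<bar>dv x a b * (u x)^2\<bar> = \<bar>dv x a b\<bar> * (1 * (u x)^2)" by (simp add: abs_mult)
  also have "\<dots> \<le> (real CARD('n) * m x a b) * (jb x * q x)" using j by (intro mult_mono m_ge q_terms) auto
  finally have "\<bar>FD x a b\<bar> \<le> 2 * (m x a b * (jb x * q x)) + real CARD('n) * (m x a b * (jb x * q x))"
    unfolding FD_def using 1 by (simp only: abs_le_iff mult.assoc) linarith
  then show ?thesis by (simp only: algebra_simps mult_1 mult_1_right)
qed

lemma F_adm:
  assumes s: "adm kp s S" and i: "integrable lborel (\<lambda>x. jb x powr kp * q x)"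
  shows "integrable lborel (\<lambda>x. FP x (s x) (S x))" "(LBINT x. FP x (s x) (S x)) = 0"
    "integrable lborel (\<lambda>x. FE x (s x) (S x))" "(LBINT x. FE x (s x) (S x)) = 0"
proof -
  have K: "2 + real CARD('n) * (1 + k^2) + A \<ge> 0" "1 + (1 + k^2) + A \<ge> 0" using A by auto
  show "integrable lborel (\<lambda>x. FP x (s x) (S x))" "(LBINT x. FP x (s x) (S x)) = 0"
    by (rule cutoff_extension[OF F_cont(1) FP_bound K(1) q_nonneg F_compact(1) i s]; assumption)+
  show "integrable lborel (\<lambda>x. FE x (s x) (S x))" "(LBINT x. FE x (s x) (S x)) = 0"
    by (rule cutoff_extension[OF F_cont(2) FE_bound K(2) q_nonneg F_compact(2) i s]; assumption)+
qed

lemma FD_adm: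
  assumes s: "adm kp s S" and i: "integrable lborel (\<lambda>x. jb x powr (kp + 1) * q x)"
  shows "integrable lborel (\<lambda>x. FD x (s x) (S x))" "(LBINT x. FD x (s x) (S x)) = 0"
proof -
  have q0: "jb x * q x \<ge> 0" for x using jb_pos[of x] by simp
  have i': "integrable lborel (\<lambda>x. jb x powr kp * (jb x * q x))"
    using i by (simp add: powr_add jb_nonneg mult.assoc)
  show "integrable lborel (\<lambda>x. FD x (s x) (S x))" "(LBINT x. FD x (s x) (S x)) = 0"
    by (rule cutoff_extension[OF F_cont(3) FD_bound _ q0 F_compact(3) i' s]; simp)+
qed

end

lemma C1_jb: "C1 jb (\<lambda>x. (1 / jb x) *\<^sub>R x)"
  using C1_sqrt[of 1] by (simp add: jbracket_def[abs_def] power2_norm_eq_inner)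

lemma C1_radial:
  assumes d: "\<And>t. t \<ge> 1 \<Longrightarrow> (sg has_real_derivative sg' t) (at t)" and c: "continuous_on {1..} sg'"
  shows "C1 (\<lambda>x. sg (jb x)) (\<lambda>x. (sg' (jb x) / jb x) *\<^sub>R x)"
proof -
  have "C1 (\<lambda>x. sg (jb x)) (\<lambda>x :: real ^ 'a. sg' (jb x) *\<^sub>R ((1 / jb x) *\<^sub>R x))"
    by (rule C1_compose[OF C1_jb])
      (auto intro: d jb_ge_1 continuous_on_subset[OF c])
  then show ?thesis by simp
qed

lemma C1_jb_powr: "C1 (\<lambda>x. jb x powr kp) (\<lambda>x. (kp * jb x powr (kp - 1) / jb x) *\<^sub>R x)"
  by (rule C1_radial) (auto intro!: derivative_eq_intros continuous_intros)

context helmholtz_solution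
begin

text \<open>Adding \<open>c\<close> times the energy density brings the leading coefficient of
  \<open>E\<close> to -d/2 with d = L - kp + dl. The coefficient of u^2 is then positive, since d >=
  dl > 0. For L >= 0 the gradient part is positive because d <= 3/2; for L < 0 the radial term loses
  at most |L| |G|^2, and 1 - d/2 + L >= (3/4)(kp + 1), the point that calls for kp > -1. All other
  terms are smaller by a factor 1/<x>.\<close>

lemma weight_pointwise:
  assumes s: "s \<ge> 0" and kp: "kp > -1" and L: "kp \<le> L" "L \<le> kp + 1"
    and dl_def: "dl = min (1/2) ((kp + 1) / 2)" and c_def: "c = (real CARD('n) + kp - dl) / 2"
    and S: "S = (s * L / (jb x)^2) *\<^sub>R x"
  shows "min (1/4) (min (3/4 * (kp + 1)) (dl * k^2 / 2)) * (s * q x)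
    - ((abs kp + 1) * (1 + k^2) + abs c * (abs kp + 1) + A + abs c * A) * (s / jb x * q x)
    \<le> FP x s S + c * FE x s S"
proof -
  define j where "j = jb x"
  define y where "y = (x \<bullet> G x) / j"
  define g where "g = (norm (G x))^2"
  define U where "U = (u x)^2"
  define E where "E = g - k^2 * U"
  have j: "j \<ge> 1" unfolding j_def by (rule jb_ge_1)
  have xG: "x \<bullet> G x = j * y" using j by (simp add: y_def)
  have gU: "g \<ge> 0" "U \<ge> 0" by (simp_all add: g_def U_def)
  have qx: "q x = U + g" by (simp add: g_def U_def)
  have y1: "abs y \<le> norm (G x)"
    using norm_inner_le_jb[of x "G x"] j by (simp add: y_def j_def[symmetric] divide_le_eq mult.commute)
  have y2: "y^2 \<le> g" using power_mono[OF y1, of 2] by (simp add: g_def)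
  have uG: "\<bar>u x\<bar> * norm (G x) \<le> q x" by (rule q_terms)
  have uy: "\<bar>u x\<bar> * abs y \<le> q x" using mult_left_mono[OF y1, of "\<bar>u x\<bar>"] uG by simp
  have xx: "x \<bullet> x = j^2 - 1" by (simp add: j_def jb_sq power2_norm_eq_inner)
  have xS: "x \<bullet> S = s * (L - L / j^2)"
  proof -
    have "x \<bullet> S = (s * L / j^2) * (j^2 - 1)" unfolding S j_def[symmetric] inner_scaleR_right xx ..
    also have "\<dots> = s * (L - L / j^2)" using j by (simp add: field_simps)
    finally show ?thesis .
  qed
  have GS: "G x \<bullet> S = s * (L * y / j)"
  proof -
    have "G x \<bullet> S = (s * L / j^2) * (j * y)" unfolding S j_def[symmetric] inner_scaleR_right xG[symmetric] by (simp add: inner_commute)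
    also have "\<dots> = s * (L * y / j)" using j by (simp add: power2_eq_square)
    finally show ?thesis .
  qed
  have dl: "dl > 0" "dl \<le> 1/2" "dl \<le> (kp + 1) / 2"
    using kp unfolding dl_def by (simp, intro min.cobounded1, intro min.cobounded2)
  \<comment> \<open>The three entries are lower bounds for the coefficient of |G|^2 when L >= 0, for
    the same coefficient when L < 0, and for the coefficient of u^2.\<close>
  define m where "m = min (1/4) (min (3/4 * (kp + 1)) (dl * k^2 / 2))"
  have m: "m \<le> 1/4" "m \<le> 3/4 * (kp + 1)" "m \<le> dl * k^2 / 2"
    unfolding m_def by (rule min.cobounded1, rule min.coboundedI2[OF min.cobounded1], rule min.coboundedI2[OF min.cobounded2])
  define d where "d = L - kp + dl"
  have main: "m * q x \<le> g + L * y^2 - (1/2) * d * E"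
  proof -
    have a: "m * g \<le> (1 - d / 2) * g + L * y^2"
    proof (cases "L \<ge> 0")
      case True
      have "m \<le> 1 - d / 2" using m(1) L dl unfolding d_def by argo
      then have "m * g \<le> (1 - d / 2) * g" by (intro mult_right_mono gU)
      then show ?thesis using True by (simp add: add_increasing2)
    next
      case False
      have "m \<le> 1 - d / 2 + L" using m(2) L dl False unfolding d_def by argo
      then have "m * g \<le> (1 - d / 2 + L) * g" by (intro mult_right_mono gU)
      moreover have "L * g \<le> L * y^2" using False y2 by (intro mult_left_mono_neg) auto
      ultimately show ?thesis by (simp add: distrib_right)
    qed
    have "dl * k^2 / 2 \<le> d * k^2 / 2" using L by (intro divide_right_mono mult_right_mono) (auto simp: d_def)
    then have b: "m * U \<le> d * k^2 / 2 * U" using m(3) by (intro mult_right_mono gU) auto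
    have "g + L * y^2 - (1/2) * d * E = ((1 - d / 2) * g + L * y^2) + d * k^2 / 2 * U"
      by (simp add: E_def field_simps)
    then show ?thesis using a b unfolding qx distrib_left by linarith
  qed
  define K where "K = abs kp + 1"
  have LK: "abs L \<le> K" using L by (auto simp: K_def)
  have e1: "\<bar>(1/2) * (L / j^2) * E\<bar> \<le> K * (1 + k^2) * (q x / j)"
  proof -
    have "\<bar>L / j^2\<bar> \<le> K / j"
    proof -
      have "\<bar>L / j^2\<bar> = abs L / j / j" using j by (simp add: power2_eq_square)
      also have "\<dots> \<le> (abs L / j) / 1" using j by (intro divide_left_mono) auto
      also have "\<dots> \<le> K / j" using LK j by (simp add: divide_right_mono)
      finally show ?thesis .
    qed
    moreover have "abs E \<le> (1 + k^2) * q x" unfolding E_def g_def U_def by (rule q_terms)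
    ultimately have "\<bar>L / j^2\<bar> * abs E \<le> (K / j) * ((1 + k^2) * q x)" using LK j by (intro mult_mono) auto
    moreover have "\<bar>(1/2) * a * b\<bar> \<le> abs a * abs b" for a b :: real
      using mult_nonneg_nonneg[OF abs_ge_zero[of a] abs_ge_zero[of b]] by (simp add: abs_mult)
    moreover note this[of "L / j^2" E]
    ultimately show ?thesis by (simp add: mult_ac)
  qed
  have e2: "\<bar>f x * (x \<bullet> G x)\<bar> \<le> A * (q x / j)"
  proof -
    have "\<bar>f x * (x \<bullet> G x)\<bar> \<le> \<bar>f x\<bar> * (j * norm (G x))"
      unfolding abs_mult j_def by (intro mult_left_mono norm_inner_le_jb) auto
    also have "\<dots> \<le> (A * \<bar>u x\<bar> / j) * norm (G x)"
      using mult_right_mono[OF f_jb[of x] norm_ge_zero[of "G x"]] by (simp add: j_def mult.assoc)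
    also have "\<dots> = A / j * (\<bar>u x\<bar> * norm (G x))" by simp
    also have "\<dots> \<le> A / j * q x" using A j uG by (intro mult_left_mono) auto
    finally show ?thesis by simp
  qed
  have e3: "\<bar>c * (u x * (L * y / j))\<bar> \<le> abs c * K * (q x / j)"
  proof -
    have "\<bar>c * (u x * (L * y / j))\<bar> = abs c * (abs L * ((\<bar>u x\<bar> * abs y) / j))" using j by (simp add: abs_mult)
    also have "\<dots> \<le> abs c * (K * (q x / j))" using uy LK j by (intro mult_left_mono mult_mono divide_right_mono) auto
    finally show ?thesis by simp
  qed
  have e4: "\<bar>c * (f x * u x)\<bar> \<le> abs c * A * (q x / j)"
  proof -
    have "\<bar>f x * u x\<bar> \<le> (A * \<bar>u x\<bar> / j) * \<bar>u x\<bar>" unfolding abs_mult j_def by (intro mult_right_mono f_le) auto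
    also have "\<dots> = A / j * U" by (simp add: U_def power2_eq_square)
    also have "\<dots> \<le> A / j * q x" using A j gU by (intro mult_left_mono) (auto simp: qx)
    finally have "abs c * \<bar>f x * u x\<bar> \<le> abs c * (A / j * q x)" by (intro mult_left_mono) auto
    then show ?thesis by (simp add: abs_mult)
  qed
  have eq: "FP x s S + c * FE x s S = s * ((g + L * y^2 - (1/2) * d * E) + (1/2) * (L / j^2) * E - f x * (x \<bullet> G x) + c * (u x * (L * y / j)) - c * (f x * u x))"
  proof -
    have r: "(s * (L * y / j)) * (j * y) = s * (L * y^2)" using j by (simp add: power2_eq_square)
    have "FP x s S + c * FE x s S = s * g + s * (L * y^2) - (1/2) * (real CARD('n) * s + s * (L - L / j^2)) * E - f x * s * (x \<bullet> G x)
        + c * (s * E + u x * (s * (L * y / j)) - f x * s * u x)"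
      unfolding FP_def FE_def xS GS g_def[symmetric] U_def[symmetric] E_def[symmetric] r[symmetric] by (simp only: xG)
    also have "\<dots> = s * ((g + L * y^2 - (1/2) * (L + real CARD('n) - 2 * c) * E) + (1/2) * (L / j^2) * E - f x * (x \<bullet> G x) + c * (u x * (L * y / j)) - c * (f x * u x))"
      by algebra
    also have "L + real CARD('n) - 2 * c = d"
    proof -
      have "2 * (b / 2) = b" for b :: real by simp
      then have "2 * c = real CARD('n) + kp - dl" unfolding c_def .
      then show ?thesis unfolding d_def by linarith
    qed
    finally show ?thesis .
  qed
  have "m * q x - (K * (1 + k^2) + abs c * K + A + abs c * A) * (q x / j)
    \<le> (g + L * y^2 - (1/2) * d * E) + (1/2) * (L / j^2) * E - f x * (x \<bullet> G x) + c * (u x * (L * y / j)) - c * (f x * u x)"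
    using main e1 e2 e3 e4 unfolding distrib_right abs_le_iff by linarith
  from mult_left_mono[OF this s] show ?thesis
    unfolding eq m_def K_def j_def by (simp add: right_diff_distrib mult_ac)
qed

text \<open>The multiplier is \<open>\<langle>x\<rangle>\<^sup>k\<^sup>p\<^sup>+\<^sup>1 M / (\<langle>x\<rangle> + M)\<close>, which grows only like \<open>\<langle>x\<rangle>\<^sup>k\<^sup>p\<close>; then \<open>M\<close> tends to infinity.\<close>

lemma weight_gain:
  assumes kp: "kp > -1" and i: "integrable lborel (\<lambda>x. jb x powr kp * q x)"
  shows "integrable lborel (\<lambda>x. jb x powr (kp + 1) * q x)"
proof -
  define dl where "dl = min (1/2) ((kp + 1) / 2)"
  define c where "c = (real CARD('n) + kp - dl) / 2"
  define m where "m = min (1/4) (min (3/4 * (kp + 1)) (dl * k^2 / 2))"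
  define K where "K = (abs kp + 1) * (1 + k^2) + abs c * (abs kp + 1) + A + abs c * A"
  have m: "m > 0" using kp k by (simp add: m_def dl_def)
  have K: "K \<ge> 0" using A by (simp add: K_def)
  define h where "h n t = real (Suc n) / (t + real (Suc n))" for n and t :: real
  define sg where "sg n t = t powr (kp + 1) * h n t" for n t
  define sg' where "sg' n t = sg n t / t * (kp + h n t)" for n t
  have h: "0 < h n t" "h n t \<le> 1" "t * h n t \<le> real (Suc n)" if "t > 0" for n t
    using that unfolding h_def by (auto simp: divide_le_eq field_simps)
  have hd: "(h n has_real_derivative - h n t / (t + real (Suc n))) (at t)" if "t > 0" for n t
  proof -
    have "t + real (Suc n) \<noteq> 0" using that by linarith
    then have "((\<lambda>t. real (Suc n) / (t + real (Suc n))) has_real_derivative (0 * (t + real (Suc n)) - real (Suc n) * (1 + 0)) / ((t + real (Suc n)) * (t + real (Suc n)))) (at t)"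
      by (intro DERIV_divide DERIV_const DERIV_add DERIV_ident)
    moreover have "(0 * (t + M) - M * (1 + 0)) / ((t + M) * (t + M)) = - (M / (t + M)) / (t + M)" for M :: real by simp
    ultimately show ?thesis unfolding h_def by (simp only:)
  qed
  have sd: "(sg n has_real_derivative sg' n t) (at t)" if t: "t > 0" for n t
  proof -
    have "((\<lambda>t. t powr (kp + 1)) has_real_derivative (kp + 1) * t powr kp) (at t)"
      using has_real_derivative_powr[OF t, of "kp + 1"] by simp
    from DERIV_mult[OF this hd[OF t, of n]]
    have "(sg n has_real_derivative (kp + 1) * t powr kp * h n t + - h n t / (t + real (Suc n)) * t powr (kp + 1)) (at t)"
      by (simp add: sg_def[abs_def])
    moreover have "(kp + 1) * t powr kp * h n t + - h n t / (t + real (Suc n)) * t powr (kp + 1) = sg' n t"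
    proof -
      have p: "t powr (kp + 1) = t powr kp * t" using t by (simp add: powr_add)
      have ht: "t / (t + real (Suc n)) = 1 - h n t" unfolding h_def using t by (simp add: field_simps)
      have "(kp + 1) * t powr kp * h n t + - h n t / (t + real (Suc n)) * t powr (kp + 1)
         = t powr kp * h n t * (kp + 1 - t / (t + real (Suc n)))"
        unfolding p by (simp add: right_diff_distrib distrib_left distrib_right mult_ac)
      also have "\<dots> = sg' n t" unfolding ht sg'_def sg_def p using t by simp
      finally show ?thesis .
    qed
    ultimately show ?thesis by simp
  qed
  have sgc: "continuous_on {1..} (sg' n)" for n
    unfolding sg'_def sg_def h_def by (intro continuous_intros) (auto simp: add_nonneg_eq_0_iff)
  define s where "s n x = sg n (jb x)" for n and x :: "real ^ 'n"
  define S where "S n x = (sg' n (jb x) / jb x) *\<^sub>R x" for n and x :: "real ^ 'n"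
  have s1: "C1 (s n) (S n)" for n unfolding s_def S_def by (rule C1_radial[OF sd sgc]) auto
  have j: "jb x \<ge> 1" "jb x > 0" for x :: "real ^ 'n" using jb_ge_1[of x] by auto
  have s0: "s n x \<ge> 0" for n x unfolding s_def sg_def using h(1)[OF j(2)] by (simp add: less_imp_le)
  have sp: "s n x = jb x powr kp * (jb x * h n (jb x))" for n x
    unfolding s_def sg_def using j[of x] by (simp add: powr_add)
  have sj: "s n x / jb x \<le> jb x powr kp" for n x
    unfolding sp using mult_left_mono[OF h(2)[OF j(2), of n x], of "jb x powr kp"] j[of x] by simp
  have sM: "s n x \<le> real (Suc n) * jb x powr kp" for n x
    unfolding sp using mult_left_mono[OF h(3)[OF j(2), of x n], of "jb x powr kp"] by (simp only: mult.commute powr_ge_zero)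
  \<comment> \<open>t times the logarithmic derivative of \<open>sg n\<close> at t =
    \<open>jb x\<close>. It lies between kp and kp + 1, the range in which
    \<open>weight_pointwise\<close> applies.\<close>
  define L where "L n x = kp + h n (jb x)" for n and x :: "real ^ 'n"
  have L: "kp \<le> L n x" "L n x \<le> kp + 1" for n x using h(1,2)[OF j(2), of n x] by (auto simp: L_def)
  have S: "S n x = (s n x * L n x / (jb x)^2) *\<^sub>R x" for n x
    unfolding S_def sg'_def s_def L_def by (simp add: power2_eq_square)
  have ad: "adm kp (s n) (S n)" for n
    unfolding adm_def
  proof (intro conjI s1 exI allI)
    fix x :: "real ^ 'n"
    let ?C = "(1 + (abs kp + 1)) * real (Suc n)"
    have LK: "\<bar>L n x\<bar> \<le> abs kp + 1" using L[of n x] by auto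
    have "\<bar>s n x\<bar> \<le> 1 * (real (Suc n) * jb x powr kp)" using s0 sM by simp
    also have "\<dots> \<le> (1 + (abs kp + 1)) * (real (Suc n) * jb x powr kp)" by (intro mult_right_mono) auto
    finally show "\<bar>s n x\<bar> \<le> ?C * jb x powr kp" by (simp only: mult.assoc)
    have "norm (S n x) = s n x * \<bar>L n x\<bar> / (jb x)^2 * norm x" unfolding S using s0 by (simp add: abs_mult)
    also have "\<dots> \<le> s n x * \<bar>L n x\<bar> / (jb x)^2 * jb x"
      using s0 by (intro mult_left_mono norm_le_jb) auto
    also have "\<dots> = s n x * \<bar>L n x\<bar> / jb x" using j[of x] by (simp add: power2_eq_square)
    also have "\<dots> \<le> (real (Suc n) * jb x powr kp) * (abs kp + 1) / jb x"
      using s0 sM LK j[of x] by (intro divide_right_mono mult_mono) auto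
    also have "\<dots> = (abs kp + 1) * (real (Suc n) * jb x powr (kp - 1))" using j[of x] by (simp add: powr_diff)
    also have "\<dots> \<le> (1 + (abs kp + 1)) * (real (Suc n) * jb x powr (kp - 1))" by (intro mult_right_mono) auto
    finally show "norm (S n x) \<le> ?C * jb x powr (kp - 1)" by (simp only: mult.assoc)
  qed
  have qc: "(\<lambda>x. q x) \<in> borel_measurable lborel"
    by (simp add: borel_measurable_continuous_onI continuous_intros uc Gc)
  have sc: "s n \<in> borel_measurable lborel" for n
    using C1_continuous[OF s1[of n]] by (simp add: borel_measurable_continuous_onI)
  have si: "integrable lborel (\<lambda>x. s n x * q x)" for n
  proof (rule integrable_dominated[OF integrable_mult_right[OF i, of "real (Suc n)"]])
    show "(\<lambda>x. s n x * q x) \<in> borel_measurable lborel" using qc sc by measurable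
    show "AE x in lborel. norm (s n x * q x) \<le> norm (real (Suc n) * (jb x powr kp * q x))"
      using mult_right_mono[OF sM q_nonneg] s0 by (intro AE_I2) (simp add: mult.assoc)
  qed
  \<comment> \<open>The bound is uniform in \<open>n\<close>: the integral of the combined densities
    vanishes, and the lower order term is controlled by s n x / <x> <= <x>^kp for every
    \<open>n\<close>.\<close>
  have b: "(LBINT x. s n x * q x) \<le> K / m * (LBINT x. jb x powr kp * q x)" for n
  proof -
    note F = F_adm[OF ad[of n] i]
    have "(LBINT x. m * (s n x * q x) - K * (jb x powr kp * q x)) \<le> (LBINT x. FP x (s n x) (S n x) + c * FE x (s n x) (S n x))"
    proof (rule integral_mono)
      show "integrable lborel (\<lambda>x. m * (s n x * q x) - K * (jb x powr kp * q x))" using si i by auto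
      show "integrable lborel (\<lambda>x. FP x (s n x) (S n x) + c * FE x (s n x) (S n x))" using F by auto
      fix x :: "real ^ 'n"
      have "K * (s n x / jb x * q x) \<le> K * (jb x powr kp * q x)"
        using sj[of n x] K by (intro mult_left_mono mult_right_mono) auto
      then show "m * (s n x * q x) - K * (jb x powr kp * q x) \<le> FP x (s n x) (S n x) + c * FE x (s n x) (S n x)"
        using weight_pointwise[OF s0[of n x] kp L[of n x] dl_def c_def S[of n x]] unfolding m_def[symmetric] K_def[symmetric] by linarith
    qed
    also have "\<dots> = 0" using F by simp
    finally have "m * (LBINT x. s n x * q x) \<le> K * (LBINT x. jb x powr kp * q x)"
      using si[of n] i by simp
    then show ?thesis using m by (simp add: field_simps)
  qed
  have hl: "(\<lambda>n. h n t) \<longlonglongrightarrow> 1" for t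
  proof -
    have "(\<lambda>n. 1 / (t * (1 / real (Suc n)) + 1)) \<longlonglongrightarrow> 1 / (t * 0 + 1)"
      using LIMSEQ_Suc[OF lim_1_over_n[where 'a=real]] by (intro tendsto_intros) auto
    moreover have "h n t = 1 / (t * (1 / real (Suc n)) + 1)" for n
      unfolding h_def by (simp add: field_simps)
    ultimately show ?thesis by simp
  qed
  show ?thesis
  proof (rule integrable_pointwise_limit[OF si _ b])
    show "s n x * q x \<ge> 0" for n x using s0 by simp
    show "(\<lambda>n. s n x * q x) \<longlonglongrightarrow> jb x powr (kp + 1) * q x" for x
      using tendsto_mult[OF tendsto_mult[OF tendsto_const[of "jb x powr (kp + 1)"] hl[of "jb x"]] tendsto_const[of "q x"]]
      by (simp add: s_def sg_def)
  qed
qed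

lemma weight_all:
  assumes kp: "kp > -1" and i: "integrable lborel (\<lambda>x. jb x powr kp * q x)"
  shows "integrable lborel (\<lambda>x. jb x powr bt * q x)"
proof -
  have n: "integrable lborel (\<lambda>x. jb x powr (kp + real n) * q x)" for n
  proof (induction n)
    case (Suc n)
    have "integrable lborel (\<lambda>x. jb x powr (kp + real n + 1) * q x)"
      by (rule weight_gain[OF _ Suc.IH]) (use kp in simp)
    then show ?case by (simp add: add_ac)
  qed (use i in simp)
  obtain n where "real n \<ge> bt - kp" using real_arch_simple by blast
  then have le: "jb x powr bt \<le> jb x powr (kp + real n)" for x :: "real ^ 'n"
    by (intro powr_mono) (auto simp: jb_ge_1)
  show ?thesis
  proof (rule integrable_dominated[OF n[of n]])
    show "(\<lambda>x. jb x powr bt * q x) \<in> borel_measurable lborel"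
      using borel_measurable_continuous_onI[of "\<lambda>x. q x"] by (simp add: continuous_intros uc Gc)
    show "AE x in lborel. norm (jb x powr bt * q x) \<le> norm (jb x powr (kp + real n) * q x)"
      using le by (intro AE_I2) (simp add: abs_mult mult_right_mono)
  qed
qed

end

section \<open>Powers of |x| as multipliers and the vanishing of rapidly decaying solutions\<close>

lemma jb_powr_real: "jb x powr real n = jb x ^ n"
  by (simp add: powr_realpow jb_pos)

lemma inner_self_le_jb: "x \<bullet> x \<le> (jb x)^2"
  by (simp add: jb_sq power2_norm_eq_inner)

lemma C1_inner_power: "C1 (\<lambda>x. (x \<bullet> x) ^ n) (\<lambda>x. (real n * (x \<bullet> x) ^ (n - 1)) *\<^sub>R (2 *\<^sub>R x))"
  by (rule C1_compose[OF C1_inner_self, where g = "\<lambda>t. t ^ n" and g' = "\<lambda>t. real n * t ^ (n - 1)"])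
    (auto intro!: continuous_intros DERIV_pow)

lemma adm_inner_power: "adm (2 * real n) (\<lambda>x. (x \<bullet> x) ^ n) (\<lambda>x. (real n * (x \<bullet> x) ^ (n - 1)) *\<^sub>R (2 *\<^sub>R x))"
  unfolding adm_def
proof (intro conjI C1_inner_power exI allI)
  fix x :: "real ^ 'a"
  let ?C = "1 + 2 * real n"
  have j: "jb x \<ge> 1" by (rule jb_ge_1)
  have p: "jb x powr (2 * real m) = ((jb x)^2) ^ m" for m
    using jb_powr_real[of x "2 * m"] by (simp add: power_mult)
  have s: "(x \<bullet> x) ^ m \<le> jb x powr (2 * real m)" for m
    unfolding p by (intro power_mono inner_self_le_jb) auto
  have "1 * jb x powr (2 * real n) \<le> ?C * jb x powr (2 * real n)" by (intro mult_right_mono) auto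
  moreover have "\<bar>(x \<bullet> x) ^ n\<bar> = (x \<bullet> x) ^ n" by simp
  ultimately show "\<bar>(x \<bullet> x) ^ n\<bar> \<le> ?C * jb x powr (2 * real n)" using s[of n] by linarith
  show "norm ((real n * (x \<bullet> x) ^ (n - 1)) *\<^sub>R (2 *\<^sub>R x)) \<le> ?C * jb x powr (2 * real n - 1)"
  proof (cases n)
    case (Suc l)
    have "norm ((real n * (x \<bullet> x) ^ (n - 1)) *\<^sub>R (2 *\<^sub>R x)) = (2 * real n) * ((x \<bullet> x) ^ l * norm x)"
      by (simp add: Suc)
    also have "\<dots> \<le> ?C * (jb x powr (2 * real l) * jb x)"
      using s[of l] norm_le_jb[of x] j by (intro mult_mono) auto
    also have "jb x powr (2 * real l) * jb x = jb x powr (2 * real l + 1)" using j by (simp add: powr_add)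
    also have "2 * real l + 1 = 2 * real n - 1" by (simp add: Suc)
    finally show ?thesis .
  qed simp
qed

lemma continuous_AE_zero:
  fixes g :: "'a::euclidean_space \<Rightarrow> real"
  assumes c: "continuous_on UNIV g" and z: "AE x in lborel. g x = 0"
  shows "g x = 0"
proof (rule ccontr)
  assume "g x \<noteq> 0"
  have o: "open {x. g x \<noteq> 0}" by (intro open_Collect_neq c continuous_intros)
  have "{x. g x \<noteq> 0} \<in> null_sets lborel"
    using z o by (subst (asm) AE_iff_null) (auto intro: borel_open)
  then have "negligible {x. g x \<noteq> 0}" by (simp add: negligible_iff_null_sets null_sets_completionI)
  with o have "{x. g x \<noteq> 0} = {}" using open_not_negligible by blast
  with \<open>g x \<noteq> 0\<close> show False by blast
qed

lemma young_divide:
  fixes a b m :: real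
  assumes "m > 0"
  shows "a * b \<le> m / 2 * a^2 + b^2 / (2 * m)"
proof -
  have "0 \<le> (m * a - b)^2 / (2 * m)" using assms by simp
  also have "\<dots> = m / 2 * a^2 + b^2 / (2 * m) - a * b" using assms by (simp add: power2_eq_square field_simps)
  finally show ?thesis by simp
qed

context helmholtz_solution
begin

text \<open>For the multiplier \<open>|x|\<^sup>2\<^sup>m\<close> the three identities combine into a square
  \<open>(2 x \<bullet> G + c u)^2\<close> with coefficient \<open>m / 2\<close>, which for large \<open>m\<close> absorbs the term with \<open>f\<close>.\<close>

lemma rapid_decay_imp_zero:
  assumes i: "\<And>bt. integrable lborel (\<lambda>x. jb x powr bt * q x)"
  shows "u x = 0"
proof -
  \<comment> \<open>Young's inequality, with the square absorbing the source term, leaves A^2/(8m)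
    times s u^2, and this has to stay below k^2 s u^2.\<close>
  obtain l :: nat where l: "real l > A^2 / (8 * k^2)" using reals_Archimedean2 by blast
  define m where "m = real (Suc l)"
  \<comment> \<open>With this value the terms with |G|^2 cancel in the sum of the Pohozaev identity
    and c/2 times the energy identity; the divergence of the field t(x) x equals c t(x), so m c/2
    times the divergence identity completes the square.\<close>
  define c where "c = real CARD('n) + 2 * real l"
  have m0: "m > 0" by (simp add: m_def)
  have "A^2 / (8 * k^2) < m" using l by (simp add: m_def)
  then have "A^2 / (8 * m) < k^2" using k m0 by (simp add: divide_less_eq mult_ac)
  with m0 have m: "m > 0" "A^2 / (8 * m) < k^2" by simp_all
  define t where "t x = (x \<bullet> x) ^ l" for x :: "real ^ 'n"
  define T where "T x = (real l * (x \<bullet> x) ^ (l - 1)) *\<^sub>R (2 *\<^sub>R x)" for x :: "real ^ 'n"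
  define s where "s x = (x \<bullet> x) ^ Suc l" for x :: "real ^ 'n"
  define S where "S x = (real (Suc l) * (x \<bullet> x) ^ (Suc l - 1)) *\<^sub>R (2 *\<^sub>R x)" for x :: "real ^ 'n"
  have a: "adm (2 * real l) t T" "adm (2 * real (Suc l)) s S"
    unfolding s_def[abs_def] S_def[abs_def] t_def[abs_def] T_def[abs_def] by (rule adm_inner_power)+
  note F = F_adm[OF a(2) i] FD_adm[OF a(1) i]
  have t0: "t x \<ge> 0" for x by (simp add: t_def)
  have st: "s x = (x \<bullet> x) * t x" for x by (simp add: s_def t_def)
  define Z where "Z x = 2 * (x \<bullet> G x) + c * u x" for x
  have id: "FP x (s x) (S x) + (c / 2) * FE x (s x) (S x) + (m * c / 2) * FD x (t x) (T x)
     = (m / 2) * t x * (Z x)^2 + k^2 * (s x * (u x)^2) - (1/2) * f x * s x * Z x" for x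
  proof -
    define r where "r = x \<bullet> G x"
    define U where "U = u x"
    define g where "g = (norm (G x))^2"
    define X where "X = x \<bullet> x"
    define \<tau> where "\<tau> = t x"
    define h where "h = f x"
    define Nn where "Nn = real CARD('n)"
    have xS: "x \<bullet> S x = 2 * m * (X * \<tau>)" by (simp add: S_def m_def X_def \<tau>_def t_def)
    have GS: "G x \<bullet> S x = 2 * m * \<tau> * r" by (simp add: S_def m_def r_def \<tau>_def t_def inner_commute)
    have xT: "x \<bullet> T x = 2 * real l * \<tau>"
      by (cases l) (simp_all add: T_def \<tau>_def t_def)
    have sx: "s x = X * \<tau>" by (simp add: st X_def \<tau>_def)
    have rl: "real l = m - 1" by (simp add: m_def)
    have c: "c = Nn + 2 * (m - 1)" by (simp add: c_def rl Nn_def)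
    show ?thesis
      unfolding FP_def FE_def FD_def xS GS xT sx Z_def r_def[symmetric] U_def[symmetric] g_def[symmetric] \<tau>_def[symmetric] h_def[symmetric] Nn_def[symmetric] c rl
      by (simp add: field_simps power2_eq_square)
  qed
  have le: "(k^2 - A^2 / (8 * m)) * (s x * (u x)^2) \<le> FP x (s x) (S x) + (c / 2) * FE x (s x) (S x) + (m * c / 2) * FD x (t x) (T x)" for x
  proof -
    have j: "jb x \<ge> 1" by (rule jb_ge_1)
    have xx: "x \<bullet> x = norm x * norm x" by (simp add: power2_norm_eq_inner[symmetric] power2_eq_square)
    have fx: "\<bar>f x\<bar> * norm x \<le> A * \<bar>u x\<bar>"
      using mult_left_mono[OF norm_le_jb[of x], of "\<bar>f x\<bar>"] f_jb'(1)[of x] by linarith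
    have "\<bar>(1/2) * f x * (x \<bullet> x) * Z x\<bar> = \<bar>Z x\<bar> * ((1/2) * (\<bar>f x\<bar> * norm x) * norm x)"
      unfolding xx by (simp add: abs_mult)
    also have "\<dots> \<le> \<bar>Z x\<bar> * ((1/2) * (A * \<bar>u x\<bar>) * norm x)" using fx by (intro mult_left_mono mult_right_mono) auto
    also have "\<dots> \<le> m / 2 * \<bar>Z x\<bar>^2 + ((1/2) * (A * \<bar>u x\<bar>) * norm x)^2 / (2 * m)" by (rule young_divide[OF m(1)])
    also have "\<dots> = m / 2 * (Z x)^2 + A^2 / (8 * m) * ((x \<bullet> x) * (u x)^2)"
      unfolding power2_norm_eq_inner[symmetric] using m by (simp add: power_mult_distrib power_divide field_simps)
    finally have "(1/2) * f x * (x \<bullet> x) * Z x \<le> m / 2 * (Z x)^2 + A^2 / (8 * m) * ((x \<bullet> x) * (u x)^2)" by simp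
    from mult_left_mono[OF this t0[of x]] have "(1/2) * f x * s x * Z x \<le> m / 2 * t x * (Z x)^2 + A^2 / (8 * m) * (s x * (u x)^2)"
      unfolding st by (simp add: distrib_left mult_ac)
    then show ?thesis unfolding id left_diff_distrib by linarith
  qed
  have si: "integrable lborel (\<lambda>x. s x * (u x)^2)"
  proof (rule integrable_dominated[OF i[of "2 * real (Suc l)"]])
    have "continuous_on UNIV (\<lambda>x. s x * (u x)^2)" unfolding s_def by (intro continuous_intros uc)
    then show "(\<lambda>x. s x * (u x)^2) \<in> borel_measurable lborel" by (simp add: borel_measurable_continuous_onI)
    show "AE x in lborel. norm (s x * (u x)^2) \<le> norm (jb x powr (2 * real (Suc l)) * q x)"
    proof (intro AE_I2)
      fix x :: "real ^ 'n"
      have "jb x powr (2 * real (Suc l)) = ((jb x)^2) ^ Suc l"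
        using jb_powr_real[of x "2 * Suc l"] by (simp only: power_mult of_nat_mult of_nat_numeral)
      then have "s x \<le> jb x powr (2 * real (Suc l))"
        unfolding s_def by (simp only: power_mono[OF inner_self_le_jb inner_ge_zero])
      then have "s x * (u x)^2 \<le> jb x powr (2 * real (Suc l)) * q x" by (intro mult_mono) auto
      moreover have "s x \<ge> 0" by (simp add: s_def)
      ultimately show "norm (s x * (u x)^2) \<le> norm (jb x powr (2 * real (Suc l)) * q x)"
        by simp
    qed
  qed
  have "(LBINT x. (k^2 - A^2 / (8 * m)) * (s x * (u x)^2)) \<le> (LBINT x. FP x (s x) (S x) + (c / 2) * FE x (s x) (S x) + (m * c / 2) * FD x (t x) (T x))"
    by (rule integral_mono) (use si F le in auto)
  also have "\<dots> = 0" using F by simp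
  finally have "(k^2 - A^2 / (8 * m)) * (LBINT x. s x * (u x)^2) \<le> 0" by simp
  then have "(LBINT x. s x * (u x)^2) \<le> 0" using m(2) by (simp add: mult_le_0_iff)
  moreover have s0: "s x * (u x)^2 \<ge> 0" for x by (simp add: s_def)
  ultimately have "(LBINT x. s x * (u x)^2) = 0" by (intro antisym integral_nonneg_AE) auto
  then have ae: "AE x in lborel. s x * (u x)^2 = 0" using si s0 by (subst (asm) integral_nonneg_eq_0_iff_AE) auto
  have "AE x in lborel. x \<noteq> (0 :: real ^ 'n)" by (rule AE_lborel_singleton)
  with ae have "AE x in lborel. u x = 0" by eventually_elim (simp add: s_def)
  then show ?thesis by (rule continuous_AE_zero[OF uc])
qed

lemma solution_zero:
  assumes "kp > -1" "integrable lborel (\<lambda>x. jb x powr kp * q x)"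
  shows "u x = 0"
  by (intro rapid_decay_imp_zero weight_all[OF assms])

text \<open>A Caccioppoli inequality: in the energy identity with multiplier cutoff times <x>^kp,
  the term u (G \<bullet> S) is absorbed because |S| is bounded by the weight times the square root
  of the cutoff. The resulting bound is uniform in \<open>n\<close>, and Fatou's lemma
  concludes.\<close>

lemma gradient_integrable:
  assumes i: "integrable lborel (\<lambda>x. jb x powr kp * (u x)^2)"
  shows "integrable lborel (\<lambda>x. jb x powr kp * q x)"
proof -
  define C where "C = abs kp + 8"
  define w where "w x = jb x powr kp" for x :: "real ^ 'n"
  define W where "W x = (kp * jb x powr (kp - 1) / jb x) *\<^sub>R x" for x :: "real ^ 'n"
  define s where "s n x = cutoff n x * w x" for n x
  define S where "S n x = cutoff n x *\<^sub>R W x + w x *\<^sub>R cutoff_grad n x" for n x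
  have s1: "C1c (s n) (S n)" for n
    unfolding s_def S_def w_def W_def by (intro C1c_mult_left cutoff_C1c C1_jb_powr)
  have w0: "w x \<ge> 0" for x by (simp add: w_def)
  have j: "jb x \<ge> 1" "jb x > 0" for x :: "real ^ 'n" using jb_ge_1[of x] by auto
  have Sb: "norm (S n x) \<le> C * (w x * sqrt (cutoff n x))" for n x
  proof -
    have c: "0 \<le> cutoff n x" "cutoff n x \<le> sqrt (cutoff n x)"
      using cutoff_bounds[of n x] by (auto intro: real_le_rsqrt simp: power2_eq_square mult_left_le)
    have "norm (W x) \<le> abs kp * w x"
    proof -
      have "norm (W x) = abs kp * jb x powr (kp - 1) * (norm x / jb x)" using j[of x] by (simp add: W_def abs_mult)
      also have "\<dots> \<le> abs kp * w x * 1"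
        using j[of x] norm_le_jb[of x] unfolding w_def by (intro mult_mono powr_mono) auto
      finally show ?thesis by simp
    qed
    moreover have "norm (cutoff_grad n x) \<le> 8 * sqrt (cutoff n x)"
    proof -
      have "8 / jb x \<le> 8 / 1" using j[of x] by (intro divide_left_mono) auto
      then have "8 / jb x * sqrt (cutoff n x) \<le> 8 * sqrt (cutoff n x)" using c by (intro mult_right_mono) auto
      then show ?thesis using cutoff_grad_bound[of n x] by linarith
    qed
    moreover have "norm (S n x) \<le> cutoff n x * norm (W x) + w x * norm (cutoff_grad n x)"
      unfolding S_def by (rule order_trans[OF norm_triangle_ineq]) (simp add: cutoff_bounds w0)
    ultimately have "norm (S n x) \<le> sqrt (cutoff n x) * (abs kp * w x) + w x * (8 * sqrt (cutoff n x))"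
      using c w0 by (smt (verit, best) mult_mono mult_left_mono norm_ge_zero real_sqrt_ge_zero)
    then show ?thesis by (simp add: C_def algebra_simps)
  qed
  \<comment> \<open>The three parts stem from the zero order term of the equation, from the source,
    and from Young's inequality.\<close>
  define K where "K = k^2 + A + C^2 / 2"
  have pt: "(1/2) * (s n x * (norm (G x))^2) - K * (w x * (u x)^2) \<le> FE x (s n x) (S n x)" for n x
  proof -
    define a where "a = sqrt (cutoff n x)"
    have a: "cutoff n x = a^2" "0 \<le> a" "a \<le> 1" using cutoff_bounds[of n x] by (auto simp: a_def)
    have sw: "s n x \<le> w x" "0 \<le> s n x" using cutoff_bounds[of n x] w0[of x] by (auto simp: s_def mult_left_le_one_le)
    have "\<bar>u x * (G x \<bullet> S n x)\<bar> \<le> \<bar>u x\<bar> * (norm (G x) * (C * (w x * a)))"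
      unfolding abs_mult a_def using Sb[of n x]
      by (intro mult_left_mono order_trans[OF Cauchy_Schwarz_ineq2]) auto
    also have "\<dots> = w x * ((a * norm (G x)) * (C * \<bar>u x\<bar>))" by simp
    also have "\<dots> \<le> w x * (1 / 2 * (a * norm (G x))^2 + (C * \<bar>u x\<bar>)^2 / (2 * 1))"
      by (intro mult_left_mono young_divide w0) simp
    also have "\<dots> = (1/2) * (s n x * (norm (G x))^2) + C^2 / 2 * (w x * (u x)^2)"
      unfolding s_def a by (simp add: power_mult_distrib algebra_simps)
    finally have 1: "\<bar>u x * (G x \<bullet> S n x)\<bar> \<le> (1/2) * (s n x * (norm (G x))^2) + C^2 / 2 * (w x * (u x)^2)" .
    have "\<bar>f x * s n x * u x\<bar> \<le> (A * \<bar>u x\<bar>) * w x * \<bar>u x\<bar>"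
      unfolding abs_mult using sw A f_jb'(2)[of x] by (intro mult_mono mult_right_mono) auto
    also have "\<dots> = A * (w x * (\<bar>u x\<bar> * \<bar>u x\<bar>))" by (simp only: mult_ac)
    also have "\<bar>u x\<bar> * \<bar>u x\<bar> = (u x)^2" by (simp add: power2_eq_square)
    finally have 2: "\<bar>f x * s n x * u x\<bar> \<le> A * (w x * (u x)^2)" .
    have 3: "k^2 * (s n x * (u x)^2) \<le> k^2 * (w x * (u x)^2)" using sw by (intro mult_left_mono mult_right_mono) auto
    have "FE x (s n x) (S n x) = s n x * (norm (G x))^2 - k^2 * (s n x * (u x)^2) + u x * (G x \<bullet> S n x) - f x * s n x * u x"
      by (simp add: FE_def right_diff_distrib mult_ac)
    moreover have "K * (w x * (u x)^2) = k^2 * (w x * (u x)^2) + A * (w x * (u x)^2) + C^2 / 2 * (w x * (u x)^2)"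
      by (simp only: K_def distrib_right)
    ultimately show ?thesis using 1 2 3 unfolding abs_le_iff by argo
  qed
  have sc: "continuous_on UNIV (s n)" "continuous_on UNIV (S n)" for n
    by (rule C1_continuous[OF C1c_C1[OF s1]], rule C1_D_continuous[OF C1c_C1[OF s1]])
  have wc: "continuous_on UNIV w" unfolding w_def by (rule C1_continuous[OF C1_jb_powr])
  have gi: "integrable lborel (\<lambda>x. s n x * (norm (G x))^2)" for n
    by (rule C1_UNIV_integrals[OF _ s1[of n]]) (auto intro!: continuous_intros sc Gc)
  have Fi: "integrable lborel (\<lambda>x. FE x (s n x) (S n x))" for n
    unfolding FE_def by (rule C1_UNIV_integrals[OF _ s1[of n]]) (auto intro!: continuous_intros sc Gc uc fc)
  have wi: "integrable lborel (\<lambda>x. w x * (u x)^2)" using i by (simp add: w_def)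
  have b: "(LBINT x. s n x * (norm (G x))^2) \<le> 2 * K * (LBINT x. w x * (u x)^2)" for n
  proof -
    have "(LBINT x. (1/2) * (s n x * (norm (G x))^2) - K * (w x * (u x)^2)) \<le> (LBINT x. FE x (s n x) (S n x))"
      by (rule integral_mono) (use gi wi Fi pt in auto)
    then show ?thesis unfolding F_compact(2)[OF s1] using gi[of n] wi by simp
  qed
  have "integrable lborel (\<lambda>x. w x * (norm (G x))^2)"
  proof (rule integrable_pointwise_limit[OF gi _ b])
    show "s n x * (norm (G x))^2 \<ge> 0" for n x using cutoff_bounds[of n x] w0[of x] by (simp add: s_def)
    show "(\<lambda>n. s n x * (norm (G x))^2) \<longlonglongrightarrow> w x * (norm (G x))^2" for x
      using tendsto_mult[OF tendsto_mult[OF cutoff_tendsto(1)[of x] tendsto_const[of "w x"]] tendsto_const[of "(norm (G x))^2"]]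
      by (simp add: s_def)
  qed
  from Bochner_Integration.integrable_add[OF wi this] show ?thesis by (simp add: w_def distrib_left)
qed

end

section \<open>Uniqueness and compactness\<close>

context radial_kernel
begin

lemma grad_inner:
  assumes l: "bounded_linear l" and g: "decays A bt g" and bt: "0 \<le> bt" "p + bt > real CARD('n)"
  shows "(\<Sum>b\<in>Basis. l (cG g b x) *\<^sub>R b) \<bullet> e = l (cG g e x)"
proof -
  interpret L: bounded_linear l by (rule l)
  interpret C: bounded_linear "\<lambda>e. cG g e x" by (rule cG_bounded_linear[OF g bt])
  have "l (cG g e x) = l (cG g (\<Sum>b\<in>Basis. (e \<bullet> b) *\<^sub>R b) x)" by (simp add: euclidean_representation)
  also have "\<dots> = (\<Sum>b\<in>Basis. (e \<bullet> b) * l (cG g b x))" by (simp add: C.sum C.scaleR L.sum L.scaleR)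
  finally show ?thesis by (simp add: inner_sum_left inner_commute[of e] mult.commute)
qed

text \<open>To be used with the real and the imaginary part as \<open>l\<close>. Because
  \<open>cE\<close> is real, both components solve the same type of real equation when the source is
  a real potential times the solution.\<close>

lemma weak_sol_component:
  assumes l: "bounded_linear l" and g: "decays A bt g" and bt: "0 \<le> bt" "p + bt > real CARD('n)" and gc: "continuous_on UNIV g"
  shows "weak_sol k (\<lambda>x. l (cv g x)) (\<lambda>x. \<Sum>b\<in>Basis. l (cG g b x) *\<^sub>R b) (\<lambda>x. cE * l (g x))"
  unfolding weak_sol_def
proof (intro conjI allI impI)
  interpret L: bounded_linear l by (rule l)
  have Lc: "continuous_on UNIV (\<lambda>x. l (F x))" if "continuous_on UNIV F" for F :: "real ^ 'n \<Rightarrow> complex"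
    by (rule L.continuous_on[OF that])
  show "continuous_on UNIV (\<lambda>x. cE * l (g x))" by (intro continuous_intros Lc gc)
  show "C1 (\<lambda>x. l (cv g x)) (\<lambda>x. \<Sum>b\<in>Basis. l (cG g b x) *\<^sub>R b)"
    unfolding C1_def
  proof (intro conjI allI)
    fix x
    show "((\<lambda>x. l (cv g x)) has_derivative (\<lambda>e. (\<Sum>b\<in>Basis. l (cG g b x) *\<^sub>R b) \<bullet> e)) (at x)"
      unfolding grad_inner[OF l g bt] by (rule L.has_derivative[OF cv_has_derivative[OF g bt gc]])
  next
    show "continuous_on UNIV (\<lambda>x. \<Sum>b\<in>Basis. l (cG g b x) *\<^sub>R b)"
      by (intro continuous_intros Lc cG_continuous[OF g bt gc])
  qed
  fix \<psi> and D :: "real ^ 'n \<Rightarrow> real ^ 'n" assume \<psi>: "C1c \<psi> D"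
  have m: "l (of_real c * z) = c * l z" for c z
    using L.scaleR[of c z] by (simp add: scaleR_conv_of_real)
  have "(LBINT x. (\<Sum>b\<in>Basis. l (cG g b x) *\<^sub>R b) \<bullet> D x - k^2 * l (cv g x) * \<psi> x)
    = (LBINT x. l (cG g (D x) x - of_real (k^2 * \<psi> x) * cv g x))"
    unfolding grad_inner[OF l g bt] L.diff m by (simp only: mult_ac)
  also have "\<dots> = l (LBINT x. cG g (D x) x - of_real (k^2 * \<psi> x) * cv g x)"
    by (rule integral_bounded_linear[OF l weak_form(2)[OF g bt \<psi>]])
  also have "\<dots> = cE * l (LBINT y. of_real (\<psi> y) * g y)" unfolding weak_form(1)[OF g bt \<psi>] by (rule m)
  also have "l (LBINT y. of_real (\<psi> y) * g y) = (LBINT y. l (of_real (\<psi> y) * g y))"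
  proof (rule integral_bounded_linear[OF l, symmetric])
    obtain R where R: "\<And>x. norm x \<ge> R \<Longrightarrow> \<psi> x = 0" using \<psi> by (auto simp: C1c_def)
    show "integrable lborel (\<lambda>y. of_real (\<psi> y) * g y)"
      by (rule integrable_continuous_compact_support[of _ R])
        (auto intro!: continuous_intros gc C1_continuous[OF C1c_C1[OF \<psi>]] simp: R)
  qed
  finally show "(LBINT x. (\<Sum>b\<in>Basis. l (cG g b x) *\<^sub>R b) \<bullet> D x - k^2 * l (cv g x) * \<psi> x) = (LBINT x. cE * l (g x) * \<psi> x)"
    unfolding m mult.assoc integral_mult_right_zero by (simp only: mult_ac)
qed

lemma potential_decay:
  assumes a: "continuous_on UNIV a" "\<And>x. \<bar>a x\<bar> \<le> A * jb x powr (- \<alpha>)" and \<alpha>: "\<alpha> > p + 1" and v: "decays B sg v"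
  shows "decays (A * B) (\<alpha> + sg) (\<lambda>y. of_real (a y) * v y)"
  unfolding decays_def
proof (intro conjI allI)
  have A: "A \<ge> 0" using order_trans[OF abs_ge_zero a(2)[of 0]] by (simp add: jbracket_def)
  have B: "B \<ge> 0" and vm[measurable]: "v \<in> borel_measurable borel" and vb: "\<And>x. norm (v x) \<le> B * jb x powr (- sg)"
    using v by (auto simp: decays_def)
  have [measurable]: "a \<in> borel_measurable borel" using a(1) by (rule borel_measurable_continuous_onI)
  show "(\<lambda>y. of_real (a y) * v y) \<in> borel_measurable borel" by measurable
  show "A * B \<ge> 0" using A B by simp
  fix y
  have "norm (of_real (a y) * v y) \<le> (A * jb y powr (- \<alpha>)) * (B * jb y powr (- sg))"
    unfolding norm_mult using a(2)[of y] vb[of y] A by (intro mult_mono) auto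
  also have "\<dots> = A * B * (jb y powr (- \<alpha>) * jb y powr (- sg))" by simp
  also have "jb y powr (- \<alpha>) * jb y powr (- sg) = jb y powr (- (\<alpha> + sg))"
    by (simp add: powr_add[symmetric])
  finally show "norm (of_real (a y) * v y) \<le> A * B * jb y powr (- (\<alpha> + sg))" .
qed

text \<open>A bootstrap: multiplication by the potential adds \<alpha> to the decay exponent, and
  convolution with the kernel returns any exponent at most p that leaves the integrability condition
  strict. Each round gains a fixed amount until p is reached.\<close>

lemma fixpoint_decay:
  assumes a: "continuous_on UNIV a" "\<And>x. \<bar>a x\<bar> \<le> A * jb x powr (- \<alpha>)" and \<alpha>: "\<alpha> > p + 1"
    and v: "decays M 0 v" and fp: "\<And>x. v x = cv (\<lambda>y. of_real (a y) * v y) x"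
  obtains B where "decays B p v"
proof -
  \<comment> \<open>Half of the available gain: as N = 2 p + 1, convolution may raise the exponent
    by anything below \<alpha> - p - 1.\<close>
  define \<gamma> where "\<gamma> = (\<alpha> - p - 1) / 2"
  have \<gamma>: "\<gamma> > 0" "\<alpha> = p + 1 + 2 * \<gamma>" using \<alpha> by (auto simp: \<gamma>_def field_simps)
  have "\<exists>B. decays B (min p (real n * \<gamma>)) v" for n
  proof (induction n)
    case 0
    have "min p 0 = 0" using p_ge_1 by simp
    then show ?case using v by auto
  next
    case (Suc n)
    then obtain B where B: "decays B (min p (real n * \<gamma>)) v" by blast
    define sg where "sg = min p (real n * \<gamma>)"
    define sg' where "sg' = min p (real (Suc n) * \<gamma>)"
    have sg: "0 \<le> sg" "sg \<le> p" using p_ge_1 \<gamma> by (auto simp: sg_def)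
    have sg': "0 \<le> sg'" "sg' \<le> p" "sg' \<le> sg + \<gamma>" using p_ge_1 \<gamma> by (auto simp: sg_def sg'_def distrib_right)
    have d: "decays (A * B) (\<alpha> + sg) (\<lambda>y. of_real (a y) * v y)"
      using potential_decay[OF a \<alpha> B] by (simp add: sg_def)
    have c: "sg' \<le> \<alpha> + sg" "p + (\<alpha> + sg) - sg' > real CARD('n)"
      using sg' sg \<gamma> p_ge_1 unfolding p_eq by linarith+
    obtain C where C: "C > 0" "\<And>A (g :: real ^ 'n \<Rightarrow> complex) x. decays A (\<alpha> + sg) g \<Longrightarrow> norm (cv g x) \<le> A * C * jb x powr (- sg')"
      by (rule cv_bounds[OF sg'(1,2) c]) (rule that; assumption)
    have "decays (A * B * C) sg' v"
      unfolding decays_def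
    proof (intro conjI allI)
      show "v \<in> borel_measurable borel" using v by (simp add: decays_def)
      show "A * B * C \<ge> 0" using d C(1) by (simp add: decays_def)
      show "norm (v x) \<le> A * B * C * jb x powr (- sg')" for x
        using C(2)[OF d, of x] unfolding fp[of x, symmetric] .
    qed
    then show ?case unfolding sg'_def by blast
  qed
  note * = this
  obtain n where "real n > p / \<gamma>" using reals_Archimedean2 by blast
  then have "min p (real n * \<gamma>) = p" using \<gamma> by (simp add: divide_less_eq)
  then show ?thesis using *[of n] that by auto
qed

text \<open>Test the equation of v1 with \<zeta> v2, that of v2 with \<zeta> v1, and subtract: the
  common real coefficient cancels. For real and imaginary parts of one function this says that the
  flux Im(cnj v grad v) is divergence free.\<close>

lemma flux_identity:
  assumes s: "weak_sol k v1 G1 (\<lambda>x. a x * v1 x)" "weak_sol k v2 G2 (\<lambda>x. a x * v2 x)" and ac: "continuous_on UNIV a"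
    and \<zeta>: "C1c \<zeta> X"
  shows "(LBINT x. v1 x * (G2 x \<bullet> X x) - v2 x * (G1 x \<bullet> X x)) = 0"
proof -
  have c1: "C1 v1 G1" "C1 v2 G2" using s by (auto simp: weak_sol_def)
  note cc = ac C1_continuous[OF c1(1)] C1_continuous[OF c1(2)] C1_D_continuous[OF c1(1)] C1_D_continuous[OF c1(2)]
    C1_continuous[OF C1c_C1[OF \<zeta>]] C1_D_continuous[OF C1c_C1[OF \<zeta>]]
  have i: "integrable lborel (\<lambda>x. G1 x \<bullet> (\<zeta> x *\<^sub>R G2 x + v2 x *\<^sub>R X x) - k^2 * v1 x * (\<zeta> x * v2 x))"
    "integrable lborel (\<lambda>x. G2 x \<bullet> (\<zeta> x *\<^sub>R G1 x + v1 x *\<^sub>R X x) - k^2 * v2 x * (\<zeta> x * v1 x))"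
    by (rule C1_UNIV_integrals[OF _ \<zeta>]; auto intro!: continuous_intros cc)+
  have "(LBINT x. G1 x \<bullet> (\<zeta> x *\<^sub>R G2 x + v2 x *\<^sub>R X x) - k^2 * v1 x * (\<zeta> x * v2 x)) = (LBINT x. a x * v1 x * (\<zeta> x * v2 x))"
    "(LBINT x. G2 x \<bullet> (\<zeta> x *\<^sub>R G1 x + v1 x *\<^sub>R X x) - k^2 * v2 x * (\<zeta> x * v1 x)) = (LBINT x. a x * v2 x * (\<zeta> x * v1 x))"
    using s C1c_mult_left[OF \<zeta> c1(1)] C1c_mult_left[OF \<zeta> c1(2)] unfolding weak_sol_def by blast+
  moreover have "(LBINT x. a x * v1 x * (\<zeta> x * v2 x)) = (LBINT x. a x * v2 x * (\<zeta> x * v1 x))"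
    by (simp only: mult_ac)
  moreover have "v1 x * (G2 x \<bullet> X x) - v2 x * (G1 x \<bullet> X x)
    = (G2 x \<bullet> (\<zeta> x *\<^sub>R G1 x + v1 x *\<^sub>R X x) - k^2 * v2 x * (\<zeta> x * v1 x)) - (G1 x \<bullet> (\<zeta> x *\<^sub>R G2 x + v2 x *\<^sub>R X x) - k^2 * v1 x * (\<zeta> x * v2 x))" for x
    by (simp add: inner_add_right inner_commute[of "G2 x" "G1 x"] mult_ac)
  ultimately show ?thesis
    by (simp only: lebesgue_diff[OF i(2,1)])
qed

text \<open>Expand the square of w/r - \<i> k z and drop the square of w/r. The mixed term is the
  flux density Im(cnj z w), whose weighted integral will vanish.\<close>

lemma radiation_square:
  assumes "r > 0"
  shows "r * k^2 * (cmod z)^2 \<le> r * (cmod (w / of_real r - \<i> * of_real k * z))^2 + 2 * k * (Re z * Im w - Im z * Re w)"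
proof -
  define d where "d = w / of_real r"
  have w: "Re w = r * Re d" "Im w = r * Im d" using assms by (simp_all add: d_def Re_divide_of_real Im_divide_of_real)
  have "(cmod (d - \<i> * of_real k * z))^2 = (cmod d)^2 + k^2 * (cmod z)^2 - 2 * k * (Re z * Im d - Im z * Re d)"
    unfolding cmod_power2 by (simp add: power2_eq_square algebra_simps)
  then have "k^2 * (cmod z)^2 \<le> (cmod (d - \<i> * of_real k * z))^2 + 2 * k * (Re z * Im d - Im z * Re d)"
    using zero_le_power2[of "cmod d"] by linarith
  from mult_left_mono[OF this, of r] show ?thesis
    using assms unfolding w d_def[symmetric] by (simp add: algebra_simps)
qed

end

text \<open>A cutoff designed through its gradient, which apart from a constant factor increases to
  <x>^(2 dl - 2) x as eps -> 0, the weight wanted in the flux identity.\<close>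

lemma powr_cutoff_C1c:
  fixes eps dl :: real
  assumes eps: "eps > 0" and dl: "dl > 0"
  shows "C1c (\<lambda>x :: real ^ 'n. (max 0 (1 - eps * jb x powr (2 * dl)))^2)
    (\<lambda>x. (- 4 * dl * eps * (max 0 (1 - eps * jb x powr (2 * dl)) * jb x powr (2 * dl - 2))) *\<^sub>R x)"
proof -
  let ?c = "\<lambda>x :: real ^ 'n. 1 - eps * jb x powr (2 * dl)"
  let ?g = "\<lambda>x :: real ^ 'n. - 4 * dl * eps * (max 0 (?c x) * jb x powr (2 * dl - 2))"
  have 1: "C1 (\<lambda>x :: real ^ 'n. 1 - eps * jb x powr (2 * dl)) (\<lambda>x. 0 - eps *\<^sub>R ((2 * dl * jb x powr (2 * dl - 1) / jb x) *\<^sub>R x))"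
    by (intro C1_diff C1_scale C1_jb_powr) (simp add: C1_def)
  have "C1 (\<lambda>x :: real ^ 'n. (max 0 (?c x))^2)
     (\<lambda>x. (2 * max 0 (?c x)) *\<^sub>R (0 - eps *\<^sub>R ((2 * dl * jb x powr (2 * dl - 1) / jb x) *\<^sub>R x)))"
    by (rule C1_compose[OF 1]) (auto intro!: max0_square_has_real_derivative continuous_intros)
  moreover have "(2 * max 0 (?c x)) *\<^sub>R (0 - eps *\<^sub>R ((2 * dl * jb x powr (2 * dl - 1) / jb x) *\<^sub>R x))
    = ?g x *\<^sub>R x" for x :: "real ^ 'n"
  proof -
    have j: "jb x powr (2 * dl - 1) / jb x = jb x powr (2 * dl - 2)"
      using powr_diff[of "jb x" "2 * dl - 1" 1] by simp
    define m where "m = max 0 (?c x)"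
    have "2 * dl * jb x powr (2 * dl - 1) / jb x = 2 * dl * jb x powr (2 * dl - 2)"
      unfolding j[symmetric] by simp
    then show ?thesis unfolding m_def[symmetric] by (simp add: mult_ac)
  qed
  ultimately have c: "C1 (\<lambda>x :: real ^ 'n. (max 0 (?c x))^2)
    (\<lambda>x. (- 4 * dl * eps * (max 0 (?c x) * jb x powr (2 * dl - 2))) *\<^sub>R x)"
    by (simp only:)
  show ?thesis
    unfolding C1c_def
  proof (intro conjI c exI allI impI)
    fix x :: "real ^ 'n" assume x: "norm x \<ge> (1 / eps) powr (1 / (2 * dl))"
    have "1 / eps = ((1 / eps) powr (1 / (2 * dl))) powr (2 * dl)" using eps dl by (simp add: powr_powr)
    also have "\<dots> \<le> jb x powr (2 * dl)"
      using x norm_le_jb[of x] dl by (intro powr_mono2) auto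
    finally have "1 - eps * jb x powr (2 * dl) \<le> 0" using eps by (simp add: field_simps)
    then have "max 0 (?c x) = 0" by (rule max_absorb1)
    then show "(max 0 (?c x))^2 = 0"
      "?g x *\<^sub>R x = 0" by simp_all
  qed
qed

context radial_kernel
begin

text \<open>In the flux identity with the cutoffs of \<open>powr_cutoff_C1c\<close> the flux
  integrates to 0, so \<open>radiation_square\<close> bounds the weighted integral of |x| |v|^2 by
  that of |x| |d|^2, where \<open>d\<close> is the radiation defect. The extra decay
  \<open>th\<close> of the defect makes the latter finite, uniformly in the cutoff.\<close>

lemma fixpoint_weighted_L2:
  assumes a: "continuous_on UNIV a" "\<And>x. \<bar>a x\<bar> \<le> A * jb x powr (- \<alpha>)" and \<alpha>: "\<alpha> > p + 1"
    and v: "decays B p v" and vc: "continuous_on UNIV v" and fp: "\<And>x. v x = cv (\<lambda>y. of_real (a y) * v y) x"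
  obtains kp where "kp > -1" "integrable lborel (\<lambda>x. jb x powr kp * (cmod (v x))^2)"
proof -
  define g where "g = (\<lambda>y. of_real (a y) * v y)"
  define bt where "bt = \<alpha> + p"
  have g: "decays (A * B) bt g" unfolding g_def bt_def by (rule potential_decay[OF a \<alpha> v])
  have gc: "continuous_on UNIV g" unfolding g_def by (intro continuous_intros a vc)
  have p1: "p \<ge> 1" by (rule p_ge_1)
  have bt: "bt > real CARD('n)" "0 \<le> bt" "p + bt > real CARD('n)" using \<alpha> p1 unfolding p_eq bt_def by linarith+
  have vg: "v x = cv g x" for x unfolding g_def by (rule fp)
  let ?V = "\<lambda>x. (cmod (v x))^2"
  have vb: "norm (v x) \<le> B * jb x powr (- p)" for x using v by (simp add: decays_def)
  have B: "B \<ge> 0" using v by (simp add: decays_def)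
  define th where "th = min 1 ((bt - real CARD('n)) / 2)"
  have th: "0 < th" "th \<le> 1" "th < bt - real CARD('n)" using bt by (auto simp: th_def min_def)
  obtain B1 where B1: "B1 \<ge> 0" "\<And>x. norm x \<ge> 1 \<Longrightarrow> norm (cG g x x / of_real (norm x) - \<i> * of_real k * cv g x) \<le> B1 * jb x powr (- (p + th))"
    by (rule cv_radiation[OF bt(1) th g]) (rule that; assumption)
  obtain C where C: "C > 0" "\<And>x e. norm (cG g e x) \<le> A * B * C * norm e * jb x powr (- p)"
  proof -
    have *: "0 \<le> p" "p \<le> p" "p \<le> bt" "p + bt - p > real CARD('n)" using p1 bt unfolding p_eq by linarith+
    show ?thesis by (rule cv_bounds[OF *]) (rule that; use g in blast)
  qed
  have AB: "A * B \<ge> 0" using g by (simp add: decays_def)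
  let ?t = "\<lambda>x :: real ^ 'n. jb x powr (- (p + th))"
  \<comment> \<open>The radiation estimate covers |x| >= 1 only. Inside the unit ball the defect is
    at most A B C + k B, and 4^(p+th) compensates the factor <x>^(-(p+th)), as <x> <= 4
    there.\<close>
  define B2 where "B2 = B1 + (A * B * C + k * B) * 4 powr (p + th)"
  have B2: "B2 \<ge> 0" using B1 AB C B k by (simp add: B2_def)
  define d where "d x = cG g x x / of_real (norm x) - \<i> * of_real k * v x" for x
  have db: "norm (d x) \<le> B2 * ?t x" if x: "x \<noteq> 0" for x
  proof (cases "norm x \<ge> 1")
    case True
    then have "norm (d x) \<le> B1 * ?t x" using B1(2)[of x] by (simp add: d_def vg)
    also have "\<dots> \<le> B2 * ?t x"
      using AB C B k by (intro mult_right_mono) (auto simp: B2_def)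
    finally show ?thesis .
  next
    case False
    have j: "jb x \<le> 4" "jb x \<ge> 1" using jb_le_1_norm[of x] jb_ge_1[of x] False by auto
    have jp: "jb x powr (- p) \<le> 1" using j p1 by (simp add: powr_minus inverse_le_1_iff ge_one_powr_ge_zero)
    have "1 \<le> 4 powr (p + th) * ?t x"
    proof -
      have "jb x powr (p + th) * ?t x \<le> 4 powr (p + th) * ?t x"
        using j p1 th by (intro mult_right_mono powr_mono2) auto
      moreover have "jb x powr (p + th) * ?t x = 1" by (simp add: powr_add[symmetric])
      ultimately show ?thesis by linarith
    qed
    then have one: "c \<le> c * 4 powr (p + th) * ?t x" if "c \<ge> 0" for c
      using mult_left_mono[of 1 "4 powr (p + th) * ?t x" c] that by (simp add: mult.assoc)
    have "norm (cG g x x / of_real (norm x)) \<le> A * B * C"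
    proof -
      have "norm (cG g x x) \<le> A * B * C * norm x * 1"
        using C(2)[of x x] jp AB C(1) by (elim order_trans) (intro mult_left_mono; simp)
      then show ?thesis using x by (simp add: norm_divide divide_le_eq)
    qed
    moreover have "norm (\<i> * of_real k * v x) \<le> k * B"
    proof -
      have "norm (v x) \<le> B * 1" using vb[of x] jp B by (elim order_trans) (intro mult_left_mono; simp)
      then show ?thesis using k by (simp add: norm_mult)
    qed
    ultimately have "norm (d x) \<le> A * B * C + k * B" unfolding d_def by (intro order_trans[OF norm_triangle_ineq4]) linarith
    also have "\<dots> \<le> (A * B * C + k * B) * 4 powr (p + th) * ?t x"
      using AB C B k by (intro one) auto
    also have "\<dots> \<le> B2 * ?t x" using B1 by (intro mult_right_mono) (auto simp: B2_def)
    finally show ?thesis .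
  qed
  \<comment> \<open>dl < th makes the squared defect integrable against <x>^(2 dl - 1), dl < 1/2
    does the same for the correction that arises when <x> is replaced by 1 + |x|, and dl > 0 puts
    the final exponent 2 dl - 1 above -1.\<close>
  define dl where "dl = min th (1/2) / 2"
  have dl: "0 < dl" "dl < th" "dl < 1/2" using th by (auto simp: dl_def min_def)
  define G where "G l x = (\<Sum>b\<in>Basis. l (cG g b x) *\<^sub>R b)" for l :: "complex \<Rightarrow> real" and x
  have ws: "weak_sol k (\<lambda>x. Re (v x)) (G Re) (\<lambda>x. cE * a x * Re (v x))" "weak_sol k (\<lambda>x. Im (v x)) (G Im) (\<lambda>x. cE * a x * Im (v x))"
  proof -
    have "cE * Re (g x) = cE * a x * Re (v x)" "cE * Im (g x) = cE * a x * Im (v x)" for x by (simp_all add: g_def)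
    with weak_sol_component[OF bounded_linear_Re g bt(2,3) gc] weak_sol_component[OF bounded_linear_Im g bt(2,3) gc]
    show "weak_sol k (\<lambda>x. Re (v x)) (G Re) (\<lambda>x. cE * a x * Re (v x))" "weak_sol k (\<lambda>x. Im (v x)) (G Im) (\<lambda>x. cE * a x * Im (v x))"
      unfolding G_def by (simp_all only: vg[symmetric])
  qed
  have Gi: "G Re x \<bullet> e = Re (cG g e x)" "G Im x \<bullet> e = Im (cG g e x)" for x e
    unfolding G_def using grad_inner[OF bounded_linear_Re g bt(2,3)] grad_inner[OF bounded_linear_Im g bt(2,3)] by simp_all
  define m where "m n x = max 0 (1 - 1 / real (Suc n) * jb x powr (2 * dl))" for n and x :: "real ^ 'n"
  define \<eta> where "\<eta> n x = m n x * jb x powr (2 * dl - 2)" for n and x :: "real ^ 'n"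
  have \<eta>: "0 \<le> \<eta> n x" "\<eta> n x \<le> jb x powr (2 * dl - 2)" for n x
    by (auto simp: \<eta>_def m_def mult_left_le_one_le)
  define J where "J x = Re (v x) * Im (cG g x x) - Im (v x) * Re (cG g x x)" for x
  let ?j = "\<lambda>x :: real ^ 'n. jb x powr (2 * dl - 2)"
  let ?N = "\<lambda>x. norm x * k^2 * ?V x"
  let ?P = "\<lambda>x :: real ^ 'n. jb x powr (- 2 * (p + th))"
  have J0: "(LBINT x. \<eta> n x * J x) = 0" and Ji: "integrable lborel (\<lambda>x. \<eta> n x * J x)" for n
  proof -
    have c: "C1c (\<lambda>x :: real ^ 'n. (m n x)^2) (\<lambda>x. (- 4 * dl * (1 / real (Suc n)) * \<eta> n x) *\<^sub>R x)"
      unfolding m_def \<eta>_def by (rule powr_cutoff_C1c) (use dl in auto)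
    have e: "Re (v x) * (G Im x \<bullet> ((- 4 * dl * (1 / real (Suc n)) * \<eta> n x) *\<^sub>R x)) - Im (v x) * (G Re x \<bullet> ((- 4 * dl * (1 / real (Suc n)) * \<eta> n x) *\<^sub>R x))
       = (- 4 * dl * (1 / real (Suc n))) * (\<eta> n x * J x)" for x
      unfolding inner_scaleR_right Gi J_def by (simp add: right_diff_distrib mult_ac)
    have z: "- 4 * dl * (1 / real (Suc n)) \<noteq> 0" using dl by simp
    from flux_identity[OF ws continuous_on_mult_left[OF a(1)] c] have "(- 4 * dl * (1 / real (Suc n))) * (LBINT x. \<eta> n x * J x) = 0"
      unfolding e integral_mult_right_zero .
    with z show "(LBINT x. \<eta> n x * J x) = 0" by (metis mult_eq_0_iff)
    have c1: "C1 (\<lambda>x. Re (v x)) (G Re)" "C1 (\<lambda>x. Im (v x)) (G Im)" using ws by (auto simp: weak_sol_def)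
    have JG: "J = (\<lambda>x. Re (v x) * (G Im x \<bullet> x) - Im (v x) * (G Re x \<bullet> x))" by (simp add: J_def[abs_def] Gi)
    have Jc: "continuous_on UNIV J" unfolding JG
      by (intro continuous_intros C1_continuous[OF c1(1)] C1_continuous[OF c1(2)] C1_D_continuous[OF c1(1)] C1_D_continuous[OF c1(2)])
    have \<eta>c: "continuous_on UNIV (\<lambda>x. \<eta> n x)" unfolding \<eta>_def[abs_def] m_def[abs_def] by (intro continuous_intros) auto
    show "integrable lborel (\<lambda>x. \<eta> n x * J x)"
    proof (rule C1_UNIV_integrals[OF _ c])
      show "continuous_on UNIV (\<lambda>x. \<eta> n x * J x)" by (intro continuous_on_mult \<eta>c Jc)
      show "\<eta> n x * J x = 0" if "(m n x)^2 = 0" for x using that by (simp add: \<eta>_def)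
    qed
  qed
  have vm: "(\<lambda>x. v x) \<in> borel_measurable lborel" using v by (simp add: decays_def)
  have \<eta>m: "(\<lambda>x. \<eta> n x) \<in> borel_measurable lborel" for n unfolding \<eta>_def m_def by measurable
  have jm: "(\<lambda>x. jb x powr s) \<in> borel_measurable lborel" for s by measurable
  define q where "q = - (2 * dl - 1 - 2 * p - 2 * th)"
  have q: "q > real CARD('n)" using dl unfolding q_def p_eq by linarith
  note jq = integrable_jb_powr[OF q]
  have j: "jb x \<ge> 1" "jb x > 0" for x :: "real ^ 'n" using jb_ge_1[of x] by auto
  have pt: "\<eta> n x * ?N x \<le> B2^2 * jb x powr (- q) + 2 * k * (\<eta> n x * J x)" for n x
  proof (cases "x = 0")
    case True
    have "cG g 0 0 = 0" by (simp add: cG_def d\<Phi>_def)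
    then show ?thesis using True by (simp add: J_def)
  next
    case False
    then have "?N x \<le> norm x * (cmod (d x))^2 + 2 * k * J x"
      using radiation_square[of "norm x" "v x" "cG g x x"] by (simp add: d_def J_def)
    also have "norm x * (cmod (d x))^2 \<le> jb x * (B2 * ?t x)^2"
      using db[OF False] norm_le_jb[of x] by (intro mult_mono power_mono) auto
    also have "(B2 * ?t x)^2 = B2^2 * ?P x"
      by (simp add: power_mult_distrib power2_eq_square powr_add[symmetric])
    finally have "?N x \<le> jb x * (B2^2 * ?P x) + 2 * k * J x" by simp
    from mult_left_mono[OF this \<eta>(1)[of n x]]
    have "\<eta> n x * ?N x \<le> \<eta> n x * (jb x * (B2^2 * ?P x)) + 2 * k * (\<eta> n x * J x)"
      by (simp add: distrib_left mult_ac)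
    also have "\<eta> n x * (jb x * (B2^2 * ?P x)) \<le> ?j x * (jb x * (B2^2 * ?P x))"
      using \<eta> j[of x] by (intro mult_right_mono) auto
    also have "?j x * (jb x * (B2^2 * ?P x)) = B2^2 * (?j x * jb x powr 1 * ?P x)"
      using j[of x] by simp
    also have "?j x * jb x powr 1 * ?P x = jb x powr (- q)"
      unfolding powr_add[symmetric] by (simp add: q_def algebra_simps)
    finally show ?thesis by simp
  qed
  define F where "F n x = \<eta> n x * ?N x" for n x
  have F0: "F n x \<ge> 0" for n x using \<eta> by (simp add: F_def)
  have ri: "integrable lborel (\<lambda>x. B2^2 * jb x powr (- q) + 2 * k * (\<eta> n x * J x))" for n
    using jq Ji[of n] by auto
  have Fi: "integrable lborel (F n)" for n
  proof (rule integrable_dominated[OF ri[of n]])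
    show "F n \<in> borel_measurable lborel" unfolding F_def using vm \<eta>m by measurable
    show "AE x in lborel. norm (F n x) \<le> norm (B2^2 * jb x powr (- q) + 2 * k * (\<eta> n x * J x))"
      using pt F0 by (intro AE_I2) (auto simp: F_def intro: order_trans[OF _ abs_ge_self])
  qed
  have Fb: "(LBINT x. F n x) \<le> B2^2 * (LBINT x. jb (x :: real ^ 'n) powr (- q))" for n
  proof -
    have "(LBINT x. F n x) \<le> (LBINT x. B2^2 * jb x powr (- q) + 2 * k * (\<eta> n x * J x))"
      by (rule integral_mono[OF Fi ri]) (use pt in \<open>simp add: F_def\<close>)
    also have "\<dots> = B2^2 * (LBINT x. jb (x :: real ^ 'n) powr (- q))" using jq Ji[of n] J0[of n] by simp
    finally show ?thesis .
  qed
  have "integrable lborel (\<lambda>x. (?j x) * ?N x)"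
  proof (rule integrable_pointwise_limit[OF Fi F0 Fb])
    fix x :: "real ^ 'n"
    have "(\<lambda>n. max 0 (1 - 1 / real (Suc n) * jb x powr (2 * dl))) \<longlonglongrightarrow> max 0 (1 - 0 * jb x powr (2 * dl))"
      by (intro tendsto_intros LIMSEQ_Suc[OF lim_1_over_n])
    then have "(\<lambda>n. m n x) \<longlonglongrightarrow> 1" by (simp add: m_def)
    from tendsto_mult[OF tendsto_mult[OF this tendsto_const[of "?j x"]] tendsto_const[of "?N x"]]
    show "(\<lambda>n. F n x) \<longlonglongrightarrow> ?j x * ?N x"
      by (simp add: F_def \<eta>_def)
  qed
  note I1 = integrable_mult_right[OF this, of "1 / k^2"]
  define r where "r = 2 + 2 * p - 2 * dl"
  have "r > real CARD('n)" using dl unfolding r_def p_eq by linarith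
  note I2 = integrable_mult_right[OF integrable_jb_powr[OF this], of "B^2"]
  have "integrable lborel (\<lambda>x. jb x powr (2 * dl - 1) * ?V x)"
  proof (rule integrable_dominated[OF Bochner_Integration.integrable_add[OF I1 I2]])
    show "(\<lambda>x. jb x powr (2 * dl - 1) * ?V x) \<in> borel_measurable lborel" using vm jm by measurable
    show "AE x in lborel. norm (jb x powr (2 * dl - 1) * ?V x)
      \<le> norm (1 / k^2 * (?j x * ?N x) + B^2 * jb x powr (- r))"
    proof (rule AE_I2)
      fix x :: "real ^ 'n"
      have "jb x powr (2 * dl - 1) = ?j x * jb x powr 1" unfolding powr_add[symmetric] by simp
      also have "\<dots> \<le> ?j x * (1 + norm x)" using jb_le_1_norm[of x] by (intro mult_left_mono) auto
      finally have "jb x powr (2 * dl - 1) * ?V x \<le> ?j x * (1 + norm x) * ?V x"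
        by (intro mult_right_mono) auto
      also have "\<dots> = ?j x * (norm x * ?V x) + ?j x * ?V x"
        by (simp add: algebra_simps)
      also have "?j x * ?V x \<le> ?j x * (B * jb x powr (- p))^2"
        using vb[of x] by (intro mult_left_mono power_mono) auto
      also have "?j x * (B * jb x powr (- p))^2 = B^2 * (?j x * jb x powr (- p) * jb x powr (- p))"
        by (simp add: power_mult_distrib power2_eq_square)
      also have "?j x * jb x powr (- p) * jb x powr (- p) = jb x powr (- r)"
        unfolding powr_add[symmetric] by (simp add: r_def algebra_simps)
      finally have "jb x powr (2 * dl - 1) * ?V x
        \<le> 1 / k^2 * (?j x * ?N x) + B^2 * jb x powr (- r)"
        using k by simp
      then show "norm (jb x powr (2 * dl - 1) * ?V x)
        \<le> norm (1 / k^2 * (?j x * ?N x) + B^2 * jb x powr (- r))"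
        by simp
    qed
  qed
  with dl show ?thesis by (intro that[of "2 * dl - 1"]) auto
qed

text \<open>Real and imaginary part solve real equations with the source \<open>cE\<close> a times
  themselves, and \<alpha> > p + 1 >= 2 supplies the decay that \<open>helmholtz_solution\<close>
  demands. The weighted bound on \<open>v\<close>, extended to the gradient, starts the chain of
  weights that ends in \<open>solution_zero\<close>.\<close>

theorem fixpoint_zero:
  assumes a: "continuous_on UNIV a" "\<And>x. \<bar>a x\<bar> \<le> A * jb x powr (- \<alpha>)" and \<alpha>: "\<alpha> > p + 1"
    and v0: "decays M 0 v" and fp: "\<And>x. v x = cv (\<lambda>y. of_real (a y) * v y) x"
  shows "v x = 0"
proof -
  obtain B where v: "decays B p v" by (rule fixpoint_decay[OF a \<alpha> v0 fp]) (rule that; assumption)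
  define g where "g = (\<lambda>y. of_real (a y) * v y)"
  define bt where "bt = \<alpha> + p"
  have g: "decays (A * B) bt g" unfolding g_def bt_def by (rule potential_decay[OF a \<alpha> v])
  have p1: "p \<ge> 1" by (rule p_ge_1)
  have bt: "0 \<le> bt" "p + bt > real CARD('n)" using \<alpha> p1 unfolding p_eq bt_def by linarith+
  have vg: "v x = cv g x" for x unfolding g_def by (rule fp)
  obtain L where L: "L > 0" "\<And>x y. norm (cv g x - cv g y) \<le> A * B * L * norm (x - y)"
    by (rule cv_lipschitz[OF bt]) (rule that; use g in blast)
  have AB: "A * B \<ge> 0" using g by (simp add: decays_def)
  have vc: "continuous_on UNIV v"
  proof (rule lipschitz_on_continuous_on[of "A * B * L"], rule lipschitz_onI)
    show "dist (v x) (v y) \<le> A * B * L * dist x y" for x y using L(2)[of x y] by (simp add: dist_norm vg)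
    show "0 \<le> A * B * L" using AB L by simp
  qed
  have gc: "continuous_on UNIV g" unfolding g_def by (intro continuous_intros a vc)
  obtain kp where kp: "kp > -1" "integrable lborel (\<lambda>x. jb x powr kp * (cmod (v x))^2)"
    by (rule fixpoint_weighted_L2[OF a \<alpha> v vc fp]) (rule that; assumption)
  have A: "A \<ge> 0" using order_trans[OF abs_ge_zero a(2)[of 0]] by (simp add: jbracket_def)
  have aj: "\<bar>a x\<bar> \<le> A * jb x powr (- 2)" for x
  proof -
    have "A * jb x powr (- \<alpha>) \<le> A * jb x powr (- 2)"
      using A \<alpha> p1 jb_ge_1[of x] by (intro mult_left_mono powr_mono) auto
    then show ?thesis using a(2)[of x] by linarith
  qed
  have z: "l (v x) = 0" if l: "bounded_linear l" "\<And>c z. l (of_real c * z) = c * l z" "\<And>z. \<bar>l z\<bar> \<le> cmod z" for l :: "complex \<Rightarrow> real"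
  proof -
    define G where "G x = (\<Sum>b\<in>Basis. l (cG g b x) *\<^sub>R b)" for x
    have ws: "weak_sol k (\<lambda>x. l (v x)) G (\<lambda>x. cE * a x * l (v x))"
    proof -
      have "cE * l (g x) = cE * a x * l (v x)" for x by (simp add: g_def l(2))
      with weak_sol_component[OF l(1) g bt gc] show ?thesis
        unfolding G_def by (simp only: vg[symmetric])
    qed
    interpret helmholtz_solution k "abs cE * A" "\<lambda>x. l (v x)" "\<lambda>x. cE * a x * l (v x)" G
    proof
      show "\<bar>cE * a x * l (v x)\<bar> \<le> abs cE * A * jb x powr (- 2) * \<bar>l (v x)\<bar>" for x
        unfolding abs_mult mult.assoc by (intro mult_left_mono) (auto simp: mult.assoc[symmetric] intro: mult_right_mono aj)
    qed (use ws k A in auto)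
    have "integrable lborel (\<lambda>x. jb x powr kp * (l (v x))^2)"
    proof (rule integrable_dominated[OF kp(2)])
      show "(\<lambda>x. jb x powr kp * (l (v x))^2) \<in> borel_measurable lborel"
        using borel_measurable_continuous_onI[OF uc] by simp
      show "AE x in lborel. norm (jb x powr kp * (l (v x))^2) \<le> norm (jb x powr kp * (cmod (v x))^2)"
      proof (rule AE_I2)
        fix x :: "real ^ 'n"
        have "(l (v x))^2 \<le> (cmod (v x))^2" using power_mono[OF l(3)[of "v x"], of 2] by simp
        then show "norm (jb x powr kp * (l (v x))^2) \<le> norm (jb x powr kp * (cmod (v x))^2)"
          by (simp add: mult_left_mono)
      qed
    qed
    from solution_zero[OF kp(1) gradient_integrable[OF this]] show ?thesis .
  qed
  have "Re (v x) = 0" "Im (v x) = 0"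
    by (rule z; simp add: bounded_linear_Re bounded_linear_Im abs_Re_le_cmod abs_Im_le_cmod)+
  then show ?thesis by (simp add: complex_eq_iff)
qed

end

text \<open>A diagonal choice gives convergence on a countable dense set, and the common Lipschitz
  constant spreads it to all points. Pointwise convergence is enough for dominated convergence
  later.\<close>

lemma equi_lipschitz_subsequence:
  fixes F :: "nat \<Rightarrow> 'a::{metric_space, second_countable_topology} \<Rightarrow> 'b::{real_normed_vector, heine_borel, complete_space}"
  assumes b: "\<And>n x. norm (F n x) \<le> M" and L: "\<And>n x y. norm (F n x - F n y) \<le> L * dist x y" "L > 0"
  obtains r v where "strict_mono (r :: nat \<Rightarrow> nat)" "\<And>x. (\<lambda>n. F (r n) x) \<longlonglongrightarrow> v x"
proof -
  obtain D :: "'a set" where D: "countable D" "\<And>X. open X \<Longrightarrow> X \<noteq> {} \<Longrightarrow> \<exists>d\<in>D. d \<in> X"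
    using countable_dense_exists by blast
  obtain r where r: "strict_mono (r :: nat \<Rightarrow> nat)" "\<And>x. x \<in> D \<Longrightarrow> \<exists>l. (\<lambda>n. F (r n) x) \<longlonglongrightarrow> l"
    by (rule function_convergent_subsequence[OF D(1), of F M]) (use b that in blast)+
  have "convergent (\<lambda>n. F (r n) x)" for x
    unfolding Cauchy_convergent_iff[symmetric]
  proof (rule metric_CauchyI)
    fix e :: real assume e: "e > 0"
    have "e / (3 * L) > 0" using e L(2) by (intro divide_pos_pos) auto
    then have "ball x (e / (3 * L)) \<noteq> {}" by simp
    then obtain d where d: "d \<in> D" "dist x d < e / (3 * L)" using D(2)[OF open_ball] by (metis mem_ball)
    have Ld: "L * dist x d < e / 3" using d(2) L by (simp add: field_simps)
    have "Cauchy (\<lambda>n. F (r n) d)" using r(2)[OF d(1)] LIMSEQ_imp_Cauchy by blast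
    then obtain N where N: "\<And>m n. m \<ge> N \<Longrightarrow> n \<ge> N \<Longrightarrow> dist (F (r m) d) (F (r n) d) < e / 3"
      using e by (metis metric_CauchyD zero_less_divide_iff zero_less_numeral)
    have "dist (F (r m) x) (F (r n) x) < e" if "m \<ge> N" "n \<ge> N" for m n
    proof -
      have "dist (F (r m) x) (F (r n) x) \<le> dist (F (r m) x) (F (r m) d) + dist (F (r m) d) (F (r n) d) + dist (F (r n) d) (F (r n) x)"
        by (metis add_mono_thms_linordered_semiring(3) dist_triangle dual_order.trans)
      also have "\<dots> < e / 3 + e / 3 + e / 3"
        using L(1)[of "r m" x d] L(1)[of "r n" x d] Ld N[OF that] by (simp add: dist_norm norm_minus_commute)
      finally show ?thesis by simp
    qed
    then show "\<exists>N. \<forall>m\<ge>N. \<forall>n\<ge>N. dist (F (r m) x) (F (r n) x) < e" by blast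
  qed
  then have "\<exists>v. \<forall>x. (\<lambda>n. F (r n) x) \<longlonglongrightarrow> v x" unfolding convergent_def by metis
  with r(1) that show ?thesis by blast
qed

context radial_kernel
begin

text \<open>The \<open>w n\<close> are only measurable, whereas the \<open>v n\<close> close to them
  are equi-Lipschitz and decay uniformly. Points where \<open>w n\<close> is large are therefore
  transferred to \<open>v n\<close>; decay confines them to a ball, and the Lipschitz bound carries
  the lower bound to the limit, which contradicts \<open>fixpoint_zero\<close>.\<close>

lemma no_blowup_sequence:
  assumes a: "continuous_on UNIV a" "\<And>x. \<bar>a x\<bar> \<le> A * jb x powr (- \<alpha>)" and \<alpha>: "\<alpha> > p + 1"
    and w: "\<And>n. decays 1 0 (w n)" and \<mu>: "\<And>n. 0 \<le> \<mu> n \<and> \<mu> n \<le> (1 :: real)" and dl: "dl \<longlonglongrightarrow> (0 :: real)"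
    and ae: "\<And>n. AE x in lborel. norm (w n x - of_real (\<mu> n) * cv (\<lambda>y. of_real (a y) * w n y) x) \<le> dl n"
    and large: "\<And>n. \<not> (AE x in lborel. norm (w n x) \<le> 3/4)"
  shows False
proof -
  define g where "g n y = of_real (a y) * w n y" for n and y :: "real ^ 'n"
  have p1: "p \<ge> 1" by (rule p_ge_1)
  have g: "decays A \<alpha> (g n)" for n using potential_decay[OF a \<alpha> w[of n]] by (simp add: g_def[abs_def])
  have A: "A \<ge> 0" using g[of 0] by (simp add: decays_def)
  define v where "v n x = of_real (\<mu> n) * cv (g n) x" for n x
  have \<alpha>': "0 \<le> \<alpha>" "p + \<alpha> > real CARD('n)" using \<alpha> p1 unfolding p_eq by linarith+
  define sg where "sg = min p ((\<alpha> - p - 1) / 2)"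
  have sg: "0 < sg" "sg \<le> p" "2 * sg \<le> \<alpha> - p - 1" using \<alpha> p1 by (auto simp: sg_def min_def)
  have sg': "0 \<le> sg" "sg \<le> p" "sg \<le> \<alpha>" "p + \<alpha> - sg > real CARD('n)" using sg p1 unfolding p_eq by linarith+
  obtain C where C: "C > 0" "\<And>n x. norm (cv (g n) x) \<le> A * C * jb x powr (- sg)"
    by (rule cv_bounds[OF sg']) (rule that; use g in blast)
  obtain L where L: "L > 0" "\<And>n x y. norm (cv (g n) x - cv (g n) y) \<le> A * L * norm (x - y)"
    by (rule cv_lipschitz[OF \<alpha>']) (rule that; use g in blast)
  have mu: "norm (of_real (\<mu> n) * z) \<le> norm z" for n and z :: complex
    using \<mu>[of n] by (simp add: norm_mult mult_left_le_one_le)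
  have vb: "norm (v n x) \<le> A * C * jb x powr (- sg)" for n x
    unfolding v_def using mu C(2) by (rule order_trans)
  have vb1: "norm (v n x) \<le> A * C" for n x
  proof -
    have "jb x powr (- sg) \<le> jb x powr 0" using sg jb_ge_1[of x] by (intro powr_mono) auto
    then have "A * C * jb x powr (- sg) \<le> A * C * 1" using A C(1) by (intro mult_left_mono) auto
    then show ?thesis using vb[of n x] by linarith
  qed
  define K where "K = A * L + 1"
  have K: "K > 0" using A L by (simp add: K_def add_nonneg_pos)
  have vl: "norm (v n x - v n y) \<le> K * dist x y" for n x y
  proof -
    have "norm (v n x - v n y) \<le> norm (cv (g n) x - cv (g n) y)"
      unfolding v_def right_diff_distrib[symmetric] by (rule mu)
    also have "\<dots> \<le> A * L * norm (x - y)" by (rule L)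
    also have "\<dots> \<le> K * dist x y" unfolding dist_norm by (intro mult_right_mono) (auto simp: K_def)
    finally show ?thesis .
  qed
  \<comment> \<open>Closeness to \<open>v n\<close> fails on a null set only, while the set where
    \<open>w n\<close> is large is not null, so some point has both properties.\<close>
  have "\<exists>x. norm (w n x) > 3/4 \<and> norm (w n x - v n x) \<le> dl n" for n
  proof (rule ccontr)
    assume c: "\<not> ?thesis"
    from ae[of n] have "AE x in lborel. norm (w n x) \<le> 3/4"
    proof eventually_elim
      case (elim x)
      then have "norm (w n x - v n x) \<le> dl n" unfolding v_def g_def .
      with c show ?case by (metis not_le)
    qed
    with large show False by blast
  qed
  then obtain X where X: "\<And>n. norm (w n (X n)) > 3/4" "\<And>n. norm (w n (X n) - v n (X n)) \<le> dl n" by metis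
  have vX: "norm (v n (X n)) > 3/4 - dl n" for n
    using X[of n] norm_triangle_ineq2[of "w n (X n)" "v n (X n)"] by linarith
  obtain n0 where n0: "\<And>n. n \<ge> n0 \<Longrightarrow> dl n < 1/4"
    using order_tendstoD(2)[OF dl, of "1/4"] by (auto simp: eventually_sequentially)
  have vX2: "norm (v n (X n)) \<ge> 1/2" if "n \<ge> n0" for n using vX[of n] n0[OF that] by linarith
  \<comment> \<open>The radius at which the uniform bound A C <x>^(-sg) drops to 1/2.\<close>
  define R where "R = (2 * A * C) powr (1 / sg)"
  have XR: "norm (X n) \<le> R" if "n \<ge> n0" for n
  proof -
    have "1/2 \<le> A * C * jb (X n) powr (- sg)" using vX2[OF that] vb[of n "X n"] by linarith
    then have "jb (X n) powr sg \<le> 2 * A * C" by (simp add: powr_minus field_simps)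
    then have "(jb (X n) powr sg) powr (1 / sg) \<le> R" unfolding R_def using sg by (intro powr_mono2) auto
    then have "jb (X n) \<le> R" using sg by (simp add: powr_powr)
    then show ?thesis using norm_le_jb[of "X n"] by linarith
  qed
  obtain r1 V where r1: "strict_mono (r1 :: nat \<Rightarrow> nat)" "\<And>x. (\<lambda>n. v (n0 + r1 n) x) \<longlonglongrightarrow> V x"
    by (rule equi_lipschitz_subsequence[of "\<lambda>n. v (n0 + n)" "A * C" K]) (use vb1 vl K that in auto)
  define Y where "Y n = (X (n0 + r1 n), \<mu> (n0 + r1 n))" for n
  have "compact (cball 0 R \<times> {0..1 :: real} :: ((real ^ 'n) \<times> real) set)" by (intro compact_Times) auto
  moreover have "Y n \<in> cball 0 R \<times> {0..1}" for n using XR \<mu> by (auto simp: Y_def)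
  ultimately obtain l r2 where r2: "l \<in> cball 0 R \<times> {0..1}" "strict_mono (r2 :: nat \<Rightarrow> nat)" "(Y \<circ> r2) \<longlonglongrightarrow> l"
    unfolding compact_def by blast
  define s where "s n = n0 + r1 (r2 n)" for n
  have s: "filterlim s at_top sequentially"
  proof -
    have "strict_mono s" using r1(1) r2(2) by (auto simp: s_def strict_mono_def)
    then show ?thesis by (rule filterlim_subseq)
  qed
  have vV: "(\<lambda>n. v (s n) x) \<longlonglongrightarrow> V x" for x
    using LIMSEQ_subseq_LIMSEQ[OF r1(2)[of x] r2(2)] by (simp add: s_def o_def)
  have Xl: "(\<lambda>n. X (s n)) \<longlonglongrightarrow> fst l" and \<mu>l: "(\<lambda>n. \<mu> (s n)) \<longlonglongrightarrow> snd l"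
    using tendsto_fst[OF r2(3)] tendsto_snd[OF r2(3)] by (simp_all add: o_def Y_def s_def)
  have dls: "(\<lambda>n. dl (s n)) \<longlonglongrightarrow> 0" by (rule filterlim_compose[OF dl s])
  have \<Phi>g: "integrable lborel (\<lambda>y. norm (\<Phi> (x - y)) * (A * jb y powr (- \<alpha>)))" for x
  proof -
    have "decays A \<alpha> (\<lambda>y :: real ^ 'n. of_real (A * jb y powr (- \<alpha>)))" using A by (simp add: decays_def norm_mult)
    from integrable_norm[OF kernel_integrable(1)[OF this \<alpha>']] show ?thesis using A by (simp add: norm_mult)
  qed
  have AE1: "AE x in lborel. (\<lambda>n. w (s n) x) \<longlonglongrightarrow> V x"
  proof -
    have "AE x in lborel. \<forall>n. norm (w n x - v n x) \<le> dl n"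
      unfolding AE_all_countable using ae by (simp add: v_def g_def[abs_def])
    then show ?thesis
    proof eventually_elim
      case (elim x)
      have "(\<lambda>n. w (s n) x - v (s n) x) \<longlonglongrightarrow> 0"
        by (rule Lim_null_comparison[OF _ dls]) (use elim in auto)
      from tendsto_add[OF this vV[of x]] show ?case by simp
    qed
  qed
  have wm[measurable]: "w n \<in> borel_measurable borel" for n using w[of n] by (simp add: decays_def)
  have wb: "norm (w n x) \<le> 1" for n x using w[of n] by (simp add: decays_def)
  have am[measurable]: "a \<in> borel_measurable borel" using a(1) by (rule borel_measurable_continuous_onI)
  have gm[measurable]: "g n \<in> borel_measurable borel" for n using g[of n] by (simp add: decays_def)
  have vm[measurable]: "v n \<in> borel_measurable borel" for n unfolding v_def by measurable
  have Vm[measurable]: "V \<in> borel_measurable borel" by (rule borel_measurable_LIMSEQ_metric[OF _ vV]) measurable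
  have Vb: "norm (V x) \<le> A * C" for x
    by (rule LIMSEQ_le_const2[OF tendsto_norm[OF vV]]) (use vb1 in auto)
  have fp: "V x = cv (\<lambda>y. of_real (snd l * a y) * V y) x" for x
  proof -
    have "(\<lambda>n. cv (g (s n)) x) \<longlonglongrightarrow> cv (\<lambda>y. of_real (a y) * V y) x"
      unfolding cv_def
    proof (rule integral_dominated_convergence[OF _ _ \<Phi>g[of x]])
      show "AE y in lborel. (\<lambda>n. \<Phi> (x - y) * g (s n) y) \<longlonglongrightarrow> \<Phi> (x - y) * (of_real (a y) * V y)"
        using AE1 unfolding g_def by eventually_elim (intro tendsto_intros)
      show "AE y in lborel. norm (\<Phi> (x - y) * g (s n) y) \<le> norm (\<Phi> (x - y)) * (A * jb y powr (- \<alpha>))" for n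
        using g[of "s n"] by (intro AE_I2) (auto simp: norm_mult decays_def intro: mult_left_mono)
    qed measurable
    from tendsto_mult[OF tendsto_of_real[OF \<mu>l] this]
    have "(\<lambda>n. v (s n) x) \<longlonglongrightarrow> of_real (snd l) * cv (\<lambda>y. of_real (a y) * V y) x" by (simp add: v_def)
    from LIMSEQ_unique[OF vV this] have "V x = of_real (snd l) * cv (\<lambda>y. of_real (a y) * V y) x" .
    also have "\<dots> = cv (\<lambda>y. of_real (snd l * a y) * V y) x"
      unfolding cv_def by (subst integral_mult_right_zero[symmetric]) (simp add: mult_ac)
    finally show ?thesis .
  qed
  \<comment> \<open>The limit of the \<mu> is absorbed into the potential; lying in [0, 1], it
    preserves the bound on \<open>a\<close>.\<close>
  have z: "V x = 0" for x
  proof (rule fixpoint_zero[OF _ _ \<alpha> _ fp])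
    show "continuous_on UNIV (\<lambda>y. snd l * a y)" by (intro continuous_intros a)
    show "\<bar>snd l * a y\<bar> \<le> A * jb y powr (- \<alpha>)" for y
    proof -
      have "\<bar>snd l * a y\<bar> \<le> 1 * \<bar>a y\<bar>" unfolding abs_mult using r2(1) by (intro mult_right_mono) auto
      then show ?thesis using a(2)[of y] by simp
    qed
    show "decays (A * C) 0 V" using Vm Vb A C by (simp add: decays_def)
  qed
  \<comment> \<open>The lower bound 1/2 holds at the moving points \<open>X (s n)\<close>; the
    Lipschitz estimate moves it to their limit \<open>fst l\<close>.\<close>
  have "(\<lambda>n. norm (v (s n) (fst l)) + K * norm (X (s n) - fst l)) \<longlonglongrightarrow> norm (V (fst l)) + K * norm (fst l - fst l)"
    by (intro tendsto_intros vV Xl)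
  moreover have "1/2 \<le> norm (v (s n) (fst l)) + K * norm (X (s n) - fst l)" for n
    using vX2[of "s n"] vl[of "s n" "X (s n)" "fst l"] norm_triangle_ineq2[of "v (s n) (X (s n))" "v (s n) (fst l)"]
    by (simp add: s_def dist_norm)
  ultimately have "1/2 \<le> norm (V (fst l)) + K * norm (fst l - fst l)" by (intro LIMSEQ_le_const) auto
  then show False by (simp add: z)
qed

end

section \<open>A priori bounds\<close>

lemma AE_lebesgue_lborel: "(AE x in lebesgue. P x) \<longleftrightarrow> (AE x in lborel. P x)"
  by (rule AE_completion_iff)

lemma Linf_norm_AE: "AE x in lebesgue. ereal (norm (w x)) \<le> Linf_norm w"
  unfolding Linf_norm_def by (rule esssup_AE)

lemma Linf_norm_leI:
  assumes "w \<in> borel_measurable lebesgue" "AE x in lebesgue. norm (w x) \<le> C"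
  shows "Linf_norm w \<le> ereal C"
  unfolding Linf_norm_def
proof (rule esssup_I)
  show "(\<lambda>x. ereal (norm (w x))) \<in> borel_measurable lebesgue" using assms(1) by measurable
  show "AE x in lebesgue. ereal (norm (w x)) \<le> ereal C" using assms(2) by simp
qed

lemma Linf_norm_nonneg:
  fixes w :: "real ^ 'n \<Rightarrow> 'b::real_normed_vector"
  shows "0 \<le> Linf_norm w"
proof -
  have "AE x :: real ^ 'n in lebesgue. 0 \<le> Linf_norm w"
    by (rule eventually_mono[OF Linf_norm_AE[of w]]) (erule order_trans[rotated], simp)
  \<comment> \<open>An inequality free of \<open>x\<close> that holds almost everywhere is true,
    because Lebesgue measure is not zero.\<close>
  then show ?thesis by (simp add: ae_filter_eq_bot_iff)
qed

lemma Linf_norm_finiteE: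
  assumes "Linf_norm w < \<infinity>"
  obtains M where "M \<ge> 0" "Linf_norm w = ereal M" "AE x in lebesgue. norm (w x) \<le> M"
proof -
  obtain M where M: "Linf_norm w = ereal M" using assms Linf_norm_nonneg[of w] by (cases "Linf_norm w") auto
  show ?thesis using M Linf_norm_nonneg[of w] Linf_norm_AE[of w] by (intro that[of M]) simp_all
qed

lemma wLinf_norm_finiteE:
  assumes "wLinf_norm \<alpha> w < \<infinity>"
  obtains M where "M \<ge> 0" "wLinf_norm \<alpha> w = ereal M" "AE x in lebesgue. jb x powr \<alpha> * norm (w x) \<le> M"
proof -
  have "Linf_norm (\<lambda>x. (jb x powr \<alpha>) *\<^sub>R w x) < \<infinity>" using assms by (simp add: wLinf_norm_def)
  then obtain M where "M \<ge> 0" "Linf_norm (\<lambda>x. (jb x powr \<alpha>) *\<^sub>R w x) = ereal M" "AE x in lebesgue. norm ((jb x powr \<alpha>) *\<^sub>R w x) \<le> M"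
    by (rule Linf_norm_finiteE)
  then show ?thesis by (intro that[of M]) (simp_all add: wLinf_norm_def)
qed

lemma lebesgue_measurableI: "f \<in> borel_measurable borel \<Longrightarrow> f \<in> borel_measurable lebesgue"
  by (simp add: measurable_completion)

lemma measurable_subst_op:
  fixes f :: "(real ^ 'n) \<times> complex \<Rightarrow> complex"
  assumes f: "continuous_on UNIV f" and u: "u \<in> borel_measurable lebesgue"
  shows "subst_op f u \<in> borel_measurable lebesgue"
proof -
  have "(\<lambda>x. (x, u x)) \<in> measurable lebesgue (borel \<Otimes>\<^sub>M borel)"
    using u by (intro measurable_Pair) (auto intro: lebesgue_measurableI)
  then have "(\<lambda>x. f (x, u x)) \<in> borel_measurable lebesgue"
    using borel_measurable_continuous_onI[OF f]
    by (intro measurable_compose[where f = "\<lambda>x. (x, u x)" and g = f]) (auto simp: borel_prod)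
  then show ?thesis by (simp add: subst_op_def[abs_def])
qed

context radial_kernel
begin

lemma outgoing_fund_measurable:
  assumes h: "\<And>x :: real ^ 'n. x \<noteq> 0 \<Longrightarrow> outgoing_fund k x = \<Phi> x"
  shows "(outgoing_fund k :: real ^ 'n \<Rightarrow> complex) \<in> borel_measurable borel"
proof -
  have "outgoing_fund k = (\<lambda>x :: real ^ 'n. if x = 0 then outgoing_fund k (0 :: real ^ 'n) else \<Phi> x)"
  proof
    fix x :: "real ^ 'n" show "outgoing_fund k x = (if x = 0 then outgoing_fund k (0 :: real ^ 'n) else \<Phi> x)" by (simp add: h)
  qed
  moreover have "(\<lambda>x :: real ^ 'n. if x = 0 then outgoing_fund k (0 :: real ^ 'n) else \<Phi> x) \<in> borel_measurable borel" by measurable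
  ultimately show ?thesis by simp
qed

text \<open>Passes from Lebesgue to Borel measurable densities and from the given kernel to the one
  with value 0 at the origin; either change concerns a null set of \<open>y\<close> only.\<close>

lemma resolvent_op_cv:
  assumes h: "\<And>x :: real ^ 'n. x \<noteq> 0 \<Longrightarrow> outgoing_fund k x = \<Phi> x"
    and g: "g \<in> borel_measurable lebesgue" and G: "G \<in> borel_measurable borel" and eq: "AE y in lebesgue. g y = G y"
  shows "resolvent_op k g x = cv G x"
proof -
  have [measurable]: "(\<lambda>y. outgoing_fund k (x - y)) \<in> borel_measurable lebesgue"
    by (intro lebesgue_measurableI measurable_compose[OF _ outgoing_fund_measurable[OF h]]) measurable
  have b: "(\<lambda>y. \<Phi> (x - y) * G y) \<in> borel_measurable borel" using G by measurable
  have "(\<integral>y. outgoing_fund k (x - y) * g y \<partial>lebesgue) = (\<integral>y. \<Phi> (x - y) * G y \<partial>lebesgue)"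
  proof (rule integral_cong_AE)
    show "(\<lambda>y. outgoing_fund k (x - y) * g y) \<in> borel_measurable lebesgue" using g by measurable
    show "(\<lambda>y. \<Phi> (x - y) * G y) \<in> borel_measurable lebesgue" by (rule lebesgue_measurableI[OF b])
    have "AE y in lebesgue. y \<noteq> x" unfolding AE_lebesgue_lborel by (rule AE_lborel_singleton)
    then show "AE y in lebesgue. outgoing_fund k (x - y) * g y = \<Phi> (x - y) * G y"
      using eq by eventually_elim (use h in auto)
  qed
  also have "\<dots> = (LBINT y. \<Phi> (x - y) * G y)" by (rule integral_completion) (use b in simp)
  finally show ?thesis by (simp add: resolvent_op_def convolution_def cv_def)
qed

lemma bounded_f2:
  fixes f :: "(real ^ 'n) \<times> complex \<Rightarrow> complex" and \<phi> :: "real ^ 'n \<Rightarrow> complex"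
  assumes h: "\<And>x :: real ^ 'n. x \<noteq> 0 \<Longrightarrow> outgoing_fund k x = \<Phi> x"
    and \<alpha>: "\<alpha> > p + 1" and f: "continuous_on UNIV f" and f2: "cond_f2 k \<alpha> f" and \<phi>: "\<phi> \<in> Linf"
  shows "\<exists>C::real. \<forall>u\<in>solution_family k f \<phi>. Linf_norm u \<le> ereal C"
proof -
  define kp where "kp = kappa_const TYPE('n) k \<alpha>"
  obtain Q b where Q: "Q \<in> wLinf \<alpha>" and b: "b \<in> wLinf \<alpha>" and lt: "wLinf_norm \<alpha> Q < 1 / kp"
    and fQ: "\<And>x u. cmod (f (x, u)) \<le> Q x * cmod u + b x" using f2 unfolding cond_f2_def kp_def by blast
  obtain q where q: "q \<ge> 0" "wLinf_norm \<alpha> Q = ereal q" "AE x in lebesgue. jb x powr \<alpha> * norm (Q x) \<le> q"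
    by (rule wLinf_norm_finiteE[of \<alpha> Q]) (use Q in \<open>auto simp: wLinf_def\<close>)
  obtain bt where bt: "bt \<ge> 0" "AE x in lebesgue. jb x powr \<alpha> * norm (b x) \<le> bt"
    by (rule wLinf_norm_finiteE[of \<alpha> b]) (use b in \<open>auto simp: wLinf_def\<close>)
  obtain B where B: "B \<ge> 0" "AE x in lebesgue. norm (\<phi> x) \<le> B"
    by (rule Linf_norm_finiteE[of \<phi>]) (use \<phi> in \<open>auto simp: Linf_def\<close>)
  have qk: "ereal q < 1 / kp" using lt q by simp
  \<comment> \<open>The quotient 1 / \<open>kp\<close> is one of extended reals: it is 0 for
    infinite \<open>kp\<close>, which contradicts q >= 0, and it is infinite for \<open>kp\<close> =
    0, where K q = 0. In the remaining case q >= 0 forces K > 0.\<close>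
  obtain K where K: "kp = ereal K" "K \<ge> 0" "K * q < 1"
  proof (cases kp)
    case (real K)
    show ?thesis
    proof (cases "K = 0")
      case False
      have "1 / kp = ereal (1 / K)" using False by (simp add: real divide_ereal_def inverse_eq_divide)
      then have "ereal q < ereal (1 / K)" using qk by (simp only:)
      then have "q < 1 / K" by (simp only: less_ereal.simps(1))
      moreover from this have "K > 0" using q(1) False by (metis less_le_trans not_less_iff_gr_or_eq zero_less_divide_1_iff order.strict_trans1)
      ultimately have "K * q < 1" by (simp add: field_simps)
      with \<open>K > 0\<close> show ?thesis using real that[of K] by simp
    qed (use real that in simp)
  qed (use qk q(1) in \<open>simp_all add: divide_ereal_def\<close>)
  \<comment> \<open>With a nonnegative exponent the weighted norm in \<open>kappa_const\<close>
    dominates the plain supremum norm.\<close>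
  have \<tau>: "tau CARD('n) \<alpha> \<ge> 0"
  proof -
    have "\<alpha> - (real CARD('n) + 1) / 2 \<ge> 0" "(real CARD('n) - 1) / 2 \<ge> 0" using \<alpha> N3 unfolding p_def by (argo, simp)
    then show ?thesis by (simp only: tau_def) simp
  qed
  have res: "AE x :: real ^ 'n in lebesgue. cmod (resolvent_op k g x) \<le> K * s"
    if g: "g \<in> borel_measurable lebesgue" and gs: "AE x in lebesgue. jb x powr \<alpha> * cmod (g x) \<le> s" and s: "s \<ge> 0" for g s
  proof -
    have "wLinf_norm \<alpha> g \<le> ereal s" unfolding wLinf_norm_def
    proof (rule Linf_norm_leI)
      show "(\<lambda>x. (jb x powr \<alpha>) *\<^sub>R g x) \<in> borel_measurable lebesgue"
        by (rule borel_measurable_scaleR[OF _ g], rule lebesgue_measurableI) measurable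
    qed (use gs in simp)
    moreover from this have "wLinf_norm \<alpha> g < \<infinity>" by (meson ereal_infty_less(1) ereal_less_eq(1) less_ereal.simps(4) not_le order_le_less_trans)
    ultimately obtain t where t: "t \<ge> 0" "wLinf_norm \<alpha> g = ereal t" "AE x in lebesgue. jb x powr \<alpha> * cmod (g x) \<le> t" "t \<le> s"
      by (elim wLinf_norm_finiteE) auto
    show ?thesis
    proof (cases "t = 0")
      \<comment> \<open>The supremum in \<open>kappa_const\<close> runs over functions of norm 1, so
        a density that vanishes almost everywhere cannot be normalized and is treated apart.\<close>
      case True
      have "AE x :: real ^ 'n in lebesgue. g x = 0" using t(3) by eventually_elim (simp add: True mult_le_0_iff)
      then have "resolvent_op k g x = cv (\<lambda>y. 0) x" for x :: "real ^ 'n" by (intro resolvent_op_cv[OF h g]) auto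
      then show ?thesis using K s by (simp add: cv_def)
    next
      case False
      then have t0: "t > 0" using t(1) by simp
      \<comment> \<open>Taking the modulus of \<open>g\<close> makes its convolution with the
        modulus of the kernel a nonnegative number, which times \<open>t\<close> dominates the
        resolvent of \<open>g\<close>.\<close>
      define w where "w y = complex_of_real (cmod (g y) / t)" for y
      have wm: "w \<in> borel_measurable lebesgue" unfolding w_def using g by measurable
      have "Linf_norm (\<lambda>x. (jb x powr \<alpha>) *\<^sub>R w x) = 1"
      proof -
        have 1: "ereal (norm ((jb x powr \<alpha>) *\<^sub>R w x)) = ereal (1 / t) * ereal (norm ((jb x powr \<alpha>) *\<^sub>R g x))" for x
          using t0 by (simp add: w_def norm_divide)
        have "Linf_norm (\<lambda>x. (jb x powr \<alpha>) *\<^sub>R w x) = ereal (1 / t) * ereal t"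
          unfolding Linf_norm_def 1 using t0 t(2) by (subst esssup_cmult) (simp_all add: wLinf_norm_def Linf_norm_def)
        then show ?thesis using t0 by (simp add: one_ereal_def)
      qed
      then have wn: "wLinf_norm \<alpha> w = 1" by (simp add: wLinf_norm_def)
      define c where "c = convolution (\<lambda>x. complex_of_real (cmod (outgoing_fund k x))) w"
      have "wLinf_norm (tau CARD('n) \<alpha>) c \<le> kp"
        unfolding kp_def kappa_const_def c_def by (rule Sup_upper) (use wm wn in \<open>auto simp: wLinf_def\<close>)
      then have cn: "Linf_norm (\<lambda>x. (jb x powr tau CARD('n) \<alpha>) *\<^sub>R c x) \<le> ereal K" unfolding wLinf_norm_def K(1) .
      have "AE x in lebesgue. ereal (norm ((jb x powr tau CARD('n) \<alpha>) *\<^sub>R c x)) \<le> ereal K"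
        by (rule eventually_mono[OF Linf_norm_AE]) (erule order_trans[OF _ cn])
      then show ?thesis
      proof eventually_elim
        case (elim x)
        have "1 * cmod (c x) \<le> jb x powr tau CARD('n) \<alpha> * cmod (c x)"
          using \<tau> jb_ge_1[of x] by (intro mult_right_mono ge_one_powr_ge_zero) auto
        also have "\<dots> \<le> K" using elim by simp
        finally have cK: "cmod (c x) \<le> K" by simp
        have "cmod (resolvent_op k g x) \<le> (\<integral>y. cmod (outgoing_fund k (x - y) * g y) \<partial>lebesgue)"
          unfolding resolvent_op_def convolution_def by (rule integral_norm_bound)
        also have "\<dots> = t * (\<integral>y. cmod (outgoing_fund k (x - y)) * (cmod (g y) / t) \<partial>lebesgue)"
          using t0 by (subst integral_mult_right_zero[symmetric]) (simp add: norm_mult)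
        also have "(\<integral>y. cmod (outgoing_fund k (x - y)) * (cmod (g y) / t) \<partial>lebesgue) \<le> cmod (c x)"
        proof -
          have "c x = complex_of_real (\<integral>y. cmod (outgoing_fund k (x - y)) * (cmod (g y) / t) \<partial>lebesgue)"
            unfolding c_def convolution_def w_def of_real_mult[symmetric] by (rule integral_complex_of_real)
          then show ?thesis by (simp only: norm_of_real abs_ge_self)
        qed
        also have "t * cmod (c x) \<le> s * K" using cK t t0 K by (intro mult_mono) auto
        finally show ?case using t0 by (simp add: mult.commute)
      qed
    qed
  qed
  show ?thesis
  proof (intro exI ballI)
    fix u assume u: "u \<in> solution_family k f \<phi>"
    then have um: "u \<in> borel_measurable lebesgue" and "Linf_norm u < \<infinity>" by (auto simp: solution_family_def Linf_def)
    then obtain M where M: "M \<ge> 0" "Linf_norm u = ereal M" "AE x in lebesgue. norm (u x) \<le> M" by (elim Linf_norm_finiteE)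
    obtain \<mu> where \<mu>: "0 \<le> \<mu>" "\<mu> \<le> 1" "AE x in lebesgue. u x = complex_of_real \<mu> * (resolvent_op k (subst_op f u) x + \<phi> x)"
      using u by (auto simp: solution_family_def)
    have "AE x in lebesgue. jb x powr \<alpha> * cmod (subst_op f u x) \<le> q * M + bt"
      using q(3) bt(2) M(3)
    proof eventually_elim
      case (elim x)
      have "cmod (subst_op f u x) \<le> Q x * cmod (u x) + b x" unfolding subst_op_def by (rule fQ)
      also have "\<dots> \<le> norm (Q x) * cmod (u x) + norm (b x)" by (intro add_mono mult_right_mono) auto
      finally have "jb x powr \<alpha> * cmod (subst_op f u x) \<le> jb x powr \<alpha> * (norm (Q x) * cmod (u x) + norm (b x))"
        by (rule mult_left_mono) simp
      also have "\<dots> = (jb x powr \<alpha> * norm (Q x)) * cmod (u x) + jb x powr \<alpha> * norm (b x)"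
        by (simp add: distrib_left)
      also have "\<dots> \<le> q * M + bt" using elim q(1) by (intro add_mono mult_mono) auto
      finally show ?case .
    qed
    from res[OF measurable_subst_op[OF f um] this] M(1) q(1) bt(1)
    have r: "AE x in lebesgue. cmod (resolvent_op k (subst_op f u) x) \<le> K * (q * M + bt)" by simp
    have "AE x in lebesgue. norm (u x) \<le> K * (q * M + bt) + B"
      using r \<mu>(3) B(2)
    proof eventually_elim
      case (elim x)
      have "norm (u x) \<le> 1 * cmod (resolvent_op k (subst_op f u) x + \<phi> x)"
        unfolding elim(2) norm_mult using \<mu> by (intro mult_right_mono) auto
      also have "\<dots> \<le> cmod (resolvent_op k (subst_op f u) x) + cmod (\<phi> x)" using norm_triangle_ineq by simp
      finally show ?case using elim by linarith
    qed
    \<comment> \<open>\<open>M\<close> is finite because \<open>u\<close> belongs to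
      \<open>Linf\<close>, so K q < 1 allows the inequality to be solved for
      \<open>M\<close>.\<close>
    from Linf_norm_leI[OF um this] have "M \<le> K * (q * M + bt) + B" by (simp add: M(2))
    then have "M * (1 - K * q) \<le> K * bt + B" by (simp add: algebra_simps)
    then have "M \<le> (K * bt + B) / (1 - K * q)" using K(3) by (simp add: pos_le_divide_eq)
    then show "Linf_norm u \<le> ereal ((K * bt + B) / (1 - K * q))" by (simp add: M(2))
  qed
qed

end

lemma growth_sup_upper: "cmod u \<le> M \<Longrightarrow> ereal (jb x powr \<alpha> * cmod (g (x, u))) \<le> growth_sup \<alpha> g M"
  unfolding growth_sup_def by (rule Sup_upper) auto

lemma growth_sup_small:
  assumes lim: "((\<lambda>M. growth_sup \<alpha> b M / ereal M) \<longlongrightarrow> 0) at_top" and eps: "eps > 0"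
  shows "\<exists>M0>0. \<forall>M\<ge>M0. \<forall>x u. cmod u \<le> M \<longrightarrow> jb x powr \<alpha> * cmod (b (x, u)) \<le> eps * M"
proof -
  have "\<forall>\<^sub>F M in at_top. growth_sup \<alpha> b M / ereal M < ereal eps"
    by (rule order_tendstoD(2)[OF lim]) (use eps in simp)
  then obtain M1 where M1: "\<And>M. M \<ge> M1 \<Longrightarrow> growth_sup \<alpha> b M / ereal M < ereal eps"
    by (auto simp: eventually_at_top_linorder)
  show ?thesis
  proof (intro exI[of _ "max M1 1"] conjI allI impI)
    fix M x u assume M: "max M1 1 \<le> M" and u: "cmod u \<le> M"
    then have M0: "M > 0" by simp
    define y where "y = jb x powr \<alpha> * cmod (b (x, u))"
    have "ereal y / ereal M \<le> growth_sup \<alpha> b M / ereal M"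
      unfolding y_def by (rule ereal_divide_right_mono[OF growth_sup_upper[OF u]]) (use M0 in simp)
    also have "\<dots> < ereal eps" using M1 M by simp
    finally have "y / M < eps" using M0 by simp
    then show "y \<le> eps * M" using M0 by (simp add: divide_less_eq)
  qed simp
qed

text \<open>Since \<open>b\<close> is o(M) uniformly in \<open>x\<close>, the quotients f(x,M)/M
  converge uniformly to \<open>a\<close>, and continuity of \<open>f\<close> passes to the limit.
  The bound results from a single value of \<open>M\<close> at which both \<open>f\<close> and
  \<open>b\<close> are controlled at every point.\<close>

lemma asymptotically_linear_coefficient:
  fixes f :: "(real ^ 'n) \<times> complex \<Rightarrow> complex" and a :: "real ^ 'n \<Rightarrow> real"
  assumes f: "continuous_on UNIV f" and fin: "\<And>M. M > 0 \<Longrightarrow> growth_sup \<alpha> f M < \<infinity>" and \<alpha>: "\<alpha> \<ge> 0"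
    and ab: "\<And>x u. f (x, u) = complex_of_real (a x) * u + b (x, u)"
    and small: "\<And>eps. eps > 0 \<Longrightarrow> \<exists>M0>0. \<forall>M\<ge>M0. \<forall>x u. cmod u \<le> M \<longrightarrow> jb x powr \<alpha> * cmod (b (x, u)) \<le> eps * M"
  shows "continuous_on UNIV a" "\<exists>A. \<forall>x. \<bar>a x\<bar> \<le> A * jb x powr (- \<alpha>)"
proof -
  show "continuous_on UNIV a"
  proof (rule uniform_limit_theorem)
    show "\<forall>\<^sub>F M in at_top. continuous_on UNIV (\<lambda>x. Re (f (x, of_real M)) / M)"
      using eventually_gt_at_top[of 0]
      by eventually_elim (intro continuous_intros continuous_on_compose2[OF f]; simp)
    show "uniform_limit UNIV (\<lambda>M x. Re (f (x, of_real M)) / M) a at_top"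
    proof (rule uniform_limitI)
      fix e :: real assume e: "e > 0"
      then obtain M0 where M0: "M0 > 0" "\<And>M x u. M \<ge> M0 \<Longrightarrow> cmod u \<le> M \<Longrightarrow> jb x powr \<alpha> * cmod (b (x, u)) \<le> e / 2 * M"
        using small[of "e / 2"] by auto
      show "\<forall>\<^sub>F M in at_top. \<forall>x\<in>UNIV. dist (Re (f (x, of_real M)) / M) (a x) < e"
        using eventually_ge_at_top[of M0]
      proof eventually_elim
        case (elim M)
        then have M: "M > 0" using M0(1) by simp
        show ?case
        proof
          fix x :: "real ^ 'n"
          have "Re (f (x, of_real M)) / M - a x = Re (b (x, of_real M)) / M"
            using M by (simp add: ab field_simps)
          then have "dist (Re (f (x, of_real M)) / M) (a x) \<le> cmod (b (x, of_real M)) / M"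
            using M abs_Re_le_cmod by (simp add: dist_real_def divide_right_mono)
          also have "\<dots> \<le> (e / 2 * M) / M"
          proof (rule divide_right_mono)
            have "1 * cmod (b (x, of_real M)) \<le> jb x powr \<alpha> * cmod (b (x, of_real M))"
              using \<alpha> jb_ge_1[of x] by (intro mult_right_mono ge_one_powr_ge_zero) auto
            also have "\<dots> \<le> e / 2 * M" using M0(2)[OF elim, of "complex_of_real M"] M by simp
            finally show "cmod (b (x, of_real M)) \<le> e / 2 * M" by simp
          qed (use M in simp)
          also have "\<dots> < e" using M e by simp
          finally show "dist (Re (f (x, of_real M)) / M) (a x) < e" .
        qed
      qed
    qed
  qed simp
  obtain M where M: "M > 0" "\<And>x u. cmod u \<le> M \<Longrightarrow> jb x powr \<alpha> * cmod (b (x, u)) \<le> 1 * M"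
    using small[of 1] by auto
  have nn: "0 \<le> growth_sup \<alpha> f M"
    by (rule order_trans[OF _ growth_sup_upper[of 0 M 0 \<alpha> f]]) (use M in auto)
  then obtain F where F: "growth_sup \<alpha> f M = ereal F" using fin[OF M(1)] by (cases "growth_sup \<alpha> f M") auto
  have "\<bar>a x\<bar> \<le> ((F + M) / M) * jb x powr (- \<alpha>)" for x
  proof -
    have "complex_of_real (a x * M) = f (x, of_real M) - b (x, of_real M)" by (simp add: ab)
    then have "\<bar>a x\<bar> * M \<le> cmod (f (x, of_real M)) + cmod (b (x, of_real M))"
      using norm_triangle_ineq4[of "f (x, of_real M)" "b (x, of_real M)"] M(1)
      by (metis abs_mult abs_of_pos norm_of_real)
    from mult_left_mono[OF this, of "jb x powr \<alpha>"]
    have "jb x powr \<alpha> * (\<bar>a x\<bar> * M) \<le> jb x powr \<alpha> * cmod (f (x, of_real M)) + jb x powr \<alpha> * cmod (b (x, of_real M))"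
      by (simp add: distrib_left)
    also have "\<dots> \<le> F + 1 * M"
      using growth_sup_upper[of "complex_of_real M" M x \<alpha> f] M by (intro add_mono M(2)) (simp_all add: F)
    finally have "jb x powr \<alpha> * \<bar>a x\<bar> \<le> (F + M) / M" using M(1) by (simp add: pos_le_divide_eq mult.assoc)
    then have "jb x powr \<alpha> * \<bar>a x\<bar> * jb x powr (- \<alpha>) \<le> (F + M) / M * jb x powr (- \<alpha>)"
      by (intro mult_right_mono) auto
    moreover have "jb x powr \<alpha> * \<bar>a x\<bar> * jb x powr (- \<alpha>) = \<bar>a x\<bar>"
      by (simp add: powr_minus)
    ultimately show ?thesis by simp
  qed
  then show "\<exists>A. \<forall>x. \<bar>a x\<bar> \<le> A * jb x powr (- \<alpha>)" by blast
qed

lemma borel_representative: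
  fixes u :: "real ^ 'n \<Rightarrow> complex"
  assumes u: "u \<in> borel_measurable lebesgue"
  obtains u' where "u' \<in> borel_measurable borel" "AE x in lebesgue. u x = u' x"
proof -
  have m: "(\<lambda>x. Re (u x)) \<in> borel_measurable lebesgue" "(\<lambda>x. Im (u x)) \<in> borel_measurable lebesgue" using u by measurable
  obtain r where r: "r \<in> borel_measurable lborel" "AE x in lborel. Re (u x) = r x"
    using completion_ex_borel_measurable_real[OF m(1)] by blast
  obtain i where i: "i \<in> borel_measurable lborel" "AE x in lborel. Im (u x) = i x"
    using completion_ex_borel_measurable_real[OF m(2)] by blast
  show ?thesis
  proof (rule that)
    show "(\<lambda>x. Complex (r x) (i x)) \<in> borel_measurable borel"
      using r(1) i(1) unfolding Complex_eq by measurable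
    show "AE x in lebesgue. u x = Complex (r x) (i x)"
      unfolding AE_lebesgue_lborel using r(2) i(2) by eventually_elim (simp add: complex_eq_iff)
  qed
qed

context radial_kernel
begin

text \<open>Dividing the equation by M = \<open>Linf_norm u\<close> makes its linear part scale
  invariant; the errors are the o(M) part of the nonlinearity, of size eps C after convolution, and
  \<phi>, of size B/M.\<close>

lemma normalized_solution:
  fixes f :: "(real ^ 'n) \<times> complex \<Rightarrow> complex" and \<phi> :: "real ^ 'n \<Rightarrow> complex"
  assumes h: "\<And>x :: real ^ 'n. x \<noteq> 0 \<Longrightarrow> outgoing_fund k x = \<Phi> x"
    and f: "continuous_on UNIV f" and a: "continuous_on UNIV a" "\<And>x. \<bar>a x\<bar> \<le> A * jb x powr (- \<alpha>)" and \<alpha>: "\<alpha> > p + 1"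
    and ab: "\<And>x u. f (x, u) = complex_of_real (a x) * u + b (x, u)"
    and bM: "\<And>x u. cmod u \<le> M \<Longrightarrow> jb x powr \<alpha> * cmod (b (x, u)) \<le> eps * M" and eps: "eps > 0"
    and C: "\<And>A g x. decays A \<alpha> g \<Longrightarrow> norm (cv g x) \<le> A * C" and B: "AE x in lebesgue. norm (\<phi> x) \<le> B"
    and u: "u \<in> solution_family k f \<phi>" and M: "Linf_norm u = ereal M" "M > 0"
  obtains w \<mu> where "decays 1 0 w" "0 \<le> \<mu>" "\<mu> \<le> 1"
    "AE x in lborel. norm (w x - of_real \<mu> * cv (\<lambda>y. of_real (a y) * w y) x) \<le> eps * C + B / M"
    "\<not> (AE x in lborel. norm (w x) \<le> 3/4)"
proof -
  have um: "u \<in> borel_measurable lebesgue" using u by (auto simp: solution_family_def Linf_def)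
  obtain \<mu> where \<mu>: "0 \<le> \<mu>" "\<mu> \<le> 1" "AE x in lebesgue. u x = complex_of_real \<mu> * (resolvent_op k (subst_op f u) x + \<phi> x)"
    using u by (auto simp: solution_family_def)
  obtain u' where u': "u' \<in> borel_measurable borel" "AE x in lebesgue. u x = u' x" by (rule borel_representative[OF um])
  note [measurable] = u'(1)
  have um': "AE x in lebesgue. norm (u x) \<le> M" using Linf_norm_AE[of u] by (simp add: M(1))
  \<comment> \<open>The truncation changes the quotient on a null set only and makes the bound by 1
    hold at every point, as \<open>decays\<close> and the pointwise estimate of \<open>b\<close>
    require.\<close>
  define w where "w x = (if cmod (u' x / of_real M) \<le> 1 then u' x / of_real M else 0)" for x
  have [measurable]: "w \<in> borel_measurable borel" unfolding w_def by measurable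
  have wb: "cmod (w x) \<le> 1" for x by (simp add: w_def)
  have w: "decays 1 0 w" using wb by (simp add: decays_def)
  have uw: "AE x in lebesgue. u x = of_real M * w x"
    using u'(2) um' by eventually_elim (use M(2) in \<open>simp add: w_def norm_divide\<close>)
  have Mw: "cmod (of_real M * w x) \<le> M" for x using mult_left_mono[OF wb[of x], of M] M(2) by (simp add: norm_mult)
  define G where "G x = f (x, of_real M * w x)" for x
  have Gm[measurable]: "G \<in> borel_measurable borel"
  proof -
    have "(\<lambda>x. (x, of_real M * w x)) \<in> borel \<rightarrow>\<^sub>M borel \<Otimes>\<^sub>M borel" by measurable
    from measurable_compose[OF this, of f borel] borel_measurable_continuous_onI[OF f] show ?thesis
      unfolding G_def by (simp add: borel_prod)
  qed
  have GA: "AE x in lebesgue. subst_op f u x = G x"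
    using uw by eventually_elim (simp add: subst_op_def G_def)
  have res: "resolvent_op k (subst_op f u) x = cv G x" for x
    by (rule resolvent_op_cv[OF h measurable_subst_op[OF f um] Gm GA])
  have [measurable]: "a \<in> borel_measurable borel" using a(1) by (rule borel_measurable_continuous_onI)
  define bt where "bt x = b (x, of_real M * w x)" for x
  have btG: "bt x = G x - of_real (a x) * (of_real M * w x)" for x by (simp add: bt_def G_def ab)
  have [measurable]: "bt \<in> borel_measurable borel" unfolding btG by measurable
  have bt: "decays (eps * M) \<alpha> bt"
    unfolding decays_def
  proof (intro conjI allI)
    fix y
    have "jb y powr \<alpha> * cmod (bt y) \<le> eps * M" unfolding bt_def by (rule bM[OF Mw])
    then show "norm (bt y) \<le> eps * M * jb y powr (- \<alpha>)" by (simp add: powr_minus field_simps)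
  qed (use eps M in simp_all)
  have aw: "decays A \<alpha> (\<lambda>y. of_real (a y) * w y)" using potential_decay[OF a \<alpha> w] by simp
  have \<alpha>': "0 \<le> \<alpha>" "p + \<alpha> > real CARD('n)" using \<alpha> p_ge_1 unfolding p_eq by linarith+
  have cvG: "cv G x = of_real M * cv (\<lambda>y. of_real (a y) * w y) x + cv bt x" for x
  proof -
    have "\<Phi> (x - y) * G y = of_real M * (\<Phi> (x - y) * (of_real (a y) * w y)) + \<Phi> (x - y) * bt y" for y
      unfolding btG by (simp add: algebra_simps)
    then show ?thesis
      using kernel_integrable(1)[OF aw \<alpha>'] kernel_integrable(1)[OF bt \<alpha>'] by (simp add: cv_def)
  qed
  show ?thesis
  proof (rule that[OF w \<mu>(1,2)])
    have "AE x in lebesgue. norm (w x - of_real \<mu> * cv (\<lambda>y. of_real (a y) * w y) x) \<le> eps * C + B / M"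
      using \<mu>(3) uw B
    proof eventually_elim
      case (elim x)
      define z where "z = cv (\<lambda>y. of_real (a y) * w y) x"
      have "of_real M * w x = of_real \<mu> * (of_real M * z + cv bt x + \<phi> x)"
        using elim(1) unfolding elim(2) res cvG z_def .
      then have "of_real M * (w x - of_real \<mu> * z) = of_real \<mu> * (cv bt x + \<phi> x)" by (simp add: algebra_simps)
      then have "M * norm (w x - of_real \<mu> * z) = \<mu> * norm (cv bt x + \<phi> x)"
        using M(2) \<mu>(1) by (metis abs_of_nonneg abs_of_pos norm_mult norm_of_real)
      also have "\<dots> \<le> 1 * norm (cv bt x + \<phi> x)" using \<mu> by (intro mult_right_mono) auto
      also have "\<dots> \<le> eps * M * C + B"
        using norm_triangle_ineq[of "cv bt x" "\<phi> x"] C[OF bt, of x] elim(3) by linarith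
      finally have "norm (w x - of_real \<mu> * z) \<le> (eps * M * C + B) / M" using M(2) by (simp add: pos_le_divide_eq mult.commute)
      also have "\<dots> = eps * C + B / M" using M(2) by (simp add: add_divide_distrib)
      finally show ?case by (simp add: z_def)
    qed
    then show "AE x in lborel. norm (w x - of_real \<mu> * cv (\<lambda>y. of_real (a y) * w y) x) \<le> eps * C + B / M"
      unfolding AE_lebesgue_lborel .
    show "\<not> (AE x in lborel. norm (w x) \<le> 3/4)"
    proof
      assume "AE x in lborel. norm (w x) \<le> 3/4"
      then have "AE x in lebesgue. norm (w x) \<le> 3/4" unfolding AE_lebesgue_lborel .
      then have "AE x in lebesgue. norm (u x) \<le> M * (3/4)"
        using uw by eventually_elim (use M(2) in \<open>simp add: norm_mult\<close>)
      from Linf_norm_leI[OF um this] show False using M by simp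
    qed
  qed
qed

lemma bounded_f1:
  fixes f :: "(real ^ 'n) \<times> complex \<Rightarrow> complex" and \<phi> :: "real ^ 'n \<Rightarrow> complex"
  assumes h: "\<And>x :: real ^ 'n. x \<noteq> 0 \<Longrightarrow> outgoing_fund k x = \<Phi> x"
    and \<alpha>: "\<alpha> > p + 1" and f: "continuous_on UNIV f" and fin: "\<And>M. M > 0 \<Longrightarrow> growth_sup \<alpha> f M < \<infinity>"
    and f1: "cond_f1 \<alpha> f" and \<phi>: "\<phi> \<in> Linf"
  shows "\<exists>C::real. \<forall>u\<in>solution_family k f \<phi>. Linf_norm u \<le> ereal C"
proof (rule ccontr)
  assume "\<not> ?thesis"
  then have unb: "\<exists>u\<in>solution_family k f \<phi>. \<not> Linf_norm u \<le> ereal C" for C by blast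
  have \<alpha>0: "\<alpha> \<ge> 0" "p + \<alpha> > real CARD('n)" using \<alpha> p_ge_1 unfolding p_eq by linarith+
  obtain a b where ab: "\<And>x u. f (x, u) = complex_of_real (a x) * u + b (x, u)"
    and lim: "((\<lambda>M. growth_sup \<alpha> b M / ereal M) \<longlongrightarrow> 0) at_top" using f1 unfolding cond_f1_def by blast
  note small = growth_sup_small[OF lim]
  have ac: "continuous_on UNIV a" by (rule asymptotically_linear_coefficient(1)[OF f fin \<alpha>0(1) ab small])
  obtain A where A: "\<And>x. \<bar>a x\<bar> \<le> A * jb x powr (- \<alpha>)"
    using asymptotically_linear_coefficient(2)[OF f fin \<alpha>0(1) ab small] by blast
  obtain B where B: "B \<ge> 0" "AE x in lebesgue. norm (\<phi> x) \<le> B"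
    by (rule Linf_norm_finiteE[of \<phi>]) (use \<phi> in \<open>auto simp: Linf_def\<close>)
  obtain C where C: "\<And>A g x. decays A \<alpha> g \<Longrightarrow> norm (cv g x) \<le> A * C"
  proof -
    have *: "0 \<le> (0::real)" "0 \<le> p" "0 \<le> \<alpha>" "p + \<alpha> - 0 > real CARD('n)" using \<alpha>0 p_ge_1 by auto
    show ?thesis
      by (rule cv_bounds[OF *]) (rule that; fastforce)
  qed
  define P where "P n w \<mu> \<longleftrightarrow> decays 1 0 w \<and> (0 \<le> \<mu> \<and> \<mu> \<le> 1) \<and>
    (AE x in lborel. norm (w x - of_real \<mu> * cv (\<lambda>y. of_real (a y) * w y) x) \<le> 1 / real (Suc n) * C + B * (1 / real (Suc n))) \<and>
    \<not> (AE x in lborel. norm (w x) \<le> 3/4)" for n w and \<mu> :: real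
  have "\<exists>w \<mu>. P n w \<mu>" for n
  proof -
    have eps: "1 / real (Suc n) > 0" by simp
    obtain M0 where M0: "M0 > 0" "\<And>M x u. M \<ge> M0 \<Longrightarrow> cmod u \<le> M \<Longrightarrow> jb x powr \<alpha> * cmod (b (x, u)) \<le> 1 / real (Suc n) * M"
      using small[OF eps] by blast
    \<comment> \<open>The norm exceeds both thresholds: \<open>M0\<close>, so that the weighted
      bound on \<open>b\<close> is at most M/(n+1), and n + 1, so that B/M is at most
      B/(n+1).\<close>
    obtain u where u: "u \<in> solution_family k f \<phi>" "\<not> Linf_norm u \<le> ereal (max M0 (real (Suc n)))" using unb by blast
    have "Linf_norm u < \<infinity>" using u(1) by (auto simp: solution_family_def Linf_def)
    then obtain M where M: "Linf_norm u = ereal M" by (elim Linf_norm_finiteE)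
    have "M > max M0 (real (Suc n))" using u(2) unfolding M by (simp only: ereal_less_eq not_le)
    then have MM: "M \<ge> M0" "M > real (Suc n)" "M > 0" using M0(1) by auto
    obtain w \<mu> where w: "decays 1 0 w" "0 \<le> \<mu>" "\<mu> \<le> 1"
      "AE x in lborel. norm (w x - of_real \<mu> * cv (\<lambda>y. of_real (a y) * w y) x) \<le> 1 / real (Suc n) * C + B / M"
      "\<not> (AE x in lborel. norm (w x) \<le> 3/4)"
      by (rule normalized_solution[OF h f ac A \<alpha> ab M0(2)[OF MM(1)] eps C B(2) u(1) M MM(3)]; (assumption | rule that; assumption))
    have "B / M \<le> B / real (Suc n)" using B MM by (intro divide_left_mono) auto
    then have "AE x in lborel. norm (w x - of_real \<mu> * cv (\<lambda>y. of_real (a y) * w y) x) \<le> 1 / real (Suc n) * C + B * (1 / real (Suc n))"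
      using w(4) by (elim eventually_mono) simp
    with w show ?thesis unfolding P_def by blast
  qed
  then obtain w \<mu> where "\<And>n. P n (w n) (\<mu> n)" by metis
  then have w: "\<And>n. decays 1 0 (w n)" "\<And>n. 0 \<le> \<mu> n \<and> \<mu> n \<le> 1"
    "\<And>n. AE x in lborel. norm (w n x - of_real (\<mu> n) * cv (\<lambda>y. of_real (a y) * w n y) x) \<le> 1 / real (Suc n) * C + B * (1 / real (Suc n))"
    "\<And>n. \<not> (AE x in lborel. norm (w n x) \<le> 3/4)" by (simp_all add: P_def)
  have "(\<lambda>n. 1 / real (Suc n) * C + B * (1 / real (Suc n))) \<longlonglongrightarrow> 0 * C + B * 0"
    by (intro tendsto_intros LIMSEQ_Suc[OF lim_1_over_n])
  then have d: "(\<lambda>n. 1 / real (Suc n) * C + B * (1 / real (Suc n))) \<longlonglongrightarrow> 0" by simp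
  show False by (rule no_blowup_sequence[OF ac A \<alpha> w(1,2) d w(3,4)])
qed

end

theorem proposition5p1:
  fixes k \<alpha> :: real
    and f :: "(real ^ 'n) \<times> complex \<Rightarrow> complex"
    and \<phi> :: "real ^ 'n \<Rightarrow> complex"
  assumes "CARD('n) \<ge> 3"
    and "k > 0"
    and "\<alpha> > (real CARD('n) + 1) / 2"
    and "continuous_on UNIV f"
    and "\<forall>M>0. growth_sup \<alpha> f M < \<infinity>"
    and "cond_f1 \<alpha> f \<or> cond_f2 k \<alpha> f"
    and "\<phi> \<in> Linf"
  shows "\<exists>C::real. \<forall>u\<in>solution_family k f \<phi>. Linf_norm u \<le> ereal C"
proof -
  have N: "CARD('n) \<ge> 2" using assms(1) by simp
  obtain C0 where C0: "C0 \<ge> 0"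
    "\<And>r. r > 0 \<Longrightarrow> norm (hr CARD('n) k r) \<le> C0 * (r powr - (real CARD('n) - 2) + r powr - ((real CARD('n) - 1) / 2))"
    "\<And>r. r > 0 \<Longrightarrow> norm (hr' CARD('n) k r) \<le> C0 * (r powr - (real CARD('n) - 1) + r powr - ((real CARD('n) - 1) / 2))"
    "\<And>r. r > 0 \<Longrightarrow> norm (hr' CARD('n) k r - \<i> * of_real k * hr CARD('n) k r) \<le> C0 * (r powr - (real CARD('n) - 1) + r powr - ((real CARD('n) + 1) / 2))"
    by (rule hr_bounds[OF assms(2,1)]) (rule that; assumption)
  obtain c0 where c0: "((\<lambda>r. of_real (r ^ (CARD('n) - 1)) * hr' CARD('n) k r) \<longlongrightarrow> complex_of_real c0) (at_right 0)"
    by (rule hr'_limit_0[OF assms(2,1)])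
  interpret radial_kernel "TYPE('n)" k "hr CARD('n) k" "hr' CARD('n) k" C0 c0
    by (unfold_locales; fact assms(1,2) C0 hr_deriv[OF assms(2) _ N] hr_ode[OF assms(2) _ N] c0)
  have h: "outgoing_fund k x = \<Phi> x" if "x \<noteq> 0" for x :: "real ^ 'n"
    using outgoing_fund_hr[OF assms(2) that N] that by (simp add: \<Phi>_def)
  have \<alpha>: "\<alpha> > p + 1" using assms(3) unfolding p_def by argo
  from assms(6) show ?thesis
  proof
    assume "cond_f1 \<alpha> f"
    then show ?thesis using assms(5) by (intro bounded_f1[OF h \<alpha> assms(4) _ _ assms(7)]) auto
  next
    assume "cond_f2 k \<alpha> f"
    then show ?thesis by (intro bounded_f2[OF h \<alpha> assms(4) _ assms(7)])
  qed
qed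

end
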